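(* Let $\mathcal{F}=\{C_q:q\in Q\}$ be a nice family of plane curves in $P\subseteq M^2$, and let $\mathcal{L}=\{\ell_p:p\in P\}$ be its dual family, $\ell_p=\{q\in Q:p\in C_q\}$. Let $X\subseteq M^2$ be a definable curve and $p_0$ a generic point of $X$ such that $X$ is not $\mathcal{F}$-linear near $p_0$. If $C_{q_0}$ touches $X$ at $p_0$, then $\ell_{p_0}$ touches $\tau(X)$ at $q_0$.
   Context: $\mathcal{M}$ is a sufficiently saturated o-minimal structure with dense order; genericity is in the sense of o-minimal dimension over the parameters defining $X$ and $\mathcal{F}$. Nice family: a definable family $\{C_q:q\in Q\}$, $Q$ open in $M^2$, of plane curves in $P$ with finite pairwise intersections, such that distinct curves meet at most once in $P$, each $C_q$ is the graph of a partial function $f_q$, and $F(a,b,x)=f_{\langle a,b\rangle}(x)$ is continuous and strictly monotone in each variable with uniform monotonicity type in each variable. $C^0$-point of a plane curve: point near which it is definably homeomorphic to an open interval. Curves $X,Y$ with a common $C^0$-point $p$ touch at $p$ if for some rectangular neighbourhood $V$ of $p$, $V\setminus X$ has two definably connected components and $Y\cap V$ misses one of them. $\tau(X,p)=\{q\in Q:C_q$ touches $X$ at $p\}$ for a $C^0$-point $p$ of $X$, and $\tau(X)=\bigcup\{\tau(X,p):p$ a $C^0$-point of $X\}$. $X$ is $\mathcal{F}$-linear near $p$ if there exist a neighbourhood $V$ of $p$ and $q\in Q$ with $\tau(X,p')=\{q\}$ for all $p'\in V\cap X$.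
   Formalization: Touching is read locally: the rectangular neighbourhood V can be chosen inside every neighbourhood of p. A nice family is also required to have F(a,b,x) defined on an open subset of M^3. Without either requirement the claim has counterexamples. *)

theory Defs
  imports "HOL-Analysis.Analysis"
begin

section \<open>First-order structures expanding a linear order\<close>

text \<open>
  The universe of a structure is the whole type \<open>'a\<close>. Equality and the order of \<open>'a\<close> are always
  in the language; the further symbols have the arities recorded in the structure. Formulas may
  mention elements of the universe (\<open>Par\<close>), so that formulas over \<open>A\<close> are the formulas whose
  parameters lie in \<open>A\<close>.
\<close>

record ('f, 'r, 'a) struct =
  fun_arity :: "'f \<Rightarrow> nat"
  rel_arity :: "'r \<Rightarrow> nat"
  fun_interp :: "'f \<Rightarrow> 'a list \<Rightarrow> 'a"
  rel_interp :: "'r \<Rightarrow> 'a list \<Rightarrow> bool"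

datatype (dead 'f, tm_params: 'a) tm =
    Var nat
  | Par 'a
  | Fn 'f "('f, 'a) tm list"

datatype (dead 'f, dead 'r, fm_params: 'a) fm =
    Eq "('f, 'a) tm" "('f, 'a) tm"
  | Less "('f, 'a) tm" "('f, 'a) tm"
  | Rel 'r "('f, 'a) tm list"
  | Neg "('f, 'r, 'a) fm"
  | Conj "('f, 'r, 'a) fm" "('f, 'r, 'a) fm"
  | Ex nat "('f, 'r, 'a) fm"

fun wf_tm :: "('f, 'r, 'a) struct \<Rightarrow> ('f, 'a) tm \<Rightarrow> bool" where
  "wf_tm M (Var i) = True"
| "wf_tm M (Par c) = True"
| "wf_tm M (Fn f ts) = (length ts = fun_arity M f \<and> (\<forall>t\<in>set ts. wf_tm M t))"

fun wf_fm :: "('f, 'r, 'a) struct \<Rightarrow> ('f, 'r, 'a) fm \<Rightarrow> bool" where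
  "wf_fm M (Eq s t) = (wf_tm M s \<and> wf_tm M t)"
| "wf_fm M (Less s t) = (wf_tm M s \<and> wf_tm M t)"
| "wf_fm M (Rel r ts) = (length ts = rel_arity M r \<and> (\<forall>t\<in>set ts. wf_tm M t))"
| "wf_fm M (Neg \<phi>) = wf_fm M \<phi>"
| "wf_fm M (Conj \<phi> \<psi>) = (wf_fm M \<phi> \<and> wf_fm M \<psi>)"
| "wf_fm M (Ex i \<phi>) = wf_fm M \<phi>"

fun fv_tm :: "('f, 'a) tm \<Rightarrow> nat set" where
  "fv_tm (Var i) = {i}"
| "fv_tm (Par c) = {}"
| "fv_tm (Fn f ts) = (\<Union>t\<in>set ts. fv_tm t)"

fun fv_fm :: "('f, 'r, 'a) fm \<Rightarrow> nat set" where
  "fv_fm (Eq s t) = fv_tm s \<union> fv_tm t"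
| "fv_fm (Less s t) = fv_tm s \<union> fv_tm t"
| "fv_fm (Rel r ts) = (\<Union>t\<in>set ts. fv_tm t)"
| "fv_fm (Neg \<phi>) = fv_fm \<phi>"
| "fv_fm (Conj \<phi> \<psi>) = fv_fm \<phi> \<union> fv_fm \<psi>"
| "fv_fm (Ex i \<phi>) = fv_fm \<phi> - {i}"

fun tm_val :: "('f, 'r, 'a) struct \<Rightarrow> (nat \<Rightarrow> 'a) \<Rightarrow> ('f, 'a) tm \<Rightarrow> 'a" where
  "tm_val M e (Var i) = e i"
| "tm_val M e (Par c) = c"
| "tm_val M e (Fn f ts) = fun_interp M f (map (tm_val M e) ts)"

fun sat :: "('f, 'r, 'a::linorder) struct \<Rightarrow> (nat \<Rightarrow> 'a) \<Rightarrow> ('f, 'r, 'a) fm \<Rightarrow> bool" where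
  "sat M e (Eq s t) = (tm_val M e s = tm_val M e t)"
| "sat M e (Less s t) = (tm_val M e s < tm_val M e t)"
| "sat M e (Rel r ts) = rel_interp M r (map (tm_val M e) ts)"
| "sat M e (Neg \<phi>) = (\<not> sat M e \<phi>)"
| "sat M e (Conj \<phi> \<psi>) = (sat M e \<phi> \<and> sat M e \<psi>)"
| "sat M e (Ex i \<phi>) = (\<exists>x. sat M (e(i := x)) \<phi>)"

text \<open>\<open>definable M A n S\<close>: \<open>S \<subseteq> M\<^sup>n\<close>, a set of lists of length \<open>n\<close>, is definable over \<open>A\<close>.\<close>

definition definable ::
  "('f, 'r, 'a::linorder) struct \<Rightarrow> 'a set \<Rightarrow> nat \<Rightarrow> 'a list set \<Rightarrow> bool" where
  "definable M A n S \<longleftrightarrow>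
     (\<exists>\<phi>. wf_fm M \<phi> \<and> fm_params \<phi> \<subseteq> A \<and> fv_fm \<phi> \<subseteq> {..<n} \<and>
          S = {xs. length xs = n \<and> sat M (\<lambda>i. xs ! i) \<phi>})"

definition tuples2 :: "('a \<times> 'a) set \<Rightarrow> 'a list set" where
  "tuples2 S = (\<lambda>(x, y). [x, y]) ` S"

abbreviation definable2 ::
  "('f, 'r, 'a::linorder) struct \<Rightarrow> 'a set \<Rightarrow> ('a \<times> 'a) set \<Rightarrow> bool" where
  "definable2 M A S \<equiv> definable M A 2 (tuples2 S)"

section \<open>O-minimality, saturation, dimension, genericity\<close>

text \<open>Open intervals have endpoints in \<open>M \<union> {\<plusminus>\<infinity>}\<close>.\<close>

definition open_intervals :: "'a::linorder set set" where
  "open_intervals =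
     {{a<..<b} | a b. a < b} \<union> {{a<..} | a. True} \<union> {{..<b} | b. True} \<union> {UNIV}"

definition o_minimal :: "('f, 'r, 'a::unbounded_dense_linorder) struct \<Rightarrow> bool" where
  "o_minimal M \<longleftrightarrow>
     (\<forall>S. definable M UNIV 1 ((\<lambda>x. [x]) ` S) \<longrightarrow>
        (\<exists>\<I>. finite \<I> \<and> \<I> \<subseteq> {{c} | c. True} \<union> open_intervals \<and> S = \<Union>\<I>))"

text \<open>
  Every 1-type over a finite set of parameters is realised. This is implied by
  \<open>\<kappa>\<close>-saturation for any infinite cardinal \<open>\<kappa>\<close>.
\<close>

definition omega_saturated :: "('f, 'r, 'a::linorder) struct \<Rightarrow> bool" where
  "omega_saturated M \<longleftrightarrow>
     (\<forall>A \<Phi>. finite A \<longrightarrow>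
        (\<forall>\<phi>\<in>\<Phi>. wf_fm M \<phi> \<and> fm_params \<phi> \<subseteq> A \<and> fv_fm \<phi> \<subseteq> {0}) \<longrightarrow>
        (\<forall>\<Psi>. finite \<Psi> \<longrightarrow> \<Psi> \<subseteq> \<Phi> \<longrightarrow> (\<exists>x. \<forall>\<phi>\<in>\<Psi>. sat M (\<lambda>_. x) \<phi>)) \<longrightarrow>
        (\<exists>x. \<forall>\<phi>\<in>\<Phi>. sat M (\<lambda>_. x) \<phi>))"

text \<open>
  O-minimal dimension of \<open>S \<subseteq> M\<^sup>n\<close>: the largest number of coordinates onto which the projection of
  \<open>S\<close> has nonempty interior, that is, contains an open box. The empty set gets dimension 0.
\<close>

definition omin_dim :: "nat \<Rightarrow> 'a::linorder list set \<Rightarrow> nat" where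
  "omin_dim n S = Max (insert 0
     {card I | I. I \<subseteq> {..<n} \<and>
        (\<exists>l u. (\<forall>i\<in>I. l i < u i) \<and>
               (\<forall>y. (\<forall>i\<in>I. l i < y i \<and> y i < u i) \<longrightarrow> (\<exists>xs\<in>S. \<forall>i\<in>I. xs ! i = y i)))})"

definition plane_curve ::
  "('f, 'r, 'a::linorder) struct \<Rightarrow> 'a set \<Rightarrow> ('a \<times> 'a) set \<Rightarrow> bool" where
  "plane_curve M A X \<longleftrightarrow> definable2 M A X \<and> omin_dim 2 (tuples2 X) = 1"

text \<open>\<open>p\<close> is generic in \<open>X\<close> over \<open>A\<close>: \<open>dim(p/A) = dim X\<close>, where \<open>dim(p/A)\<close> is the least dimension
  of an \<open>A\<close>-definable set containing \<open>p\<close>.\<close>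

definition generic ::
  "('f, 'r, 'a::linorder) struct \<Rightarrow> 'a set \<Rightarrow> ('a \<times> 'a) set \<Rightarrow> 'a \<times> 'a \<Rightarrow> bool" where
  "generic M A X p \<longleftrightarrow> p \<in> X \<and>
     (\<forall>Y. definable2 M A Y \<longrightarrow> p \<in> Y \<longrightarrow> omin_dim 2 (tuples2 X) \<le> omin_dim 2 (tuples2 Y))"

section \<open>Touching curves\<close>

definition definably_connected ::
  "('f, 'r, 'a::linorder_topology) struct \<Rightarrow> ('a \<times> 'a) set \<Rightarrow> bool" where
  "definably_connected M S \<longleftrightarrow>
     \<not> (\<exists>U W. definable2 M UNIV U \<and> definable2 M UNIV W \<and>
          openin (top_of_set S) U \<and> openin (top_of_set S) W \<and>
          U \<noteq> {} \<and> W \<noteq> {} \<and> U \<inter> W = {} \<and> U \<union> W = S)"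

definition def_components ::
  "('f, 'r, 'a::linorder_topology) struct \<Rightarrow> ('a \<times> 'a) set \<Rightarrow> ('a \<times> 'a) set set" where
  "def_components M S =
     {K. K \<noteq> {} \<and> K \<subseteq> S \<and> definable2 M UNIV K \<and> definably_connected M K \<and>
         (\<forall>K'. K \<subseteq> K' \<longrightarrow> K' \<subseteq> S \<longrightarrow> definable2 M UNIV K' \<longrightarrow> definably_connected M K' \<longrightarrow> K' = K)}"

definition C0_point ::
  "('f, 'r, 'a::linorder_topology) struct \<Rightarrow> ('a \<times> 'a) set \<Rightarrow> 'a \<times> 'a \<Rightarrow> bool" where
  "C0_point M X p \<longleftrightarrow> p \<in> X \<and>
     (\<exists>V I h k. open V \<and> p \<in> V \<and> I \<in> open_intervals \<and> homeomorphism I (X \<inter> V) h k \<and>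
        definable M UNIV 3 ((\<lambda>t. [t, fst (h t), snd (h t)]) ` I))"

definition rectangular_nbhds :: "'a::linorder \<times> 'a \<Rightarrow> ('a \<times> 'a) set set" where
  "rectangular_nbhds p = {V. p \<in> V \<and> (\<exists>a b c d. V = {a<..<b} \<times> {c<..<d})}"

text \<open>
  \<open>Y\<close> touches \<open>X\<close> at \<open>p\<close>. The notion is local: the witnessing rectangles are required to exist
  inside every neighbourhood of \<open>p\<close>. With one rectangle of arbitrary size, a piece of \<open>X\<close> away from
  \<open>p\<close>, such as a small circle, could account for the second component although \<open>Y\<close> crosses \<open>X\<close>
  at \<open>p\<close>.
\<close>

definition touches ::
  "('f, 'r, 'a::linorder_topology) struct \<Rightarrow> ('a \<times> 'a) set \<Rightarrow> ('a \<times> 'a) set \<Rightarrow> 'a \<times> 'a \<Rightarrow> bool" where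
  "touches M Y X p \<longleftrightarrow>
     plane_curve M UNIV X \<and> plane_curve M UNIV Y \<and> C0_point M X p \<and> C0_point M Y p \<and>
     (\<forall>U. open U \<longrightarrow> p \<in> U \<longrightarrow>
        (\<exists>V\<in>rectangular_nbhds p. V \<subseteq> U \<and>
           card (def_components M (V - X)) = 2 \<and>
           (\<exists>K\<in>def_components M (V - X). Y \<inter> V \<inter> K = {})))"

section \<open>Nice families and their duals\<close>

text \<open>
  A family of curves is a function \<open>C\<close> together with an index set \<open>Q\<close>. When each \<open>C q\<close> is the graph
  of a partial function \<open>f\<^sub>q\<close>, \<open>family_fun C (a, b, x)\<close> is the value at \<open>x\<close> of that function for
  \<open>q = (a, b)\<close>, meaningful for \<open>(a, b, x)\<close> in \<open>family_dom Q C\<close> only.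
\<close>

definition family_dom :: "('a \<times> 'a) set \<Rightarrow> ('a \<times> 'a \<Rightarrow> ('a \<times> 'a) set) \<Rightarrow> ('a \<times> 'a \<times> 'a) set" where
  "family_dom Q C = {(a, b, x). (a, b) \<in> Q \<and> (\<exists>y. (x, y) \<in> C (a, b))}"

definition family_fun :: "('a \<times> 'a \<Rightarrow> ('a \<times> 'a) set) \<Rightarrow> 'a \<times> 'a \<times> 'a \<Rightarrow> 'a" where
  "family_fun C = (\<lambda>(a, b, x). THE y. (x, y) \<in> C (a, b))"

text \<open>
  The domain of \<open>F = family_fun C\<close> is required to be open in \<open>M\<^sup>3\<close>. Continuity on a domain that is
  not open says nothing about how the curve through a given point varies with \<open>q\<close>: one may delete
  from the lines \<open>y = ax + b\<close> all their transversal intersections with the parabola \<open>y = x\<^sup>2\<close>,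
  and then only one curve passes through each point of the parabola.
\<close>

definition nice_family ::
  "('f, 'r, 'a::linorder_topology) struct \<Rightarrow> 'a set \<Rightarrow> ('a \<times> 'a) set \<Rightarrow> ('a \<times> 'a) set \<Rightarrow>
     ('a \<times> 'a \<Rightarrow> ('a \<times> 'a) set) \<Rightarrow> bool" where
  "nice_family M A P Q C \<longleftrightarrow>
     (let D = family_dom Q C; F = family_fun C in
      open Q \<and> definable2 M A Q \<and>
      definable M A 4 {[a, b, x, y] | a b x y. (a, b) \<in> Q \<and> (x, y) \<in> C (a, b)} \<and>
      (\<forall>q\<in>Q. plane_curve M UNIV (C q) \<and> C q \<subseteq> P) \<and>
      (\<forall>q\<in>Q. \<forall>q'\<in>Q. q \<noteq> q' \<longrightarrow> finite (C q \<inter> C q')) \<and>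
      (\<forall>q\<in>Q. \<forall>q'\<in>Q. C q \<noteq> C q' \<longrightarrow>
         (\<forall>p\<in>C q \<inter> C q' \<inter> P. \<forall>p'\<in>C q \<inter> C q' \<inter> P. p = p')) \<and>
      (\<forall>q\<in>Q. \<forall>x y y'. (x, y) \<in> C q \<longrightarrow> (x, y') \<in> C q \<longrightarrow> y = y') \<and>
      open D \<and> continuous_on D F \<and>
      ((\<forall>b x. strict_mono_on {a. (a, b, x) \<in> D} (\<lambda>a. F (a, b, x))) \<or>
       (\<forall>b x. strict_antimono_on {a. (a, b, x) \<in> D} (\<lambda>a. F (a, b, x)))) \<and>
      ((\<forall>a x. strict_mono_on {b. (a, b, x) \<in> D} (\<lambda>b. F (a, b, x))) \<or>
       (\<forall>a x. strict_antimono_on {b. (a, b, x) \<in> D} (\<lambda>b. F (a, b, x)))) \<and>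
      ((\<forall>a b. strict_mono_on {x. (a, b, x) \<in> D} (\<lambda>x. F (a, b, x))) \<or>
       (\<forall>a b. strict_antimono_on {x. (a, b, x) \<in> D} (\<lambda>x. F (a, b, x)))))"

definition dual_curve ::
  "('a \<times> 'a) set \<Rightarrow> ('a \<times> 'a \<Rightarrow> ('a \<times> 'a) set) \<Rightarrow> 'a \<times> 'a \<Rightarrow> ('a \<times> 'a) set" where
  "dual_curve Q C p = {q \<in> Q. p \<in> C q}"

definition tau_at ::
  "('f, 'r, 'a::linorder_topology) struct \<Rightarrow> ('a \<times> 'a) set \<Rightarrow> ('a \<times> 'a \<Rightarrow> ('a \<times> 'a) set) \<Rightarrow>
     ('a \<times> 'a) set \<Rightarrow> 'a \<times> 'a \<Rightarrow> ('a \<times> 'a) set" where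
  "tau_at M Q C X p = {q \<in> Q. touches M (C q) X p}"

definition tau ::
  "('f, 'r, 'a::linorder_topology) struct \<Rightarrow> ('a \<times> 'a) set \<Rightarrow> ('a \<times> 'a \<Rightarrow> ('a \<times> 'a) set) \<Rightarrow>
     ('a \<times> 'a) set \<Rightarrow> ('a \<times> 'a) set" where
  "tau M Q C X = (\<Union>p\<in>{p. C0_point M X p}. tau_at M Q C X p)"

definition family_linear_near ::
  "('f, 'r, 'a::linorder_topology) struct \<Rightarrow> ('a \<times> 'a) set \<Rightarrow> ('a \<times> 'a \<Rightarrow> ('a \<times> 'a) set) \<Rightarrow>
     ('a \<times> 'a) set \<Rightarrow> 'a \<times> 'a \<Rightarrow> bool" where
  "family_linear_near M Q C X p \<longleftrightarrow>
     (\<exists>V q. open V \<and> p \<in> V \<and> q \<in> Q \<and> (\<forall>p'\<in>V \<inter> X. tau_at M Q C X p' = {q}))"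

end

theory Submission
  imports Defs
begin

text \<open>
  Write \<open>F(q, x)\<close> for the value at \<open>x\<close> of the function with graph \<open>C\<^sub>q\<close>.

  Saturation replaces cell decomposition: if \<open>E(x, l)\<close> holds for every \<open>x\<close> in an interval and
  all \<open>l\<close> close enough to \<open>x\<close> on one side, then one \<open>l\<close> works for infinitely many \<open>x\<close>. This gives the
  monotonicity theorem, the fact that a definable subset of the plane with infinitely many infinite
  fibres contains a box, and hence the local structure of \<open>X\<close> away from finitely many points. There,
  touching means that \<open>C\<^sub>q\<close> lies on one side of \<open>X\<close>.

  Two distinct curves of the family never touch each other, because a shift in the parameter would
  produce two intersections. So only finitely many curves touch \<open>X\<close> at all but finitely many of its
  points, and \<open>\<tau>(X)\<close> is one-dimensional.

  If the conclusion failed at the generic point \<open>p\<^sub>0\<close>, then it would fail along an arc \<open>x \<mapsto> (x, z(x))\<close> of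
  \<open>X\<close> on which the touching curve \<open>q(x)\<close> varies definably. After shrinking the arc, every curve \<open>C\<^bsub>q(x)\<^esub>\<close>
  lies on the same side of the whole arc, say \<open>F(q(x), x') \<ge> z(x')\<close> for all \<open>x\<close> and \<open>x'\<close>. If \<open>q\<close> is
  constant then \<open>X\<close> is linear. Otherwise \<open>q\<close> parametrizes \<open>\<tau>(X)\<close> locally and, read for a fixed \<open>x'\<close>, the
  inequality says that \<open>\<tau>(X)\<close> lies on one side of the dual curve of \<open>(x', z(x'))\<close>.
\<close>

section \<open>Definable predicates\<close>

text \<open>Apart from \<open>p0 \<in> X\<close>, genericity enters in one form only:
  \<open>p0\<close> lies in no finite set definable over \<open>A\<close>. Hence every set of bad
  points must be finite and also definable over \<open>A\<close>. Touching resists the second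
  demand, because it quantifies over definable sets, the components. There are two substitutes. At
  points where \<open>X\<close> is locally a monotone graph, touching becomes the first-order
  condition \<open>tang\<close>. The set of all tangents is enlarged to \<open>tau_hull\<close>,
  which contains every curve through the finitely many exceptional points: it is definable over
  \<open>A\<close>, still thin, and agrees with \<open>tau\<close> wherever it consists of regular
  tangents. The definition of touching also requires \<open>tau\<close> itself to be definable, with
  any parameters, and this takes a separate argument, the finitely many classes of
  \<open>eqv\<close>. Statements about finiteness can be used inside formulas because a definable
  subset of the line is infinite exactly when it contains an interval.\<close>

lemma tm_val_cong: "(\<forall>i\<in>fv_tm t. e i = e' i) \<Longrightarrow> tm_val M e t = tm_val M e' t"
proof (induction t)
  case (Fn f ts)
  then have "map (tm_val M e) ts = map (tm_val M e') ts" by auto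
  then show ?case by (simp only: tm_val.simps)
qed auto

lemma sat_cong: "(\<forall>i\<in>fv_fm \<phi>. e i = e' i) \<Longrightarrow> sat M e \<phi> = sat M e' \<phi>"
proof (induction \<phi> arbitrary: e e')
  case (Eq s t)
  then have "tm_val M e s = tm_val M e' s" "tm_val M e t = tm_val M e' t"
    by (auto intro!: tm_val_cong)
  then show ?case by simp
next
  case (Less s t)
  then have "tm_val M e s = tm_val M e' s" "tm_val M e t = tm_val M e' t"
    by (auto intro!: tm_val_cong)
  then show ?case by simp
next
  case (Rel r ts)
  then have "map (tm_val M e) ts = map (tm_val M e') ts"
    by (auto intro!: tm_val_cong)
  then show ?case by (simp only: sat.simps)
next
  case (Neg \<phi>)
  then show ?case by (metis fv_fm.simps(4) sat.simps(4))
next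
  case (Conj \<phi> \<psi>)
  then show ?case by (metis UnCI fv_fm.simps(5) sat.simps(5))
next
  case (Ex i \<phi>)
  have "sat M (e(i := x)) \<phi> = sat M (e'(i := x)) \<phi>" for x
    using Ex.prems by (intro Ex.IH) auto
  then show ?case by simp
qed

lemma finite_fv_tm: "finite (fv_tm t)"
  by (induction t) auto

lemma finite_fv_fm: "finite (fv_fm \<phi>)"
  by (induction \<phi>) (auto simp: finite_fv_tm)

lemma finite_tm_params: "finite (tm_params t)"
  by (induction t) auto

lemma finite_fm_params: "finite (fm_params \<phi>)"
  by (induction \<phi>) (auto simp: finite_tm_params)

section \<open>Substitution of variables and parameters into formulas\<close>

fun subst_tm :: "(nat \<Rightarrow> ('f, 'a) tm) \<Rightarrow> ('f, 'a) tm \<Rightarrow> ('f, 'a) tm" where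
  "subst_tm t (Var i) = t i"
| "subst_tm t (Par c) = Par c"
| "subst_tm t (Fn f ts) = Fn f (map (subst_tm t) ts)"

text \<open>Coordinates and constants are the only terms ever substituted. Such a term is
  well-formed in every structure and its parameters stay in \<open>A\<close>.\<close>

definition simple_tm :: "'a set \<Rightarrow> ('f, 'a) tm \<Rightarrow> bool" where
  "simple_tm A t \<longleftrightarrow> (\<exists>j. t = Var j) \<or> (\<exists>c\<in>A. t = Par c)"

lemma subst_tm_props:
  assumes "\<forall>k. simple_tm A (t k)" "wf_tm M s" "tm_params s \<subseteq> A"
  shows "wf_tm M (subst_tm t s) \<and> tm_params (subst_tm t s) \<subseteq> A \<and>
     fv_tm (subst_tm t s) \<subseteq> (\<Union>k\<in>fv_tm s. fv_tm (t k)) \<and>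
     tm_val M e (subst_tm t s) = tm_val M (\<lambda>k. tm_val M e (t k)) s"
  using assms(2,3)
proof (induction s)
  case (Var k)
  have "simple_tm A (t k)" using assms(1) by blast
  then show ?case by (auto simp: simple_tm_def)
next
  case (Fn f ts)
  have IH: "wf_tm M (subst_tm t s) \<and> tm_params (subst_tm t s) \<subseteq> A \<and>
     fv_tm (subst_tm t s) \<subseteq> (\<Union>k\<in>fv_tm s. fv_tm (t k)) \<and>
     tm_val M e (subst_tm t s) = tm_val M (\<lambda>k. tm_val M e (t k)) s" if "s \<in> set ts" for s
  proof (rule Fn.IH[OF that])
    show "wf_tm M s" using Fn.prems(1) that by simp
    show "tm_params s \<subseteq> A" using Fn.prems(2) that by auto
  qed
  have m: "map (tm_val M e \<circ> subst_tm t) ts = map (tm_val M (\<lambda>k. tm_val M e (t k))) ts"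
    using IH by simp
  have "fv_tm (subst_tm t (Fn f ts)) \<subseteq> (\<Union>k\<in>fv_tm (Fn f ts). fv_tm (t k))"
  proof
    fix x assume "x \<in> fv_tm (subst_tm t (Fn f ts))"
    then obtain s where s: "s \<in> set ts" "x \<in> fv_tm (subst_tm t s)" by auto
    then obtain k where "k \<in> fv_tm s" "x \<in> fv_tm (t k)" using IH[OF s(1)] by blast
    then show "x \<in> (\<Union>k\<in>fv_tm (Fn f ts). fv_tm (t k))" using s(1) by auto
  qed
  moreover have "wf_tm M (subst_tm t (Fn f ts))" "tm_params (subst_tm t (Fn f ts)) \<subseteq> A"
    using IH Fn.prems by (auto simp del: UN_subset_iff)
  ultimately show ?case by (simp add: m)
qed auto

text \<open>Avoiding capture forces bound variables to be renamed, so the result is obtained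
  existentially, by an induction over all substitutions at once, and not as the value of a recursive
  function.\<close>

lemma substitution:
  assumes "\<forall>k. simple_tm A (t k)" "wf_fm M \<phi>" "fm_params \<phi> \<subseteq> A"
  shows "\<exists>\<psi>. wf_fm M \<psi> \<and> fm_params \<psi> \<subseteq> A \<and> fv_fm \<psi> \<subseteq> (\<Union>k\<in>fv_fm \<phi>. fv_tm (t k)) \<and>
     (\<forall>e. sat M e \<psi> = sat M (\<lambda>k. tm_val M e (t k)) \<phi>)"
  using assms
proof (induction \<phi> arbitrary: t)
  case (Eq u v)
  then have uv: "wf_tm M u" "wf_tm M v" "tm_params u \<subseteq> A" "tm_params v \<subseteq> A" by auto
  note U = subst_tm_props[OF Eq.prems(1) uv(1,3)] and V = subst_tm_props[OF Eq.prems(1) uv(2,4)]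
  have "fv_fm (Eq (subst_tm t u) (subst_tm t v)) \<subseteq> (\<Union>k\<in>fv_fm (Eq u v). fv_tm (t k))"
    unfolding fv_fm.simps UN_Un using U V by (intro Un_mono) simp_all
  then show ?case
    using U V by (intro exI[of _ "Eq (subst_tm t u) (subst_tm t v)"]) simp
next
  case (Less u v)
  then have uv: "wf_tm M u" "wf_tm M v" "tm_params u \<subseteq> A" "tm_params v \<subseteq> A" by auto
  note U = subst_tm_props[OF Less.prems(1) uv(1,3)] and V = subst_tm_props[OF Less.prems(1) uv(2,4)]
  have "fv_fm (Less (subst_tm t u) (subst_tm t v)) \<subseteq> (\<Union>k\<in>fv_fm (Less u v). fv_tm (t k))"
    unfolding fv_fm.simps UN_Un using U V by (intro Un_mono) simp_all
  then show ?case
    using U V by (intro exI[of _ "Less (subst_tm t u) (subst_tm t v)"]) simp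
next
  case (Rel r ts)
  have *: "wf_tm M (subst_tm t s) \<and> tm_params (subst_tm t s) \<subseteq> A \<and>
     fv_tm (subst_tm t s) \<subseteq> (\<Union>k\<in>fv_tm s. fv_tm (t k)) \<and>
     tm_val M e (subst_tm t s) = tm_val M (\<lambda>k. tm_val M e (t k)) s" if "s \<in> set ts" for s e
    by (rule subst_tm_props) (use Rel.prems that in auto)
  have m: "map (tm_val M e \<circ> subst_tm t) ts = map (tm_val M (\<lambda>k. tm_val M e (t k))) ts" for e
    using * by simp
  have "fv_fm (Rel r (map (subst_tm t) ts)) \<subseteq> (\<Union>k\<in>fv_fm (Rel r ts). fv_tm (t k))"
  proof
    fix x assume "x \<in> fv_fm (Rel r (map (subst_tm t) ts))"
    then obtain s where s: "s \<in> set ts" "x \<in> fv_tm (subst_tm t s)" by auto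
    then obtain k where "k \<in> fv_tm s" "x \<in> fv_tm (t k)" using *[OF s(1)] by blast
    then show "x \<in> (\<Union>k\<in>fv_fm (Rel r ts). fv_tm (t k))" using s(1) by auto
  qed
  moreover have "wf_fm M (Rel r (map (subst_tm t) ts))" "fm_params (Rel r (map (subst_tm t) ts)) \<subseteq> A"
    using * Rel.prems by (auto simp del: UN_subset_iff)
  ultimately show ?case
    by (intro exI[of _ "Rel r (map (subst_tm t) ts)"]) (simp add: m)
next
  case (Neg \<phi>)
  then obtain \<psi> where "wf_fm M \<psi> \<and> fm_params \<psi> \<subseteq> A \<and> fv_fm \<psi> \<subseteq> (\<Union>k\<in>fv_fm \<phi>. fv_tm (t k)) \<and>
     (\<forall>e. sat M e \<psi> = sat M (\<lambda>k. tm_val M e (t k)) \<phi>)" by (metis fm.set(4) wf_fm.simps(4))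
  then show ?case by (intro exI[of _ "Neg \<psi>"]) simp
next
  case (Conj \<phi>1 \<phi>2)
  then have w: "wf_fm M \<phi>1" "wf_fm M \<phi>2" "fm_params \<phi>1 \<subseteq> A" "fm_params \<phi>2 \<subseteq> A" by auto
  obtain \<psi>1 where 1: "wf_fm M \<psi>1" "fm_params \<psi>1 \<subseteq> A" "fv_fm \<psi>1 \<subseteq> (\<Union>k\<in>fv_fm \<phi>1. fv_tm (t k))"
     "\<forall>e. sat M e \<psi>1 = sat M (\<lambda>k. tm_val M e (t k)) \<phi>1" using Conj.IH(1)[OF Conj.prems(1) w(1,3)] by blast
  obtain \<psi>2 where 2: "wf_fm M \<psi>2" "fm_params \<psi>2 \<subseteq> A" "fv_fm \<psi>2 \<subseteq> (\<Union>k\<in>fv_fm \<phi>2. fv_tm (t k))"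
     "\<forall>e. sat M e \<psi>2 = sat M (\<lambda>k. tm_val M e (t k)) \<phi>2" using Conj.IH(2)[OF Conj.prems(1) w(2,4)] by blast
  have "fv_fm (Conj \<psi>1 \<psi>2) \<subseteq> (\<Union>k\<in>fv_fm (Conj \<phi>1 \<phi>2). fv_tm (t k))"
    unfolding fv_fm.simps UN_Un using 1 2 by (intro Un_mono)
  then show ?case using 1 2 by (intro exI[of _ "Conj \<psi>1 \<psi>2"]) simp
next
  case (Ex i \<phi>)
  \<comment> \<open>A fresh name \<open>j\<close> for the bound variable: no term put in for a free
    variable mentions it, so quantifying over \<open>j\<close> captures nothing.\<close>
  have "finite (\<Union>k\<in>fv_fm \<phi>. fv_tm (t k))" by (auto simp: finite_fv_tm finite_fv_fm)
  then obtain j where j: "j \<notin> (\<Union>k\<in>fv_fm \<phi>. fv_tm (t k))" by (meson ex_new_if_finite infinite_UNIV_nat)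
  have "\<forall>k. simple_tm A ((t(i := Var j)) k)" using Ex.prems(1) by (auto simp: simple_tm_def)
  from Ex.IH[OF this] Ex.prems obtain \<psi> where \<psi>: "wf_fm M \<psi>" "fm_params \<psi> \<subseteq> A"
     "fv_fm \<psi> \<subseteq> (\<Union>k\<in>fv_fm \<phi>. fv_tm ((t(i := Var j)) k))"
     "\<And>e. sat M e \<psi> = sat M (\<lambda>k. tm_val M e ((t(i := Var j)) k)) \<phi>" by auto
  have "sat M (\<lambda>k. tm_val M (e(j := x)) ((t(i := Var j)) k)) \<phi> =
        sat M ((\<lambda>k. tm_val M e (t k))(i := x)) \<phi>" for e x
  proof (rule sat_cong, rule ballI)
    fix k assume k: "k \<in> fv_fm \<phi>"
    show "tm_val M (e(j := x)) ((t(i := Var j)) k) = ((\<lambda>k. tm_val M e (t k))(i := x)) k"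
    proof (cases "k = i")
      case False
      with k j have "j \<notin> fv_tm (t k)" by auto
      then have "tm_val M (e(j := x)) (t k) = tm_val M e (t k)"
        by (intro tm_val_cong) auto
      with False show ?thesis by simp
    qed simp
  qed
  moreover have "fv_fm \<psi> - {j} \<subseteq> (\<Union>k\<in>fv_fm \<phi> - {i}. fv_tm (t k))"
  proof
    fix x assume x: "x \<in> fv_fm \<psi> - {j}"
    then obtain k where "k \<in> fv_fm \<phi>" "x \<in> fv_tm ((t(i := Var j)) k)" using \<psi>(3) by blast
    moreover from this x have "k \<noteq> i" by auto
    ultimately show "x \<in> (\<Union>k\<in>fv_fm \<phi> - {i}. fv_tm (t k))" by auto
  qed
  ultimately show ?case using \<psi>(1,2,4) by (intro exI[of _ "Ex j \<psi>"]) simp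
qed

text \<open>A point \<open>e\<close> of an arbitrary type is viewed as the tuple of its coordinates \<open>v e\<close>, \<open>v \<in> set vs\<close>.\<close>

definition dfp :: "('f, 'r, 'a::linorder) struct \<Rightarrow> 'a set \<Rightarrow> ('e \<Rightarrow> 'a) list \<Rightarrow> ('e \<Rightarrow> bool) \<Rightarrow> bool" where
  "dfp M A vs P \<longleftrightarrow> (\<exists>\<phi>. wf_fm M \<phi> \<and> fm_params \<phi> \<subseteq> A \<and> fv_fm \<phi> \<subseteq> {..<length vs} \<and>
     (\<forall>e. P e \<longleftrightarrow> sat M (\<lambda>i. (vs ! i) e) \<phi>))"

text \<open>The functions of the point that can be written as a simple term. This is the side
  condition of the rules for atomic formulas and of every change of variables below.\<close>

definition coord :: "'a set \<Rightarrow> ('e \<Rightarrow> 'a) list \<Rightarrow> ('e \<Rightarrow> 'a) \<Rightarrow> bool" where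
  "coord A vs v \<longleftrightarrow> v \<in> set vs \<or> (\<exists>c\<in>A. v = (\<lambda>_. c))"

lemma coord_tm:
  assumes "coord A vs v"
  obtains t where "simple_tm A t" "fv_tm t \<subseteq> {..<length vs}" "\<And>e. tm_val M (\<lambda>i. (vs ! i) e) t = v e"
proof (cases "v \<in> set vs")
  case True
  then obtain i where "i < length vs" "vs ! i = v" by (auto simp: in_set_conv_nth)
  then show ?thesis by (intro that[of "Var i"]) (auto simp: simple_tm_def)
next
  case False
  then obtain c where "c \<in> A" "v = (\<lambda>_. c)" using assms by (auto simp: coord_def)
  then show ?thesis by (intro that[of "Par c"]) (auto simp: simple_tm_def)
qed

text \<open>Change of variables: a definable predicate is pulled back along any map whose
  coordinates are variables or parameters. Every later use of a definable relation at particular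
  arguments comes down to this.\<close>

lemma dfp_subst:
  assumes "dfp M A vs P" "\<forall>v\<in>set vs. coord A ws (\<lambda>e. v (f e))"
  shows "dfp M A ws (\<lambda>e. P (f e))"
proof -
  obtain \<phi> where \<phi>: "wf_fm M \<phi>" "fm_params \<phi> \<subseteq> A" "fv_fm \<phi> \<subseteq> {..<length vs}"
     "\<And>e. P e \<longleftrightarrow> sat M (\<lambda>i. (vs ! i) e) \<phi>" using assms(1) by (auto simp: dfp_def)
  have "\<exists>t. simple_tm A t \<and> (k < length vs \<longrightarrow> fv_tm t \<subseteq> {..<length ws} \<and>
           (\<forall>e. tm_val M (\<lambda>i. (ws ! i) e) t = (vs ! k) (f e)))" for k
  proof (cases "k < length vs")
    case True
    then have "coord A ws (\<lambda>e. (vs ! k) (f e))" using assms(2) by auto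
    then show ?thesis by (metis coord_tm)
  next
    case False
    \<comment> \<open>Indices beyond the list do not occur in \<open>\<phi>\<close>, so any simple
      term will do.\<close>
    then show ?thesis by (intro exI[of _ "Var 0"]) (auto simp: simple_tm_def)
  qed
  then obtain t where t: "\<And>k. simple_tm A (t k)" "\<And>k. k < length vs \<Longrightarrow> fv_tm (t k) \<subseteq> {..<length ws}"
     "\<And>k e. k < length vs \<Longrightarrow> tm_val M (\<lambda>i. (ws ! i) e) (t k) = (vs ! k) (f e)"
    by metis
  obtain \<psi> where \<psi>: "wf_fm M \<psi>" "fm_params \<psi> \<subseteq> A" "fv_fm \<psi> \<subseteq> (\<Union>k\<in>fv_fm \<phi>. fv_tm (t k))"
     "\<And>e. sat M e \<psi> = sat M (\<lambda>k. tm_val M e (t k)) \<phi>"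
    using substitution[of A t M \<phi>] t(1) \<phi>(1,2) by auto
  have "fv_fm \<psi> \<subseteq> {..<length ws}"
  proof
    fix x assume "x \<in> fv_fm \<psi>"
    then obtain k where "k \<in> fv_fm \<phi>" "x \<in> fv_tm (t k)" using \<psi>(3) by blast
    then show "x \<in> {..<length ws}" using \<phi>(3) t(2)[of k] by auto
  qed
  moreover have "P (f e) \<longleftrightarrow> sat M (\<lambda>i. (ws ! i) e) \<psi>" for e
    unfolding \<phi>(4) \<psi>(4) using \<phi>(3) t(3) by (intro sat_cong) auto
  ultimately show ?thesis using \<psi>(1,2) unfolding dfp_def by blast
qed

section \<open>Closure of definable predicates under connectives and quantifiers\<close>

lemma dfp_less:
  assumes "coord A vs v" "coord A vs w" shows "dfp M A vs (\<lambda>e. v e < w e)"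
proof -
  obtain s where "simple_tm A s" "fv_tm s \<subseteq> {..<length vs}" "\<And>e. tm_val M (\<lambda>i. (vs ! i) e) s = v e"
    using coord_tm[OF assms(1)] by metis
  moreover obtain t where "simple_tm A t" "fv_tm t \<subseteq> {..<length vs}" "\<And>e. tm_val M (\<lambda>i. (vs ! i) e) t = w e"
    using coord_tm[OF assms(2)] by metis
  ultimately show ?thesis unfolding dfp_def
    by (intro exI[of _ "Less s t"]) (auto simp: simple_tm_def)
qed

lemma dfp_eq:
  assumes "coord A vs v" "coord A vs w" shows "dfp M A vs (\<lambda>e. v e = w e)"
proof -
  obtain s where "simple_tm A s" "fv_tm s \<subseteq> {..<length vs}" "\<And>e. tm_val M (\<lambda>i. (vs ! i) e) s = v e"
    using coord_tm[OF assms(1)] by metis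
  moreover obtain t where "simple_tm A t" "fv_tm t \<subseteq> {..<length vs}" "\<And>e. tm_val M (\<lambda>i. (vs ! i) e) t = w e"
    using coord_tm[OF assms(2)] by metis
  ultimately show ?thesis unfolding dfp_def
    by (intro exI[of _ "Eq s t"]) (auto simp: simple_tm_def)
qed

lemma dfp_not: "dfp M A vs P \<Longrightarrow> dfp M A vs (\<lambda>e. \<not> P e)"
  unfolding dfp_def by (metis fm.set(4) fv_fm.simps(4) sat.simps(4) wf_fm.simps(4))

lemma dfp_conj: "dfp M A vs P \<Longrightarrow> dfp M A vs Q \<Longrightarrow> dfp M A vs (\<lambda>e. P e \<and> Q e)"
  unfolding dfp_def
  apply (elim exE conjE)
  subgoal for \<phi> \<psi> by (rule exI[of _ "Conj \<phi> \<psi>"]) auto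
  done

lemma dfp_disj: "dfp M A vs P \<Longrightarrow> dfp M A vs Q \<Longrightarrow> dfp M A vs (\<lambda>e. P e \<or> Q e)"
  using dfp_not[OF dfp_conj[OF dfp_not dfp_not, of M A vs P Q]] by simp

lemma dfp_imp: "dfp M A vs P \<Longrightarrow> dfp M A vs Q \<Longrightarrow> dfp M A vs (\<lambda>e. P e \<longrightarrow> Q e)"
  using dfp_not[OF dfp_conj[OF _ dfp_not, of M A vs P Q]] by simp

lemma dfp_iff: "dfp M A vs P \<Longrightarrow> dfp M A vs Q \<Longrightarrow> dfp M A vs (\<lambda>e. P e \<longleftrightarrow> Q e)"
  unfolding iff_conv_conj_imp by (intro dfp_conj dfp_imp)

lemma dfp_le:
  assumes "coord A vs v" "coord A vs w" shows "dfp M A vs (\<lambda>e. v e \<le> w e)"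
  using dfp_not[OF dfp_less[OF assms(2,1)], of M] by (simp add: not_less)

lemma dfp_const: "dfp M A vs (\<lambda>e. b)"
proof -
  \<comment> \<open>A closed tautology, since \<open>vs\<close> may be empty and then no free
    variable is allowed.\<close>
  have T: "dfp M A vs (\<lambda>e. True)" unfolding dfp_def
    by (rule exI[of _ "Ex 0 (Eq (Var 0) (Var 0))"]) auto
  from T dfp_not[OF T] show ?thesis by (cases b) auto
qed

text \<open>The quantified value becomes one more coordinate, appended at the end. It is therefore
  variable number \<open>length vs\<close>, and the points acquire a second component.\<close>

lemma dfp_ex:
  assumes "dfp M A (map (\<lambda>v z. v (fst z)) vs @ [snd]) (\<lambda>z. P (fst z) (snd z))"
  shows "dfp M A vs (\<lambda>e. \<exists>x. P e x)"
proof -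
  let ?n = "length vs" and ?ws = "map (\<lambda>v z. v (fst z)) vs @ [snd]"
  obtain \<phi> where \<phi>: "wf_fm M \<phi>" "fm_params \<phi> \<subseteq> A" "fv_fm \<phi> \<subseteq> {..<Suc ?n}"
     "\<And>z. P (fst z) (snd z) \<longleftrightarrow> sat M (\<lambda>i. (?ws ! i) z) \<phi>" using assms(1) by (auto simp: dfp_def)
  have "P e x \<longleftrightarrow> sat M ((\<lambda>i. (vs ! i) e)(?n := x)) \<phi>" for e x
  proof -
    have "P e x \<longleftrightarrow> sat M (\<lambda>i. (?ws ! i) (e, x)) \<phi>" using \<phi>(4)[of "(e, x)"] by simp
    also have "\<dots> \<longleftrightarrow> sat M ((\<lambda>i. (vs ! i) e)(?n := x)) \<phi>"
      using \<phi>(3) by (intro sat_cong) (auto simp: nth_append less_Suc_eq)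
    finally show ?thesis .
  qed
  moreover have "fv_fm \<phi> - {?n} \<subseteq> {..<?n}" using \<phi>(3) by auto
  ultimately show ?thesis unfolding dfp_def using \<phi>(1,2) by (intro exI[of _ "Ex ?n \<phi>"]) auto
qed

lemma dfp_all:
  assumes "dfp M A (map (\<lambda>v z. v (fst z)) vs @ [snd]) (\<lambda>z. P (fst z) (snd z))"
  shows "dfp M A vs (\<lambda>e. \<forall>x. P e x)"
  using dfp_not[OF dfp_ex[OF dfp_not[OF assms]]] by simp

lemma dfp_mono: "dfp M A vs P \<Longrightarrow> A \<subseteq> B \<Longrightarrow> dfp M B vs P"
  unfolding dfp_def by blast

text \<open>One formula mentions finitely many parameters. This makes saturation over finite sets
  applicable to sets that are definable with arbitrary parameters.\<close>

lemma dfp_finite_params: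
  assumes "dfp M B vs P"
  obtains A where "finite A" "A \<subseteq> B" "dfp M A vs P"
  using assms finite_fm_params unfolding dfp_def by (metis order_refl)

text \<open>When the coordinates identify points with tuples, both notions of definability use the
  very same formula; injectivity and surjectivity are what the two directions require.\<close>

lemma dfp_definable:
  assumes inj: "\<And>e e'. map (\<lambda>v. v e) vs = map (\<lambda>v. v e') vs \<Longrightarrow> e = e'"
    and surj: "\<And>xs. length xs = length vs \<Longrightarrow> \<exists>e. map (\<lambda>v. v e) vs = xs"
    and n: "n = length vs"
  shows "definable M A n ((\<lambda>e. map (\<lambda>v. v e) vs) ` {e. P e}) \<longleftrightarrow> dfp M A vs P"
proof -
  have s: "sat M (\<lambda>i. (vs ! i) e) \<phi> \<longleftrightarrow> sat M (\<lambda>i. map (\<lambda>v. v e) vs ! i) \<phi>" if "fv_fm \<phi> \<subseteq> {..<length vs}" for e \<phi>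
    using that by (intro sat_cong) auto
  have key: "(\<lambda>e. map (\<lambda>v. v e) vs) ` {e. P e} = {xs. length xs = n \<and> sat M (\<lambda>i. xs ! i) \<phi>} \<longleftrightarrow>
     (\<forall>e. P e \<longleftrightarrow> sat M (\<lambda>i. map (\<lambda>v. v e) vs ! i) \<phi>)" (is "?S = ?T \<longleftrightarrow> _") for \<phi>
  proof
    assume eq: "?S = ?T"
    show "\<forall>e. P e \<longleftrightarrow> sat M (\<lambda>i. map (\<lambda>v. v e) vs ! i) \<phi>"
    proof
      fix e
      have "P e \<longleftrightarrow> map (\<lambda>v. v e) vs \<in> ?S" using inj by blast
      then show "P e \<longleftrightarrow> sat M (\<lambda>i. map (\<lambda>v. v e) vs ! i) \<phi>" unfolding eq using n by simp
    qed
  next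
    assume H: "\<forall>e. P e \<longleftrightarrow> sat M (\<lambda>i. map (\<lambda>v. v e) vs ! i) \<phi>"
    show "?S = ?T"
    proof (intro subset_antisym subsetI)
      fix xs assume "xs \<in> ?T"
      then obtain e where "map (\<lambda>v. v e) vs = xs" using surj n by auto
      with \<open>xs \<in> ?T\<close> H show "xs \<in> ?S" by auto
    qed (use H n in auto)
  qed
  show ?thesis unfolding dfp_def definable_def key n[symmetric]
    by (rule ex_cong1) (simp add: s n cong: conj_cong)
qed

section \<open>Definable sets of tuples of length at most four\<close>

lemma definable1_dfp: "definable M A 1 ((\<lambda>x. [x]) ` S) \<longleftrightarrow> dfp M A [\<lambda>x. x] (\<lambda>x. x \<in> S)"
  using dfp_definable[of "[\<lambda>x. x]" 1 M A "\<lambda>x. x \<in> S"] by (auto simp: length_Suc_conv)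

lemma definable2_dfp: "definable2 M A S \<longleftrightarrow> dfp M A [fst, snd] (\<lambda>p. p \<in> S)"
proof -
  have "(\<lambda>p. map (\<lambda>v. v p) [fst, snd]) ` {p. p \<in> S} = tuples2 S"
    by (simp add: tuples2_def split_def)
  then show ?thesis
    using dfp_definable[of "[fst, snd]" 2 M A "\<lambda>x. x \<in> S"]
    by (auto simp: length_Suc_conv numeral_2_eq_2 prod_eq_iff)
qed

lemma definable3_dfp:
  fixes M :: "('f, 'r, 'a::linorder) struct"
  shows "definable M A 3 {[x, y, z] | x y z. P x y z} \<longleftrightarrow>
     dfp M A [fst, \<lambda>e. fst (snd e), \<lambda>e. snd (snd e)] (\<lambda>e. P (fst e) (fst (snd e)) (snd (snd e)))"
proof -
  let ?vs = "[fst, \<lambda>e. fst (snd e), \<lambda>e. snd (snd e)]"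
  have img: "(\<lambda>p. map (\<lambda>v. v p) ?vs) ` {e. P (fst e) (fst (snd e)) (snd (snd e))} =
     {[x, y, z] | x y z. P x y z}"
    by (auto simp: image_def)
  have surj: "\<exists>e. map (\<lambda>v. v e) ?vs = xs" if "length xs = length ?vs" for xs :: "'a list"
    using that by (auto simp: length_Suc_conv)
  have "definable M A 3 ((\<lambda>p. map (\<lambda>v. v p) ?vs) ` {e. P (fst e) (fst (snd e)) (snd (snd e))}) \<longleftrightarrow>
      dfp M A ?vs (\<lambda>e. P (fst e) (fst (snd e)) (snd (snd e)))"
    apply (rule dfp_definable)
    subgoal by (auto simp: prod_eq_iff)
    subgoal by (rule surj)
    by simp
  then show ?thesis unfolding img .
qed

lemma definable4_dfp:
  fixes M :: "('f, 'r, 'a::linorder) struct"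
  shows "definable M A 4 {[w, x, y, z] | w x y z. P w x y z} \<longleftrightarrow>
     dfp M A [fst, \<lambda>e. fst (snd e), \<lambda>e. fst (snd (snd e)), \<lambda>e. snd (snd (snd e))]
       (\<lambda>e. P (fst e) (fst (snd e)) (fst (snd (snd e))) (snd (snd (snd e))))"
proof -
  let ?vs = "[fst, \<lambda>e. fst (snd e), \<lambda>e. fst (snd (snd e)), \<lambda>e. snd (snd (snd e))]"
  have img: "(\<lambda>p. map (\<lambda>v. v p) ?vs) ` {e. P (fst e) (fst (snd e)) (fst (snd (snd e))) (snd (snd (snd e)))} =
     {[w, x, y, z] | w x y z. P w x y z}"
    by (auto simp: image_def)
  have surj: "\<exists>e. map (\<lambda>v. v e) ?vs = xs" if "length xs = length ?vs" for xs :: "'a list"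
    using that by (auto simp: length_Suc_conv)
  have "definable M A 4 ((\<lambda>p. map (\<lambda>v. v p) ?vs) ` {e. P (fst e) (fst (snd e)) (fst (snd (snd e))) (snd (snd (snd e)))}) \<longleftrightarrow>
      dfp M A ?vs (\<lambda>e. P (fst e) (fst (snd e)) (fst (snd (snd e))) (snd (snd (snd e))))"
    apply (rule dfp_definable)
    subgoal by (auto simp: prod_eq_iff)
    subgoal by (rule surj)
    by simp
  then show ?thesis unfolding img .
qed

lemma dfp_pair_mem:
  assumes "definable2 M A S" "coord A vs v" "coord A vs w"
  shows "dfp M A vs (\<lambda>e. (v e, w e) \<in> S)"
  using dfp_subst[of M A "[fst, snd]" "\<lambda>p. p \<in> S" vs "\<lambda>e. (v e, w e)"] assms
  by (simp add: definable2_dfp)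

lemmas dfp_rules = dfp_ex dfp_all dfp_conj dfp_disj dfp_iff dfp_imp dfp_not dfp_le dfp_less dfp_eq dfp_const

lemma const_fun_eq: "((\<lambda>_. c) = (\<lambda>_. d)) \<longleftrightarrow> c = d"
  by (meson fun_cong)

lemmas coord_simps = coord_def const_fun_eq

section \<open>O-minimality in one variable\<close>

text \<open>In this form a one-sided germ is a first-order condition, so \<open>eventually\<close>
  may occur inside definable predicates.\<close>

lemma eventually_at_right_iff:
  fixes x :: "'a::{linorder_topology, no_top}"
  shows "eventually P (at_right x) \<longleftrightarrow> (\<exists>b>x. \<forall>y. x < y \<and> y < b \<longrightarrow> P y)"
proof -
  obtain z where "x < z" using gt_ex by blast
  then show ?thesis unfolding eventually_at_right[OF \<open>x < z\<close>] by blast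
qed

lemma eventually_at_left_iff:
  fixes x :: "'a::{linorder_topology, no_bot}"
  shows "eventually P (at_left x) \<longleftrightarrow> (\<exists>b<x. \<forall>y. b < y \<and> y < x \<longrightarrow> P y)"
proof -
  obtain z where "z < x" using lt_ex by blast
  then show ?thesis unfolding eventually_at_left[OF \<open>z < x\<close>] by blast
qed

lemma at_right_neq_bot: "at_right (x::'a::{linorder_topology, no_top, dense_order}) \<noteq> bot"
  unfolding trivial_limit_def eventually_at_right_iff by (meson dense)

lemma at_left_neq_bot: "at_left (x::'a::{linorder_topology, no_bot, dense_order}) \<noteq> bot"
  unfolding trivial_limit_def eventually_at_left_iff by (meson dense)

lemma open_intervals_cases:
  assumes "I \<in> open_intervals"
  obtains (Ioo) a b where "I = {a<..<b}" "a < b" | (Ioi) a where "I = {a<..}"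
    | (Iio) b where "I = {..<b}" | (all) "I = UNIV"
  using assms unfolding open_intervals_def by (elim UnE CollectE exE conjE singletonE) blast+

lemma open_intervals_convex:
  "I \<in> open_intervals \<Longrightarrow> x \<in> I \<Longrightarrow> z \<in> I \<Longrightarrow> x \<le> y \<Longrightarrow> y \<le> z \<Longrightarrow> y \<in> I"
  unfolding open_intervals_def by auto

text \<open>If the set has points arbitrarily close to \<open>a\<close> on the right, convexity
  fills the gap between them and a fixed point of the set; if not, it misses a right
  neighbourhood.\<close>

lemma convex_germ_right:
  fixes a :: "'a::{linorder_topology, no_top}"
  assumes "\<And>x y z. x \<in> S \<Longrightarrow> z \<in> S \<Longrightarrow> x \<le> y \<Longrightarrow> y \<le> z \<Longrightarrow> y \<in> S"
  shows "eventually (\<lambda>x. x \<in> S) (at_right a) \<or> eventually (\<lambda>x. x \<notin> S) (at_right a)"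
proof (rule disjCI)
  assume H: "\<not> eventually (\<lambda>x. x \<notin> S) (at_right a)"
  then obtain s where s: "s \<in> S" "a < s"
    unfolding eventually_at_right_iff using gt_ex[of a] by auto
  have "x \<in> S" if "a < x" "x < s" for x
    using H that s assms[of _ s x] unfolding eventually_at_right_iff by (meson less_imp_le)
  then show "eventually (\<lambda>x. x \<in> S) (at_right a)"
    unfolding eventually_at_right_iff using s by auto
qed

lemma convex_germ_left:
  fixes a :: "'a::{linorder_topology, no_bot}"
  assumes "\<And>x y z. x \<in> S \<Longrightarrow> z \<in> S \<Longrightarrow> x \<le> y \<Longrightarrow> y \<le> z \<Longrightarrow> y \<in> S"
  shows "eventually (\<lambda>x. x \<in> S) (at_left a) \<or> eventually (\<lambda>x. x \<notin> S) (at_left a)"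
proof (rule disjCI)
  assume H: "\<not> eventually (\<lambda>x. x \<notin> S) (at_left a)"
  then obtain s where s: "s \<in> S" "s < a"
    unfolding eventually_at_left_iff using lt_ex[of a] by auto
  have "x \<in> S" if "x < a" "s < x" for x
    using H that s assms[of s _ x] unfolding eventually_at_left_iff by (meson less_imp_le)
  then show "eventually (\<lambda>x. x \<in> S) (at_left a)"
    unfolding eventually_at_left_iff using s by auto
qed

lemma finite_union_germ:
  assumes "finite \<I>" "\<And>I. I \<in> \<I> \<Longrightarrow> eventually (\<lambda>x. x \<in> I) F \<or> eventually (\<lambda>x. x \<notin> I) F"
  shows "eventually (\<lambda>x. x \<in> \<Union>\<I>) F \<or> eventually (\<lambda>x. x \<notin> \<Union>\<I>) F"
proof (cases "\<exists>I\<in>\<I>. eventually (\<lambda>x. x \<in> I) F")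
  case True
  then show ?thesis by (auto elim: eventually_mono)
next
  case False
  then have "\<forall>I\<in>\<I>. eventually (\<lambda>x. x \<notin> I) F" using assms(2) by blast
  then have "eventually (\<lambda>x. \<forall>I\<in>\<I>. x \<notin> I) F" using assms(1) by (simp add: eventually_ball_finite_distrib)
  then show ?thesis by simp
qed

locale omin =
  fixes M :: "('f, 'r, 'a::{unbounded_dense_linorder, linorder_topology}) struct"
  assumes omin: "o_minimal M" and saturated: "omega_saturated M"
begin

abbreviation df1 :: "('a \<Rightarrow> bool) \<Rightarrow> bool" where "df1 P \<equiv> dfp M UNIV [\<lambda>x. x] P"
abbreviation df2 :: "('a \<Rightarrow> 'a \<Rightarrow> bool) \<Rightarrow> bool" where
  "df2 E \<equiv> dfp M UNIV [fst, snd] (\<lambda>z. E (fst z) (snd z))"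

lemma df1_pieces:
  assumes "df1 P"
  shows "\<exists>\<I>. finite \<I> \<and> \<I> \<subseteq> {{c} | c. True} \<union> open_intervals \<and> P = (\<lambda>x. x \<in> \<Union>\<I>)"
proof -
  have "definable M UNIV 1 ((\<lambda>x. [x]) ` {x. P x})" using assms unfolding definable1_dfp by simp
  from omin[unfolded o_minimal_def, rule_format, OF this] obtain \<I> where
    I: "finite \<I>" "\<I> \<subseteq> {{c} | c. True} \<union> open_intervals" "{x. P x} = \<Union>\<I>"
    by (elim exE conjE)
  have "P = (\<lambda>x. x \<in> \<Union>\<I>)" unfolding I(3)[symmetric] by simp
  then show ?thesis by (intro exI[of _ \<I>] conjI I(1,2))
qed

lemma germ_right:
  assumes "df1 P" shows "eventually P (at_right a) \<or> eventually (\<lambda>x. \<not> P x) (at_right a)"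
proof -
  from df1_pieces[OF assms] obtain \<I> where I: "finite \<I>"
    "\<I> \<subseteq> {{c} | c. True} \<union> open_intervals" "P = (\<lambda>x. x \<in> \<Union>\<I>)"
    by (elim exE conjE)
  show ?thesis unfolding I(3)
  proof (rule finite_union_germ[OF I(1)], rule convex_germ_right)
    fix I x y z assume "I \<in> \<I>" "x \<in> I" "z \<in> I" "x \<le> y" "y \<le> z"
    then show "y \<in> I" using I(2) open_intervals_convex[of I] by force
  qed
qed

lemma germ_left:
  assumes "df1 P" shows "eventually P (at_left a) \<or> eventually (\<lambda>x. \<not> P x) (at_left a)"
proof -
  from df1_pieces[OF assms] obtain \<I> where I: "finite \<I>"
    "\<I> \<subseteq> {{c} | c. True} \<union> open_intervals" "P = (\<lambda>x. x \<in> \<Union>\<I>)"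
    by (elim exE conjE)
  show ?thesis unfolding I(3)
  proof (rule finite_union_germ[OF I(1)], rule convex_germ_left)
    fix I x y z assume "I \<in> \<I>" "x \<in> I" "z \<in> I" "x \<le> y" "y \<le> z"
    then show "y \<in> I" using I(2) open_intervals_convex[of I] by force
  qed
qed

lemma open_interval_contains_Ioo:
  assumes "I \<in> open_intervals" obtains a b :: 'a where "a < b" "{a<..<b} \<subseteq> I"
proof -
  obtain a b :: 'a where ab: "a < b" using gt_ex by blast
  from assms show thesis
  proof (cases rule: open_intervals_cases)
    case (Ioo a b) then show ?thesis using that by blast
  next
    case (Ioi a)
    obtain b where "a < b" using gt_ex by blast
    moreover have "{a<..<b} \<subseteq> I" using Ioi by auto
    ultimately show ?thesis by (rule that)
  next
    case (Iio b)
    obtain a where "a < b" using lt_ex by blast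
    moreover have "{a<..<b} \<subseteq> I" using Iio by auto
    ultimately show ?thesis by (rule that)
  next
    case all then show ?thesis using that[OF ab] by auto
  qed
qed

lemma infinite_imp_interval:
  assumes "df1 P" "infinite {x. P x}"
  obtains a b where "a < b" "\<And>x. a < x \<Longrightarrow> x < b \<Longrightarrow> P x"
proof -
  from df1_pieces[OF assms(1)] obtain \<I> where I: "finite \<I>"
    "\<I> \<subseteq> {{c} | c. True} \<union> open_intervals" "P = (\<lambda>x. x \<in> \<Union>\<I>)"
    by (elim exE conjE)
  have "infinite (\<Union>\<I>)" using assms(2) unfolding I(3) by (simp only: Collect_mem_eq not_False_eq_True)
  then obtain J where J: "J \<in> \<I>" "infinite J" using I(1) finite_Union by meson
  then have "J \<in> open_intervals" using I(2) by auto
  then obtain a b where ab: "a < b" "{a<..<b} \<subseteq> J" by (rule open_interval_contains_Ioo)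
  show thesis
  proof (rule that[OF ab(1)])
    fix x assume "a < x" "x < b"
    then have "x \<in> J" using ab(2) by auto
    then show "P x" using I(3) J(1) by auto
  qed
qed

text \<open>The right-hand side is first-order. This is how infinity and finiteness enter formulas
  later.\<close>

lemma infinite_iff_interval:
  assumes "df1 P"
  shows "infinite {x. P x} \<longleftrightarrow> (\<exists>a b. a < b \<and> (\<forall>x. a < x \<and> x < b \<longrightarrow> P x))"
proof
  assume "\<exists>a b. a < b \<and> (\<forall>x. a < x \<and> x < b \<longrightarrow> P x)"
  then obtain a b where "a < b" "\<forall>x. a < x \<and> x < b \<longrightarrow> P x" by blast
  moreover from this have "{a<..<b} \<subseteq> {x. P x}" by auto
  ultimately show "infinite {x. P x}" using infinite_Ioo infinite_super by blast
qed (metis infinite_imp_interval[OF assms])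

text \<open>The order need not be complete. But a definable set is a finite union of points and
  intervals whose finite ends belong to the structure, so the largest of the suprema of the pieces
  serves; the pieces unbounded above are excluded by \<open>b\<close>.\<close>

lemma definable_lub:
  assumes "df1 P" "P x0" "\<And>x. P x \<Longrightarrow> x \<le> b"
  obtains s where "\<And>x. P x \<Longrightarrow> x \<le> s" "\<And>c. (\<And>x. P x \<Longrightarrow> x \<le> c) \<Longrightarrow> s \<le> c"
proof -
  from df1_pieces[OF assms(1)] obtain \<I> where I: "finite \<I>"
    "\<I> \<subseteq> {{c} | c. True} \<union> open_intervals" "P = (\<lambda>x. x \<in> \<Union>\<I>)"
    by (elim exE conjE)
  have lub: "\<exists>s. (\<forall>x\<in>J. x \<le> s) \<and> (\<forall>c. (\<forall>x\<in>J. x \<le> c) \<longrightarrow> s \<le> c)" if J: "J \<in> \<I>" for J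
  proof -
    have bd: "\<forall>x\<in>J. x \<le> b" using assms(3) I(3) J by auto
    have "J \<in> {{c} | c. True} \<union> open_intervals" using I(2) J by (rule subsetD)
    then consider (pt) c where "J = {c}" | (oi) "J \<in> open_intervals" by blast
    then show ?thesis
    proof cases
      case pt then show ?thesis by auto
    next
      case oi
      then show ?thesis
      proof (cases rule: open_intervals_cases)
      case (Ioo a b)
      have "b \<le> c" if "\<forall>x\<in>J. x \<le> c" for c
      proof (rule ccontr)
        assume "\<not> b \<le> c"
        then have "max a c < b" using Ioo(2) by (simp add: not_le)
        then obtain z where z: "max a c < z" "z < b" using dense by blast
        then have "z \<in> J" using Ioo(1) by simp
        then show False using that z(1) by (meson max_less_iff_conj not_le)
      qed
      moreover have "\<forall>x\<in>J. x \<le> b" unfolding Ioo(1) by (simp add: less_imp_le)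
      ultimately show ?thesis by (intro exI[of _ b] conjI allI impI)
    next
      case (Ioi a)
      obtain z where z: "max a b < z" using gt_ex by blast
      then have "z \<in> J" using Ioi by simp
      then have "z \<le> b" using bd by blast
      moreover have "b < z" using z by simp
      ultimately have False by order
      then show ?thesis by (rule FalseE)
    next
      case (Iio b)
      have "b \<le> c" if "\<forall>x\<in>J. x \<le> c" for c
      proof (rule dense_le)
        fix x assume "x < b"
        then have "x \<in> J" using Iio by simp
        then show "x \<le> c" by (rule bspec[OF that])
      qed
      moreover have "\<forall>x\<in>J. x \<le> b" unfolding Iio by (simp add: less_imp_le)
      ultimately show ?thesis by (intro exI[of _ b] conjI allI impI)
    next
      case all
      obtain z where z: "b < z" using gt_ex by blast
      have "z \<le> b" using bd all by blast
      moreover have "b < z" using z by simp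
      ultimately have False by order
      then show ?thesis by (rule FalseE)
      qed
    qed
  qed
  from lub obtain \<sigma> where \<sigma>: "\<And>J x. J \<in> \<I> \<Longrightarrow> x \<in> J \<Longrightarrow> x \<le> \<sigma> J"
      "\<And>J c. J \<in> \<I> \<Longrightarrow> (\<forall>x\<in>J. x \<le> c) \<Longrightarrow> \<sigma> J \<le> c"
    by metis
  have ne: "\<I> \<noteq> {}" using assms(2) I(3) by auto
  show thesis
  proof (rule that[of "Max (\<sigma> ` \<I>)"])
    fix x assume "P x"
    then obtain J where "J \<in> \<I>" "x \<in> J" using I(3) by auto
    then show "x \<le> Max (\<sigma> ` \<I>)" using \<sigma>(1) I(1) by (meson Max_ge finite_imageI imageI order_trans)
  next
    fix c assume c: "\<And>x. P x \<Longrightarrow> x \<le> c"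
    have "\<sigma> J \<le> c" if "J \<in> \<I>" for J
      using that by (rule \<sigma>(2)) (use c I(3) that in blast)
    then show "Max (\<sigma> ` \<I>) \<le> c" using I(1) ne by simp
  qed
qed

text \<open>The lower bounds form a definable set, bounded by \<open>x0\<close> and containing
  \<open>b\<close>; their supremum is the required infimum.\<close>

lemma definable_glb:
  assumes "df1 P" "P x0" "\<And>x. P x \<Longrightarrow> b \<le> x"
  obtains s where "\<And>x. P x \<Longrightarrow> s \<le> x" "\<And>c. (\<And>x. P x \<Longrightarrow> c \<le> x) \<Longrightarrow> c \<le> s"
proof -
  have P: "dfp M UNIV vs (\<lambda>e. P (v e))" if "coord UNIV vs v" for vs v
    by (rule dfp_subst[OF assms(1)]) (use that in simp)
  have "df1 (\<lambda>l. \<forall>x. P x \<longrightarrow> l \<le> x)"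
    by (intro dfp_rules P; simp add: coord_simps)
  from definable_lub[OF this, of b x0] obtain s where
    s: "\<And>l. (\<forall>x. P x \<longrightarrow> l \<le> x) \<Longrightarrow> l \<le> s" "\<And>c. (\<And>l. \<forall>x. P x \<longrightarrow> l \<le> x \<Longrightarrow> l \<le> c) \<Longrightarrow> s \<le> c"
    using assms(2,3) by auto
  show thesis
  proof (rule that)
    show "s \<le> x" if "P x" for x using s(2) that by blast
    show "c \<le> s" if "\<And>x. P x \<Longrightarrow> c \<le> x" for c using s(1) that by blast
  qed
qed

text \<open>Connectedness of \<open>{s..t}\<close> for definable sets. Let \<open>m\<close> be the
  supremum of those \<open>x\<close> for which \<open>P\<close> holds on \<open>{s..x}\<close>:
  openness of the complement gives \<open>P m\<close>, and openness of \<open>P\<close> then forces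
  \<open>m = t\<close>.\<close>

lemma definable_connected_interval:
  assumes P: "df1 P"
    and open1: "\<And>x. s \<le> x \<Longrightarrow> x \<le> t \<Longrightarrow> P x \<Longrightarrow> \<exists>u v. u < x \<and> x < v \<and> (\<forall>y. u < y \<and> y < v \<and> s \<le> y \<and> y \<le> t \<longrightarrow> P y)"
    and open2: "\<And>x. s \<le> x \<Longrightarrow> x \<le> t \<Longrightarrow> \<not> P x \<Longrightarrow> \<exists>u v. u < x \<and> x < v \<and> (\<forall>y. u < y \<and> y < v \<and> s \<le> y \<and> y \<le> t \<longrightarrow> \<not> P y)"
    and "s \<le> t" "P s"
  shows "P t"
proof -
  have Pc: "dfp M UNIV vs (\<lambda>e. P (v e))" if "coord UNIV vs v" for vs v
    by (rule dfp_subst[OF P]) (use that in simp)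
  define B where "B x \<longleftrightarrow> s \<le> x \<and> x \<le> t \<and> (\<forall>y. s \<le> y \<and> y \<le> x \<longrightarrow> P y)" for x
  have "df1 B" unfolding B_def by (intro dfp_rules Pc; simp add: coord_simps)
  moreover have "B s" using assms(4,5) by (auto simp: B_def)
  moreover have "\<And>x. B x \<Longrightarrow> x \<le> t" by (auto simp: B_def)
  ultimately obtain m where m: "\<And>x. B x \<Longrightarrow> x \<le> m" "\<And>c. (\<And>x. B x \<Longrightarrow> x \<le> c) \<Longrightarrow> m \<le> c"
    using definable_lub by metis
  have sm: "s \<le> m" "m \<le> t" using m(1)[OF \<open>B s\<close>] m(2)[of t] by (auto simp: B_def)
  have below: "P y" if "s \<le> y" "y < m" for y
    using that m(2)[of y] unfolding B_def by (meson linorder_not_le less_imp_le)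
  have "P m"
  proof (rule ccontr)
    assume nP: "\<not> P m"
    then obtain u v where uv: "u < m" "m < v" "\<forall>y. u < y \<and> y < v \<and> s \<le> y \<and> y \<le> t \<longrightarrow> \<not> P y"
      using open2 sm by blast
    have "s < m" using nP assms(5) sm(1) by (cases "s = m") auto
    then obtain y where "max u s < y" "y < m" using dense[of "max u s" m] uv(1) by auto
    moreover from this have "y < v" using uv(2) by order
    moreover from calculation have "u < y" "s \<le> y" "y \<le> t" using sm(2) by auto
    ultimately show False using uv(3) below[of y] by blast
  qed
  then have Bm: "B m" using sm below unfolding B_def by (metis order_less_le)
  have "m = t"
  proof (rule ccontr)
    assume "m \<noteq> t"
    then have "m < t" using sm by auto
    obtain u v where uv: "u < m" "m < v" "\<forall>y. u < y \<and> y < v \<and> s \<le> y \<and> y \<le> t \<longrightarrow> P y"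
      using open1 sm \<open>P m\<close> by blast
    obtain z where z: "m < z" "z < min v t" using dense[of m "min v t"] uv \<open>m < t\<close> by auto
    have "P y" if "s \<le> y" "y \<le> z" for y
    proof (cases "y \<le> m")
      case True then show ?thesis using Bm that by (auto simp: B_def)
    next
      case False
      then have "u < y \<and> y < v \<and> s \<le> y \<and> y \<le> t" using uv z that by auto
      then show ?thesis using uv(3) by blast
    qed
    then have "B z" using z sm by (auto simp: B_def)
    then show False using m(1) z(1) by (meson linorder_not_le)
  qed
  with \<open>P m\<close> show ?thesis by simp
qed

end

section \<open>Saturation and monotonicity\<close>

lemma dfp2_coord:
  assumes "dfp M A [fst, snd] (\<lambda>z. E (fst z) (snd z))" "coord A vs v" "coord A vs w"
  shows "dfp M A vs (\<lambda>e. E (v e) (w e))"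
  using dfp_subst[of M A "[fst, snd]" "\<lambda>z. E (fst z) (snd z)" vs "\<lambda>e. (v e, w e)"] assms by simp

lemma dfp1_coord:
  assumes "dfp M A [\<lambda>x. x] P" "coord A vs v"
  shows "dfp M A vs (\<lambda>e. P (v e))"
  using dfp_subst[of M A "[\<lambda>x. x]" P vs v] assms by simp

lemma Ioo_subsetD:
  fixes j1 :: "'a::dense_linorder"
  assumes "j1 < j2" "\<And>x. j1 < x \<Longrightarrow> x < j2 \<Longrightarrow> i1 < x \<and> x < i2"
  shows "i1 \<le> j1" "j2 \<le> i2"
proof -
  have "{j1<..<j2} \<subseteq> {i1<..<i2}" using assms(2) by auto
  then show "i1 \<le> j1" "j2 \<le> i2" using assms(1) by (simp_all add: greaterThanLessThan_subseteq_greaterThanLessThan)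
qed

text \<open>\<open>chain E n l z\<close>: the fibre of \<open>E\<close> over \<open>l\<close> has at least \<open>n\<close> elements above \<open>z\<close>.\<close>

primrec chain :: "('a::linorder \<Rightarrow> 'a \<Rightarrow> bool) \<Rightarrow> nat \<Rightarrow> 'a \<Rightarrow> 'a \<Rightarrow> bool" where
  "chain E 0 l z = True"
| "chain E (Suc n) l z = (\<exists>x. z < x \<and> E l x \<and> chain E n l x)"

lemma dfp_chain:
  assumes "dfp M A [fst, snd] (\<lambda>z. E (fst z) (snd z))"
  shows "dfp M A [fst, snd] (\<lambda>z. chain E n (fst z) (snd z))"
proof (induction n)
  case 0
  show ?case unfolding chain.simps by (rule dfp_const)
next
  case (Suc n)
  show ?case unfolding chain.simps
    by (intro dfp_rules dfp2_coord[OF assms] dfp2_coord[OF Suc]; simp add: coord_simps)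
qed

lemma chain_card: "chain E n l z \<Longrightarrow> \<exists>S. finite S \<and> card S = n \<and> (\<forall>x\<in>S. z < x \<and> E l x)"
proof (induction n arbitrary: z)
  case 0
  show ?case by (intro exI[of _ "{}"]) simp
next
  case (Suc n)
  then obtain x where x: "z < x" "E l x" "chain E n l x" by auto
  from Suc.IH[OF x(3)] obtain S where S: "finite S" "card S = n" "\<forall>y\<in>S. x < y \<and> E l y" by blast
  then have "x \<notin> S" by blast
  then have "card (insert x S) = Suc n" using S by simp
  moreover have "\<forall>y\<in>insert x S. z < y \<and> E l y" using S(3) x by (auto intro: less_trans)
  ultimately show ?case using S(1) by (intro exI[of _ "insert x S"]) simp
qed

lemma card_chain:
  "finite S \<Longrightarrow> card S = n \<Longrightarrow> (\<forall>x\<in>S. z < x \<and> E l x) \<Longrightarrow> chain E n l z"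
proof (induction n arbitrary: S z)
  case 0
  show ?case by simp
next
  case (Suc n)
  then have ne: "S \<noteq> {}" by auto
  define x where "x = Min S"
  have x: "x \<in> S" using Suc.prems(1) ne unfolding x_def by (rule Min_in)
  have "chain E n l x"
  proof (rule Suc.IH)
    show "finite (S - {x})" using Suc.prems(1) by simp
    show "card (S - {x}) = n" using Suc.prems x by simp
    show "\<forall>y\<in>S - {x}. x < y \<and> E l y"
    proof
      fix y assume y: "y \<in> S - {x}"
      then have "x \<le> y" using Suc.prems(1) unfolding x_def by simp
      then show "x < y \<and> E l y" using y Suc.prems(3) by auto
    qed
  qed
  then show ?case using x Suc.prems(3) by auto
qed

lemma chain_le: "chain E m l z \<Longrightarrow> n \<le> m \<Longrightarrow> chain E n l z"
proof (induction n arbitrary: m z)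
  case (Suc n)
  then obtain m' where "m = Suc m'" by (cases m) auto
  with Suc show ?case by auto
qed simp

lemma finite_lower_bound:
  fixes S :: "'a::{linorder, no_bot} set"
  assumes "finite S" shows "\<exists>z. \<forall>x\<in>S. z < x"
proof (cases "S = {}")
  case False
  obtain z where "z < Min S" using lt_ex by blast
  then show ?thesis using assms False by auto
qed simp

context omin
begin

lemma infinite_interval:
  assumes "infinite {x. P x}" "df1 P" shows "\<exists>a b. a < b \<and> (\<forall>x. a < x \<and> x < b \<longrightarrow> P x)"
  using assms infinite_iff_interval by (simp only: not_False_eq_True)

text \<open>The only appeal to \<open>omega_saturated\<close>. The formulas saying that the fibre
  over \<open>l\<close> has at least \<open>n\<close> elements grow stronger with \<open>n\<close>,
  so finitely many of them have a common solution; a realization of all of them has an infinite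
  fibre.\<close>

lemma saturation_infinite:
  assumes E: "df2 E" and big: "\<And>n. \<exists>l S. finite S \<and> card S = n \<and> (\<forall>x\<in>S. E l x)"
  shows "\<exists>l. infinite {x. E l x}"
proof -
  obtain A where A: "finite A" "A \<subseteq> UNIV" "dfp M A [fst, snd] (\<lambda>z. E (fst z) (snd z))"
    using dfp_finite_params[OF E] by metis
  have "dfp M A [\<lambda>x. x] (\<lambda>l. \<exists>z. chain E n l z)" for n
    by (intro dfp_rules dfp2_coord[OF dfp_chain[OF A(3)]]; simp add: coord_simps)
  then have "\<forall>n. \<exists>\<phi>. wf_fm M \<phi> \<and> fm_params \<phi> \<subseteq> A \<and> fv_fm \<phi> \<subseteq> {..<length [\<lambda>x::'a. x]} \<and>
     (\<forall>e. (\<exists>z. chain E n e z) \<longleftrightarrow> sat M (\<lambda>i. ([\<lambda>x. x] ! i) e) \<phi>)"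
    unfolding dfp_def by (rule allI)
  from choice[OF this] obtain \<phi> where \<phi>: "\<forall>n. wf_fm M (\<phi> n) \<and> fm_params (\<phi> n) \<subseteq> A \<and> fv_fm (\<phi> n) \<subseteq> {..<length [\<lambda>x::'a. x]} \<and>
     (\<forall>e. (\<exists>z. chain E n e z) \<longleftrightarrow> sat M (\<lambda>i. ([\<lambda>x. x] ! i) e) (\<phi> n))" by (elim exE)
  have sat: "sat M (\<lambda>_. l) (\<phi> n) \<longleftrightarrow> (\<exists>z. chain E n l z)" for l n
  proof -
    have "sat M (\<lambda>_. l) (\<phi> n) \<longleftrightarrow> sat M (\<lambda>i. ([\<lambda>x. x] ! i) l) (\<phi> n)"
      using \<phi> by (intro sat_cong ballI) (auto simp: nth_Cons' subset_iff)
    then show ?thesis using \<phi> by simp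
  qed
  have fin: "\<exists>x. \<forall>\<psi>\<in>\<Psi>. sat M (\<lambda>_. x) \<psi>" if \<Psi>: "finite \<Psi>" "\<Psi> \<subseteq> range \<phi>" for \<Psi>
  proof -
    obtain N where N: "finite N" "\<Psi> = \<phi> ` N" using finite_subset_image[OF \<Psi>] by auto
    \<comment> \<open>The largest index decides; \<open>0\<close> is inserted because
      \<open>N\<close> may be empty.\<close>
    obtain l S where S: "finite S" "card S = Max (insert 0 N)" "\<forall>x\<in>S. E l x" using big by metis
    obtain z where "\<forall>x\<in>S. z < x" using finite_lower_bound[OF S(1)] by blast
    then have "chain E (Max (insert 0 N)) l z" using S by (intro card_chain[of S]) auto
    then have "chain E n l z" if "n \<in> N" for n using N(1) that by (auto elim!: chain_le)
    then have "\<forall>\<psi>\<in>\<Psi>. sat M (\<lambda>_. l) \<psi>" unfolding N(2) by (auto simp: sat)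
    then show ?thesis by blast
  qed
  have "\<exists>x. \<forall>\<psi>\<in>range \<phi>. sat M (\<lambda>_. x) \<psi>"
  proof (rule saturated[unfolded omega_saturated_def, rule_format, of A "range \<phi>"])
    show "finite A" by (rule A(1))
    show "wf_fm M \<psi> \<and> fm_params \<psi> \<subseteq> A \<and> fv_fm \<psi> \<subseteq> {0}" if "\<psi> \<in> range \<phi>" for \<psi>
      using \<phi> that by (auto simp: subset_iff)
    show "\<exists>x. \<forall>\<psi>\<in>\<Psi>. sat M (\<lambda>_. x) \<psi>" if "finite \<Psi>" "\<Psi> \<subseteq> range \<phi>" for \<Psi> using fin[OF that] .
  qed
  then obtain l where l: "\<And>n. \<exists>z. chain E n l z" using sat by auto
  have "infinite {x. E l x}"
  proof
    assume fin: "finite {x. E l x}"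
    obtain z where "chain E (Suc (card {x. E l x})) l z" using l[of "Suc (card {x. E l x})"] by (elim exE)
    from chain_card[OF this] obtain S where S: "finite S" "card S = Suc (card {x. E l x})"
      "\<forall>x\<in>S. z < x \<and> E l x" by (elim exE conjE)
    then have "card S \<le> card {x. E l x}" using fin by (intro card_mono) auto
    with S(2) show False by simp
  qed
  then show ?thesis by blast
qed

text \<open>Finitely many points chosen one after the other, each close to the previous one, have a common
  \<open>l\<close>. Saturation then provides an \<open>l\<close> common to infinitely many points.\<close>

lemma star_left:
  assumes E: "df2 E" and i: "i1 < i2"
    and ev: "\<And>x. i1 < x \<Longrightarrow> x < i2 \<Longrightarrow> eventually (E x) (at_left x)"
  shows "\<exists>l. infinite {x. i1 < x \<and> x < i2 \<and> l < x \<and> E x l}"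
proof (rule saturation_infinite)
  show "df2 (\<lambda>l x. i1 < x \<and> x < i2 \<and> l < x \<and> E x l)"
    by (intro dfp_rules dfp2_coord[OF E]; simp add: coord_simps)
  fix n
  \<comment> \<open>Invariant of the choice: \<open>m\<close> is a lower bound of the points chosen
    so far, and every \<open>l\<close> in \<open>{c<..<m}\<close> serves all of them. The next point
    is taken inside this interval, so the choice proceeds to the left.\<close>
  have "\<exists>S m c. finite S \<and> card S = n \<and> i1 < m \<and> m < i2 \<and> c < m \<and>
     (\<forall>x\<in>S. i1 < x \<and> x < i2 \<and> m \<le> x \<and> (\<forall>l. c < l \<and> l < m \<longrightarrow> E x l))"
  proof (induction n)
    case 0
    obtain m where "i1 < m" "m < i2" using dense[OF i] by blast
    then show ?case by (intro exI[of _ "{}"] exI[of _ m] exI[of _ i1]) simp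
  next
    case (Suc n)
    then obtain S m c where S: "finite S" "card S = n" "i1 < m" "m < i2" "c < m"
      "\<forall>x\<in>S. i1 < x \<and> x < i2 \<and> m \<le> x \<and> (\<forall>l. c < l \<and> l < m \<longrightarrow> E x l)" by blast
    obtain x where x: "max c i1 < x" "x < m" using dense[of "max c i1" m] S(3,5) by auto
    then have xi: "i1 < x" "x < i2" "c < x" using S(4) by auto
    obtain b where b: "b < x" "\<And>y. b < y \<Longrightarrow> y < x \<Longrightarrow> E x y"
      using ev[OF xi(1,2)] unfolding eventually_at_left_iff by blast
    have "x \<notin> S" using S(6) x(2) by auto
    then have "card (insert x S) = Suc n" using S by simp
    moreover have "\<forall>y\<in>insert x S. i1 < y \<and> y < i2 \<and> x \<le> y \<and> (\<forall>l. max b c < l \<and> l < x \<longrightarrow> E y l)"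
    proof
      fix y assume "y \<in> insert x S"
      then show "i1 < y \<and> y < i2 \<and> x \<le> y \<and> (\<forall>l. max b c < l \<and> l < x \<longrightarrow> E y l)"
      proof
        assume "y = x" then show ?thesis using xi b by simp
      next
        assume "y \<in> S"
        then have y: "i1 < y" "y < i2" "m \<le> y" "\<And>l. c < l \<Longrightarrow> l < m \<Longrightarrow> E y l" using S(6) by auto
        have "E y l" if "max b c < l" "l < x" for l
          using that x(2) by (intro y(4)) (simp, order)
        then show ?thesis using y x(2) by (auto intro: less_imp_le less_le_trans)
      qed
    qed
    ultimately show ?case using S(1) xi b(1)
      by (intro exI[of _ "insert x S"] exI[of _ x] exI[of _ "max b c"]) simp
  qed
  then obtain S m c where S: "finite S" "card S = n" "c < m"
    "\<forall>x\<in>S. i1 < x \<and> x < i2 \<and> m \<le> x \<and> (\<forall>l. c < l \<and> l < m \<longrightarrow> E x l)" by blast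
  obtain l where l: "c < l" "l < m" using dense[OF S(3)] by blast
  have "\<forall>x\<in>S. i1 < x \<and> x < i2 \<and> l < x \<and> E x l" using S(4) l by (auto intro: less_le_trans)
  then show "\<exists>l S. finite S \<and> card S = n \<and> (\<forall>x\<in>S. i1 < x \<and> x < i2 \<and> l < x \<and> E x l)"
    using S(1,2) by blast
qed

text \<open>Mirror image of \<open>star_left\<close>: the points are chosen from left to
  right.\<close>

lemma star_right:
  assumes E: "df2 E" and i: "i1 < i2"
    and ev: "\<And>x. i1 < x \<Longrightarrow> x < i2 \<Longrightarrow> eventually (E x) (at_right x)"
  shows "\<exists>l. infinite {x. i1 < x \<and> x < i2 \<and> x < l \<and> E x l}"
proof (rule saturation_infinite)
  show "df2 (\<lambda>l x. i1 < x \<and> x < i2 \<and> x < l \<and> E x l)"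
    by (intro dfp_rules dfp2_coord[OF E]; simp add: coord_simps)
  fix n
  have "\<exists>S m c. finite S \<and> card S = n \<and> i1 < m \<and> m < i2 \<and> m < c \<and>
     (\<forall>x\<in>S. i1 < x \<and> x < i2 \<and> x \<le> m \<and> (\<forall>l. m < l \<and> l < c \<longrightarrow> E x l))"
  proof (induction n)
    case 0
    obtain m where "i1 < m" "m < i2" using dense[OF i] by blast
    then show ?case by (intro exI[of _ "{}"] exI[of _ m] exI[of _ i2]) simp
  next
    case (Suc n)
    then obtain S m c where S: "finite S" "card S = n" "i1 < m" "m < i2" "m < c"
      "\<forall>x\<in>S. i1 < x \<and> x < i2 \<and> x \<le> m \<and> (\<forall>l. m < l \<and> l < c \<longrightarrow> E x l)" by blast
    obtain x where x: "m < x" "x < min c i2" using dense[of m "min c i2"] S(4,5) by auto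
    then have xi: "i1 < x" "x < i2" "x < c" using S(3) by auto
    obtain b where b: "x < b" "\<And>y. x < y \<Longrightarrow> y < b \<Longrightarrow> E x y"
      using ev[OF xi(1,2)] unfolding eventually_at_right_iff by blast
    have "x \<notin> S" using S(6) x(1) by auto
    then have "card (insert x S) = Suc n" using S by simp
    moreover have "\<forall>y\<in>insert x S. i1 < y \<and> y < i2 \<and> y \<le> x \<and> (\<forall>l. x < l \<and> l < min b c \<longrightarrow> E y l)"
    proof
      fix y assume "y \<in> insert x S"
      then show "i1 < y \<and> y < i2 \<and> y \<le> x \<and> (\<forall>l. x < l \<and> l < min b c \<longrightarrow> E y l)"
      proof
        assume "y = x" then show ?thesis using xi b by simp
      next
        assume "y \<in> S"
        then have y: "i1 < y" "y < i2" "y \<le> m" "\<And>l. m < l \<Longrightarrow> l < c \<Longrightarrow> E y l" using S(6) by auto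
        have "E y l" if "x < l" "l < min b c" for l
          using that x(1) by (intro y(4)) (order, simp)
        then show ?thesis using y x(1) by (auto intro: less_imp_le le_less_trans)
      qed
    qed
    ultimately show ?case using S(1) xi b(1)
      by (intro exI[of _ "insert x S"] exI[of _ x] exI[of _ "min b c"]) simp
  qed
  then obtain S m c where S: "finite S" "card S = n" "m < c"
    "\<forall>x\<in>S. i1 < x \<and> x < i2 \<and> x \<le> m \<and> (\<forall>l. m < l \<and> l < c \<longrightarrow> E x l)" by blast
  obtain l where l: "m < l" "l < c" using dense[OF S(3)] by blast
  have "\<forall>x\<in>S. i1 < x \<and> x < i2 \<and> x < l \<and> E x l" using S(4) l by (auto intro: le_less_trans)
  then show "\<exists>l S. finite S \<and> card S = n \<and> (\<forall>x\<in>S. i1 < x \<and> x < i2 \<and> x < l \<and> E x l)"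
    using S(1,2) by blast
qed

text \<open>Only the restriction to the interval has to be definable. The functions below are
  introduced by \<open>THE\<close> or \<open>Min\<close> and take unspecified values
  elsewhere.\<close>

definition dfun :: "'a \<Rightarrow> 'a \<Rightarrow> ('a \<Rightarrow> 'a) \<Rightarrow> bool" where
  "dfun i1 i2 f \<longleftrightarrow> df2 (\<lambda>x y. i1 < x \<and> x < i2 \<and> f x = y)"

lemma dfun_subinterval:
  assumes f: "dfun i1 i2 f" and j: "i1 \<le> j1" "j2 \<le> i2"
  shows "dfun j1 j2 f"
proof -
  have eq: "(\<lambda>z. j1 < fst z \<and> fst z < j2 \<and> f (fst z) = snd z) =
    (\<lambda>z. j1 < fst z \<and> fst z < j2 \<and> i1 < fst z \<and> fst z < i2 \<and> f (fst z) = snd z)"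
    using j by (intro ext) (auto intro: le_less_trans less_le_trans)
  show ?thesis unfolding dfun_def eq
    by (intro dfp_conj dfp_less dfp2_coord[OF f[unfolded dfun_def]]; simp add: coord_simps)
qed

lemma dfun_rel:
  assumes f: "dfun i1 i2 f" and R: "df2 R"
  shows "df2 (\<lambda>x y. i1 < x \<and> x < i2 \<and> i1 < y \<and> y < i2 \<and> R (f x) (f y))"
proof -
  have eq: "(\<lambda>z. i1 < fst z \<and> fst z < i2 \<and> i1 < snd z \<and> snd z < i2 \<and> R (f (fst z)) (f (snd z))) =
    (\<lambda>z. \<exists>u v. (i1 < fst z \<and> fst z < i2 \<and> f (fst z) = u) \<and> (i1 < snd z \<and> snd z < i2 \<and> f (snd z) = v) \<and> R u v)"
    by (intro ext) auto
  note F = dfp2_coord[OF f[unfolded dfun_def]]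
  show ?thesis unfolding eq
    by (intro dfp_ex, intro dfp_conj[OF F dfp_conj[OF F dfp2_coord[OF R]]]; simp add: coord_simps)
qed

text \<open>Taking for \<open>E x l\<close> that \<open>R (f y) (f x)\<close> holds for all \<open>y\<close> between \<open>l\<close> and \<open>x\<close>, the common \<open>l\<close> turns the
  condition on germs into monotonicity on an interval.\<close>

lemma monotone_subinterval_aux:
  assumes i: "i1 < i2" and R: "df2 (\<lambda>x y. i1 < x \<and> x < i2 \<and> i1 < y \<and> y < i2 \<and> R (f x) (f y))"
    and inf: "infinite {x. i1 < x \<and> x < i2 \<and> eventually (\<lambda>y. i1 < y \<and> y < i2 \<and> R (f y) (f x)) (at_left x)}"
  shows "\<exists>j1 j2. i1 \<le> j1 \<and> j1 < j2 \<and> j2 \<le> i2 \<and> (\<forall>x y. j1 < x \<and> x < y \<and> y < j2 \<longrightarrow> R (f x) (f y))"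
proof -
  \<comment> \<open>The bounds stay inside the relation because \<open>f\<close> is definable only
    between them.\<close>
  let ?R = "\<lambda>x y. i1 < x \<and> x < i2 \<and> i1 < y \<and> y < i2 \<and> R (f x) (f y)"
  have R1: "df1 (\<lambda>x. eventually (\<lambda>y. ?R y x) (at_left x))"
    unfolding eventually_at_left_iff
    by (intro dfp_ex dfp_all dfp_conj dfp_imp dfp2_coord[OF R] dfp_less; simp add: coord_simps)
  have "{x. i1 < x \<and> x < i2 \<and> eventually (\<lambda>y. i1 < y \<and> y < i2 \<and> R (f y) (f x)) (at_left x)}
     \<subseteq> {x. eventually (\<lambda>y. ?R y x) (at_left x)}" by (auto elim: eventually_mono)
  then have "infinite {x. eventually (\<lambda>y. ?R y x) (at_left x)}" using inf infinite_super by blast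
  from infinite_interval[OF this R1] obtain k1 k2 where k: "k1 < k2"
    "\<And>x. k1 < x \<Longrightarrow> x < k2 \<Longrightarrow> eventually (\<lambda>y. ?R y x) (at_left x)" by (elim exE conjE) simp
  have ki: "i1 < x \<and> x < i2" if "k1 < x" "x < k2" for x
    using eventually_happens'[OF at_left_neq_bot k(2)[OF that]] by blast
  define E where "E x l \<longleftrightarrow> (\<forall>y. l < y \<and> y < x \<longrightarrow> ?R y x)" for x l
  have E: "df2 E" unfolding E_def
    by (intro dfp_all dfp_conj dfp_imp dfp2_coord[OF R] dfp_less; simp add: coord_simps)
  have "eventually (E x) (at_left x)" if "k1 < x" "x < k2" for x
    using k(2)[OF that] unfolding eventually_at_left_iff E_def by (meson less_trans)
  from star_left[OF E k(1) this] obtain l where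
    "infinite {x. k1 < x \<and> x < k2 \<and> l < x \<and> E x l}" by blast
  moreover have "df1 (\<lambda>x. k1 < x \<and> x < k2 \<and> l < x \<and> E x l)"
    by (intro dfp_rules dfp2_coord[OF E]; simp add: coord_simps)
  from infinite_interval[OF calculation this] obtain j1 j2 where j: "j1 < j2"
    "\<And>x. j1 < x \<Longrightarrow> x < j2 \<Longrightarrow> k1 < x \<and> x < k2 \<and> l < x \<and> E x l" by (elim exE conjE) simp
  have "i1 \<le> j1" "j2 \<le> i2" using Ioo_subsetD[OF j(1), of i1 i2] j(2) ki by auto
  moreover have "R (f x) (f y)" if "j1 < x" "x < y" "y < j2" for x y
  proof -
    have "l < x" "E y l" using j(2)[of x] j(2)[of y] that by auto
    then show ?thesis using that(2) unfolding E_def by blast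
  qed
  ultimately show ?thesis using j(1) by blast
qed

text \<open>By the dichotomy for germs, just to the left of each point one of \<open><\<close>,
  \<open>>\<close> and \<open>=\<close> compares \<open>f y\<close> with \<open>f x\<close>. One of
  the three therefore occurs at infinitely many points.\<close>

lemma monotone_subinterval:
  assumes f: "dfun i1 i2 f" and i: "i1 < i2"
  shows "\<exists>j1 j2. i1 \<le> j1 \<and> j1 < j2 \<and> j2 \<le> i2 \<and>
     ((\<forall>x y. j1 < x \<and> x < y \<and> y < j2 \<longrightarrow> f x < f y) \<or>
      (\<forall>x y. j1 < x \<and> x < y \<and> y < j2 \<longrightarrow> f x > f y) \<or>
      (\<forall>x y. j1 < x \<and> x < y \<and> y < j2 \<longrightarrow> f x = f y))"
proof -
  have d: "df2 (<)" "df2 (>)" "df2 (=)" by (intro dfp_rules; simp add: coord_simps)+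
  note R = d[THEN dfun_rel[OF f]]
  let ?S = "\<lambda>R. {x. i1 < x \<and> x < i2 \<and> eventually (\<lambda>y. i1 < y \<and> y < i2 \<and> R (f y) (f x)) (at_left x)}"
  have "{i1<..<i2} \<subseteq> ?S (<) \<union> ?S (>) \<union> ?S (=)"
  proof
    fix x assume "x \<in> {i1<..<i2}"
    then have x: "i1 < x" "x < i2" by auto
    have c: "df1 (\<lambda>y. i1 < y \<and> y < i2 \<and> i1 < x \<and> x < i2 \<and> Q (f y) (f x))"
      if "df2 (\<lambda>x y. i1 < x \<and> x < i2 \<and> i1 < y \<and> y < i2 \<and> Q (f x) (f y))" for Q
      by (rule dfp2_coord[OF that]; simp add: coord_simps)
    have ev: "eventually (\<lambda>y. i1 < y \<and> y < i2) (at_left x)"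
      unfolding eventually_at_left_iff using x by (intro exI[of _ i1]) auto
    consider "eventually (\<lambda>y. i1 < y \<and> y < i2 \<and> i1 < x \<and> x < i2 \<and> f y < f x) (at_left x)"
      | "eventually (\<lambda>y. i1 < y \<and> y < i2 \<and> i1 < x \<and> x < i2 \<and> f y > f x) (at_left x)"
      | "eventually (\<lambda>y. \<not> (i1 < y \<and> y < i2 \<and> i1 < x \<and> x < i2 \<and> f y < f x)) (at_left x)"
        "eventually (\<lambda>y. \<not> (i1 < y \<and> y < i2 \<and> i1 < x \<and> x < i2 \<and> f y > f x)) (at_left x)"
      using germ_left[OF c[OF R(1)], of x] germ_left[OF c[OF R(2)], of x] by blast
    then show "x \<in> ?S (<) \<union> ?S (>) \<union> ?S (=)"
    proof cases
      case 1
      then have "eventually (\<lambda>y. i1 < y \<and> y < i2 \<and> f y < f x) (at_left x)" by (rule eventually_mono) simp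
      then show ?thesis using x by simp
    next
      case 2
      then have "eventually (\<lambda>y. i1 < y \<and> y < i2 \<and> f y > f x) (at_left x)" by (rule eventually_mono) simp
      then show ?thesis using x by simp
    next
      case 3
      from 3(1) 3(2) ev have "eventually (\<lambda>y. i1 < y \<and> y < i2 \<and> f y = f x) (at_left x)"
        by eventually_elim (use x in auto)
      then show ?thesis using x by simp
    qed
  qed
  then have "infinite (?S (<) \<union> ?S (>) \<union> ?S (=))" using infinite_Ioo[OF i] infinite_super by blast
  then consider "infinite (?S (<))" | "infinite (?S (>))" | "infinite (?S (=))" by (auto simp del: Collect_disj_eq)
  then show ?thesis
  proof cases
    case 1 from monotone_subinterval_aux[where f=f and R="\<lambda>x y. x < y", OF i R(1) this] show ?thesis by blast
  next
    case 2 from monotone_subinterval_aux[where f=f and R="\<lambda>x y. x > y", OF i R(2) this] show ?thesis by blast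
  next
    case 3 from monotone_subinterval_aux[where f=f and R="\<lambda>x y. x = y", OF i R(3) this] show ?thesis by blast
  qed
qed

lemma continuous_on_Ioo_if:
  fixes f :: "'a \<Rightarrow> 'a"
  assumes "\<And>x u. j1 < x \<Longrightarrow> x < j2 \<Longrightarrow> u < f x \<Longrightarrow> \<exists>a b. a < x \<and> x < b \<and> (\<forall>y. a < y \<and> y < b \<longrightarrow> u < f y)"
    and "\<And>x u. j1 < x \<Longrightarrow> x < j2 \<Longrightarrow> f x < u \<Longrightarrow> \<exists>a b. a < x \<and> x < b \<and> (\<forall>y. a < y \<and> y < b \<longrightarrow> f y < u)"
  shows "continuous_on {j1<..<j2} f"
  unfolding continuous_on_def
proof
  fix x assume "x \<in> {j1<..<j2}"
  then have x: "j1 < x" "x < j2" by auto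
  have ev: "eventually P (at x within {j1<..<j2})" if "a < x" "x < b" "\<forall>y. a < y \<and> y < b \<longrightarrow> P y" for a b P
    unfolding eventually_at_topological using that by (intro exI[of _ "{a<..<b}"]) auto
  show "(f \<longlongrightarrow> f x) (at x within {j1<..<j2})"
  proof (rule order_tendstoI)
    fix u assume "u < f x"
    from assms(1)[OF x this] show "eventually (\<lambda>y. u < f y) (at x within {j1<..<j2})" using ev by (elim exE conjE)
  next
    fix u assume "f x < u"
    from assms(2)[OF x this] show "eventually (\<lambda>y. f y < u) (at x within {j1<..<j2})" using ev by (elim exE conjE)
  qed
qed

text \<open>An injective image of an interval is infinite, and it is definable. The interval inside
  it plays the role of surjectivity in the continuity argument that follows.\<close>

lemma dfun_image_interval:
  assumes f: "dfun i1 i2 f" and i: "i1 < i2" and inj: "inj_on f {i1<..<i2}"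
  shows "\<exists>r s. r < s \<and> (\<forall>y. r < y \<and> y < s \<longrightarrow> (\<exists>x. i1 < x \<and> x < i2 \<and> f x = y))"
proof (rule infinite_interval)
  have "f ` {i1<..<i2} = {y. \<exists>x. i1 < x \<and> x < i2 \<and> f x = y}" by auto
  moreover have "infinite (f ` {i1<..<i2})" using inj infinite_Ioo[OF i] finite_imageD by blast
  ultimately show "infinite {y. \<exists>x. i1 < x \<and> x < i2 \<and> f x = y}" by simp
  show "df1 (\<lambda>y. \<exists>x. i1 < x \<and> x < i2 \<and> f x = y)"
    by (rule dfp_ex, rule dfp2_coord[OF f[unfolded dfun_def]]; simp add: coord_simps)
qed

text \<open>A strictly monotone function that attains all values between two of its values is
  continuous between the corresponding arguments. The relation \<open>S\<close> treats increasing
  and decreasing functions together.\<close>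

lemma strict_monotone_continuous_subinterval:
  fixes f S :: "'a \<Rightarrow> _"
  assumes S: "S = (<) \<or> S = (>)" and f: "dfun k1 k2 f" and k: "k1 < k2"
    and mono: "\<forall>x y. k1 < x \<and> x < y \<and> y < k2 \<longrightarrow> S (f x) (f y)"
  shows "\<exists>x1 x2. k1 \<le> x1 \<and> x1 < x2 \<and> x2 \<le> k2 \<and> continuous_on {x1<..<x2} f"
proof -
  have S_asym: "\<not> S v u" "u \<noteq> v" if "S u v" for u v using S that by auto
  have S_trans: "S u w" if "S u v" "S v w" for u v w using S that by auto
  have S_dense: "\<exists>v. S u v \<and> S y v \<and> S v w" if "S u w" "S y w" for u y w
    using S that dense[of "max u y" w] dense[of w "min u y"] by auto
  have S_dense': "\<exists>v. S w v \<and> S v u \<and> S v y" if "S w u" "S w y" for u y w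
    using S that dense[of "max u y" w] dense[of w "min u y"] by auto
  have inj: "inj_on f {k1<..<k2}"
  proof (rule linorder_inj_onI)
    show "f x \<noteq> f y" if "x < y" "x \<in> {k1<..<k2}" "y \<in> {k1<..<k2}" for x y
    proof -
      have "S (f x) (f y)" using mono that by simp
      then show ?thesis by (rule S_asym)
    qed
  qed auto
  from dfun_image_interval[OF f k inj] obtain r s where rs: "r < s"
    "\<forall>y. r < y \<and> y < s \<longrightarrow> (\<exists>x. k1 < x \<and> x < k2 \<and> f x = y)" by (elim exE conjE)
  obtain c where c: "r < c" "c < s" using dense[OF rs(1)] by blast
  obtain d where d: "c < d" "d < s" using dense[OF c(2)] by blast
  have rd: "r < d" using c d by order
  \<comment> \<open>These are \<open>c\<close> and \<open>d\<close> in the order prescribed by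
    \<open>S\<close>; all values between them are attained.\<close>
  obtain y1 y2 where y: "S y1 y2" "r < y1" "y1 < s" "r < y2" "y2 < s" using S c d rd by blast
  obtain x1 where x1: "k1 < x1" "x1 < k2" "f x1 = y1" using rs(2) y by blast
  obtain x2 where x2: "k1 < x2" "x2 < k2" "f x2 = y2" using rs(2) y by blast
  have lt: "x < y" if "k1 < x" "x < k2" "k1 < y" "y < k2" "S (f x) (f y)" for x y
    using mono that S_asym by (metis linorder_neqE)
  have x12: "x1 < x2" using lt x1 x2 y by blast
  have pre: "\<exists>x. x1 < x \<and> x < x2 \<and> f x = v" if "S y1 v" "S v y2" for v
  proof -
    have "r < v" "v < s" using S y that by auto
    then obtain x where x: "k1 < x" "x < k2" "f x = v" using rs(2) by blast
    then have "x1 < x" "x < x2" using lt x1 x2 that by blast+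
    then show ?thesis using x by blast
  qed
  have mem: "k1 < x" "x < k2" if "x1 < x" "x < x2" for x using that x1 x2 by order+
  have bds: "S y1 (f x)" "S (f x) y2" if "x1 < x" "x < x2" for x
    using mono that x1 x2 mem[OF that] by blast+
  have lower: "\<exists>a b. a < x \<and> x < b \<and> (\<forall>y. a < y \<and> y < b \<longrightarrow> S u (f y))" if x: "x1 < x" "x < x2" and u: "S u (f x)" for x u
  proof -
    obtain v where v: "S u v" "S y1 v" "S v (f x)" using S_dense[OF u bds(1)[OF x]] by blast
    then obtain z where z: "x1 < z" "z < x2" "f z = v" using pre S_trans bds(2)[OF x] by blast
    have "z < x" using lt[of z x] z v(3) mem[OF x] mem[OF z(1,2)] by blast
    moreover have "S u (f y)" if "z < y" "y < x2" for y
    proof -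
      have "S (f z) (f y)" using mono that mem[OF z(1,2)] x2 by (meson less_trans)
      then show ?thesis using z(3) v(1) S_trans by blast
    qed
    ultimately show ?thesis using x(2) by blast
  qed
  have upper: "\<exists>a b. a < x \<and> x < b \<and> (\<forall>y. a < y \<and> y < b \<longrightarrow> S (f y) u)" if x: "x1 < x" "x < x2" and u: "S (f x) u" for x u
  proof -
    obtain v where v: "S (f x) v" "S v u" "S v y2" using S_dense'[OF u bds(2)[OF x]] by blast
    then obtain z where z: "x1 < z" "z < x2" "f z = v" using pre S_trans bds(1)[OF x] by blast
    have "x < z" using lt[of x z] z v(1) mem[OF x] mem[OF z(1,2)] by blast
    moreover have "S (f y) u" if "x1 < y" "y < z" for y
    proof -
      have "S (f y) (f z)" using mono that mem[OF z(1,2)] x1 by (meson less_trans)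
      then show ?thesis using z(3) v(2) S_trans by blast
    qed
    ultimately show ?thesis using x(1) by blast
  qed
  have "continuous_on {x1<..<x2} f"
    using S by (elim disjE) (rule continuous_on_Ioo_if; use lower upper in simp)+
  then show ?thesis using x1 x2 x12 by (intro exI[of _ x1] exI[of _ x2]) auto
qed

lemma monotone_continuous_subinterval:
  assumes f: "dfun i1 i2 f" and i: "i1 < i2"
  shows "\<exists>j1 j2. i1 \<le> j1 \<and> j1 < j2 \<and> j2 \<le> i2 \<and> continuous_on {j1<..<j2} f \<and>
     ((\<forall>x y. j1 < x \<and> x < y \<and> y < j2 \<longrightarrow> f x < f y) \<or>
      (\<forall>x y. j1 < x \<and> x < y \<and> y < j2 \<longrightarrow> f x > f y) \<or>
      (\<forall>x y. j1 < x \<and> x < y \<and> y < j2 \<longrightarrow> f x = f y))"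
proof -
  from monotone_subinterval[OF f i] obtain k1 k2 where k: "i1 \<le> k1" "k1 < k2" "k2 \<le> i2"
     and mono: "((\<forall>x y. k1 < x \<and> x < y \<and> y < k2 \<longrightarrow> f x < f y) \<or>
      (\<forall>x y. k1 < x \<and> x < y \<and> y < k2 \<longrightarrow> f x > f y) \<or>
      (\<forall>x y. k1 < x \<and> x < y \<and> y < k2 \<longrightarrow> f x = f y))" by (elim exE conjE)
  have fk: "dfun k1 k2 f" using dfun_subinterval[OF f k(1,3)] .
  have "\<exists>x1 x2. k1 \<le> x1 \<and> x1 < x2 \<and> x2 \<le> k2 \<and> continuous_on {x1<..<x2} f"
    using mono
  proof (elim disjE)
    assume "\<forall>x y. k1 < x \<and> x < y \<and> y < k2 \<longrightarrow> f x < f y"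
    then show ?thesis by (intro strict_monotone_continuous_subinterval[OF _ fk k(2), of "(<)"]) simp_all
  next
    assume "\<forall>x y. k1 < x \<and> x < y \<and> y < k2 \<longrightarrow> f x > f y"
    then show ?thesis by (intro strict_monotone_continuous_subinterval[OF _ fk k(2), of "(>)"]) simp_all
  next
    assume const: "\<forall>x y. k1 < x \<and> x < y \<and> y < k2 \<longrightarrow> f x = f y"
    obtain c where c: "k1 < c" "c < k2" using dense[OF k(2)] by blast
    have "f x = f c" if "x \<in> {k1<..<k2}" for x
      using const that c by (cases x c rule: linorder_cases) auto
    then have "continuous_on {k1<..<k2} f \<longleftrightarrow> continuous_on {k1<..<k2} (\<lambda>_. f c)" by (intro continuous_on_cong) auto
    then have "continuous_on {k1<..<k2} f" by simp
    then show ?thesis using k(2) by blast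
  qed
  then obtain x1 x2 where x: "k1 \<le> x1" "x1 < x2" "x2 \<le> k2" "continuous_on {x1<..<x2} f" by (elim exE conjE)
  have "k1 < v \<and> w < k2" if "x1 < v" "w < x2" for v w using x that by auto
  then have "(\<forall>x y. x1 < x \<and> x < y \<and> y < x2 \<longrightarrow> f x < f y) \<or>
      (\<forall>x y. x1 < x \<and> x < y \<and> y < x2 \<longrightarrow> f x > f y) \<or>
      (\<forall>x y. x1 < x \<and> x < y \<and> y < x2 \<longrightarrow> f x = f y)" using mono by (elim disjE) blast+
  moreover have "i1 \<le> x1" "x2 \<le> i2" using k x by order+
  ultimately show ?thesis using x(2,4) by (intro exI[of _ x1] exI[of _ x2] conjI)
qed

text \<open>Finiteness of a fibre means that it contains no interval, which is first-order and
  introduces no new parameters. The latter matters for the sets that a generic point has to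
  avoid.\<close>

lemma dfp_finite:
  fixes vs :: "('e \<Rightarrow> 'a) list"
  assumes P: "dfp M A (map (\<lambda>v z. v (fst z)) vs @ [snd]) (\<lambda>z. P (fst z) (snd z))"
  shows "dfp M A vs (\<lambda>e. finite {x. P e x})"
proof -
  have d: "df1 (P e)" for e
    using dfp_subst[OF dfp_mono[OF P subset_UNIV], of "[\<lambda>x. x]" "\<lambda>x. (e, x)"]
    by (simp add: coord_simps)
  have "(\<lambda>e. finite {x. P e x}) = (\<lambda>e. \<not> (\<exists>a b. a < b \<and> (\<forall>x. a < x \<and> x < b \<longrightarrow> P e x)))"
    using infinite_iff_interval[OF d] by (intro ext) blast
  moreover have "dfp M A vs (\<lambda>e. \<not> (\<exists>a b. a < b \<and> (\<forall>x. a < x \<and> x < b \<longrightarrow> P e x)))"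
    apply (intro dfp_rules)
    apply (simp_all add: coord_simps)
    apply (rule dfp_subst[OF P, where f = "\<lambda>z. (fst (fst (fst z)), snd z)", simplified])
    apply (auto simp: coord_simps)
    done
  ultimately show ?thesis by simp
qed

end

section \<open>Thin sets and plane curves\<close>

context omin
begin

section \<open>Infinite fibres and open boxes\<close>

lemma dfp_infinite_fibre: "df2 E \<Longrightarrow> df1 (\<lambda>x. infinite {y. E x y})"
  by (rule dfp_not, rule dfp_finite) simp

text \<open>Finitely many germs at the same point \<open>y\<close> can be intersected, so any finite
  set of \<open>x\<close> has a common \<open>l\<close>, and saturation passes to infinitely many.
  Unlike in \<open>star_right\<close>, the base point does not vary with \<open>x\<close>.\<close>

lemma common_right:
  assumes S: "df1 S" "infinite {x. S x}" and E: "df2 E"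
    and ev: "\<And>x. S x \<Longrightarrow> eventually (E x) (at_right y)"
  shows "\<exists>l. y < l \<and> infinite {x. S x \<and> E x l}"
proof -
  have "\<exists>l. infinite {x. y < l \<and> S x \<and> E x l}"
  proof (rule saturation_infinite)
    show "df2 (\<lambda>l x. y < l \<and> S x \<and> E x l)"
      by (intro dfp_rules dfp1_coord[OF S(1)] dfp2_coord[OF E]; simp add: coord_simps)
    fix n
    obtain T where T: "finite T" "card T = n" "T \<subseteq> {x. S x}"
      using infinite_arbitrarily_large[OF S(2)] by metis
    have "eventually (\<lambda>l. \<forall>x\<in>T. E x l) (at_right y)"
      using T ev by (subst eventually_ball_finite_distrib) auto
    then have "eventually (\<lambda>l. y < l \<and> (\<forall>x\<in>T. E x l)) (at_right y)"
      by (intro eventually_conj eventually_at_right_less)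
    from eventually_happens'[OF at_right_neq_bot this] obtain l where "y < l \<and> (\<forall>x\<in>T. E x l)" by (elim exE)
    then show "\<exists>l T. finite T \<and> card T = n \<and> (\<forall>x\<in>T. y < l \<and> S x \<and> E x l)" using T by (intro exI[of _ l] exI[of _ T]) auto
  qed
  then obtain l where l: "infinite {x. y < l \<and> S x \<and> E x l}" by (elim exE)
  then have "y < l" using not_finite_existsD by auto
  with l show ?thesis by auto
qed

text \<open>Each fibre contains an interval; let it begin at \<open>cm x\<close>. Either infinitely
  many fibres share this beginning, and \<open>common_right\<close> applies at that height, or the
  beginnings run through an interval and \<open>star_right\<close> applies to them. Both give a
  height in infinitely many fibres.\<close>

lemma fubini:
  assumes E: "df2 E" and i: "i1 < i2" and inf: "\<And>x. i1 < x \<Longrightarrow> x < i2 \<Longrightarrow> infinite {y. E x y}"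
  shows "\<exists>y. infinite {x. i1 < x \<and> x < i2 \<and> E x y}"
proof (rule ccontr)
  assume neg: "\<nexists>y. infinite {x. i1 < x \<and> x < i2 \<and> E x y}"
  have Ev: "df1 (E x)" for x by (rule dfp2_coord[OF E]; simp add: coord_simps)
  \<comment> \<open>Fibres may be unbounded below and then have no first beginning. A bound
    \<open>e0\<close> below which nothing is considered is obtained by saturation, at the price of
    passing to a smaller interval of \<open>x\<close>.\<close>
  define U where "U e x \<longleftrightarrow> i1 < x \<and> x < i2 \<and> (\<exists>u v. e < u \<and> u < v \<and> (\<forall>y. u < y \<and> y < v \<longrightarrow> E x y))" for e x
  have U: "df2 U" unfolding U_def by (intro dfp_rules dfp2_coord[OF E]; simp add: coord_simps)
  have "\<exists>e. infinite {x. U e x}"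
  proof (rule saturation_infinite[OF U])
    fix n
    obtain T where T: "finite T" "card T = n" "T \<subseteq> {i1<..<i2}"
      using infinite_arbitrarily_large[OF infinite_Ioo[OF i]] by metis
    have "\<forall>x\<in>T. \<exists>u v. u < v \<and> (\<forall>y. u < y \<and> y < v \<longrightarrow> E x y)"
    proof
      fix x assume "x \<in> T"
      then have "infinite {y. E x y}" using inf T(3) by auto
      from infinite_interval[OF this Ev] show "\<exists>u v. u < v \<and> (\<forall>y. u < y \<and> y < v \<longrightarrow> E x y)" .
    qed
    from bchoice[OF this] obtain u where u: "\<forall>x\<in>T. \<exists>v. u x < v \<and> (\<forall>y. u x < y \<and> y < v \<longrightarrow> E x y)" by (elim exE)
    obtain e where e: "\<forall>z\<in>u ` T. e < z" using finite_lower_bound[OF finite_imageI[OF T(1)]] by blast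
    have "U e x" if "x \<in> T" for x
    proof -
      have "i1 < x" "x < i2" "e < u x" using T(3) e that by auto
      moreover obtain v where "u x < v \<and> (\<forall>y. u x < y \<and> y < v \<longrightarrow> E x y)" using bspec[OF u \<open>x \<in> T\<close>] by (elim exE)
      ultimately show ?thesis unfolding U_def by blast
    qed
    then show "\<exists>e S. finite S \<and> card S = n \<and> (\<forall>x\<in>S. U e x)" using T(1,2) by blast
  qed
  then obtain e0 where "infinite {x. U e0 x}" by (elim exE)
  from infinite_interval[OF this] obtain k1 k2 where k: "k1 < k2" "\<forall>x. k1 < x \<and> x < k2 \<longrightarrow> U e0 x"
    using dfp2_coord[OF U, of "[\<lambda>x. x]" "\<lambda>_. e0" "\<lambda>x. x"] by (auto simp: coord_simps)
  have ki: "i1 < x \<and> x < i2" if "k1 < x" "x < k2" for x using k(2) that unfolding U_def by blast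
  \<comment> \<open>The fibre contains a right neighbourhood of \<open>c\<close>; \<open>cm\<close>
    selects the least such \<open>c\<close> that is not below \<open>e0\<close>.\<close>
  define K where "K x c \<longleftrightarrow> e0 \<le> c \<and> eventually (E x) (at_right c)" for x c
  have K: "df2 K" unfolding K_def eventually_at_right_iff
    by (intro dfp_rules dfp2_coord[OF E]; simp add: coord_simps)
  have K1: "df1 (K x)" for x by (rule dfp2_coord[OF K]; simp add: coord_simps)
  define cm where "cm x c \<longleftrightarrow> K x c \<and> (\<forall>c'. K x c' \<longrightarrow> c \<le> c')" for x c
  have cm: "df2 cm" unfolding cm_def by (intro dfp_rules dfp2_coord[OF K]; simp add: coord_simps)
  have ex: "\<exists>c. cm x c" if x: "k1 < x" "x < k2" for x
  proof -
    have "U e0 x" using k(2) x by blast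
    then obtain u v where uv: "e0 < u" "u < v" "\<forall>y. u < y \<and> y < v \<longrightarrow> E x y" unfolding U_def by blast
    have "K x u" unfolding K_def eventually_at_right_iff using uv by (auto intro: less_imp_le)
    moreover have "e0 \<le> c" if "K x c" for c using that unfolding K_def by blast
    ultimately obtain s where s: "\<And>c. K x c \<Longrightarrow> s \<le> c" "\<And>b. (\<And>c. K x c \<Longrightarrow> b \<le> c) \<Longrightarrow> b \<le> s"
      using definable_glb[OF K1] by metis
    have es: "e0 \<le> s" using s(2) unfolding K_def by blast
    \<comment> \<open>The infimum is attained: otherwise the fibre would avoid a right neighbourhood
      of \<open>s\<close>, although candidates \<open>c\<close> exist arbitrarily close to
      \<open>s\<close>.\<close>
    have "eventually (E x) (at_right s)"
    proof (rule ccontr)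
      assume "\<not> eventually (E x) (at_right s)"
      then have "eventually (\<lambda>y. \<not> E x y) (at_right s)" using germ_right[OF Ev] by blast
      then obtain b where b: "s < b" "\<forall>y. s < y \<and> y < b \<longrightarrow> \<not> E x y" unfolding eventually_at_right_iff by blast
      have "\<exists>c. K x c \<and> c < b" using s(2)[of b] b(1) by (meson not_le)
      then obtain c where c: "K x c" "c < b" by blast
      then obtain d where d: "c < d" "\<forall>y. c < y \<and> y < d \<longrightarrow> E x y" unfolding K_def eventually_at_right_iff by blast
      obtain y where y: "c < y" "y < min b d" using dense[of c "min b d"] c d by auto
      have "s < y" using s(1)[OF c(1)] y(1) by order
      then show False using b(2) d(2) y by auto
    qed
    then have "K x s" using es unfolding K_def by blast
    then show ?thesis using s(1) unfolding cm_def by blast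
  qed
  have uniq: "c = c'" if "cm x c" "cm x c'" for x c c' using that unfolding cm_def by (meson antisym)
  have fin: "finite {x. k1 < x \<and> x < k2 \<and> E x l}" for l
    by (rule finite_subset[of _ "{x. i1 < x \<and> x < i2 \<and> E x l}"]) (use neg ki in auto)
  show False
  proof (cases "\<exists>y. infinite {x. k1 < x \<and> x < k2 \<and> cm x y}")
    case True
    then obtain y where y: "infinite {x. k1 < x \<and> x < k2 \<and> cm x y}" by (elim exE)
    have "df1 (\<lambda>x. k1 < x \<and> x < k2 \<and> cm x y)"
      by (intro dfp_rules dfp2_coord[OF cm]; simp add: coord_simps)
    from common_right[OF this y E, of y] obtain l where "infinite {x. (k1 < x \<and> x < k2 \<and> cm x y) \<and> E x l}"
      unfolding cm_def K_def by blast
    then show False using fin[of l] by (elim notE) (rule finite_subset, auto)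
  next
    case False
    define Z where "Z y \<longleftrightarrow> (\<exists>x. k1 < x \<and> x < k2 \<and> cm x y)" for y
    have Z: "df1 Z" unfolding Z_def by (intro dfp_rules dfp2_coord[OF cm]; simp add: coord_simps)
    have "infinite {y. Z y}"
    proof
      assume finZ: "finite {y. Z y}"
      have "{k1<..<k2} \<subseteq> (\<Union>y\<in>{y. Z y}. {x. k1 < x \<and> x < k2 \<and> cm x y})"
        using ex unfolding Z_def by fastforce
      moreover have "finite (\<Union>y\<in>{y. Z y}. {x. k1 < x \<and> x < k2 \<and> cm x y})" using finZ False by auto
      ultimately show False using infinite_Ioo[OF k(1)] finite_subset by blast
    qed
    from infinite_interval[OF this Z] obtain r s where rs: "r < s" "\<forall>y. r < y \<and> y < s \<longrightarrow> Z y" by (elim exE conjE)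
    define E2 where "E2 y l \<longleftrightarrow> (\<exists>x. k1 < x \<and> x < k2 \<and> cm x y \<and> E x l)" for y l
    have E2: "df2 E2" unfolding E2_def by (intro dfp_rules dfp2_coord[OF cm] dfp2_coord[OF E]; simp add: coord_simps)
    have "eventually (E2 y) (at_right y)" if "r < y" "y < s" for y
    proof -
      obtain x where x: "k1 < x" "x < k2" "cm x y" using rs(2) \<open>r < y\<close> \<open>y < s\<close> unfolding Z_def by blast
      then have "eventually (E x) (at_right y)" unfolding cm_def K_def by blast
      then show ?thesis by (rule eventually_mono) (use x in \<open>auto simp: E2_def\<close>)
    qed
    from star_right[OF E2 rs(1) this] obtain l where l: "infinite {y. r < y \<and> y < s \<and> y < l \<and> E2 y l}" by blast
    \<comment> \<open>Different \<open>y\<close> come from different \<open>x\<close>, because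
      \<open>cm\<close> is a function of \<open>x\<close>; so infinitely many \<open>x\<close> share
      this \<open>l\<close>.\<close>
    have "{y. r < y \<and> y < s \<and> y < l \<and> E2 y l} \<subseteq> (\<lambda>x. THE c. cm x c) ` {x. k1 < x \<and> x < k2 \<and> E x l}"
    proof
      fix y assume "y \<in> {y. r < y \<and> y < s \<and> y < l \<and> E2 y l}"
      then obtain x where x: "k1 < x" "x < k2" "cm x y" "E x l" unfolding E2_def by blast
      have "(THE c. cm x c) = y" by (rule the_equality) (use x(3) uniq in blast)+
      then show "y \<in> (\<lambda>x. THE c. cm x c) ` {x. k1 < x \<and> x < k2 \<and> E x l}" using x by force
    qed
    then show False using l fin[of l] finite_surj by blast
  qed
qed

text \<open>Applied to the interiors of the fibres, \<open>fubini\<close> gives a height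
  \<open>y\<close> that is interior to infinitely many of them; \<open>common_right\<close> then
  lets these fibres reach from \<open>y\<close> up to a common height \<open>d\<close>.\<close>

lemma box:
  assumes E: "df2 E" and inf: "infinite {x. infinite {y. E x y}}"
  shows "\<exists>a b c d. a < b \<and> c < d \<and> (\<forall>x y. a < x \<and> x < b \<and> c < y \<and> y < d \<longrightarrow> E x y)"
proof -
  have Ev: "df1 (E x)" for x by (rule dfp2_coord[OF E]; simp add: coord_simps)
  from infinite_interval[OF inf dfp_infinite_fibre[OF E]] obtain i1 i2 where i: "i1 < i2"
    "\<forall>x. i1 < x \<and> x < i2 \<longrightarrow> infinite {y. E x y}" by (elim exE conjE)
  define E' where "E' x y \<longleftrightarrow> (\<exists>u v. u < y \<and> y < v \<and> (\<forall>w. u < w \<and> w < v \<longrightarrow> E x w))" for x y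
  have E': "df2 E'" unfolding E'_def by (intro dfp_rules dfp2_coord[OF E]; simp add: coord_simps)
  have "infinite {y. E' x y}" if "i1 < x" "x < i2" for x
  proof -
    have "infinite {y. E x y}" using i(2) that by blast
    from infinite_interval[OF this Ev] obtain u v where uv: "u < v" "\<forall>w. u < w \<and> w < v \<longrightarrow> E x w" by (elim exE conjE)
    have "E' x y" if "u < y" "y < v" for y using that uv(2) unfolding E'_def by blast
    then have "{u<..<v} \<subseteq> {y. E' x y}" by auto
    then show ?thesis using infinite_Ioo[OF uv(1)] infinite_super by blast
  qed
  from fubini[OF E' i(1) this] obtain y where y: "infinite {x. i1 < x \<and> x < i2 \<and> E' x y}" by blast
  define E'' where "E'' x d \<longleftrightarrow> (\<forall>w. y < w \<and> w < d \<longrightarrow> E x w)" for x d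
  have E'': "df2 E''" unfolding E''_def by (intro dfp_rules dfp2_coord[OF E]; simp add: coord_simps)
  have S: "df1 (\<lambda>x. i1 < x \<and> x < i2 \<and> E' x y)" by (intro dfp_rules dfp2_coord[OF E']; simp add: coord_simps)
  have "eventually (E'' x) (at_right y)" if "i1 < x \<and> x < i2 \<and> E' x y" for x
  proof -
    obtain u v where "u < y" "y < v" "\<forall>w. u < w \<and> w < v \<longrightarrow> E x w" using \<open>i1 < x \<and> x < i2 \<and> E' x y\<close> unfolding E'_def by blast
    then show ?thesis unfolding eventually_at_right_iff E''_def by (intro exI[of _ v]) (auto intro: less_trans)
  qed
  from common_right[OF S y E'' this] obtain d where d: "y < d" "infinite {x. (i1 < x \<and> x < i2 \<and> E' x y) \<and> E'' x d}"
    by blast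
  have "df1 (\<lambda>x. (i1 < x \<and> x < i2 \<and> E' x y) \<and> E'' x d)"
    by (intro dfp_conj[OF S] dfp2_coord[OF E'']; simp add: coord_simps)
  from infinite_interval[OF d(2) this] obtain a b where "a < b" "\<forall>x. a < x \<and> x < b \<longrightarrow> E'' x d" by blast
  then show ?thesis using d(1) unfolding E''_def by blast
qed

end

text \<open>For definable sets this says that the dimension is at most one, because infinitely many
  infinite vertical fibres would produce an open box. Single vertical lines are allowed.\<close>

definition thin :: "('a \<times> 'a) set \<Rightarrow> bool" where
  "thin X \<longleftrightarrow> finite {x. infinite {y. (x, y) \<in> X}}"

lemma thin_subset: "thin Y \<Longrightarrow> X \<subseteq> Y \<Longrightarrow> thin X"
proof -
  assume *: "thin Y" "X \<subseteq> Y"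
  have "{x. infinite {y. (x, y) \<in> X}} \<subseteq> {x. infinite {y. (x, y) \<in> Y}}"
  proof
    fix x assume x: "x \<in> {x. infinite {y. (x, y) \<in> X}}"
    have "{y. (x, y) \<in> X} \<subseteq> {y. (x, y) \<in> Y}" using *(2) by auto
    then show "x \<in> {x. infinite {y. (x, y) \<in> Y}}" using x by (auto dest: finite_subset)
  qed
  then show "thin X" using *(1) unfolding thin_def by (rule finite_subset)
qed

lemma thin_Un: "thin X \<Longrightarrow> thin Y \<Longrightarrow> thin (X \<union> Y)"
  unfolding thin_def
  by (rule finite_subset[of _ "{x. infinite {y. (x, y) \<in> X}} \<union> {x. infinite {y. (x, y) \<in> Y}}"])
     (auto simp: Collect_disj_eq)

lemma thin_UN: "finite I \<Longrightarrow> (\<And>i. i \<in> I \<Longrightarrow> thin (X i)) \<Longrightarrow> thin (\<Union>i\<in>I. X i)"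
  by (induction I rule: finite_induct) (auto intro: thin_Un, simp add: thin_def)

section \<open>Dimension of plane sets\<close>

definition has_box :: "nat set \<Rightarrow> 'a::linorder list set \<Rightarrow> bool" where
  "has_box I S \<longleftrightarrow> (\<exists>l u. (\<forall>i\<in>I. l i < u i) \<and>
     (\<forall>y. (\<forall>i\<in>I. l i < y i \<and> y i < u i) \<longrightarrow> (\<exists>xs\<in>S. \<forall>i\<in>I. xs ! i = y i)))"

lemma omin_dim_ge:
  "k \<le> omin_dim n S \<longleftrightarrow> k = 0 \<or> (\<exists>I. I \<subseteq> {..<n} \<and> has_box I S \<and> k \<le> card I)"
proof -
  have "finite (insert 0 {card I | I. I \<subseteq> {..<n} \<and> has_box I S})"
    by (rule finite.insertI, rule finite_subset[of _ "card ` Pow {..<n}"]) auto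
  then show ?thesis unfolding omin_dim_def has_box_def[symmetric] by (subst Max_ge_iff) auto
qed

lemma tuples2_mem: "xs \<in> tuples2 X \<longleftrightarrow> (\<exists>x y. xs = [x, y] \<and> (x, y) \<in> X)"
  unfolding tuples2_def by auto

context omin
begin

lemma omin_dim_pos_infinite:
  assumes "omin_dim 2 (tuples2 X) \<noteq> 0" shows "infinite (X :: ('a \<times> 'a) set)"
proof
  assume fin: "finite X"
  have "1 \<le> omin_dim 2 (tuples2 X)" using assms by simp
  then obtain I where I: "I \<subseteq> {..<2}" "has_box I (tuples2 X)" "1 \<le> card I" unfolding omin_dim_ge by auto
  then obtain i where i: "i \<in> I" by fastforce
  obtain l u where lu: "\<forall>i\<in>I. l i < u i"
    "\<forall>y. (\<forall>i\<in>I. l i < y i \<and> y i < u i) \<longrightarrow> (\<exists>xs\<in>tuples2 X. \<forall>i\<in>I. xs ! i = y i)"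
    using I(2) unfolding has_box_def by blast
  have "\<forall>j\<in>I. \<exists>m. l j < m \<and> m < u j" using lu(1) dense by blast
  \<comment> \<open>The points \<open>m j\<close> hold the other coordinates fixed while coordinate
    \<open>i\<close> runs through an interval.\<close>
  from bchoice[OF this] obtain m where m: "\<forall>j\<in>I. l j < m j \<and> m j < u j" by (elim exE)
  have "{l i<..<u i} \<subseteq> (\<lambda>xs. xs ! i) ` tuples2 X"
  proof
    fix t assume t: "t \<in> {l i<..<u i}"
    then have "\<forall>j\<in>I. l j < (m(i := t)) j \<and> (m(i := t)) j < u j" using m by auto
    then obtain xs where "xs \<in> tuples2 X" "\<forall>j\<in>I. xs ! j = (m(i := t)) j" using lu(2) by blast
    then show "t \<in> (\<lambda>xs. xs ! i) ` tuples2 X" using i by force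
  qed
  moreover have "finite ((\<lambda>xs. xs ! i) ` tuples2 X)" using fin unfolding tuples2_def by auto
  ultimately show False using infinite_Ioo[of "l i" "u i"] lu(1) i finite_subset by blast
qed

lemma plane_curve_infinite: "plane_curve M A X \<Longrightarrow> infinite X"
  by (rule omin_dim_pos_infinite) (simp add: plane_curve_def)

lemma plane_curve_thin:
  assumes "plane_curve M A X" shows "thin X"
proof (rule ccontr)
  assume "\<not> thin X"
  then have inf: "infinite {x. infinite {y. (x, y) \<in> X}}" by (simp add: thin_def)
  have "definable2 M A X" using assms by (simp add: plane_curve_def)
  then have "df2 (\<lambda>x y. (x, y) \<in> X)" unfolding definable2_dfp by (auto intro: dfp_mono)
  from box[OF this inf] obtain a b c d where abcd: "a < b" "c < d"
     "\<forall>x y. a < x \<and> x < b \<and> c < y \<and> y < d \<longrightarrow> (x, y) \<in> X" by (elim exE conjE)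
  have "has_box {0, 1} (tuples2 X)" unfolding has_box_def
  proof (intro exI conjI allI impI)
    show "\<forall>i\<in>{0, 1}. (if i = (0::nat) then a else c) < (if i = 0 then b else d)" using abcd by simp
    fix y :: "nat \<Rightarrow> 'a" assume "\<forall>i\<in>{0, 1}. (if i = 0 then a else c) < y i \<and> y i < (if i = 0 then b else d)"
    then have "(y 0, y 1) \<in> X" using abcd(3) by auto
    then show "\<exists>xs\<in>tuples2 X. \<forall>i\<in>{0, 1}. xs ! i = y i" by (intro bexI[of _ "[y 0, y 1]"]) (auto simp: tuples2_mem)
  qed
  then have "2 \<le> omin_dim 2 (tuples2 X)" unfolding omin_dim_ge by (intro disjI2 exI[of _ "{0, 1}"]) auto
  then show False using assms by (simp add: plane_curve_def)
qed

text \<open>The interval of nonempty fibres gives dimension at least one, and a box in both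
  coordinates is excluded by thinness.\<close>

lemma plane_curveI:
  assumes X: "definable2 M UNIV X" "thin X" and ab: "a < b" "\<And>x. a < x \<Longrightarrow> x < b \<Longrightarrow> \<exists>y. (x, y) \<in> X"
  shows "plane_curve M UNIV X"
proof -
  have "has_box {0} (tuples2 X)" unfolding has_box_def
  proof (rule exI[of _ "\<lambda>_. a"], rule exI[of _ "\<lambda>_. b"], intro conjI allI impI)
    show "\<forall>i\<in>{0::nat}. a < b" using ab(1) by simp
    fix y :: "nat \<Rightarrow> 'a" assume "\<forall>i\<in>{0}. a < y i \<and> y i < b"
    then obtain z where "(y 0, z) \<in> X" using ab(2)[of "y 0"] by auto
    then show "\<exists>xs\<in>tuples2 X. \<forall>i\<in>{0}. xs ! i = y i" by (intro bexI[of _ "[y 0, z]"]) (auto simp: tuples2_mem)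
  qed
  then have "1 \<le> omin_dim 2 (tuples2 X)" unfolding omin_dim_ge by (intro disjI2 exI[of _ "{0}"]) auto
  moreover have "\<not> 2 \<le> omin_dim 2 (tuples2 X)"
  proof
    assume "2 \<le> omin_dim 2 (tuples2 X)"
    then obtain I where I: "I \<subseteq> {..<2}" "has_box I (tuples2 X)" "2 \<le> card I" unfolding omin_dim_ge by auto
    have "I = {..<2}" by (rule card_subset_eq) (use I card_mono[OF _ I(1)] in auto)
    then have I': "I = {0, 1}" by auto
    obtain l u where lu: "\<forall>i\<in>{0, 1}. l i < u i"
      "\<forall>y. (\<forall>i\<in>{0, 1}. l i < y i \<and> y i < u i) \<longrightarrow> (\<exists>xs\<in>tuples2 X. \<forall>i\<in>{0, 1}. xs ! i = y i)"
      using I(2) unfolding has_box_def I' by blast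
    have XX: "(s, t) \<in> X" if "l 0 < s" "s < u 0" "l 1 < t" "t < u 1" for s t
    proof -
      have "\<forall>i\<in>{0, 1}. l i < (if i = 0 then s else t) \<and> (if i = 0 then s else t) < u i" using that by auto
      from mp[OF spec[OF lu(2)] this] obtain xs where "xs \<in> tuples2 X" "\<forall>i\<in>{0, 1}. xs ! i = (if i = 0 then s else t)"
        by blast
      then show ?thesis by (auto simp: tuples2_mem)
    qed
    have "infinite {y. (x, y) \<in> X}" if "x \<in> {l 0<..<u 0}" for x
    proof (rule infinite_super)
      show "{l 1<..<u 1} \<subseteq> {y. (x, y) \<in> X}" using XX that by auto
      show "infinite {l 1<..<u 1}" using lu(1) by (intro infinite_Ioo) simp
    qed
    then have "{l 0<..<u 0} \<subseteq> {x. infinite {y. (x, y) \<in> X}}" by auto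
    moreover have "infinite {l 0<..<u 0}" using lu(1) by (intro infinite_Ioo) simp
    ultimately show False using X(2) infinite_super unfolding thin_def by blast
  qed
  ultimately show ?thesis using X(1) unfolding plane_curve_def by simp
qed

lemma generic_not_finite:
  assumes "generic M A X p" "plane_curve M A X" "definable2 M A Y" "p \<in> Y"
  shows "infinite Y"
  using assms by (intro omin_dim_pos_infinite) (fastforce simp: generic_def plane_curve_def)

end

section \<open>Components of the complement of a graph\<close>

lemma definable2_Collect:
  "definable2 M A {(x, y). P x y} \<longleftrightarrow> dfp M A [fst, snd] (\<lambda>z. P (fst z) (snd z))"
  unfolding definable2_dfp by (simp add: split_def)

lemma definable2_mem: "definable2 M A X \<Longrightarrow> dfp M A [fst, snd] (\<lambda>z. (fst z, snd z) \<in> X)"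
  unfolding definable2_dfp by simp

lemma definable2_Int: "definable2 M A X \<Longrightarrow> definable2 M A Y \<Longrightarrow> definable2 M A (X \<inter> Y)"
  unfolding definable2_dfp Int_iff by (rule dfp_conj)

lemma definable2_Un: "definable2 M A X \<Longrightarrow> definable2 M A Y \<Longrightarrow> definable2 M A (X \<union> Y)"
  unfolding definable2_dfp Un_iff by (rule dfp_disj)

lemma definable2_empty: "definable2 M A {}"
  unfolding definable2_dfp empty_iff by (rule dfp_const)

lemma definable2_UN:
  "finite I \<Longrightarrow> (\<And>i. i \<in> I \<Longrightarrow> definable2 M A (X i)) \<Longrightarrow> definable2 M A (\<Union>i\<in>I. X i)"
  by (induction I rule: finite_induct) (auto intro: definable2_Un, simp add: definable2_empty)

section \<open>Neighbourhoods in the order topology and in its square\<close>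

lemma open_interval_nbhd:
  fixes x :: "'a::{linorder_topology, no_top, no_bot}"
  assumes "open T" "x \<in> T" shows "\<exists>u v. u < x \<and> x < v \<and> (\<forall>y. u < y \<and> y < v \<longrightarrow> y \<in> T)"
proof -
  obtain l where l: "l < x" using lt_ex by blast
  obtain r where r: "x < r" using gt_ex by blast
  from open_right[OF assms r] obtain v where v: "x < v" "{x..<v} \<subseteq> T" by blast
  from open_left[OF assms l] obtain u where u: "u < x" "{u<..x} \<subseteq> T" by blast
  have "y \<in> T" if "u < y" "y < v" for y
    using that u(2) v(2) by (cases "y \<le> x") auto
  then show ?thesis using u v by blast
qed

lemma open_boxE:
  fixes S :: "('a::{linorder_topology, no_top, no_bot} \<times> 'a) set"
  assumes "open S" "(x, y) \<in> S"
  shows "\<exists>s t u v. s < x \<and> x < t \<and> u < y \<and> y < v \<and> {s<..<t} \<times> {u<..<v} \<subseteq> S"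
proof -
  obtain A B where AB: "open A" "open B" "x \<in> A" "y \<in> B" "A \<times> B \<subseteq> S"
    using open_prod_elim[OF assms] by (metis mem_Sigma_iff)
  from open_interval_nbhd[OF AB(1,3)] obtain s t where st: "s < x" "x < t" "\<forall>y. s < y \<and> y < t \<longrightarrow> y \<in> A" by blast
  from open_interval_nbhd[OF AB(2,4)] obtain u v where uv: "u < y" "y < v" "\<forall>z. u < z \<and> z < v \<longrightarrow> z \<in> B" by blast
  have "{s<..<t} \<times> {u<..<v} \<subseteq> S" using AB(5) st(3) uv(3) by auto
  then show ?thesis using st uv by blast
qed

lemma open_boxI:
  fixes S :: "('a::linorder_topology \<times> 'a) set"
  assumes "\<And>x y. (x, y) \<in> S \<Longrightarrow> \<exists>s t u v. s < x \<and> x < t \<and> u < y \<and> y < v \<and> {s<..<t} \<times> {u<..<v} \<subseteq> S"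
  shows "open S"
proof (subst open_subopen, rule ballI)
  fix p assume "p \<in> S"
  then obtain s t u v where "s < fst p" "fst p < t" "u < snd p" "snd p < v" "{s<..<t} \<times> {u<..<v} \<subseteq> S"
    using assms[of "fst p" "snd p"] by auto
  then show "\<exists>T. open T \<and> p \<in> T \<and> T \<subseteq> S"
    by (intro exI[of _ "{s<..<t} \<times> {u<..<v}"]) (auto simp: mem_Times_iff open_Times)
qed

lemma continuous_on_Ioo_nbhd:
  fixes g :: "'a::{linorder_topology, no_top, no_bot} \<Rightarrow> 'a"
  assumes g: "continuous_on {x1<..<x2} g" and x: "x1 < x" "x < x2" and T: "open T" "g x \<in> T"
  shows "\<exists>s t. s < x \<and> x < t \<and> (\<forall>y. s < y \<and> y < t \<longrightarrow> x1 < y \<and> y < x2 \<and> g y \<in> T)"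
proof -
  have "open ({x1<..<x2} \<inter> g -` T)"
    by (rule continuous_open_preimage[OF g open_greaterThanLessThan T(1)])
  from open_interval_nbhd[OF this, of x] x T(2) obtain s t where "s < x" "x < t"
    "\<forall>y. s < y \<and> y < t \<longrightarrow> y \<in> {x1<..<x2} \<inter> g -` T" by auto
  then show ?thesis by (intro exI[of _ s] exI[of _ t]) auto
qed

text \<open>A box over whose whole base \<open>X\<close> is a graph. Inside a smaller rectangle the
  graph may leave through the top or the bottom, which is why the components are described by
  \<open>graph_side\<close> for arbitrary rectangles.\<close>

definition gbox :: "('a \<times> 'a) set \<Rightarrow> 'a \<Rightarrow> 'a \<Rightarrow> 'a \<Rightarrow> 'a \<Rightarrow> ('a::linorder_topology \<Rightarrow> 'a) \<Rightarrow> bool" where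
  "gbox X x1 x2 y1 y2 g \<longleftrightarrow> (\<forall>x. x1 < x \<and> x < x2 \<longrightarrow> y1 < g x \<and> g x < y2) \<and>
     (\<forall>x y. x1 < x \<and> x < x2 \<and> y1 < y \<and> y < y2 \<longrightarrow> ((x, y) \<in> X \<longleftrightarrow> y = g x)) \<and>
     continuous_on {x1<..<x2} g"

text \<open>Monotonicity guards against disconnected sides: in a rectangle lower than the variation
  of \<open>g\<close>, the part above the graph of an oscillating function can fall into several
  pieces.\<close>

definition wmono :: "('a::linorder \<Rightarrow> 'a) \<Rightarrow> 'a \<Rightarrow> 'a \<Rightarrow> bool" where
  "wmono g x1 x2 \<longleftrightarrow> (\<forall>x y. x1 < x \<and> x \<le> y \<and> y < x2 \<longrightarrow> g x \<le> g y) \<or>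
     (\<forall>x y. x1 < x \<and> x \<le> y \<and> y < x2 \<longrightarrow> g y \<le> g x)"

lemma wmono_between:
  assumes S: "S = (<) \<or> S = (>)" and g: "wmono g x1 x2" and x: "x1 < min x x'" "max x x' < x2"
    and t: "min x x' \<le> t" "t \<le> max x x'" and m: "S (g x) m" "S (g x') m"
  shows "S (g t) m"
proof -
  have *: "x1 < t" "t < x2" using x t by order+
  let ?l = "min x x'" and ?r = "max x x'"
  have lr: "S (g ?l) m" "S (g ?r) m" using m by (auto simp: min_def max_def)
  from g consider "g ?l \<le> g t" "g t \<le> g ?r" | "g t \<le> g ?l" "g ?r \<le> g t"
    unfolding wmono_def using x t * by blast
  then show ?thesis using S lr by cases (auto intro: le_less_trans less_le_trans)
qed

definition graph_side :: "('a \<Rightarrow> 'a \<Rightarrow> bool) \<Rightarrow> 'a::linorder \<Rightarrow> 'a \<Rightarrow> 'a \<Rightarrow> 'a \<Rightarrow> ('a \<Rightarrow> 'a) \<Rightarrow> ('a \<times> 'a) set" where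
  "graph_side S a b c d g = {(x, y). a < x \<and> x < b \<and> c < y \<and> y < d \<and> S (g x) y}"

abbreviation upper_part :: "'a::linorder \<Rightarrow> 'a \<Rightarrow> 'a \<Rightarrow> 'a \<Rightarrow> ('a \<Rightarrow> 'a) \<Rightarrow> ('a \<times> 'a) set" where
  "upper_part \<equiv> graph_side (<)"
abbreviation lower_part :: "'a::linorder \<Rightarrow> 'a \<Rightarrow> 'a \<Rightarrow> 'a \<Rightarrow> ('a \<Rightarrow> 'a) \<Rightarrow> ('a \<times> 'a) set" where
  "lower_part \<equiv> graph_side (>)"

context omin
begin

abbreviation dc :: "('a \<times> 'a) set \<Rightarrow> bool" where "dc \<equiv> definably_connected M"
abbreviation def2 :: "('a \<times> 'a) set \<Rightarrow> bool" where "def2 \<equiv> definable2 M UNIV"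

section \<open>Definable connectedness\<close>

lemma separation_side:
  assumes L: "dc L" "def2 L" "L \<subseteq> S" and U: "def2 U" "openin (top_of_set S) U"
    and W: "def2 W" "openin (top_of_set S) W" and UW: "U \<inter> W = {}" "U \<union> W = S"
  shows "L \<subseteq> U \<or> L \<subseteq> W"
proof (rule ccontr)
  assume *: "\<not> (L \<subseteq> U \<or> L \<subseteq> W)"
  have o: "openin (top_of_set L) (L \<inter> T)" if T: "openin (top_of_set S) T" for T
  proof -
    obtain T' where "open T'" "T = S \<inter> T'" using T unfolding openin_open by blast
    then show ?thesis unfolding openin_open using L(3) by (intro exI[of _ T']) auto
  qed
  have "\<exists>U W. def2 U \<and> def2 W \<and> openin (top_of_set L) U \<and> openin (top_of_set L) W \<and>
          U \<noteq> {} \<and> W \<noteq> {} \<and> U \<inter> W = {} \<and> U \<union> W = L"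
    using * L UW o[OF U(2)] o[OF W(2)] definable2_Int[OF L(2) U(1)] definable2_Int[OF L(2) W(1)]
    by (intro exI[of _ "L \<inter> U"] exI[of _ "L \<inter> W"] conjI) auto
  then show False using L(1) unfolding definably_connected_def by blast
qed

lemma dc_paths:
  assumes "\<And>z z'. z \<in> S \<Longrightarrow> z' \<in> S \<Longrightarrow> \<exists>L. L \<subseteq> S \<and> z \<in> L \<and> z' \<in> L \<and> dc L \<and> def2 L"
  shows "dc S"
  unfolding definably_connected_def
proof
  assume "\<exists>U W. def2 U \<and> def2 W \<and> openin (top_of_set S) U \<and> openin (top_of_set S) W \<and>
          U \<noteq> {} \<and> W \<noteq> {} \<and> U \<inter> W = {} \<and> U \<union> W = S"
  then obtain U W where *: "def2 U" "def2 W" "openin (top_of_set S) U" "openin (top_of_set S) W"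
          "U \<noteq> {}" "W \<noteq> {}" "U \<inter> W = {}" "U \<union> W = S" by (elim exE conjE)
  obtain z z' where z: "z \<in> U" "z' \<in> W" using *(5,6) by blast
  then obtain L where L: "L \<subseteq> S" "z \<in> L" "z' \<in> L" "dc L" "def2 L" using assms[of z z'] *(8) by blast
  from separation_side[OF L(4,5,1) *(1,3,2,4,7,8)] show False using L(2,3) z *(7) by blast
qed

lemma dc_Un:
  assumes "dc L1" "def2 L1" "dc L2" "def2 L2" "z \<in> L1" "z \<in> L2"
  shows "dc (L1 \<union> L2)"
  unfolding definably_connected_def
proof
  assume "\<exists>U W. def2 U \<and> def2 W \<and> openin (top_of_set (L1 \<union> L2)) U \<and> openin (top_of_set (L1 \<union> L2)) W \<and>
          U \<noteq> {} \<and> W \<noteq> {} \<and> U \<inter> W = {} \<and> U \<union> W = L1 \<union> L2"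
  then obtain U W where *: "def2 U" "def2 W" "openin (top_of_set (L1 \<union> L2)) U" "openin (top_of_set (L1 \<union> L2)) W"
          "U \<noteq> {}" "W \<noteq> {}" "U \<inter> W = {}" "U \<union> W = L1 \<union> L2" by (elim exE conjE)
  from separation_side[OF assms(1,2) _ *(1,3,2,4,7,8)] separation_side[OF assms(3,4) _ *(1,3,2,4,7,8)]
  have "L1 \<subseteq> U \<or> L1 \<subseteq> W" "L2 \<subseteq> U \<or> L2 \<subseteq> W" by auto
  then show False using assms(5,6) *(5-8) by blast
qed

text \<open>In place of definability of the path, it is required that preimages of definable sets be
  definable. This is the only consequence used, and it suits paths with values in the plane.\<close>

lemma dc_image:
  assumes st: "s \<le> t" and cont: "continuous_on {s..t} h" and df: "\<And>U. def2 U \<Longrightarrow> df1 (\<lambda>\<tau>. h \<tau> \<in> U)"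
  shows "dc (h ` {s..t})"
  unfolding definably_connected_def
proof
  let ?S = "h ` {s..t}"
  assume "\<exists>U W. def2 U \<and> def2 W \<and> openin (top_of_set ?S) U \<and> openin (top_of_set ?S) W \<and>
          U \<noteq> {} \<and> W \<noteq> {} \<and> U \<inter> W = {} \<and> U \<union> W = ?S"
  then obtain U W where *: "def2 U" "def2 W" "openin (top_of_set ?S) U" "openin (top_of_set ?S) W"
          "U \<noteq> {}" "W \<noteq> {}" "U \<inter> W = {}" "U \<union> W = ?S" by (elim exE conjE)
  have op: "\<exists>u v. u < x \<and> x < v \<and> (\<forall>y. u < y \<and> y < v \<and> s \<le> y \<and> y \<le> t \<longrightarrow> h y \<in> Z)"
    if Z: "openin (top_of_set ?S) Z" and x: "s \<le> x" "x \<le> t" "h x \<in> Z" for Z x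
  proof -
    obtain T where T: "open T" "Z = ?S \<inter> T" using Z unfolding openin_open by blast
    have "openin (top_of_set {s..t}) ({s..t} \<inter> h -` T)" by (rule continuous_openin_preimage_gen[OF cont T(1)])
    then obtain T' where T': "open T'" "{s..t} \<inter> h -` T = {s..t} \<inter> T'" unfolding openin_open by blast
    have "x \<in> {s..t} \<inter> T'" unfolding T'(2)[symmetric] using x T(2) by simp
    then have "x \<in> T'" by simp
    from open_interval_nbhd[OF T'(1) this] obtain u v where uv: "u < x" "x < v" "\<forall>y. u < y \<and> y < v \<longrightarrow> y \<in> T'" by blast
    have "h y \<in> Z" if y: "u < y" "y < v" "s \<le> y" "y \<le> t" for y
    proof -
      have "y \<in> {s..t} \<inter> T'" using uv(3) y by simp
      then have "y \<in> {s..t} \<inter> h -` T" unfolding T'(2) .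
      then show ?thesis unfolding T(2) by auto
    qed
    then show ?thesis using uv by blast
  qed
  have all: "h \<tau> \<in> Z" if Z: "def2 Z" "openin (top_of_set ?S) Z" "openin (top_of_set ?S) Z'" "Z \<inter> Z' = {}" "Z \<union> Z' = ?S" "h s \<in> Z"
     and \<tau>: "s \<le> \<tau>" "\<tau> \<le> t" for Z Z' \<tau>
  proof (rule definable_connected_interval[of "\<lambda>\<tau>. h \<tau> \<in> Z" s \<tau>])
    show "df1 (\<lambda>\<tau>. h \<tau> \<in> Z)" by (rule df[OF Z(1)])
    show "\<exists>u v. u < x \<and> x < v \<and> (\<forall>y. u < y \<and> y < v \<and> s \<le> y \<and> y \<le> \<tau> \<longrightarrow> h y \<in> Z)"
      if x: "s \<le> x" "x \<le> \<tau>" "h x \<in> Z" for x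
    proof -
      have "x \<le> t" using x \<tau> by order
      from op[OF Z(2) x(1) this x(3)] show ?thesis using \<tau>(2) by (meson order_trans)
    qed
    show "\<exists>u v. u < x \<and> x < v \<and> (\<forall>y. u < y \<and> y < v \<and> s \<le> y \<and> y \<le> \<tau> \<longrightarrow> h y \<notin> Z)"
      if x: "s \<le> x" "x \<le> \<tau>" "h x \<notin> Z" for x
    proof -
      have xt: "x \<le> t" using x \<tau> by order
      have "h x \<in> Z'" using Z(5) x xt by auto
      from op[OF Z(3) x(1) xt this] obtain u v where uv: "u < x" "x < v"
        "\<forall>y. u < y \<and> y < v \<and> s \<le> y \<and> y \<le> t \<longrightarrow> h y \<in> Z'" by blast
      have "h y \<notin> Z" if "u < y \<and> y < v \<and> s \<le> y \<and> y \<le> \<tau>" for y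
      proof -
        have "y \<le> t" using that \<tau> by (meson order_trans)
        then show ?thesis using uv(3) that Z(4) by blast
      qed
      then show ?thesis using uv(1,2) by blast
    qed
    show "s \<le> \<tau>" "h s \<in> Z" by fact+
  qed
  have "h s \<in> U \<or> h s \<in> W" using *(8) st by auto
  then show False
  proof
    assume "h s \<in> U"
    from all[OF *(1,3,4,7,8) this] have "?S \<subseteq> U" by auto
    then show False using *(6,7,8) by blast
  next
    assume "h s \<in> W"
    have "W \<inter> U = {}" "W \<union> U = ?S" using *(7,8) by auto
    from all[OF *(2,4,3) this \<open>h s \<in> W\<close>] have "?S \<subseteq> W" by auto
    then show False using *(5,7,8) by blast
  qed
qed

lemma vseg:
  assumes "y \<le> y'" shows "dc ({x} \<times> {y..y'})" "def2 ({x} \<times> {y..y'})"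
proof -
  have "dc (Pair x ` {y..y'})"
  proof (rule dc_image[OF assms])
    show "continuous_on {y..y'} (Pair x)" by (intro continuous_intros)
    show "df1 (\<lambda>\<tau>. (x, \<tau>) \<in> U)" if "def2 U" for U by (intro dfp_pair_mem[OF that]; simp add: coord_simps)
  qed
  moreover have eq: "Pair x ` {y..y'} = {x} \<times> {y..y'}" by auto
  ultimately show "dc ({x} \<times> {y..y'})" by simp
  have "{x} \<times> {y..y'} = {(u, v). u = x \<and> y \<le> v \<and> v \<le> y'}" by auto
  then show "def2 ({x} \<times> {y..y'})" by (simp only: definable2_Collect) (intro dfp_rules; simp add: coord_simps)
qed

lemma hseg:
  assumes "x \<le> x'" shows "dc ({x..x'} \<times> {y})" "def2 ({x..x'} \<times> {y})"
proof -
  have "dc ((\<lambda>t. (t, y)) ` {x..x'})"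
  proof (rule dc_image[OF assms])
    show "continuous_on {x..x'} (\<lambda>t. (t, y))" by (intro continuous_intros)
    show "df1 (\<lambda>\<tau>. (\<tau>, y) \<in> U)" if "def2 U" for U by (intro dfp_pair_mem[OF that]; simp add: coord_simps)
  qed
  moreover have eq: "(\<lambda>t. (t, y)) ` {x..x'} = {x..x'} \<times> {y}" by auto
  ultimately show "dc ({x..x'} \<times> {y})" by simp
  have "{x..x'} \<times> {y} = {(u, v). v = y \<and> x \<le> u \<and> u \<le> x'}" by auto
  then show "def2 ({x..x'} \<times> {y})" by (simp only: definable2_Collect) (intro dfp_rules; simp add: coord_simps)
qed

lemma three_segment_path:
  "\<exists>L. (x, y) \<in> L \<and> (x', y') \<in> L \<and> dc L \<and> def2 L \<and>
    L \<subseteq> {x} \<times> {min y m..max y m} \<union> {min x x'..max x x'} \<times> {m} \<union> {x'} \<times> {min y' m..max y' m}"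
proof -
  let ?A = "{x} \<times> {min y m..max y m}" and ?B = "{min x x'..max x x'} \<times> {m}" and ?C = "{x'} \<times> {min y' m..max y' m}"
  have mm: "min u v \<le> max u v" for u v :: 'a by (rule order_trans[OF min.cobounded1 max.cobounded1])
  have AB: "def2 (?A \<union> ?B)" "dc (?A \<union> ?B)"
    by (rule definable2_Un[OF vseg(2)[OF mm] hseg(2)[OF mm]],
        rule dc_Un[OF vseg[OF mm] hseg[OF mm], where z = "(x, m)"], auto)
  have "def2 (?A \<union> ?B \<union> ?C)" "dc (?A \<union> ?B \<union> ?C)"
    by (rule definable2_Un[OF AB(1) vseg(2)[OF mm]],
        rule dc_Un[OF AB(2,1) vseg[OF mm], where z = "(x', m)"], auto)
  then show ?thesis by (intro exI[of _ "?A \<union> ?B \<union> ?C"]) auto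
qed

text \<open>Two points are joined by moving both vertically, away from the graph, to a common height
  and then horizontally. By monotonicity the graph cannot cross that height in between, since it
  does not reach it over either end.\<close>

lemma dc_graph_side:
  assumes S: "S = (<) \<or> S = (>)" and g: "wmono g x1 x2" and ab: "\<And>x. a < x \<Longrightarrow> x < b \<Longrightarrow> x1 < x \<and> x < x2"
  shows "dc (graph_side S a b c d g)"
proof (rule dc_paths)
  fix z z' assume z: "z \<in> graph_side S a b c d g" "z' \<in> graph_side S a b c d g"
  obtain x y x' y' where xy: "z = (x, y)" "z' = (x', y')" by (metis surj_pair)
  have p: "a < x" "x < b" "c < y" "y < d" "S (g x) y" "a < x'" "x' < b" "c < y'" "y' < d" "S (g x') y'"
    using z unfolding xy graph_side_def by auto
  \<comment> \<open>Of the two given heights, the one further out in the direction \<open>S\<close>;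
    being one of them, it lies between \<open>c\<close> and \<open>d\<close>.\<close>
  define m where "m = (if S y y' then y' else y)"
  have m: "c < m" "m < d" unfolding m_def using p by auto
  have St: "S (g x) t" if "min y m \<le> t" "t \<le> max y m" for t
    using S p(5) that unfolding m_def by (auto simp: min_def max_def split: if_splits)
  have St': "S (g x') t" if "min y' m \<le> t" "t \<le> max y' m" for t
    using S p(10) that unfolding m_def by (auto simp: min_def max_def split: if_splits)
  obtain L where L: "(x, y) \<in> L" "(x', y') \<in> L" "dc L" "def2 L"
    "L \<subseteq> {x} \<times> {min y m..max y m} \<union> {min x x'..max x x'} \<times> {m} \<union> {x'} \<times> {min y' m..max y' m}"
    using three_segment_path by metis
  have cd: "c < t" "t < d" if "min u m \<le> t" "t \<le> max u m" "c < u" "u < d" for u t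
    using that m by (auto simp: min_le_iff_disj le_max_iff_disj)
  have "{x} \<times> {min y m..max y m} \<subseteq> graph_side S a b c d g" "{x'} \<times> {min y' m..max y' m} \<subseteq> graph_side S a b c d g"
    unfolding graph_side_def using p(1,2,6,7) St St' cd(1)[OF _ _ p(3,4)] cd(2)[OF _ _ p(3,4)]
      cd(1)[OF _ _ p(8,9)] cd(2)[OF _ _ p(8,9)] by auto
  moreover have "{min x x'..max x x'} \<times> {m} \<subseteq> graph_side S a b c d g"
  proof
    fix w assume "w \<in> {min x x'..max x x'} \<times> {m}"
    then obtain t where t: "w = (t, m)" "min x x' \<le> t" "t \<le> max x x'" by auto
    have tab: "a < t" "t < b" using t p by (auto simp: min_le_iff_disj le_max_iff_disj)
    have "x1 < min x x'" "max x x' < x2" using ab[of x] ab[of x'] p by auto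
    moreover have "S (g x) m" "S (g x') m" by (rule St St'; simp)+
    ultimately have "S (g t) m" using wmono_between[OF S g _ _ t(2,3)] by blast
    then show "w \<in> graph_side S a b c d g" unfolding graph_side_def t(1) using tab m by auto
  qed
  ultimately have "L \<subseteq> graph_side S a b c d g" using L(5) by blast
  then show "\<exists>L. L \<subseteq> graph_side S a b c d g \<and> z \<in> L \<and> z' \<in> L \<and> dc L \<and> def2 L" using L(1-4) xy by blast
qed

section \<open>Components of a rectangle minus a graph or a vertical segment\<close>

lemma def_components_two:
  assumes S: "L1 \<union> L2 = S" "L1 \<inter> L2 = {}" and L1: "L1 \<noteq> {}" "dc L1" "def2 L1" "openin (top_of_set S) L1"
    and L2: "L2 \<noteq> {}" "dc L2" "def2 L2" "openin (top_of_set S) L2"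
  shows "def_components M S = {L1, L2}"
proof -
  have side: "K \<subseteq> L1 \<or> K \<subseteq> L2" if "dc K" "def2 K" "K \<subseteq> S" for K
    by (rule separation_side[OF that L1(3,4) L2(3,4) S(2,1)])
  have sub: "L1 \<subseteq> S" "L2 \<subseteq> S" using S by auto
  show ?thesis
  proof (intro subset_antisym subsetI)
    fix K assume "K \<in> def_components M S"
    then have K: "K \<subseteq> S" "def2 K" "dc K"
      "\<And>K'. K \<subseteq> K' \<Longrightarrow> K' \<subseteq> S \<Longrightarrow> def2 K' \<Longrightarrow> dc K' \<Longrightarrow> K' = K" unfolding def_components_def by auto
    show "K \<in> {L1, L2}" using side[OF K(3,2,1)] K(4)[of L1] K(4)[of L2] L1 L2 sub by blast
  next
    fix K assume "K \<in> {L1, L2}"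
    then have K: "K = L1 \<or> K = L2" by simp
    have "K' = K" if "K \<subseteq> K'" "K' \<subseteq> S" "def2 K'" "dc K'" for K'
      using side[OF that(4,3,2)] that(1) K S(2) L1(1) L2(1) by blast
    moreover have "K \<noteq> {}" "K \<subseteq> S" "def2 K" "dc K" using K L1 L2 sub by auto
    ultimately show "K \<in> def_components M S" unfolding def_components_def by auto
  qed
qed

lemma def_component_absorbs:
  assumes K: "K \<in> def_components M S" and L: "dc L" "def2 L" "L \<subseteq> S" "z \<in> L" "z \<in> K"
  shows "L \<subseteq> K"
proof -
  have K': "K \<subseteq> S" "def2 K" "dc K"
      "\<And>K'. K \<subseteq> K' \<Longrightarrow> K' \<subseteq> S \<Longrightarrow> def2 K' \<Longrightarrow> dc K' \<Longrightarrow> K' = K" using K unfolding def_components_def by auto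
  have "K \<union> L = K"
    by (rule K'(4)) (use K' L dc_Un[OF K'(3,2) L(1,2) L(5,4)] definable2_Un[OF K'(2) L(2)] in auto)
  then show ?thesis by auto
qed

lemma gbox_dfun:
  assumes X: "def2 X" and g: "gbox X x1 x2 y1 y2 g"
  shows "dfun x1 x2 g"
proof -
  have "(\<lambda>z. x1 < fst z \<and> fst z < x2 \<and> g (fst z) = snd z) =
    (\<lambda>z. x1 < fst z \<and> fst z < x2 \<and> y1 < snd z \<and> snd z < y2 \<and> (fst z, snd z) \<in> X)"
    using g unfolding gbox_def by (intro ext) metis
  then show ?thesis unfolding dfun_def
    by (simp only:) (intro dfp_rules dfp_pair_mem[OF X]; simp add: coord_simps)
qed

lemma gbox_graph_side:
  assumes S: "S = (<) \<or> S = (>)" and X: "def2 X" and g: "gbox X x1 x2 y1 y2 g"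
    and ab: "\<And>x. a < x \<Longrightarrow> x < b \<Longrightarrow> x1 < x \<and> x < x2"
  shows "def2 (graph_side S a b c d g)" "open (graph_side S a b c d g)"
proof -
  have dS: "dfp M UNIV vs (\<lambda>e. S (v e) (w e))" if "coord UNIV vs v" "coord UNIV vs w" for vs :: "('e \<Rightarrow> 'a) list" and v w
    using S that by (elim disjE) (simp_all add: dfp_less)
  have oS: "open {y. S y v}" "open {y. S v y}" for v
    using S open_lessThan[of v] open_greaterThan[of v] unfolding lessThan_def greaterThan_def by (elim disjE; simp)+
  have S_dense: "\<exists>v. S u v \<and> S v w" if "S u w" for u w using S that dense by blast
  have S_trans: "S u w" if "S u v" "S v w" for u v w using S that by auto
  have "graph_side S a b c d g = {(x, y). a < x \<and> x < b \<and> c < y \<and> y < d \<and> (\<exists>v. (x1 < x \<and> x < x2 \<and> g x = v) \<and> S v y)}"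
    unfolding graph_side_def using ab by blast
  moreover have E: "dfp M UNIV [fst, snd] (\<lambda>z. \<exists>v. (x1 < fst z \<and> fst z < x2 \<and> g (fst z) = v) \<and> S v (snd z))"
    by (rule dfp_ex, rule dfp_conj[OF dfp2_coord[OF gbox_dfun[OF X g, unfolded dfun_def]] dS]; simp add: coord_simps)
  ultimately show "def2 (graph_side S a b c d g)" by (simp only: definable2_Collect)
    (intro dfp_conj dfp_less E; simp add: coord_simps)
  have cont: "continuous_on {x1<..<x2} g" using g unfolding gbox_def by blast
  have cont': "continuous_on {a<..<b} g" by (rule continuous_on_subset[OF cont]) (use ab in auto)
  show "open (graph_side S a b c d g)"
  proof (rule open_boxI)
    fix x y assume "(x, y) \<in> graph_side S a b c d g"
    then have p: "a < x" "x < b" "c < y" "y < d" "S (g x) y" unfolding graph_side_def by auto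
    obtain v where v: "S (g x) v" "S v y" using S_dense[OF p(5)] by blast
    have "g x \<in> {y. S y v}" using v(1) by simp
    from continuous_on_Ioo_nbhd[OF cont' p(1,2) oS(1) this] obtain s t where
      st: "s < x" "x < t" "\<forall>y. s < y \<and> y < t \<longrightarrow> a < y \<and> y < b \<and> g y \<in> {y. S y v}" by blast
    have "open ({y. S v y} \<inter> {c<..<d})" "y \<in> {y. S v y} \<inter> {c<..<d}" using oS(2) v(2) p by auto
    from open_interval_nbhd[OF this] obtain l r where lr: "l < y" "y < r" "\<forall>z. l < z \<and> z < r \<longrightarrow> z \<in> {y. S v y} \<inter> {c<..<d}"
      by blast
    have "{s<..<t} \<times> {l<..<r} \<subseteq> graph_side S a b c d g"
    proof
      fix w assume "w \<in> {s<..<t} \<times> {l<..<r}"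
      then obtain x' y' where w: "w = (x', y')" "s < x'" "x' < t" "l < y'" "y' < r" by auto
      then have "a < x'" "x' < b" "S (g x') v" "S v y'" "c < y'" "y' < d" using st(3) lr(3) by auto
      moreover from this have "S (g x') y'" using S_trans by blast
      ultimately show "w \<in> graph_side S a b c d g" unfolding graph_side_def w(1) by simp
    qed
    then show "\<exists>s t u v. s < x \<and> x < t \<and> u < y \<and> y < v \<and> {s<..<t} \<times> {u<..<v} \<subseteq> graph_side S a b c d g"
      using st lr by blast
  qed
qed

text \<open>The rectangle need only contain one point of \<open>X\<close>. The graph passes through
  this point strictly between \<open>c\<close> and \<open>d\<close>, so both sides are nonempty;
  they are open and connected.\<close>

lemma gbox_components:
  assumes X: "def2 X" and g: "gbox X x1 x2 y1 y2 g" "wmono g x1 x2"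
    and V: "{a<..<b} \<times> {c<..<d} \<subseteq> {x1<..<x2} \<times> {y1<..<y2}" and p: "(x0, y0) \<in> {a<..<b} \<times> {c<..<d}" "(x0, y0) \<in> X"
  shows "def_components M ({a<..<b} \<times> {c<..<d} - X) = {upper_part a b c d g, lower_part a b c d g}"
    "card (def_components M ({a<..<b} \<times> {c<..<d} - X)) = 2"
proof -
  let ?V = "{a<..<b} \<times> {c<..<d}" and ?A = "upper_part a b c d g" and ?B = "lower_part a b c d g"
  have p': "a < x0" "x0 < b" "c < y0" "y0 < d" using p by auto
  have ab: "x1 < x \<and> x < x2" if "a < x" "x < b" for x
  proof -
    have "(x, y0) \<in> {x1<..<x2} \<times> {y1<..<y2}" using V that p' by (intro subsetD[OF V]) auto
    then show ?thesis by simp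
  qed
  have inV: "(x, y) \<in> X \<longleftrightarrow> y = g x" if "(x, y) \<in> ?V" for x y
  proof -
    have "(x, y) \<in> {x1<..<x2} \<times> {y1<..<y2}" using V that by (rule subsetD)
    then show ?thesis using g(1) unfolding gbox_def by auto
  qed
  have gx0: "g x0 = y0" using inV p by auto
  have un: "?A \<union> ?B = ?V - X"
  proof (intro subset_antisym subsetI)
    fix z assume z: "z \<in> ?A \<union> ?B"
    then have zV: "(fst z, snd z) \<in> ?V" "snd z \<noteq> g (fst z)" unfolding graph_side_def by auto
    then show "z \<in> ?V - X" using inV[OF zV(1)] by simp
  next
    fix z assume z: "z \<in> ?V - X"
    then have zV: "(fst z, snd z) \<in> ?V" by simp
    then have "snd z \<noteq> g (fst z)" using z inV[OF zV] by auto
    then show "z \<in> ?A \<union> ?B" using z unfolding graph_side_def by auto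
  qed
  have disj: "?A \<inter> ?B = {}" unfolding graph_side_def by auto
  obtain m where "y0 < m" "m < d" using dense p' by blast
  then have neA: "(x0, m) \<in> ?A" unfolding graph_side_def using p' gx0 by auto
  obtain m' where "c < m'" "m' < y0" using dense p' by blast
  then have neB: "(x0, m') \<in> ?B" unfolding graph_side_def using p' gx0 by auto
  have d: "def2 ?A" "open ?A" "def2 ?B" "open ?B"
    by (rule gbox_graph_side[OF _ X g(1) ab]; simp)+
  have c: "dc ?A" "dc ?B" by (rule dc_graph_side[OF _ g(2) ab]; simp)+
  have o: "openin (top_of_set (?V - X)) ?A" "openin (top_of_set (?V - X)) ?B"
    unfolding un[symmetric] using d(2,4) by (auto intro: open_subset)
  have "?A \<noteq> {}" "?B \<noteq> {}" using neA neB by auto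
  then show 1: "def_components M (?V - X) = {?A, ?B}"
    using def_components_two[OF un disj _ c(1) d(1) o(1) _ c(2) d(3) o(2)] by blast
  have "?A \<noteq> ?B" using neA disj by blast
  then show "card (def_components M (?V - X)) = 2" unfolding 1 by simp
qed

lemma gbox_C0_point:
  assumes X: "def2 X" and g: "gbox X x1 x2 y1 y2 g" and x0: "x1 < x0" "x0 < x2"
  shows "C0_point M X (x0, g x0)"
proof -
  let ?V = "{x1<..<x2} \<times> {y1<..<y2}"
  have cont: "continuous_on {x1<..<x2} g" using g unfolding gbox_def by blast
  have gu: "y = g x" if "(x, y) \<in> X" "x1 < x" "x < x2" "y1 < y" "y < y2" for x y using g that unfolding gbox_def by blast
  have im: "(\<lambda>t. (t, g t)) ` {x1<..<x2} = X \<inter> ?V" using g unfolding gbox_def by (auto simp: image_def)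
  have hom: "homeomorphism {x1<..<x2} (X \<inter> ?V) (\<lambda>t. (t, g t)) fst"
    by (rule homeomorphismI) (use im cont in \<open>auto intro!: continuous_intros dest: gu\<close>)
  have "(\<lambda>t. [t, fst (t, g t), snd (t, g t)]) ` {x1<..<x2} =
     {[t, u, v] | t u v. t = u \<and> x1 < t \<and> t < x2 \<and> g t = v}" by (auto simp: image_def)
  moreover have "definable M UNIV 3 {[t, u, v] | t u v. t = u \<and> x1 < t \<and> t < x2 \<and> g t = v}"
    unfolding definable3_dfp
    by (rule dfp_conj[OF dfp_eq dfp2_coord[OF gbox_dfun[OF X g, unfolded dfun_def]]]; simp add: coord_simps)
  ultimately have def: "definable M UNIV 3 ((\<lambda>t. [t, fst (t, g t), snd (t, g t)]) ` {x1<..<x2})" by simp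
  have "x1 < x2" using x0 by order
  then have I: "{x1<..<x2} \<in> open_intervals" unfolding open_intervals_def by blast
  have "y1 < g x0" "g x0 < y2" "(x0, g x0) \<in> X" using g x0 unfolding gbox_def by auto
  then show ?thesis unfolding C0_point_def using x0 I hom def
    by (intro conjI exI[of _ ?V] exI[of _ "{x1<..<x2}"] exI[of _ "\<lambda>t. (t, g t)"] exI[of _ fst])
      (auto intro: open_Times)
qed

text \<open>One-sidedness in a single neighbourhood \<open>U0\<close> is enough: the rectangle
  required inside a given \<open>U\<close> can also be placed inside \<open>U0\<close> and the box
  of the graph.\<close>

lemma gbox_touchI:
  assumes X: "plane_curve M UNIV X" and Y: "plane_curve M UNIV Y" and g: "gbox X x1 x2 y1 y2 g" "wmono g x1 x2"
    and x0: "x1 < x0" "x0 < x2" and C0: "C0_point M Y (x0, g x0)"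
    and U0: "open U0" "(x0, g x0) \<in> U0"
    and side: "(\<forall>x y. (x, y) \<in> Y \<inter> U0 \<longrightarrow> y \<le> g x) \<or> (\<forall>x y. (x, y) \<in> Y \<inter> U0 \<longrightarrow> g x \<le> y)"
  shows "touches M Y X (x0, g x0)"
proof -
  have X': "def2 X" using X by (simp add: plane_curve_def)
  have p: "y1 < g x0" "g x0 < y2" "(x0, g x0) \<in> X" using g(1) x0 unfolding gbox_def by auto
  have "\<exists>V\<in>rectangular_nbhds (x0, g x0). V \<subseteq> U \<and> card (def_components M (V - X)) = 2 \<and>
           (\<exists>K\<in>def_components M (V - X). Y \<inter> V \<inter> K = {})" if U: "open U" "(x0, g x0) \<in> U" for U
  proof -
    have "open (U \<inter> U0 \<inter> ({x1<..<x2} \<times> {y1<..<y2}))"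
      using U U0 by (intro open_Int open_Times open_greaterThanLessThan)
    from open_boxE[OF this, of x0 "g x0"] obtain a b c d where abcd: "a < x0" "x0 < b" "c < g x0" "g x0 < d"
      "{a<..<b} \<times> {c<..<d} \<subseteq> U \<inter> U0 \<inter> ({x1<..<x2} \<times> {y1<..<y2})" using U U0 x0 p by auto
    let ?V = "{a<..<b} \<times> {c<..<d}"
    have V: "(x0, g x0) \<in> ?V" using abcd by simp
    have sub: "?V \<subseteq> {x1<..<x2} \<times> {y1<..<y2}" "?V \<subseteq> U" "?V \<subseteq> U0" using abcd(5) by blast+
    note comps = gbox_components[OF X' g sub(1) V p(3)]
    have "?V \<in> rectangular_nbhds (x0, g x0)" unfolding rectangular_nbhds_def using V by blast
    moreover have "Y \<inter> ?V \<inter> upper_part a b c d g = {} \<or> Y \<inter> ?V \<inter> lower_part a b c d g = {}"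
      using side
    proof
      assume "\<forall>x y. (x, y) \<in> Y \<inter> U0 \<longrightarrow> y \<le> g x"
      then have "Y \<inter> ?V \<inter> upper_part a b c d g = {}" using sub(3) unfolding graph_side_def by fastforce
      then show ?thesis ..
    next
      assume "\<forall>x y. (x, y) \<in> Y \<inter> U0 \<longrightarrow> g x \<le> y"
      then have "Y \<inter> ?V \<inter> lower_part a b c d g = {}" using sub(3) unfolding graph_side_def by fastforce
      then show ?thesis ..
    qed
    ultimately show ?thesis using comps sub(2) by (intro bexI[of _ ?V]) auto
  qed
  then show ?thesis unfolding touches_def using X Y C0 gbox_C0_point[OF X' g(1) x0] by blast
qed

lemma gbox_touchD:
  assumes t: "touches M Y X (x0, g x0)" and g: "gbox X x1 x2 y1 y2 g" "wmono g x1 x2" and x0: "x1 < x0" "x0 < x2"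
  shows "\<exists>a b c d. a < x0 \<and> x0 < b \<and> c < g x0 \<and> g x0 < d \<and> {a<..<b} \<times> {c<..<d} \<subseteq> {x1<..<x2} \<times> {y1<..<y2} \<and>
     ((\<forall>x y. (x, y) \<in> Y \<and> a < x \<and> x < b \<and> c < y \<and> y < d \<longrightarrow> y \<le> g x) \<or>
      (\<forall>x y. (x, y) \<in> Y \<and> a < x \<and> x < b \<and> c < y \<and> y < d \<longrightarrow> g x \<le> y))"
proof -
  have X': "def2 X" using t by (simp add: plane_curve_def touches_def)
  let ?U = "{x1<..<x2} \<times> {y1<..<y2}"
  have p: "y1 < g x0" "g x0 < y2" "(x0, g x0) \<in> X" using g(1) x0 unfolding gbox_def by auto
  have "open ?U" "(x0, g x0) \<in> ?U" using x0 p by (auto intro: open_Times)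
  then obtain V K where V: "V \<in> rectangular_nbhds (x0, g x0)" "V \<subseteq> ?U"
    "K \<in> def_components M (V - X)" "Y \<inter> V \<inter> K = {}" using t unfolding touches_def by meson
  then obtain a b c d where abcd: "V = {a<..<b} \<times> {c<..<d}" "(x0, g x0) \<in> V" unfolding rectangular_nbhds_def by blast
  have "K \<in> {upper_part a b c d g, lower_part a b c d g}"
    using gbox_components(1)[OF X' g V(2)[unfolded abcd(1)] abcd(2)[unfolded abcd(1)] p(3)] V(3) abcd(1) by simp
  then have "(\<forall>x y. (x, y) \<in> Y \<and> a < x \<and> x < b \<and> c < y \<and> y < d \<longrightarrow> y \<le> g x) \<or>
      (\<forall>x y. (x, y) \<in> Y \<and> a < x \<and> x < b \<and> c < y \<and> y < d \<longrightarrow> g x \<le> y)"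
  proof (elim insertE emptyE)
    assume K: "K = upper_part a b c d g"
    have "y \<le> g x" if "(x, y) \<in> Y \<and> a < x \<and> x < b \<and> c < y \<and> y < d" for x y
    proof (rule ccontr)
      assume "\<not> y \<le> g x"
      then have "(x, y) \<in> Y \<inter> V \<inter> K" using that unfolding K graph_side_def abcd(1) by auto
      then show False using V(4) by blast
    qed
    then show ?thesis by blast
  next
    assume K: "K = lower_part a b c d g"
    have "g x \<le> y" if "(x, y) \<in> Y \<and> a < x \<and> x < b \<and> c < y \<and> y < d" for x y
    proof (rule ccontr)
      assume "\<not> g x \<le> y"
      then have "(x, y) \<in> Y \<inter> V \<inter> K" using that unfolding K graph_side_def abcd(1) by auto
      then show False using V(4) by blast
    qed
    then show ?thesis by blast
  qed
  then show ?thesis using abcd V(2) by (intro exI[of _ a] exI[of _ b] exI[of _ c] exI[of _ d]) auto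
qed

text \<open>A component of the complement contains a point to the left or to the right of the
  segment and hence absorbs the whole half-rectangle there; the curve \<open>Y\<close> meets both
  halves.\<close>

lemma vertical_not_touches:
  assumes X: "\<And>x y. x1 < x \<Longrightarrow> x < x2 \<Longrightarrow> y1 < y \<Longrightarrow> y < y2 \<Longrightarrow> (x, y) \<in> X \<longleftrightarrow> x = x0"
    and p: "x1 < x0" "x0 < x2" "y1 < y0" "y0 < y2"
    and Y: "\<And>a b c d. a < x0 \<Longrightarrow> x0 < b \<Longrightarrow> c < y0 \<Longrightarrow> y0 < d \<Longrightarrow>
       (\<exists>x y. (x, y) \<in> Y \<and> a < x \<and> x < x0 \<and> c < y \<and> y < d) \<and> (\<exists>x y. (x, y) \<in> Y \<and> x0 < x \<and> x < b \<and> c < y \<and> y < d)"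
  shows "\<not> touches M Y X (x0, y0)"
proof
  assume t: "touches M Y X (x0, y0)"
  let ?U = "{x1<..<x2} \<times> {y1<..<y2}"
  have "open ?U" "(x0, y0) \<in> ?U" using p by (auto intro: open_Times)
  then obtain V K where V: "V \<in> rectangular_nbhds (x0, y0)" "V \<subseteq> ?U"
    "K \<in> def_components M (V - X)" "Y \<inter> V \<inter> K = {}" using t unfolding touches_def by meson
  then obtain a b c d where abcd: "V = {a<..<b} \<times> {c<..<d}" "(x0, y0) \<in> V" unfolding rectangular_nbhds_def by blast
  have pV: "a < x0" "x0 < b" "c < y0" "y0 < d" using abcd by auto
  have box: "dc ({s<..<t} \<times> {c<..<d})" "def2 ({s<..<t} \<times> {c<..<d})" for s t
  proof -
    have eq: "{s<..<t} \<times> {c<..<d} = {(x, y). s < x \<and> x < t \<and> c < y \<and> y < d}" by auto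
    show "def2 ({s<..<t} \<times> {c<..<d})" unfolding eq definable2_Collect by (intro dfp_rules; simp add: coord_simps)
    show "dc ({s<..<t} \<times> {c<..<d})"
    proof (rule dc_paths)
      fix z z' assume z: "z \<in> {s<..<t} \<times> {c<..<d}" "z' \<in> {s<..<t} \<times> {c<..<d}"
      obtain x y x' y' where xy: "z = (x, y)" "z' = (x', y')" by (metis surj_pair)
      obtain L where L: "(x, y) \<in> L" "(x', y') \<in> L" "dc L" "def2 L"
        "L \<subseteq> {x} \<times> {min y y..max y y} \<union> {min x x'..max x x'} \<times> {y} \<union> {x'} \<times> {min y' y..max y' y}"
        using three_segment_path by metis
      have "{x} \<times> {min y y..max y y} \<union> {min x x'..max x x'} \<times> {y} \<union> {x'} \<times> {min y' y..max y' y} \<subseteq> {s<..<t} \<times> {c<..<d}"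
        using z unfolding xy by (auto simp: min_def max_def split: if_splits)
      then have "L \<subseteq> {s<..<t} \<times> {c<..<d}" using L(5) by (rule subset_trans[rotated])
      then show "\<exists>L. L \<subseteq> {s<..<t} \<times> {c<..<d} \<and> z \<in> L \<and> z' \<in> L \<and> dc L \<and> def2 L" using L xy by blast
    qed
  qed
  have inX: "(x, y) \<in> X \<longleftrightarrow> x = x0" if "(x, y) \<in> V" for x y using X subsetD[OF V(2) that] by auto
  obtain z where z: "z \<in> K" using V(3) unfolding def_components_def by blast
  have zV: "z \<in> V - X" using z V(3) unfolding def_components_def by blast
  then have "fst z \<noteq> x0" using inX[of "fst z" "snd z"] by auto
  then consider "fst z < x0" | "x0 < fst z" by (meson linorder_neqE)
  then show False
  proof cases
    case 1
    let ?L = "{a<..<x0} \<times> {c<..<d}"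
    have LV: "?L \<subseteq> V" using pV unfolding abcd(1) by auto
    have "?L \<subseteq> V - X" using LV inX by force
    moreover have "z \<in> ?L" using 1 zV unfolding abcd(1) by (auto simp: mem_Times_iff)
    ultimately have "?L \<subseteq> K" using def_component_absorbs[OF V(3) box] z by blast
    moreover obtain x y where xy: "(x, y) \<in> Y" "a < x" "x < x0" "c < y" "y < d" using Y[OF pV] by blast
    moreover have "(x, y) \<in> ?L" using xy by simp
    ultimately have "(x, y) \<in> Y \<inter> V \<inter> K" using LV by blast
    then show False using V(4) by blast
  next
    case 2
    let ?L = "{x0<..<b} \<times> {c<..<d}"
    have LV: "?L \<subseteq> V" using pV unfolding abcd(1) by auto
    have "?L \<subseteq> V - X" using LV inX by force
    moreover have "z \<in> ?L" using 2 zV unfolding abcd(1) by (auto simp: mem_Times_iff)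
    ultimately have "?L \<subseteq> K" using def_component_absorbs[OF V(3) box] z by blast
    moreover obtain x y where xy: "(x, y) \<in> Y" "x0 < x" "x < b" "c < y" "y < d" using Y[OF pV] by blast
    moreover have "(x, y) \<in> ?L" using xy by simp
    ultimately have "(x, y) \<in> Y \<inter> V \<inter> K" using LV by blast
    then show False using V(4) by blast
  qed
qed

end

section \<open>Regular points of plane curves\<close>

definition inbox :: "('a::linorder \<times> 'a) set \<Rightarrow> 'a \<Rightarrow> 'a \<Rightarrow> 'a \<Rightarrow> 'a \<Rightarrow> 'a \<Rightarrow> 'a \<Rightarrow> bool" where
  "inbox X x1 x2 y1 y2 x y \<longleftrightarrow> x1 < x \<and> x < x2 \<and> y1 < y \<and> y < y2 \<and> (x, y) \<in> X"

text \<open>First-order form of \<open>gbox\<close> together with \<open>wmono\<close>.\<close>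

definition fbox :: "('a::linorder \<times> 'a) set \<Rightarrow> 'a \<Rightarrow> 'a \<Rightarrow> 'a \<Rightarrow> 'a \<Rightarrow> bool" where
  "fbox X x1 x2 y1 y2 \<longleftrightarrow>
     (\<forall>x. x1 < x \<and> x < x2 \<longrightarrow> (\<exists>y. inbox X x1 x2 y1 y2 x y)) \<and>
     (\<forall>x y y'. inbox X x1 x2 y1 y2 x y \<and> inbox X x1 x2 y1 y2 x y' \<longrightarrow> y = y') \<and>
     ((\<forall>x y x' y'. inbox X x1 x2 y1 y2 x y \<and> inbox X x1 x2 y1 y2 x' y' \<and> x \<le> x' \<longrightarrow> y \<le> y') \<or>
      (\<forall>x y x' y'. inbox X x1 x2 y1 y2 x y \<and> inbox X x1 x2 y1 y2 x' y' \<and> x \<le> x' \<longrightarrow> y' \<le> y)) \<and>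
     (\<forall>x y u v. inbox X x1 x2 y1 y2 x y \<and> u < y \<and> y < v \<longrightarrow>
        (\<exists>s t. s < x \<and> x < t \<and> (\<forall>x' y'. s < x' \<and> x' < t \<and> inbox X x1 x2 y1 y2 x' y' \<longrightarrow> u < y' \<and> y' < v)))"

definition ggraph :: "('a::linorder \<times> 'a) set \<Rightarrow> 'a \<Rightarrow> 'a \<Rightarrow> bool" where
  "ggraph X x y \<longleftrightarrow> (\<exists>x1 x2 y1 y2. inbox X x1 x2 y1 y2 x y \<and> fbox X x1 x2 y1 y2)"

text \<open>The second local form of \<open>X\<close>, a vertical segment. The curves of the family
  are graphs and pass through it from one side to the other, so such points contribute no
  tangents.\<close>

definition vgood :: "('a::linorder \<times> 'a) set \<Rightarrow> 'a \<Rightarrow> 'a \<Rightarrow> bool" where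
  "vgood X x y \<longleftrightarrow> (\<exists>x1 x2 y1 y2. x1 < x \<and> x < x2 \<and> y1 < y \<and> y < y2 \<and>
     (\<forall>x' y'. x1 < x' \<and> x' < x2 \<and> y1 < y' \<and> y' < y2 \<longrightarrow> ((x', y') \<in> X \<longleftrightarrow> x' = x)))"

lemma dfp_inbox:
  assumes "definable2 M A X" "coord A vs a" "coord A vs b" "coord A vs c" "coord A vs d" "coord A vs x" "coord A vs y"
  shows "dfp M A vs (\<lambda>e. inbox X (a e) (b e) (c e) (d e) (x e) (y e))"
  unfolding inbox_def using assms by (intro dfp_conj dfp_less dfp_pair_mem)

lemma dfp_ggraph:
  assumes X: "definable2 M A X" and v: "coord A vs v" "coord A vs w"
  shows "dfp M A vs (\<lambda>e. ggraph X (v e) (w e))"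
proof -
  have "dfp M A [fst, snd] (\<lambda>e. ggraph X (fst e) (snd e))"
    unfolding ggraph_def fbox_def by (intro dfp_rules dfp_inbox[OF X]; simp add: coord_simps)
  from dfp2_coord[OF this v] show ?thesis .
qed

lemma dfp_vgood:
  assumes X: "definable2 M A X" and v: "coord A vs v" "coord A vs w"
  shows "dfp M A vs (\<lambda>e. vgood X (v e) (w e))"
proof -
  have "dfp M A [fst, snd] (\<lambda>e. vgood X (fst e) (snd e))"
    unfolding vgood_def by (intro dfp_rules dfp_pair_mem[OF X]; simp add: coord_simps)
  from dfp2_coord[OF this v] show ?thesis .
qed

context omin
begin

lemma fbox_gbox:
  fixes X :: "('a \<times> 'a) set"
  assumes "fbox X x1 x2 y1 y2"
  shows "\<exists>g. gbox X x1 x2 y1 y2 g \<and> wmono g x1 x2"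
proof -
  note f = assms[unfolded fbox_def]
  note f1 = conjunct1[OF f] and f2 = conjunct1[OF conjunct2[OF f]]
    and f3 = conjunct1[OF conjunct2[OF conjunct2[OF f]]] and f4 = conjunct2[OF conjunct2[OF conjunct2[OF f]]]
  let ?B = "inbox X x1 x2 y1 y2"
  define g where "g x = (THE y. ?B x y)" for x
  have Bx: "\<exists>y. ?B x y" if "x1 < x" "x < x2" for x using f1 that by blast
  have uniq: "y = y'" if "?B x y" "?B x y'" for x y y' using f2 that by blast
  have gB: "?B x (g x)" if x: "x1 < x" "x < x2" for x
  proof -
    obtain y where y: "?B x y" using Bx[OF x] by blast
    have "g x = y" unfolding g_def by (rule the_equality) (use y uniq in blast)+
    then show ?thesis using y by simp
  qed
  have Bg: "y = g x" if "?B x y" for x y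
    by (rule uniq[OF that gB]) (use that in \<open>auto simp: inbox_def\<close>)
  have F4: "\<exists>s t. s < x \<and> x < t \<and> (\<forall>x' y'. s < x' \<and> x' < t \<and> ?B x' y' \<longrightarrow> u < y' \<and> y' < v)"
    if "?B x y" "u < y" "y < v" for x y u v using f4 that by blast
  have nb: "\<exists>a b. a < x \<and> x < b \<and> (\<forall>y. a < y \<and> y < b \<longrightarrow> u < g y \<and> g y < v)"
    if x: "x1 < x" "x < x2" and uv: "u < g x" "g x < v" for x u v
  proof -
    from F4[OF gB[OF x] uv] obtain s t where st: "s < x" "x < t"
      "\<forall>x' y'. s < x' \<and> x' < t \<and> ?B x' y' \<longrightarrow> u < y' \<and> y' < v" by (elim exE conjE)
    have "u < g y \<and> g y < v" if "max s x1 < y \<and> y < min t x2" for y using st(3) gB[of y] that by auto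
    then show ?thesis using st(1,2) x by (intro exI[of _ "max s x1"] exI[of _ "min t x2"]) auto
  qed
  have gy: "y1 < g x" "g x < y2" "(x, g x) \<in> X" if "x1 < x" "x < x2" for x using gB[OF that] unfolding inbox_def by auto
  have "continuous_on {x1<..<x2} g"
  proof (rule continuous_on_Ioo_if)
    fix x u assume x: "x1 < x" "x < x2" and u: "u < g x"
    show "\<exists>a b. a < x \<and> x < b \<and> (\<forall>y. a < y \<and> y < b \<longrightarrow> u < g y)" using nb[OF x u gy(2)[OF x]] by blast
  next
    fix x u assume x: "x1 < x" "x < x2" and u: "g x < u"
    show "\<exists>a b. a < x \<and> x < b \<and> (\<forall>y. a < y \<and> y < b \<longrightarrow> g y < u)" using nb[OF x gy(1)[OF x] u] by blast
  qed
  moreover have "(x, y) \<in> X \<longleftrightarrow> y = g x" if "x1 < x \<and> x < x2 \<and> y1 < y \<and> y < y2" for x y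
    using Bg[of x y] gy[of x] that unfolding inbox_def by auto
  ultimately have "gbox X x1 x2 y1 y2 g" unfolding gbox_def using gy by blast
  moreover have "wmono g x1 x2"
  proof -
    have m: "(\<forall>x y x' y'. ?B x y \<and> ?B x' y' \<and> x \<le> x' \<longrightarrow> y \<le> y') \<or> (\<forall>x y x' y'. ?B x y \<and> ?B x' y' \<and> x \<le> x' \<longrightarrow> y' \<le> y)"
      by (rule f3)
    have *: "?B x (g x)" "?B x' (g x')" if "x1 < x \<and> x \<le> x' \<and> x' < x2" for x x'
      using that by (auto intro!: gB)
    from m show ?thesis unfolding wmono_def using * by (elim disjE) blast+
  qed
  ultimately show ?thesis by blast
qed

lemma gbox_fbox:
  fixes X :: "('a \<times> 'a) set"
  assumes g: "gbox X x1 x2 y1 y2 g" "wmono g x1 x2"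
  shows "fbox X x1 x2 y1 y2"
proof -
  let ?B = "inbox X x1 x2 y1 y2"
  have B: "?B x y \<longleftrightarrow> x1 < x \<and> x < x2 \<and> y = g x" for x y using g(1) unfolding gbox_def inbox_def by blast
  have cont: "continuous_on {x1<..<x2} g" using g unfolding gbox_def by blast
  have nb: "\<exists>s t. s < x \<and> x < t \<and> (\<forall>x' y'. s < x' \<and> x' < t \<and> ?B x' y' \<longrightarrow> u < y' \<and> y' < v)"
    if "?B x y" "u < y" "y < v" for x y u v
    using continuous_on_Ioo_nbhd[OF cont, of x "{u<..<v}"] that unfolding B by auto
  from g(2) have "(\<forall>x y x' y'. ?B x y \<and> ?B x' y' \<and> x \<le> x' \<longrightarrow> y \<le> y') \<or> (\<forall>x y x' y'. ?B x y \<and> ?B x' y' \<and> x \<le> x' \<longrightarrow> y' \<le> y)"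
    unfolding wmono_def B by (elim disjE) blast+
  then show ?thesis unfolding fbox_def using nb B by auto
qed

lemma ggraph_gbox:
  fixes X :: "('a \<times> 'a) set"
  assumes "ggraph X x y"
  obtains x1 x2 y1 y2 g where "x1 < x" "x < x2" "g x = y" "gbox X x1 x2 y1 y2 g" "wmono g x1 x2"
proof -
  obtain x1 x2 y1 y2 where b: "inbox X x1 x2 y1 y2 x y" "fbox X x1 x2 y1 y2" using assms unfolding ggraph_def by blast
  from fbox_gbox[OF b(2)] obtain g where g: "gbox X x1 x2 y1 y2 g" "wmono g x1 x2" by blast
  have "g x = y" using b(1) g(1) unfolding inbox_def gbox_def by auto
  then show thesis using that[of x1 x2 g y1 y2] g b(1) unfolding inbox_def by blast
qed

lemma gbox_ggraph:
  fixes X :: "('a \<times> 'a) set"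
  assumes g: "gbox X x1 x2 y1 y2 g" "wmono g x1 x2" and x: "x1 < x" "x < x2"
  shows "ggraph X x (g x)"
proof -
  have "inbox X x1 x2 y1 y2 x (g x)" using g(1) x unfolding inbox_def gbox_def by auto
  then show ?thesis unfolding ggraph_def using gbox_fbox[OF g] by blast
qed

lemma ggraph_mem: "ggraph X x y \<Longrightarrow> (x, y) \<in> X"
  unfolding ggraph_def inbox_def by blast

lemma wmonoI:
  fixes z :: "'a \<Rightarrow> 'a"
  assumes "(\<forall>x y. j1 < x \<and> x < y \<and> y < j2 \<longrightarrow> z x < z y) \<or>
      (\<forall>x y. j1 < x \<and> x < y \<and> y < j2 \<longrightarrow> z x > z y) \<or>
      (\<forall>x y. j1 < x \<and> x < y \<and> y < j2 \<longrightarrow> z x = z y)"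
  shows "wmono z j1 j2"
  using assms unfolding wmono_def
proof (elim disjE)
  assume *: "\<forall>x y. j1 < x \<and> x < y \<and> y < j2 \<longrightarrow> z x < z y"
  have "z x \<le> z y" if "j1 < x" "x \<le> y" "y < j2" for x y
    using * that by (cases "x = y") (auto intro: less_imp_le)
  then show "(\<forall>x y. j1 < x \<and> x \<le> y \<and> y < j2 \<longrightarrow> z x \<le> z y) \<or> (\<forall>x y. j1 < x \<and> x \<le> y \<and> y < j2 \<longrightarrow> z y \<le> z x)" by blast
next
  assume *: "\<forall>x y. j1 < x \<and> x < y \<and> y < j2 \<longrightarrow> z x > z y"
  have "z y \<le> z x" if "j1 < x" "x \<le> y" "y < j2" for x y
    using * that by (cases "x = y") (auto intro: less_imp_le)
  then show "(\<forall>x y. j1 < x \<and> x \<le> y \<and> y < j2 \<longrightarrow> z x \<le> z y) \<or> (\<forall>x y. j1 < x \<and> x \<le> y \<and> y < j2 \<longrightarrow> z y \<le> z x)" by blast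
next
  assume *: "\<forall>x y. j1 < x \<and> x < y \<and> y < j2 \<longrightarrow> z x = z y"
  have "z x \<le> z y" if "j1 < x" "x \<le> y" "y < j2" for x y
    using *[rule_format, of x y] that by (cases "x = y") (simp_all add: less_le)
  then show "(\<forall>x y. j1 < x \<and> x \<le> y \<and> y < j2 \<longrightarrow> z x \<le> z y) \<or> (\<forall>x y. j1 < x \<and> x \<le> y \<and> y < j2 \<longrightarrow> z y \<le> z x)" by blast
qed

section \<open>Points where \<open>X\<close> is neither a graph nor a vertical segment\<close>

lemma isolated_fibre_finite:
  assumes P: "df1 P" and iso: "\<And>y. P y \<Longrightarrow> \<exists>u v. u < y \<and> y < v \<and> (\<forall>y'. u < y' \<and> y' < v \<and> P y' \<longrightarrow> y' = y)"
  shows "finite {y. P y}"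
proof (rule ccontr)
  assume "infinite {y. P y}"
  from infinite_interval[OF this P] obtain a b where ab: "a < b" "\<forall>x. a < x \<and> x < b \<longrightarrow> P x" by blast
  obtain y where y: "a < y" "y < b" using dense[OF ab(1)] by blast
  then obtain u v where uv: "u < y" "y < v" "\<forall>y'. u < y' \<and> y' < v \<and> P y' \<longrightarrow> y' = y" using iso[of y] ab(2) by blast
  have "y < min v b" using uv y by simp
  then obtain y' where y': "y < y'" "y' < min v b" using dense by blast
  have "u < y'" "a < y'" using uv(1) y(1) y'(1) by order+
  then have "y' = y" using uv(3) ab(2) y' by auto
  then show False using y'(1) by simp
qed

lemma ggraph_fibre_finite:
  assumes X: "def2 X" shows "finite {y. ggraph X x y}"
proof (rule isolated_fibre_finite)
  show "df1 (ggraph X x)" by (rule dfp_ggraph[OF X]; simp add: coord_simps)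
  fix y assume "ggraph X x y"
  then obtain x1 x2 y1 y2 g where g: "x1 < x" "x < x2" "g x = y" "gbox X x1 x2 y1 y2 g" "wmono g x1 x2"
    by (rule ggraph_gbox)
  have "y' = y" if "y1 < y' \<and> y' < y2 \<and> ggraph X x y'" for y'
    using g that ggraph_mem[of X x y'] unfolding gbox_def by blast
  moreover have "y1 < y" "y < y2" using g unfolding gbox_def by blast+
  ultimately show "\<exists>u v. u < y \<and> y < v \<and> (\<forall>y'. u < y' \<and> y' < v \<and> ggraph X x y' \<longrightarrow> y' = y)" by blast
qed

text \<open>Left and right germs are treated together by letting the filter vary.\<close>

definition side :: "'a filter \<Rightarrow> 'a \<Rightarrow> bool" where
  "side F a \<longleftrightarrow> F = at_left a \<or> F = at_right a"

lemma side_neq_bot: "side F a \<Longrightarrow> F \<noteq> bot"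
  unfolding side_def by (elim disjE) (simp_all add: at_left_neq_bot at_right_neq_bot)

lemma side_germ: "side F a \<Longrightarrow> df1 P \<Longrightarrow> eventually P F \<or> eventually (\<lambda>x. \<not> P x) F"
  unfolding side_def using germ_left germ_right by blast

lemma side_infinite: "side F a \<Longrightarrow> eventually P F \<Longrightarrow> infinite {x. P x}"
proof -
  have *: "infinite {x. P x}" if "u < v" "\<forall>y. u < y \<and> y < v \<longrightarrow> P y" for u v
  proof -
    have "{u<..<v} \<subseteq> {x. P x}" using that(2) by auto
    then show ?thesis using infinite_Ioo[OF that(1)] infinite_super by blast
  qed
  assume F: "side F a" and ev: "eventually P F"
  from F show ?thesis unfolding side_def
  proof
    assume F: "F = at_left a"
    from ev[unfolded F eventually_at_left_iff] obtain b where "b < a" "\<forall>y. b < y \<and> y < a \<longrightarrow> P y" by blast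
    then show ?thesis by (rule *)
  next
    assume F: "F = at_right a"
    from ev[unfolded F eventually_at_right_iff] obtain b where "a < b" "\<forall>y. a < y \<and> y < b \<longrightarrow> P y" by blast
    then show ?thesis by (rule *)
  qed
qed

lemma side_finite_not: "side F a \<Longrightarrow> df1 P \<Longrightarrow> finite {x. P x} \<Longrightarrow> eventually (\<lambda>x. \<not> P x) F"
  using side_germ side_infinite by blast

lemma dfp_eventually_side:
  assumes F: "side F a" and P: "dfp M UNIV (map (\<lambda>v z. v (fst z)) vs @ [snd]) (\<lambda>z. P (fst z) (snd z))"
  shows "dfp M UNIV vs (\<lambda>e. eventually (P e) F)"
proof -
  have P': "dfp M UNIV (map (\<lambda>v z. v (fst z)) (map (\<lambda>v z. v (fst z)) vs @ [snd]) @ [snd]) (\<lambda>z. P (fst (fst z)) (snd z))"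
    using dfp_subst[OF P, of "map (\<lambda>v z. v (fst z)) (map (\<lambda>v z. v (fst z)) vs @ [snd]) @ [snd]" "\<lambda>z. (fst (fst z), snd z)"]
    by (auto simp: coord_simps)
  from F show ?thesis unfolding side_def eventually_at_left_iff[symmetric]
  proof (elim disjE)
    assume F: "F = at_left a"
    show ?thesis unfolding F eventually_at_left_iff
      by (rule dfp_ex, rule dfp_conj, (rule dfp_less; simp add: coord_simps), rule dfp_all, rule dfp_imp[OF _ P'],
          intro dfp_conj dfp_less; simp add: coord_simps)
  next
    assume F: "F = at_right a"
    show ?thesis unfolding F eventually_at_right_iff
      by (rule dfp_ex, rule dfp_conj, (rule dfp_less; simp add: coord_simps), rule dfp_all, rule dfp_imp[OF _ P'],
          intro dfp_conj dfp_less; simp add: coord_simps)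
  qed
qed

lemma thin_eventually_finite:
  assumes "def2 X" "thin X" "side F a"
  shows "eventually (\<lambda>x. finite {y. (x, y) \<in> X}) F"
  using side_finite_not[OF assms(3) dfp_infinite_fibre[OF definable2_mem[OF assms(1)]]] assms(2)
  unfolding thin_def by simp

text \<open>If \<open>X\<close> accumulated over every subinterval, then nearby fibres would have a
  point in each of \<open>n\<close> disjoint subintervals, for every \<open>n\<close>. Finite fibres
  of unbounded size contradict saturation.\<close>

lemma thin_no_accumulation:
  assumes X: "def2 X" "thin X" and F: "side F a" and l: "l1 < l2"
    and acc: "\<And>c d. l1 \<le> c \<Longrightarrow> c < d \<Longrightarrow> d \<le> l2 \<Longrightarrow> \<not> eventually (\<lambda>x. \<not> (\<exists>y. c < y \<and> y < d \<and> (x, y) \<in> X)) F"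
  shows False
proof -
  have X2: "dfp M UNIV [fst, snd] (\<lambda>z. (fst z, snd z) \<in> X)" by (rule definable2_mem[OF X(1)])
  have ev: "eventually (\<lambda>x. \<exists>S. finite S \<and> card S = n \<and> (\<forall>y\<in>S. c < y \<and> y < d \<and> (x, y) \<in> X)) F"
    if "l1 \<le> c" "c < d" "d \<le> l2" for n c d
    using that
  proof (induction n arbitrary: c d)
    case 0
    show ?case by (rule always_eventually) (auto intro: exI[of _ "{}"])
  next
    case (Suc n)
    \<comment> \<open>The interval is split: one point is found above \<open>m\<close>, and
      \<open>n\<close> points below it by induction.\<close>
    obtain m where m: "c < m" "m < d" using dense[OF Suc.prems(2)] by blast
    have cm: "m \<le> l2" "l1 \<le> m" using Suc.prems m by order+
    have "df1 (\<lambda>x. \<exists>y. m < y \<and> y < d \<and> (x, y) \<in> X)"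
      by (intro dfp_rules dfp_pair_mem[OF X(1)]; simp add: coord_simps)
    then have "eventually (\<lambda>x. \<exists>y. m < y \<and> y < d \<and> (x, y) \<in> X) F"
      using side_germ[OF F] acc[OF cm(2) m(2) Suc.prems(3)] by blast
    moreover have "eventually (\<lambda>x. \<exists>S. finite S \<and> card S = n \<and> (\<forall>y\<in>S. c < y \<and> y < m \<and> (x, y) \<in> X)) F"
      by (rule Suc.IH[OF Suc.prems(1) m(1) cm(1)])
    ultimately show ?case
    proof eventually_elim
      case (elim x)
      obtain y S where *: "m < y" "y < d" "(x, y) \<in> X" "finite S" "card S = n" "\<forall>y\<in>S. c < y \<and> y < m \<and> (x, y) \<in> X"
        using elim by blast
      then have "card (insert y S) = Suc n" by (subst card_insert_disjoint) auto
      moreover have "\<forall>y\<in>insert y S. c < y \<and> y < d \<and> (x, y) \<in> X" using * m by (auto intro: less_trans)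
      ultimately show ?case using *(4) by (intro exI[of _ "insert y S"]) simp
    qed
  qed
  \<comment> \<open>Saturation will offer an infinite fibre; the conjunct that this very fibre is
    finite turns it into a contradiction.\<close>
  have "\<exists>x. infinite {y. finite {y. (x, y) \<in> X} \<and> (x, y) \<in> X}"
  proof (rule saturation_infinite)
    show "df2 (\<lambda>x y. finite {y. (x, y) \<in> X} \<and> (x, y) \<in> X)"
    proof (rule dfp_conj[OF _ X2])
      show "dfp M UNIV [fst, snd] (\<lambda>z. finite {y. (fst z, y) \<in> X})"
        by (rule dfp_finite) (intro dfp_pair_mem[OF X(1)]; simp add: coord_simps)
    qed
    fix n
    have "eventually (\<lambda>x. finite {y. (x, y) \<in> X} \<and> (\<exists>S. finite S \<and> card S = n \<and> (\<forall>y\<in>S. l1 < y \<and> y < l2 \<and> (x, y) \<in> X))) F"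
      using thin_eventually_finite[OF X F] ev[OF order_refl l order_refl] by (rule eventually_conj)
    from eventually_happens'[OF side_neq_bot[OF F] this]
    show "\<exists>x S. finite S \<and> card S = n \<and> (\<forall>y\<in>S. finite {y. (x, y) \<in> X} \<and> (x, y) \<in> X)" by blast
  qed
  then show False by auto
qed

text \<open>The point of the fibre next to \<open>z x\<close> in the direction \<open>S\<close> is a
  definable function of \<open>x\<close>, hence continuous on a subinterval. A level
  \<open>m\<close> strictly between the two keeps the rest of \<open>X\<close> away from the
  section. If there are no such points over an interval, any level works.\<close>

lemma separation:
  assumes S: "S = (<) \<or> S = (>)" and X: "def2 X" and z: "dfun i1 i2 z" and i: "i1 < i2"
    and fin: "\<And>x. i1 < x \<Longrightarrow> x < i2 \<Longrightarrow> finite {y. (x, y) \<in> X}"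
  shows "\<exists>j1 j2. i1 \<le> j1 \<and> j1 < j2 \<and> j2 \<le> i2 \<and> (\<forall>x. j1 < x \<and> x < j2 \<longrightarrow>
     (\<exists>m s t. S (z x) m \<and> s < x \<and> x < t \<and> (\<forall>x' y. s < x' \<and> x' < t \<and> (x', y) \<in> X \<and> S (z x') y \<longrightarrow> S m y)))"
proof -
  have dS: "dfp M UNIV vs (\<lambda>e. S (v e) (w e))" if "coord UNIV vs v" "coord UNIV vs w" for vs :: "('e \<Rightarrow> 'a) list" and v w
    using S that by (elim disjE) (simp_all add: dfp_less)
  have oS: "open {y. S v y}" for v
    using S open_lessThan[of v] open_greaterThan[of v] unfolding lessThan_def greaterThan_def by (elim disjE; simp)
  have S_dense: "\<exists>v. S u v \<and> S v w" if "S u w" for u w using S that dense by blast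
  have S_ex: "\<exists>v. S u v" for u using S lt_ex gt_ex by blast
  have S_least: "\<exists>y\<in>T. \<forall>y'\<in>T. y = y' \<or> S y y'" if "finite T" "T \<noteq> {}" for T
  proof -
    have "Min T \<in> T" "Max T \<in> T" "\<forall>y\<in>T. Min T \<le> y \<and> y \<le> Max T" using that by auto
    moreover from this(3) have "Min T = y \<or> Min T < y" "Max T = y \<or> y < Max T" if "y \<in> T" for y
      using that le_neq_trans by metis+
    then have "(\<forall>y\<in>T. Min T = y \<or> S (Min T) y) \<or> (\<forall>y\<in>T. Max T = y \<or> S (Max T) y)"
      using S by (elim disjE) simp_all
    ultimately show ?thesis by blast
  qed
  have S_trans: "S u w" if "S u v" "S v w" for u v w using S that by auto
  have S_asym: "\<not> S v u" if "S u v" for u v using S that by auto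
  note Z = dfp2_coord[OF z[unfolded dfun_def]]
  define U where "U x y \<longleftrightarrow> (\<exists>u. (i1 < x \<and> x < i2 \<and> z x = u) \<and> S u y \<and> (x, y) \<in> X)" for x y
  have U: "df2 U" unfolding U_def
    by (rule dfp_ex, rule dfp_conj[OF Z dfp_conj[OF dS dfp_pair_mem[OF X]]]; simp add: coord_simps)
  have U': "U x y \<longleftrightarrow> S (z x) y \<and> (x, y) \<in> X" if "i1 < x" "x < i2" for x y using that unfolding U_def by auto
  have U1: "df1 (\<lambda>x. i1 < x \<and> x < i2 \<and> (\<exists>y. U x y))" "df1 (\<lambda>x. i1 < x \<and> x < i2 \<and> \<not> (\<exists>y. U x y))"
    by (intro dfp_rules dfp2_coord[OF U]; simp add: coord_simps)+
  have "{i1<..<i2} \<subseteq> {x. i1 < x \<and> x < i2 \<and> (\<exists>y. U x y)} \<union> {x. i1 < x \<and> x < i2 \<and> \<not> (\<exists>y. U x y)}" by auto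
  then have "infinite ({x. i1 < x \<and> x < i2 \<and> (\<exists>y. U x y)} \<union> {x. i1 < x \<and> x < i2 \<and> \<not> (\<exists>y. U x y)})"
    using infinite_Ioo[OF i] infinite_super by blast
  then consider "infinite {x. i1 < x \<and> x < i2 \<and> (\<exists>y. U x y)}" | "infinite {x. i1 < x \<and> x < i2 \<and> \<not> (\<exists>y. U x y)}"
    unfolding finite_Un by blast
  then show ?thesis
  proof cases
    case 2
    from infinite_interval[OF 2 U1(2)] obtain j1 j2 where j: "j1 < j2"
      "\<forall>x. j1 < x \<and> x < j2 \<longrightarrow> i1 < x \<and> x < i2 \<and> \<not> (\<exists>y. U x y)" by (elim exE conjE)
    have ij: "i1 \<le> j1" "j2 \<le> i2" using Ioo_subsetD[OF j(1), of i1 i2] j(2) by auto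
    have "\<exists>m s t. S (z x) m \<and> s < x \<and> x < t \<and> (\<forall>x' y. s < x' \<and> x' < t \<and> (x', y) \<in> X \<and> S (z x') y \<longrightarrow> S m y)"
      if x: "j1 < x \<and> x < j2" for x
    proof -
      obtain m where m: "S (z x) m" using S_ex by blast
      have "\<not> ((x', y) \<in> X \<and> S (z x') y)" if "j1 < x'" "x' < j2" for x' y using j(2) that U'[of x' y] by blast
      then show ?thesis using m x by blast
    qed
    then show ?thesis using j(1) ij by blast
  next
    case 1
    from infinite_interval[OF 1 U1(1)] obtain j1 j2 where j: "j1 < j2"
      "\<forall>x. j1 < x \<and> x < j2 \<longrightarrow> i1 < x \<and> x < i2 \<and> (\<exists>y. U x y)" by (elim exE conjE)
    have ij: "i1 \<le> j1" "j2 \<le> i2" using Ioo_subsetD[OF j(1), of i1 i2] j(2) by auto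
    define up where "up x = (THE y. U x y \<and> (\<forall>y'. U x y' \<longrightarrow> y = y' \<or> S y y'))" for x
    have finU: "finite {y. U x y}" if "j1 < x" "x < j2" for x
      by (rule finite_subset[of _ "{y. (x, y) \<in> X}"]) (use fin[of x] j(2) that in \<open>auto simp: U_def\<close>)
    have neU: "{y. U x y} \<noteq> {}" if "j1 < x" "x < j2" for x using j(2) that by auto
    have up: "up x = y \<longleftrightarrow> U x y \<and> (\<forall>y'. U x y' \<longrightarrow> y = y' \<or> S y y')" if x: "j1 < x" "x < j2" for x y
    proof -
      have "\<exists>y. U x y \<and> (\<forall>y'. U x y' \<longrightarrow> y = y' \<or> S y y')" using S_least[OF finU[OF x] neU[OF x]] by blast
      then have "\<exists>!y. U x y \<and> (\<forall>y'. U x y' \<longrightarrow> y = y' \<or> S y y')" using S_asym by blast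
      from theI'[OF this] the1_equality[OF this] show ?thesis unfolding up_def by blast
    qed
    have "dfun j1 j2 up"
    proof -
      have "(\<lambda>z. j1 < fst z \<and> fst z < j2 \<and> up (fst z) = snd z) =
         (\<lambda>z. j1 < fst z \<and> fst z < j2 \<and> U (fst z) (snd z) \<and> (\<forall>y'. U (fst z) y' \<longrightarrow> snd z = y' \<or> S (snd z) y'))"
        using up by (intro ext) blast
      then show ?thesis unfolding dfun_def
        by (simp only:) (intro dfp_conj dfp_all dfp_imp dfp_disj dfp_less dfp_eq dS dfp2_coord[OF U]; simp add: coord_simps)
    qed
    from monotone_continuous_subinterval[OF this j(1)] obtain k1 k2 where
      k: "j1 \<le> k1" "k1 < k2" "k2 \<le> j2" "continuous_on {k1<..<k2} up" by (elim exE conjE)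
    have "\<exists>m s t. S (z x) m \<and> s < x \<and> x < t \<and> (\<forall>x' y. s < x' \<and> x' < t \<and> (x', y) \<in> X \<and> S (z x') y \<longrightarrow> S m y)"
      if x: "k1 < x \<and> x < k2" for x
    proof -
      have xj: "j1 < x" "x < j2" using x k by (auto intro: le_less_trans less_le_trans)
      have xi: "i1 < x" "x < i2" using xj ij by order+
      have "U x (up x)" using up[OF xj, of "up x"] by blast
      then have "S (z x) (up x)" using U'[OF xi] by blast
      then obtain m where m: "S (z x) m" "S m (up x)" using S_dense by blast
      have xk: "k1 < x" "x < k2" "up x \<in> {y. S m y}" using x m(2) by auto
      from continuous_on_Ioo_nbhd[OF k(4) xk(1,2) oS xk(3)] obtain s t where st: "s < x" "x < t"
        "\<forall>y. s < y \<and> y < t \<longrightarrow> k1 < y \<and> y < k2 \<and> up y \<in> {y. S m y}" by blast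
      have "S m y" if "s < x'" "x' < t" "(x', y) \<in> X" "S (z x') y" for x' y
      proof -
        have x': "k1 < x'" "x' < k2" "S m (up x')" using st(3) that by auto
        have xj': "j1 < x'" "x' < j2" using x' k by order+
        have xi': "i1 < x'" "x' < i2" using xj' ij by order+
        have "U x' y" using U'[OF xi'] that by blast
        then have "up x' = y \<or> S (up x') y" using up[OF xj', of "up x'"] by blast
        then show ?thesis using x'(3) S_trans by blast
      qed
      then show ?thesis using m(1) st(1,2) by blast
    qed
    moreover have "i1 \<le> k1" "k2 \<le> i2" using ij k by order+
    ultimately show ?thesis using k(2) by blast
  qed
qed

lemma finite_fst_image:
  assumes "finite {x. \<exists>y. (x, y) \<in> Z}" "\<And>x. finite {y. (x, y) \<in> Z}" shows "finite Z"
proof -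
  have "Z \<subseteq> (SIGMA x:{x. \<exists>y. (x, y) \<in> Z}. {y. (x, y) \<in> Z})" by auto
  then show ?thesis using assms finite_SigmaI finite_subset by (metis (no_types, lifting))
qed

text \<open>Definable choice: over an interval the fibres are nonempty and finite, and the least
  element of a finite fibre is definable from it.\<close>

lemma thin_min_section:
  assumes Z: "def2 Z" "infinite Z" and fin: "thin X" "Z \<subseteq> X" "def2 X" and proj: "infinite {x. \<exists>y. (x, y) \<in> Z}"
  shows "\<exists>i1 i2 z. i1 < i2 \<and> dfun i1 i2 z \<and> (\<forall>x. i1 < x \<and> x < i2 \<longrightarrow> (x, z x) \<in> Z \<and> finite {y. (x, y) \<in> X})"
proof -
  have inf: "infinite {x. (\<exists>y. (x, y) \<in> Z) \<and> finite {y. (x, y) \<in> X}}"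
  proof
    assume "finite {x. (\<exists>y. (x, y) \<in> Z) \<and> finite {y. (x, y) \<in> X}}"
    then have "finite ({x. (\<exists>y. (x, y) \<in> Z) \<and> finite {y. (x, y) \<in> X}} \<union> {x. infinite {y. (x, y) \<in> X}})"
      using fin(1) unfolding thin_def by simp
    then have "finite {x. \<exists>y. (x, y) \<in> Z}" by (rule rev_finite_subset) auto
    then show False using proj by simp
  qed
  have "df1 (\<lambda>x. (\<exists>y. (x, y) \<in> Z) \<and> finite {y. (x, y) \<in> X})"
    by (intro dfp_conj dfp_ex dfp_finite dfp_pair_mem[OF Z(1)] dfp_pair_mem[OF fin(3)]; simp add: coord_simps)
  from infinite_interval[OF inf this] obtain i1 i2 where i: "i1 < i2"
    "\<forall>x. i1 < x \<and> x < i2 \<longrightarrow> (\<exists>y. (x, y) \<in> Z) \<and> finite {y. (x, y) \<in> X}" by (elim exE conjE)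
  define z where "z x = Min {y. (x, y) \<in> Z}" for x
  have z: "z x = y \<longleftrightarrow> (x, y) \<in> Z \<and> (\<forall>y'. (x, y') \<in> Z \<longrightarrow> y \<le> y')" if x: "i1 < x" "x < i2" for x y
  proof -
    have "finite {y. (x, y) \<in> Z}" by (rule finite_subset[of _ "{y. (x, y) \<in> X}"]) (use fin(2) i(2) x in auto)
    moreover have "{y. (x, y) \<in> Z} \<noteq> {}" using i(2) x by auto
    ultimately show ?thesis unfolding z_def using Min_eq_iff[of "{y. (x, y) \<in> Z}"] by auto
  qed
  have "(\<lambda>e. i1 < fst e \<and> fst e < i2 \<and> z (fst e) = snd e) =
      (\<lambda>e. i1 < fst e \<and> fst e < i2 \<and> (fst e, snd e) \<in> Z \<and> (\<forall>y'. (fst e, y') \<in> Z \<longrightarrow> snd e \<le> y'))"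
    using z by (intro ext) blast
  then have "dfun i1 i2 z" unfolding dfun_def
    by (simp only:) (intro dfp_rules dfp_pair_mem[OF Z(1)]; simp add: coord_simps)
  moreover have "(x, z x) \<in> Z" if "i1 < x" "x < i2" for x using z[OF that, of "z x"] by blast
  ultimately show ?thesis using i by blast
qed

text \<open>If infinitely many bad points had distinct abscissae, a continuous section through them
  could be separated from the rest of \<open>X\<close> above and below, making \<open>X\<close> a
  monotone graph there. Otherwise they fill an interval on one vertical line; at all but finitely
  many of its heights \<open>X\<close> does not accumulate from outside the line and is a vertical
  segment.\<close>

lemma finite_bad_points:
  assumes X: "def2 X" "thin X"
  shows "finite {(x, y). (x, y) \<in> X \<and> \<not> ggraph X x y \<and> \<not> vgood X x y}" (is "finite ?Z")
proof (rule ccontr)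
  assume inf: "infinite ?Z"
  have Z: "def2 ?Z" unfolding definable2_Collect
    by (intro dfp_conj dfp_not dfp_pair_mem[OF X(1)] dfp_ggraph[OF X(1)] dfp_vgood[OF X(1)]; simp add: coord_simps)
  show False
  proof (cases "infinite {x. \<exists>y. (x, y) \<in> ?Z}")
    case True
    have "?Z \<subseteq> X" by auto
    from thin_min_section[OF Z inf X(2) this X(1) True] obtain i1 i2 z where i: "i1 < i2" "dfun i1 i2 z"
      "\<forall>x. i1 < x \<and> x < i2 \<longrightarrow> (x, z x) \<in> ?Z \<and> finite {y. (x, y) \<in> X}" by (elim exE conjE)
    from monotone_continuous_subinterval[OF i(2,1)] obtain j1 j2 where j: "i1 \<le> j1" "j1 < j2" "j2 \<le> i2"
      "continuous_on {j1<..<j2} z" and mono: "((\<forall>x y. j1 < x \<and> x < y \<and> y < j2 \<longrightarrow> z x < z y) \<or>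
      (\<forall>x y. j1 < x \<and> x < y \<and> y < j2 \<longrightarrow> z x > z y) \<or>
      (\<forall>x y. j1 < x \<and> x < y \<and> y < j2 \<longrightarrow> z x = z y))" by (elim exE conjE)
    have wm: "wmono z j1 j2" by (rule wmonoI[OF mono])
    have zj: "dfun j1 j2 z" by (rule dfun_subinterval[OF i(2) j(1,3)])
    have finj: "finite {y. (x, y) \<in> X}" if "j1 < x" "x < j2" for x
    proof -
      have "i1 < x" "x < i2" using that j by order+
      then show ?thesis using i(3) by blast
    qed
    obtain k1 k2 where k: "j1 \<le> k1" "k1 < k2" "k2 \<le> j2"
      "\<forall>x. k1 < x \<and> x < k2 \<longrightarrow>
     (\<exists>m s t. z x < m \<and> s < x \<and> x < t \<and> (\<forall>x' y. s < x' \<and> x' < t \<and> (x', y) \<in> X \<and> z x' < y \<longrightarrow> m < y))"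
      using separation[OF _ X(1) zj j(2) finj, of "(<)"] by blast
    have zk: "dfun k1 k2 z" by (rule dfun_subinterval[OF zj k(1,3)])
    have fink: "finite {y. (x, y) \<in> X}" if "k1 < x" "x < k2" for x
      by (rule finj) (use that k in order)+
    obtain l1 l2 where l: "k1 \<le> l1" "l1 < l2" "l2 \<le> k2"
      "\<forall>x. l1 < x \<and> x < l2 \<longrightarrow>
     (\<exists>m s t. m < z x \<and> s < x \<and> x < t \<and> (\<forall>x' y. s < x' \<and> x' < t \<and> (x', y) \<in> X \<and> y < z x' \<longrightarrow> y < m))"
      using separation[OF _ X(1) zk k(2) fink, of "(>)"] by blast
    obtain x where x: "l1 < x" "x < l2" using dense[OF l(2)] by blast
    have xk: "k1 < x" "x < k2" using x l by order+
    have xj: "j1 < x" "x < j2" using xk k by order+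
    have xi: "i1 < x" "x < i2" using xj j by order+
    from k(4) xk obtain m s t where m: "z x < m" "s < x" "x < t"
      "\<forall>x' y. s < x' \<and> x' < t \<and> (x', y) \<in> X \<and> z x' < y \<longrightarrow> m < y" by blast
    from l(4) x obtain m' s' t' where m': "m' < z x" "s' < x" "x < t'"
      "\<forall>x' y. s' < x' \<and> x' < t' \<and> (x', y) \<in> X \<and> y < z x' \<longrightarrow> y < m'" by blast
    from continuous_on_Ioo_nbhd[OF j(4) xj, of "{m'<..<m}"] m(1) m'(1) obtain a b where ab: "a < x" "x < b"
      "\<forall>y. a < y \<and> y < b \<longrightarrow> j1 < y \<and> y < j2 \<and> z y \<in> {m'<..<m}" by auto
    define x1 where "x1 = max a (max s s')"
    define x2 where "x2 = min b (min t t')"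
    have x12: "x1 < x" "x < x2" unfolding x1_def x2_def using ab m m' by auto
    have sub: "j1 < y" "y < j2" "m' < z y" "z y < m" "(y, z y) \<in> X" "s < y" "y < t" "s' < y" "y < t'" if "x1 < y" "y < x2" for y
    proof -
      have "a < y" "y < b" "s < y" "y < t" "s' < y" "y < t'" using that unfolding x1_def x2_def by auto
      then show "j1 < y" "y < j2" "m' < z y" "z y < m" "s < y" "y < t" "s' < y" "y < t'" using ab(3) by auto
      then have "i1 < y" "y < i2" using j by order+
      then show "(y, z y) \<in> X" using i(3) by blast
    qed
    have xx: "j1 \<le> x1" "x2 \<le> j2"
      using Ioo_subsetD[of x1 x2 j1 j2] sub(1,2) x12 by (meson less_trans)+
    have "gbox X x1 x2 m' m z" unfolding gbox_def
    proof (intro conjI allI impI)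
      show "m' < z y" "z y < m" if "x1 < y \<and> y < x2" for y using sub that by blast+
      show "continuous_on {x1<..<x2} z" by (rule continuous_on_subset[OF j(4)]) (use sub in auto)
      fix y v assume y: "x1 < y \<and> y < x2 \<and> m' < v \<and> v < m"
      then have s: "s < y" "y < t" "s' < y" "y < t'" "(y, z y) \<in> X" using sub by blast+
      show "(y, v) \<in> X \<longleftrightarrow> v = z y"
      proof
        assume "(y, v) \<in> X"
        then have "\<not> z y < v" "\<not> v < z y" using m(4) m'(4) s y by (meson less_asym)+
        then show "v = z y" by order
      qed (use s in simp)
    qed
    moreover have "wmono z x1 x2" using wm xx unfolding wmono_def by (meson le_less_trans less_le_trans)
    ultimately have "ggraph X x (z x)" using gbox_ggraph x12 by blast
    then show False using i(3) xi by blast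
  next
    case False
    have "\<not> (\<forall>x. finite {y. (x, y) \<in> ?Z})" using finite_fst_image[of ?Z] False inf by blast
    then obtain x0 where x0: "infinite {y. (x0, y) \<in> ?Z}" by blast
    have "df1 (\<lambda>y. (x0, y) \<in> ?Z)" by (rule dfp_pair_mem[OF Z]; simp add: coord_simps)
    from infinite_interval[OF x0 this] obtain k1 k2 where k: "k1 < k2" "\<forall>y. k1 < y \<and> y < k2 \<longrightarrow> (x0, y) \<in> ?Z" by (elim exE conjE)
    \<comment> \<open>The heights on the vertical interval at which \<open>X\<close> accumulates
      from the side \<open>F\<close>. An interval of them would contradict
      \<open>thin_no_accumulation\<close>.\<close>
    define acc where "acc F y \<longleftrightarrow> k1 < y \<and> y < k2 \<and> (\<forall>c d. c < y \<and> y < d \<longrightarrow> \<not> eventually (\<lambda>x. \<not> (\<exists>y. c < y \<and> y < d \<and> (x, y) \<in> X)) F)" for F y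
    have accdf: "df1 (acc F)" if F: "side F x0" for F unfolding acc_def
      by (intro dfp_conj dfp_not dfp_less dfp_imp dfp_all dfp_eventually_side[OF F] dfp_ex dfp_pair_mem[OF X(1)]; simp add: coord_simps)
    have noacc: "finite {y. acc F y}" if F: "side F x0" for F
    proof (rule ccontr)
      assume "infinite {y. acc F y}"
      from infinite_interval[OF this accdf[OF F]] obtain l1 l2 where l: "l1 < l2" "\<forall>y. l1 < y \<and> y < l2 \<longrightarrow> acc F y" by (elim exE conjE)
      show False
      proof (rule thin_no_accumulation[OF X F l(1)])
        fix c d assume cd: "l1 \<le> c" "c < d" "d \<le> l2"
        obtain y where y: "c < y" "y < d" using dense[OF cd(2)] by blast
        have "l1 < y" "y < l2" using y cd by order+
        then have "acc F y" using l(2) by blast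
        then show "\<not> eventually (\<lambda>x. \<not> (\<exists>y. c < y \<and> y < d \<and> (x, y) \<in> X)) F" using y unfolding acc_def by blast
      qed
    qed
    have sides: "side (at_left x0) x0" "side (at_right x0) x0" unfolding side_def by auto
    have "{k1<..<k2} \<subseteq> {y. acc (at_left x0) y} \<union> {y. acc (at_right x0) y}"
    proof
      fix y assume "y \<in> {k1<..<k2}"
      then have y: "k1 < y" "y < k2" by auto
      show "y \<in> {y. acc (at_left x0) y} \<union> {y. acc (at_right x0) y}"
      proof (rule ccontr)
        assume "\<not> ?thesis"
        then have n: "\<not> acc (at_left x0) y" "\<not> acc (at_right x0) y" by auto
        from n(1) y obtain c d where 1: "c < y" "y < d" "eventually (\<lambda>x. \<not> (\<exists>y. c < y \<and> y < d \<and> (x, y) \<in> X)) (at_left x0)"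
          unfolding acc_def by blast
        from n(2) y obtain c' d' where 2: "c' < y" "y < d'" "eventually (\<lambda>x. \<not> (\<exists>y. c' < y \<and> y < d' \<and> (x, y) \<in> X)) (at_right x0)"
          unfolding acc_def by blast
        from 1(3) obtain a where a: "a < x0" "\<forall>x. a < x \<and> x < x0 \<longrightarrow> \<not> (\<exists>y. c < y \<and> y < d \<and> (x, y) \<in> X)"
          unfolding eventually_at_left_iff by blast
        from 2(3) obtain b where b: "x0 < b" "\<forall>x. x0 < x \<and> x < b \<longrightarrow> \<not> (\<exists>y. c' < y \<and> y < d' \<and> (x, y) \<in> X)"
          unfolding eventually_at_right_iff by blast
        define y1 where "y1 = max k1 (max c c')"
        define y2 where "y2 = min k2 (min d d')"
        have y12: "y1 < y" "y < y2" unfolding y1_def y2_def using 1 2 y by auto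
        have "(x', y') \<in> X \<longleftrightarrow> x' = x0" if h: "a < x' \<and> x' < b \<and> y1 < y' \<and> y' < y2" for x' y'
        proof -
          have y': "k1 < y'" "y' < k2" "c < y'" "y' < d" "c' < y'" "y' < d'" using h unfolding y1_def y2_def by auto
          consider "x' < x0" | "x' = x0" | "x0 < x'" by (meson linorder_neqE)
          then show ?thesis
          proof cases
            case 1 then show ?thesis using a(2) h y' by blast
          next
            case 2
            have "(x0, y') \<in> ?Z" using k(2) y'(1,2) by blast
            then show ?thesis using 2 by simp
          next
            case 3 then show ?thesis using b(2) h y' by blast
          qed
        qed
        then have "vgood X x0 y" unfolding vgood_def using a(1) b(1) y12 by blast
        then show False using k(2) y by blast
      qed
    qed
    moreover have "finite ({y. acc (at_left x0) y} \<union> {y. acc (at_right x0) y})" using noacc[OF sides(1)] noacc[OF sides(2)] by simp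
    ultimately show False using infinite_Ioo[OF k(1)] finite_subset by blast
  qed
qed

end

section \<open>Nice families\<close>

locale nice = omin M for M :: "('f, 'r, 'a::{unbounded_dense_linorder, linorder_topology}) struct" +
  fixes A :: "'a set" and P Q :: "('a \<times> 'a) set" and C :: "'a \<times> 'a \<Rightarrow> ('a \<times> 'a) set"
  assumes nice: "nice_family M A P Q C"
begin

text \<open>The family as a relation of four variables. It is definable as it stands and carries
  both \<open>Q\<close> and the domain of the function, so no undefined values arise.\<close>

definition G :: "'a \<Rightarrow> 'a \<Rightarrow> 'a \<Rightarrow> 'a \<Rightarrow> bool" where
  "G a b x y \<longleftrightarrow> (a, b) \<in> Q \<and> (x, y) \<in> C (a, b)"

lemma nice_props:
  shows definable_family: "definable M A 4 {[a, b, x, y] | a b x y. (a, b) \<in> Q \<and> (x, y) \<in> C (a, b)}"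
    and C_curve: "\<And>q. q \<in> Q \<Longrightarrow> plane_curve M UNIV (C q)"
    and C_finite: "\<And>q q'. q \<in> Q \<Longrightarrow> q' \<in> Q \<Longrightarrow> q \<noteq> q' \<Longrightarrow> finite (C q \<inter> C q')"
    and C_once: "\<And>q q' p p'. q \<in> Q \<Longrightarrow> q' \<in> Q \<Longrightarrow> C q \<noteq> C q' \<Longrightarrow> p \<in> C q \<inter> C q' \<Longrightarrow> p' \<in> C q \<inter> C q' \<Longrightarrow> p = p'"
    and C_graph: "\<And>q x y y'. q \<in> Q \<Longrightarrow> (x, y) \<in> C q \<Longrightarrow> (x, y') \<in> C q \<Longrightarrow> y = y'"
    and open_dom: "open (family_dom Q C)" and continuous_fun: "continuous_on (family_dom Q C) (family_fun C)"
    and mono_b0: "(\<forall>a x. strict_mono_on {b. (a, b, x) \<in> family_dom Q C} (\<lambda>b. family_fun C (a, b, x))) \<or>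
       (\<forall>a x. strict_antimono_on {b. (a, b, x) \<in> family_dom Q C} (\<lambda>b. family_fun C (a, b, x)))"
    and mono_x0: "(\<forall>a b. strict_mono_on {x. (a, b, x) \<in> family_dom Q C} (\<lambda>x. family_fun C (a, b, x))) \<or>
       (\<forall>a b. strict_antimono_on {x. (a, b, x) \<in> family_dom Q C} (\<lambda>x. family_fun C (a, b, x)))"
proof -
  note n = nice[unfolded nice_family_def Let_def]
  note n1 = conjunct2[OF conjunct2[OF conjunct2[OF n]]]
  note n2 = conjunct2[OF conjunct2[OF conjunct2[OF n1]]]
  note n3 = conjunct2[OF conjunct2[OF conjunct2[OF n2]]]
  show "definable M A 4 {[a, b, x, y] | a b x y. (a, b) \<in> Q \<and> (x, y) \<in> C (a, b)}"
    by (rule conjunct1[OF conjunct2[OF conjunct2[OF n]]])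
  show "plane_curve M UNIV (C q)" if "q \<in> Q" for q using conjunct1[OF n1] that by blast
  show "finite (C q \<inter> C q')" if "q \<in> Q" "q' \<in> Q" "q \<noteq> q'" for q q'
    using conjunct1[OF conjunct2[OF n1]] that by blast
  show "p = p'" if h: "q \<in> Q" "q' \<in> Q" "C q \<noteq> C q'" "p \<in> C q \<inter> C q'" "p' \<in> C q \<inter> C q'" for q q' p p'
  proof -
    have "C q \<subseteq> P" using conjunct1[OF n1] h(1) by blast
    then have "p \<in> C q \<inter> C q' \<inter> P" "p' \<in> C q \<inter> C q' \<inter> P" using h by blast+
    then show ?thesis using conjunct1[OF conjunct2[OF conjunct2[OF n1]]] h(1-3) by meson
  qed
  show "y = y'" if "q \<in> Q" "(x, y) \<in> C q" "(x, y') \<in> C q" for q x y y'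
    using conjunct1[OF n2] that by meson
  show "open (family_dom Q C)" by (rule conjunct1[OF conjunct2[OF n2]])
  show "continuous_on (family_dom Q C) (family_fun C)" by (rule conjunct1[OF conjunct2[OF conjunct2[OF n2]]])
  show "(\<forall>a x. strict_mono_on {b. (a, b, x) \<in> family_dom Q C} (\<lambda>b. family_fun C (a, b, x))) \<or>
       (\<forall>a x. strict_antimono_on {b. (a, b, x) \<in> family_dom Q C} (\<lambda>b. family_fun C (a, b, x)))"
    by (rule conjunct1[OF conjunct2[OF n3]])
  show "(\<forall>a b. strict_mono_on {x. (a, b, x) \<in> family_dom Q C} (\<lambda>x. family_fun C (a, b, x))) \<or>
       (\<forall>a b. strict_antimono_on {x. (a, b, x) \<in> family_dom Q C} (\<lambda>x. family_fun C (a, b, x)))"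
    by (rule conjunct2[OF conjunct2[OF n3]])
qed

lemma G_unique: "G a b x y \<Longrightarrow> G a b x y' \<Longrightarrow> y = y'"
  unfolding G_def using C_graph by blast

lemma G_dom: "(a, b, x) \<in> family_dom Q C \<longleftrightarrow> (\<exists>y. G a b x y)"
  unfolding family_dom_def G_def by auto

lemma G_fun: "G a b x y \<Longrightarrow> family_fun C (a, b, x) = y"
  unfolding family_fun_def by (simp, rule the_equality) (use G_unique in \<open>auto simp: G_def\<close>)

lemma dfp_G:
  assumes "coord A vs a" "coord A vs b" "coord A vs x" "coord A vs y"
  shows "dfp M A vs (\<lambda>e. G (a e) (b e) (x e) (y e))"
proof -
  have "dfp M A [fst, \<lambda>e. fst (snd e), \<lambda>e. fst (snd (snd e)), \<lambda>e. snd (snd (snd e))]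
       (\<lambda>e. G (fst e) (fst (snd e)) (fst (snd (snd e))) (snd (snd (snd e))))"
    using definable_family[unfolded definable4_dfp] unfolding G_def .
  from dfp_subst[OF this, of vs "\<lambda>e. (a e, b e, x e, y e)"] assms show ?thesis by simp
qed

lemma dfp_G_param:
  assumes "A \<subseteq> B" "coord B vs a" "coord B vs b" "coord B vs x" "coord B vs y"
  shows "dfp M B vs (\<lambda>e. G (a e) (b e) (x e) (y e))"
proof -
  have "dfp M B [fst, \<lambda>e. fst (snd e), \<lambda>e. fst (snd (snd e)), \<lambda>e. snd (snd (snd e))]
       (\<lambda>e. G (fst e) (fst (snd e)) (fst (snd (snd e))) (snd (snd (snd e))))"
    by (rule dfp_mono[OF dfp_G assms(1)]; simp add: coord_simps)
  from dfp_subst[OF this, of vs "\<lambda>e. (a e, b e, x e, y e)"] assms show ?thesis by simp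
qed

lemmas dfp_G_UNIV = dfp_G_param[OF subset_UNIV]

text \<open>Continuity together with openness of the domain: curves with nearby parameters exist
  over nearby abscissae, with nearby values. Every argument that perturbs a parameter rests on
  this.\<close>

lemma G_nbhd:
  assumes g: "G a b x y" and uv: "u < y" "y < v"
  shows "\<exists>a1 a2 b1 b2 x1 x2. a1 < a \<and> a < a2 \<and> b1 < b \<and> b < b2 \<and> x1 < x \<and> x < x2 \<and>
    (\<forall>a' b' x'. a1 < a' \<and> a' < a2 \<and> b1 < b' \<and> b' < b2 \<and> x1 < x' \<and> x' < x2 \<longrightarrow> (\<exists>y'. G a' b' x' y' \<and> u < y' \<and> y' < v))"
proof -
  let ?D = "family_dom Q C" and ?F = "family_fun C"
  let ?S = "?D \<inter> ?F -` {u<..<v}"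
  have S: "open ?S" by (rule continuous_open_preimage[OF continuous_fun open_dom open_greaterThanLessThan])
  have "(a, b, x) \<in> ?S" using g G_dom G_fun[OF g] uv by auto
  from open_prod_elim[OF S this] obtain T U where TU: "open T" "open U" "(a, (b, x)) \<in> T \<times> U" "T \<times> U \<subseteq> ?S" by metis
  have aT: "a \<in> T" and bU: "(b, x) \<in> U" using TU(3) by auto
  from open_interval_nbhd[OF TU(1) aT] obtain a1 a2 where a: "a1 < a" "a < a2" "\<forall>a'. a1 < a' \<and> a' < a2 \<longrightarrow> a' \<in> T" by blast
  from open_boxE[OF TU(2) bU] obtain b1 b2 x1 x2 where b: "b1 < b" "b < b2" "x1 < x" "x < x2" "{b1<..<b2} \<times> {x1<..<x2} \<subseteq> U" by blast
  have "\<exists>y'. G a' b' x' y' \<and> u < y' \<and> y' < v"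
    if h: "a1 < a' \<and> a' < a2 \<and> b1 < b' \<and> b' < b2 \<and> x1 < x' \<and> x' < x2" for a' b' x'
  proof -
    have "a' \<in> T" using a(3) h by blast
    moreover have "(b', x') \<in> U" by (rule subsetD[OF b(5)]) (use h in simp)
    ultimately have s: "(a', b', x') \<in> ?S" using TU(4) by blast
    then obtain y' where y': "G a' b' x' y'" using G_dom by blast
    then show ?thesis using s G_fun[OF y'] by auto
  qed
  then show ?thesis using a(1,2) b(1-4) by blast
qed

lemma G_nbhd_x:
  assumes g: "G a b x y" and uv: "u < y" "y < v"
  shows "\<exists>x1 x2. x1 < x \<and> x < x2 \<and> (\<forall>x'. x1 < x' \<and> x' < x2 \<longrightarrow> (\<exists>y'. G a b x' y' \<and> u < y' \<and> y' < v))"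
  using G_nbhd[OF assms] by meson

lemma G_mono_b:
  "(\<forall>a b b' x y y'. G a b x y \<and> G a b' x y' \<and> b < b' \<longrightarrow> y < y') \<or>
   (\<forall>a b b' x y y'. G a b x y \<and> G a b' x y' \<and> b < b' \<longrightarrow> y' < y)"
  using mono_b0
proof
  assume *: "\<forall>a x. strict_mono_on {b. (a, b, x) \<in> family_dom Q C} (\<lambda>b. family_fun C (a, b, x))"
  have "y < y'" if "G a b x y" "G a b' x y'" "b < b'" for a b b' x y y'
    using monotone_onD[OF *[rule_format, of a x], of b b'] that G_dom G_fun[OF that(1)] G_fun[OF that(2)] by auto
  then show ?thesis by blast
next
  assume *: "\<forall>a x. strict_antimono_on {b. (a, b, x) \<in> family_dom Q C} (\<lambda>b. family_fun C (a, b, x))"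
  have "y' < y" if "G a b x y" "G a b' x y'" "b < b'" for a b b' x y y'
    using monotone_onD[OF *[rule_format, of a x], of b b'] that G_dom G_fun[OF that(1)] G_fun[OF that(2)] by auto
  then show ?thesis by blast
qed

lemma G_mono_x:
  "(\<forall>a b x x' y y'. G a b x y \<and> G a b x' y' \<and> x < x' \<longrightarrow> y < y') \<or>
   (\<forall>a b x x' y y'. G a b x y \<and> G a b x' y' \<and> x < x' \<longrightarrow> y' < y)"
  using mono_x0
proof
  assume *: "\<forall>a b. strict_mono_on {x. (a, b, x) \<in> family_dom Q C} (\<lambda>x. family_fun C (a, b, x))"
  have "y < y'" if "G a b x y" "G a b x' y'" "x < x'" for a b x x' y y'
    using monotone_onD[OF *[rule_format, of a b], of x x'] that G_dom G_fun[OF that(1)] G_fun[OF that(2)] by auto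
  then show ?thesis by blast
next
  assume *: "\<forall>a b. strict_antimono_on {x. (a, b, x) \<in> family_dom Q C} (\<lambda>x. family_fun C (a, b, x))"
  have "y' < y" if "G a b x y" "G a b x' y'" "x < x'" for a b x x' y y'
    using monotone_onD[OF *[rule_format, of a b], of x x'] that G_dom G_fun[OF that(1)] G_fun[OF that(2)] by auto
  then show ?thesis by blast
qed

text \<open>In the dual plane this says that the dual curve of a point is a graph over the first
  coordinate.\<close>

lemma G_b_unique: "G a b x y \<Longrightarrow> G a b' x y \<Longrightarrow> b = b'"
  using G_mono_b by (metis less_irrefl linorder_neqE)

text \<open>Distinct parameters give distinct curves: otherwise the finite intersection would be a
  whole curve, which is infinite. The family hypothesis on distinct curves then applies.\<close>

lemma G_meet_once:
  assumes "G a b x y" "G a' b' x y" "G a b z w" "G a' b' z w" "(a, b) \<noteq> (a', b')"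
  shows "x = z"
proof -
  have Q: "(a, b) \<in> Q" "(a', b') \<in> Q" using assms unfolding G_def by auto
  have "C (a, b) \<noteq> C (a', b')"
  proof
    assume "C (a, b) = C (a', b')"
    then have "finite (C (a, b))" using C_finite[OF Q assms(5)] by simp
    then show False using plane_curve_infinite[OF C_curve[OF Q(1)]] by simp
  qed
  from C_once[OF Q this, of "(x, y)" "(z, w)"] show ?thesis using assms unfolding G_def by auto
qed

text \<open>An intermediate value argument. While the curves do not meet, the set of
  \<open>x\<close> over which the first is lower and its complement are both open in
  \<open>{s..t}\<close> by continuity, and it is definable.\<close>

lemma G_curves_cross:
  assumes st: "s \<le> t" and dom: "\<And>x. s \<le> x \<Longrightarrow> x \<le> t \<Longrightarrow> \<exists>y. G a b x y" "\<And>x. s \<le> x \<Longrightarrow> x \<le> t \<Longrightarrow> \<exists>y. G a' b' x y"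
    and s: "G a b s y1" "G a' b' s y2" "y1 < y2" and t: "G a b t z1" "G a' b' t z2" "z2 < z1"
  shows "\<exists>x y. s < x \<and> x < t \<and> G a b x y \<and> G a' b' x y"
proof (rule ccontr)
  assume neg: "\<nexists>x y. s < x \<and> x < t \<and> G a b x y \<and> G a' b' x y"
  define P where "P x \<longleftrightarrow> (\<exists>u v. G a b x u \<and> G a' b' x v \<and> u < v)" for x
  have ne: "u \<noteq> v" if x: "s \<le> x" "x \<le> t" "G a b x u" "G a' b' x v" for x u v
  proof
    assume uv: "u = v"
    consider "x = s" | "x = t" | "s < x \<and> x < t" using x(1,2) by (auto simp: le_less)
    then show False
    proof cases
      case 1 then show ?thesis using s x uv G_unique by (metis less_irrefl)
    next
      case 2 then show ?thesis using t x uv G_unique by (metis less_irrefl)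
    next
      case 3 then show ?thesis using neg x uv by blast
    qed
  qed
  have sep: "\<exists>l r. l < x \<and> x < r \<and> (\<forall>y. l < y \<and> y < r \<longrightarrow> (\<exists>u' v'. G a1 b1 y u' \<and> G a2 b2 y v' \<and> u' < v'))"
    if h: "G a1 b1 x u" "G a2 b2 x v" "u < v" for x u v a1 b1 a2 b2
  proof -
    obtain m where m: "u < m" "m < v" using dense[OF h(3)] by blast
    obtain m1 where m1: "m1 < u" using lt_ex by blast
    obtain m2 where m2: "v < m2" using gt_ex by blast
    from G_nbhd_x[OF h(1) m1 m(1)] obtain p q where 1: "p < x" "x < q"
      "\<forall>x'. p < x' \<and> x' < q \<longrightarrow> (\<exists>y'. G a1 b1 x' y' \<and> m1 < y' \<and> y' < m)" by blast
    from G_nbhd_x[OF h(2) m(2) m2] obtain p' q' where 2: "p' < x" "x < q'"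
      "\<forall>x'. p' < x' \<and> x' < q' \<longrightarrow> (\<exists>y'. G a2 b2 x' y' \<and> m < y' \<and> y' < m2)" by blast
    have "\<exists>u' v'. G a1 b1 y u' \<and> G a2 b2 y v' \<and> u' < v'" if hy: "max p p' < y \<and> y < min q q'" for y
    proof -
      obtain u' where "G a1 b1 y u'" "u' < m" using 1(3) hy by auto
      moreover obtain v' where "G a2 b2 y v'" "m < v'" using 2(3) hy by auto
      ultimately show ?thesis by (meson less_trans)
    qed
    then show ?thesis using 1 2 by (intro exI[of _ "max p p'"] exI[of _ "min q q'"]) auto
  qed
  have "P t"
  proof (rule definable_connected_interval[of P s t])
    show "df1 P" unfolding P_def by (intro dfp_rules dfp_G_UNIV; simp add: coord_simps)
    show "\<exists>u v. u < x \<and> x < v \<and> (\<forall>y. u < y \<and> y < v \<and> s \<le> y \<and> y \<le> t \<longrightarrow> P y)" if x: "s \<le> x" "x \<le> t" "P x" for x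
    proof -
      obtain u v where "G a b x u" "G a' b' x v" "u < v" using x(3) unfolding P_def by blast
      from sep[OF this] show ?thesis unfolding P_def by blast
    qed
    show "\<exists>u v. u < x \<and> x < v \<and> (\<forall>y. u < y \<and> y < v \<and> s \<le> y \<and> y \<le> t \<longrightarrow> \<not> P y)" if x: "s \<le> x" "x \<le> t" "\<not> P x" for x
    proof -
      obtain u v where uv: "G a b x u" "G a' b' x v" using dom x by blast
      then have "\<not> u < v" "u \<noteq> v" using x(3) ne[OF x(1,2)] unfolding P_def by blast+
      then have "v < u" by order
      from sep[OF uv(2,1) this] obtain l r where lr: "l < x" "x < r"
        "\<forall>y. l < y \<and> y < r \<longrightarrow> (\<exists>u' v'. G a' b' y u' \<and> G a b y v' \<and> u' < v')" by blast
      have "\<not> P y" if y: "l < y \<and> y < r" for y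
      proof
        assume "P y"
        then obtain u v where 1: "G a b y u" "G a' b' y v" "u < v" unfolding P_def by blast
        obtain u' v' where 2: "G a' b' y u'" "G a b y v'" "u' < v'" using lr(3) y by blast
        have "u = v'" "v = u'" using 1 2 G_unique by blast+
        then show False using 1 2 by order
      qed
      then show ?thesis using lr(1,2) by blast
    qed
    show "s \<le> t" by (rule st)
    show "P s" unfolding P_def using s by blast
  qed
  then show False unfolding P_def using t G_unique by (metis less_asym)
qed

text \<open>A slight shift in \<open>b\<close> of the lower one of two touching curves would meet the upper one twice.\<close>

lemma no_touching:
  assumes g: "G a b x0 y0" "G a' b' x0 y0" and ne: "(a, b) \<noteq> (a', b')" and st: "s < x0" "x0 < t"
    and le: "\<And>x. s < x \<Longrightarrow> x < t \<Longrightarrow> \<exists>u v. G a b x u \<and> G a' b' x v \<and> u \<le> v"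
  shows False
proof -
  obtain l r where lr: "l < y0" "y0 < r" using lt_ex gt_ex by blast
  from G_nbhd[OF g(1) lr] obtain a1 a2 b1 b2 x1 x2 where N: "a1 < a" "a < a2" "b1 < b" "b < b2" "x1 < x0" "x0 < x2"
    "\<forall>a' b' x'. a1 < a' \<and> a' < a2 \<and> b1 < b' \<and> b' < b2 \<and> x1 < x' \<and> x' < x2 \<longrightarrow> (\<exists>y'. G a' b' x' y' \<and> l < y' \<and> y' < r)"
    by blast
  have "max s x1 < x0" "x0 < min t x2" using st N by auto
  then obtain xl xr where x: "max s x1 < xl" "xl < x0" "x0 < xr" "xr < min t x2" using dense by meson
  have strict: "\<exists>u v. G a b x u \<and> G a' b' x v \<and> u < v" if h: "s < x" "x < t" "x \<noteq> x0" for x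
  proof -
    obtain u v where uv: "G a b x u" "G a' b' x v" "u \<le> v" using le[OF h(1,2)] by blast
    then have "u \<noteq> v" using G_meet_once[OF g(1,2) _ _ ne, of x u] h(3) by blast
    then show ?thesis using uv by (meson order_le_neq_trans)
  qed
  have "s < xl" "xl < t" "s < xr" "xr < t" using x st by auto
  then obtain ul vl ur vr where L: "G a b xl ul" "G a' b' xl vl" "ul < vl" and R: "G a b xr ur" "G a' b' xr vr" "ur < vr"
    using strict[of xl] strict[of xr] x by (metis less_irrefl)
  obtain ll lr' where ll: "ll < ul" "lr' < ur" using lt_ex by meson
  from G_nbhd[OF L(1) ll(1) L(3)] obtain bl1 bl2 where NL: "bl1 < b" "b < bl2"
    "\<forall>b'. bl1 < b' \<and> b' < bl2 \<longrightarrow> (\<exists>y'. G a b' xl y' \<and> ll < y' \<and> y' < vl)" by meson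
  from G_nbhd[OF R(1) ll(2) R(3)] obtain br1 br2 where NR: "br1 < b" "b < br2"
    "\<forall>b'. br1 < b' \<and> b' < br2 \<longrightarrow> (\<exists>y'. G a b' xr y' \<and> lr' < y' \<and> y' < vr)" by meson
  have bb: "max b1 (max bl1 br1) < b" "b < min b2 (min bl2 br2)" using N NL NR by auto
  \<comment> \<open>The shift raises the lower curve above the common point over \<open>x0\<close>,
    and is so small that over \<open>xl\<close> and \<open>xr\<close> the curve remains below the
    upper one. Which way \<open>b\<close> moves depends on the type of monotonicity.\<close>
  obtain b'' y'' where b'': "max b1 (max bl1 br1) < b''" "b'' < min b2 (min bl2 br2)" "G a b'' x0 y''" "y0 < y''"
  proof -
    from G_mono_b show thesis
    proof
      assume inc: "\<forall>a b b' x y y'. G a b x y \<and> G a b' x y' \<and> b < b' \<longrightarrow> y < y'"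
      obtain b'' where b'': "b < b''" "b'' < min b2 (min bl2 br2)" using dense[OF bb(2)] by blast
      have lb: "max b1 (max bl1 br1) < b''" using bb(1) b''(1) by (rule less_trans)
      note BB = lb b''(2)
      have "b1 < b''" "b'' < b2" using BB by auto
      then obtain y'' where y'': "G a b'' x0 y''" using N by meson
      then have "y0 < y''" using inc g(1) b''(1) by blast
      then show thesis using that[OF lb b''(2) y''] by blast
    next
      assume dec: "\<forall>a b b' x y y'. G a b x y \<and> G a b' x y' \<and> b < b' \<longrightarrow> y' < y"
      obtain b'' where b'': "max b1 (max bl1 br1) < b''" "b'' < b" using dense[OF bb(1)] by blast
      have ub: "b'' < min b2 (min bl2 br2)" using b''(2) bb(2) by (rule less_trans)
      note BB = ub b''(1)
      have "b1 < b''" "b'' < b2" using BB by auto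
      then obtain y'' where y'': "G a b'' x0 y''" using N by meson
      then have "y0 < y''" using dec g(1) b''(2) by blast
      then show thesis using that[OF b''(1) ub y''] by blast
    qed
  qed
  have dom1: "\<exists>y. G a b'' x y" if "xl \<le> x" "x \<le> xr" for x
  proof -
    have "x1 < x" "x < x2" using that x by auto
    moreover have "b1 < b''" "b'' < b2" using b''(1,2) by auto
    ultimately show ?thesis using N by blast
  qed
  have dom2: "\<exists>y. G a' b' x y" if "xl \<le> x" "x \<le> xr" for x
  proof -
    have "s < x" "x < t" using that x by auto
    then show ?thesis using le by blast
  qed
  have "bl1 < b'' \<and> b'' < bl2" "br1 < b'' \<and> b'' < br2" using b''(1,2) by auto
  then obtain wl wr where W: "G a b'' xl wl" "wl < vl" "G a b'' xr wr" "wr < vr" using NL(3) NR(3) by blast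
  have "\<exists>x y. xl < x \<and> x < x0 \<and> G a b'' x y \<and> G a' b' x y"
  proof (rule G_curves_cross[of xl x0 a b'' a' b' wl vl y'' y0])
    show "\<exists>y. G a b'' x y" "\<exists>y. G a' b' x y" if "xl \<le> x" "x \<le> x0" for x
      using dom1[of x] dom2[of x] that x(3) by (meson less_imp_le order_trans)+
  qed (use x W L b'' g in \<open>auto intro: less_imp_le\<close>)
  then obtain z1 w1 where z1: "z1 < x0" "G a b'' z1 w1" "G a' b' z1 w1" by blast
  have "\<exists>x y. x0 < x \<and> x < xr \<and> G a' b' x y \<and> G a b'' x y"
  proof (rule G_curves_cross[of x0 xr a' b' a b'' y0 y'' vr wr])
    show "\<exists>y. G a b'' x y" "\<exists>y. G a' b' x y" if "x0 \<le> x" "x \<le> xr" for x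
      using dom1[of x] dom2[of x] that x(2) by (meson less_imp_le order_trans)+
  qed (use x W R b'' g in \<open>auto intro: less_imp_le\<close>)
  then obtain z2 w2 where z2: "x0 < z2" "G a' b' z2 w2" "G a b'' z2 w2" by blast
  have "(a, b'') \<noteq> (a', b')"
  proof
    assume "(a, b'') = (a', b')"
    then have "y'' = y0" using b''(3) g(2) G_unique by blast
    then show False using b''(4) by simp
  qed
  from G_meet_once[OF z1(2,3) z2(3,2) this] show False using z1(1) z2(1) by order
qed

section \<open>First-order description of touching\<close>

lemma curve_gbox:
  assumes g: "G a b x y" and uv: "u < y" "y < v"
  shows "\<exists>x1 x2 f. x1 < x \<and> x < x2 \<and> f x = y \<and> gbox (C (a, b)) x1 x2 u v f \<and> (\<forall>x'. x1 < x' \<and> x' < x2 \<longrightarrow> G a b x' (f x'))"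
proof -
  from G_nbhd_x[OF assms] obtain x1 x2 where x: "x1 < x" "x < x2"
    "\<forall>x'. x1 < x' \<and> x' < x2 \<longrightarrow> (\<exists>y'. G a b x' y' \<and> u < y' \<and> y' < v)" by blast
  define f where "f x' = (THE y'. G a b x' y')" for x'
  have fI: "f x' = y'" if "G a b x' y'" for x' y'
    unfolding f_def by (rule the_equality) (use that G_unique in blast)+
  have f: "G a b x' (f x')" "u < f x'" "f x' < v" if "x1 < x'" "x' < x2" for x'
    using x(3) that fI by blast+
  have nb: "\<exists>s t. s < x' \<and> x' < t \<and> (\<forall>z. s < z \<and> z < t \<longrightarrow> l < f z \<and> f z < r)"
    if "x1 < x'" "x' < x2" "l < f x'" "f x' < r" for x' l r
    using G_nbhd_x[OF f(1)[OF that(1,2)] that(3,4)] fI by metis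
  have "continuous_on {x1<..<x2} f"
  proof (rule continuous_on_Ioo_if)
    fix x' w assume x': "x1 < x'" "x' < x2" and w: "w < f x'"
    show "\<exists>s t. s < x' \<and> x' < t \<and> (\<forall>z. s < z \<and> z < t \<longrightarrow> w < f z)" using nb[OF x' w f(3)[OF x']] by blast
  next
    fix x' w assume x': "x1 < x'" "x' < x2" and w: "f x' < w"
    show "\<exists>s t. s < x' \<and> x' < t \<and> (\<forall>z. s < z \<and> z < t \<longrightarrow> f z < w)" using nb[OF x' f(2)[OF x'] w] by blast
  qed
  moreover have "(x', y') \<in> C (a, b) \<longleftrightarrow> y' = f x'" if "x1 < x' \<and> x' < x2" for x' y'
    using f(1)[of x'] fI[of x' y'] that unfolding G_def by auto
  ultimately have "gbox (C (a, b)) x1 x2 u v f" unfolding gbox_def using f by blast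
  then show ?thesis using x(1,2) fI[OF g] f(1) by blast
qed

lemma curve_def2: "(a, b) \<in> Q \<Longrightarrow> def2 (C (a, b))"
  using C_curve unfolding plane_curve_def by blast

lemma curve_C0_point:
  assumes "G a b x y" shows "C0_point M (C (a, b)) (x, y)"
proof -
  obtain u v where uv: "u < y" "y < v" using lt_ex gt_ex by blast
  from curve_gbox[OF assms uv] obtain x1 x2 f where "x1 < x" "x < x2" "f x = y" "gbox (C (a, b)) x1 x2 u v f" by blast
  moreover have "(a, b) \<in> Q" using assms unfolding G_def by blast
  ultimately show ?thesis using gbox_C0_point[OF curve_def2] by blast
qed

lemma touches_G: "(a, b) \<in> Q \<Longrightarrow> touches M (C (a, b)) X (x, y) \<Longrightarrow> G a b x y"
  unfolding touches_def C0_point_def G_def by blast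

text \<open>One-sided contact: with \<open>(\<le>)\<close> for \<open>R\<close> the curve runs
  weakly above \<open>X\<close> near the point, with \<open>(\<ge>)\<close> weakly below. In
  contrast to \<open>touches\<close>, there is no quantification over sets.\<close>

definition tang :: "('a \<Rightarrow> 'a \<Rightarrow> bool) \<Rightarrow> ('a \<times> 'a) set \<Rightarrow> 'a \<Rightarrow> 'a \<Rightarrow> 'a \<Rightarrow> 'a \<Rightarrow> bool" where
  "tang R X a b x y \<longleftrightarrow> G a b x y \<and> (\<exists>x1 x2 y1 y2. x1 < x \<and> x < x2 \<and> y1 < y \<and> y < y2 \<and>
     (\<forall>x' y'. x1 < x' \<and> x' < x2 \<and> y1 < y' \<and> y' < y2 \<and> (x', y') \<in> X \<longrightarrow> (\<exists>v. G a b x' v \<and> R y' v)))"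

text \<open>Where \<open>X\<close> is a monotone graph, the two components of the complement are its
  two sides, and a curve misses one of them exactly when it stays weakly on the other.\<close>

lemma touches_iff_tang:
  assumes X: "plane_curve M UNIV X" and gg: "ggraph X x y" and q: "(a, b) \<in> Q"
  shows "touches M (C (a, b)) X (x, y) \<longleftrightarrow> tang (\<le>) X a b x y \<or> tang (\<ge>) X a b x y"
proof -
  obtain x1 x2 y1 y2 g where g: "x1 < x" "x < x2" "g x = y" "gbox X x1 x2 y1 y2 g" "wmono g x1 x2"
    using gg by (rule ggraph_gbox)
  have cont: "continuous_on {x1<..<x2} g" using g unfolding gbox_def by blast
  have gX: "(x', g x') \<in> X" if "x1 < x'" "x' < x2" for x' using g(4) that unfolding gbox_def by blast
  have sufficient: "touches M (C (a, b)) X (x, y)" if T: "tang R X a b x y" and R: "R = (\<le>) \<or> R = (\<ge>)" for R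
  proof -
    obtain s t l r where *: "G a b x y" "s < x" "x < t" "l < y" "y < r"
      "\<forall>x' y'. s < x' \<and> x' < t \<and> l < y' \<and> y' < r \<and> (x', y') \<in> X \<longrightarrow> (\<exists>v. G a b x' v \<and> R y' v)"
      using T unfolding tang_def by blast
    from continuous_on_Ioo_nbhd[OF cont g(1,2), of "{l<..<r}"] * g(3) obtain p q where pq: "p < x" "x < q"
      "\<forall>x'. p < x' \<and> x' < q \<longrightarrow> x1 < x' \<and> x' < x2 \<and> g x' \<in> {l<..<r}" by auto
    \<comment> \<open>A full vertical strip can be used, because the curve has a single point over
      each abscissa.\<close>
    let ?U = "{max s p<..<min t q} \<times> (UNIV :: 'a set)"
    have U: "open ?U" "(x, g x) \<in> ?U" using * pq by (auto intro: open_Times)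
    have RR: "R (g x') y'" if h: "(x', y') \<in> C (a, b) \<inter> ?U" for x' y'
    proof -
      have x': "s < x'" "x' < t" "p < x'" "x' < q" using h by auto
      then obtain v where v: "G a b x' v" "R (g x') v" using *(6) pq(3) gX by (metis greaterThanLessThan_iff)
      have "G a b x' y'" using h q unfolding G_def by blast
      then have "y' = v" using v(1) G_unique by blast
      then show ?thesis using v(2) by simp
    qed
    have "touches M (C (a, b)) X (x, g x)"
    proof (rule gbox_touchI[OF X C_curve[OF q] g(4,5,1,2) _ U])
      show "C0_point M (C (a, b)) (x, g x)" using curve_C0_point *(1) g(3) by simp
      show "(\<forall>x y. (x, y) \<in> C (a, b) \<inter> ?U \<longrightarrow> y \<le> g x) \<or> (\<forall>x y. (x, y) \<in> C (a, b) \<inter> ?U \<longrightarrow> g x \<le> y)"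
        using R RR by blast
    qed
    then show ?thesis using g(3) by simp
  qed
  have necessary: "tang (\<le>) X a b x y \<or> tang (\<ge>) X a b x y" if t: "touches M (C (a, b)) X (x, y)"
  proof -
    have Gxy: "G a b x y" by (rule touches_G[OF q t])
    from gbox_touchD[OF t[folded g(3)] g(4,5,1,2)] obtain s t l r where b: "s < x" "x < t" "l < y" "y < r"
      "{s<..<t} \<times> {l<..<r} \<subseteq> {x1<..<x2} \<times> {y1<..<y2}"
      "(\<forall>x y. (x, y) \<in> C (a, b) \<and> s < x \<and> x < t \<and> l < y \<and> y < r \<longrightarrow> y \<le> g x) \<or>
       (\<forall>x y. (x, y) \<in> C (a, b) \<and> s < x \<and> x < t \<and> l < y \<and> y < r \<longrightarrow> g x \<le> y)" unfolding g(3) by blast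
    from G_nbhd_x[OF Gxy b(3,4)] obtain p p' where p: "p < x" "x < p'"
      "\<forall>x'. p < x' \<and> x' < p' \<longrightarrow> (\<exists>y'. G a b x' y' \<and> l < y' \<and> y' < r)" by blast
    have key: "\<exists>v. G a b x' v \<and> R y' v"
      if R: "\<forall>x y. (x, y) \<in> C (a, b) \<and> s < x \<and> x < t \<and> l < y \<and> y < r \<longrightarrow> R (g x) y"
        and h: "max s p < x' \<and> x' < min t p' \<and> l < y' \<and> y' < r \<and> (x', y') \<in> X" for R x' y'
    proof -
      obtain v where v: "G a b x' v" "l < v" "v < r" using p(3) h by auto
      have "(x', y') \<in> {x1<..<x2} \<times> {y1<..<y2}" by (rule subsetD[OF b(5)]) (use h in auto)
      then have "y' = g x'" using g(4) h unfolding gbox_def by auto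
      moreover have "R (g x') v" using R h v unfolding G_def by auto
      ultimately show ?thesis using v(1) by blast
    qed
    have box: "max s p < x" "x < min t p'" using b p by auto
    from b(6) show ?thesis
    proof
      assume "\<forall>x y. (x, y) \<in> C (a, b) \<and> s < x \<and> x < t \<and> l < y \<and> y < r \<longrightarrow> y \<le> g x"
      then have "\<forall>x' y'. max s p < x' \<and> x' < min t p' \<and> l < y' \<and> y' < r \<and> (x', y') \<in> X \<longrightarrow> (\<exists>v. G a b x' v \<and> y' \<ge> v)"
        using key[of "(\<ge>)"] by blast
      then have "tang (\<ge>) X a b x y" unfolding tang_def using Gxy box b(3,4) by blast
      then show ?thesis by blast
    next
      assume "\<forall>x y. (x, y) \<in> C (a, b) \<and> s < x \<and> x < t \<and> l < y \<and> y < r \<longrightarrow> g x \<le> y"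
      then have "\<forall>x' y'. max s p < x' \<and> x' < min t p' \<and> l < y' \<and> y' < r \<and> (x', y') \<in> X \<longrightarrow> (\<exists>v. G a b x' v \<and> y' \<le> v)"
        using key[of "(\<le>)"] by blast
      then have "tang (\<le>) X a b x y" unfolding tang_def using Gxy box b(3,4) by blast
      then show ?thesis by blast
    qed
  qed
  show ?thesis using sufficient necessary by blast
qed

lemma vgood_not_touches:
  assumes "vgood X x y" "(a, b) \<in> Q" shows "\<not> touches M (C (a, b)) X (x, y)"
proof
  assume t: "touches M (C (a, b)) X (x, y)"
  have Gxy: "G a b x y" by (rule touches_G[OF assms(2) t])
  obtain x1 x2 y1 y2 where v: "x1 < x" "x < x2" "y1 < y" "y < y2"
     "\<forall>x' y'. x1 < x' \<and> x' < x2 \<and> y1 < y' \<and> y' < y2 \<longrightarrow> ((x', y') \<in> X \<longleftrightarrow> x' = x)" using assms(1) unfolding vgood_def by blast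
  have "\<not> touches M (C (a, b)) X (x, y)"
  proof (rule vertical_not_touches)
    show "(x', y') \<in> X \<longleftrightarrow> x' = x" if "x1 < x'" "x' < x2" "y1 < y'" "y' < y2" for x' y' using v(5) that by blast
    fix s t l r assume h: "s < x" "x < t" "l < y" "y < r"
    from G_nbhd_x[OF Gxy h(3,4)] obtain p q where pq: "p < x" "x < q"
      "\<forall>x'. p < x' \<and> x' < q \<longrightarrow> (\<exists>y'. G a b x' y' \<and> l < y' \<and> y' < r)" by blast
    have "max s p < x" "x < min t q" using pq h by auto
    then obtain xl xr where xx: "max s p < xl" "xl < x" "x < xr" "xr < min t q" using dense by meson
    have "p < xl" "xl < q" "p < xr" "xr < q" using xx pq by auto
    then obtain yl yr where "G a b xl yl" "l < yl" "yl < r" "G a b xr yr" "l < yr" "yr < r" using pq(3) by blast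
    then show "(\<exists>x' y'. (x', y') \<in> C (a, b) \<and> s < x' \<and> x' < x \<and> l < y' \<and> y' < r) \<and>
      (\<exists>x' y'. (x', y') \<in> C (a, b) \<and> x < x' \<and> x' < t \<and> l < y' \<and> y' < r)" using xx unfolding G_def by auto
  qed (use v in auto)
  then show False using t by blast
qed

end

section \<open>Tangents at a given point\<close>

definition btw :: "'a::linorder \<Rightarrow> 'a \<Rightarrow> 'a \<Rightarrow> bool" where
  "btw u v y \<longleftrightarrow> u \<le> y \<and> y \<le> v \<or> v \<le> y \<and> y \<le> u"

context nice
begin

lemma curve_arc:
  assumes st: "s \<le> t" and dom: "\<And>x. s \<le> x \<Longrightarrow> x \<le> t \<Longrightarrow> \<exists>y. G a b x y"
  shows "dc {(x, y). s \<le> x \<and> x \<le> t \<and> G a b x y}" "def2 {(x, y). s \<le> x \<and> x \<le> t \<and> G a b x y}"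
proof -
  \<comment> \<open>The default value outside \<open>{s..t}\<close> makes preimages under the total
    map \<open>\<lambda>x. (x, f x)\<close> definable, as \<open>dc_image\<close> demands.\<close>
  define f where "f x = (if s \<le> x \<and> x \<le> t then (THE y. G a b x y) else s)" for x
  have fI: "f x = y" if "s \<le> x" "x \<le> t" "G a b x y" for x y
  proof -
    have "(THE y. G a b x y) = y" by (rule the_equality) (use that G_unique in blast)+
    then show ?thesis unfolding f_def using that by simp
  qed
  have f: "G a b x (f x)" if "s \<le> x" "x \<le> t" for x using dom[OF that] fI[OF that] by blast
  have nb: "eventually (\<lambda>z. l < f z \<and> f z < r) (at x within {s..t})" if x: "s \<le> x" "x \<le> t" "l < f x" "f x < r" for x l r
  proof -
    from G_nbhd_x[OF f[OF x(1,2)] x(3,4)] obtain p q where pq: "p < x" "x < q"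
      "\<forall>x'. p < x' \<and> x' < q \<longrightarrow> (\<exists>y'. G a b x' y' \<and> l < y' \<and> y' < r)" by blast
    have "l < f z \<and> f z < r" if "p < z" "z < q" "z \<in> {s..t}" for z
      using pq(3) that fI[of z] by (metis atLeastAtMost_iff)
    then show ?thesis unfolding eventually_at_topological using pq(1,2)
      by (intro exI[of _ "{p<..<q}"]) auto
  qed
  have cont: "continuous_on {s..t} f"
    unfolding continuous_on_def
  proof
    fix x assume "x \<in> {s..t}"
    then have x: "s \<le> x" "x \<le> t" by auto
    show "(f \<longlongrightarrow> f x) (at x within {s..t})"
    proof (rule order_tendstoI)
      fix l assume l: "l < f x"
      obtain r where "f x < r" using gt_ex by blast
      from nb[OF x l this] show "eventually (\<lambda>z. l < f z) (at x within {s..t})" by (rule eventually_mono) simp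
    next
      fix r assume r: "f x < r"
      obtain l where "l < f x" using lt_ex by blast
      from nb[OF x this r] show "eventually (\<lambda>z. f z < r) (at x within {s..t})" by (rule eventually_mono) simp
    qed
  qed
  have "dc ((\<lambda>x. (x, f x)) ` {s..t})"
  proof (rule dc_image[OF st])
    show "continuous_on {s..t} (\<lambda>x. (x, f x))" using cont by (intro continuous_intros)
    fix U assume U: "def2 U"
    have "(\<lambda>x. (x, f x) \<in> U) = (\<lambda>x. (s \<le> x \<and> x \<le> t \<and> (\<exists>y. G a b x y \<and> (x, y) \<in> U)) \<or> (\<not> (s \<le> x \<and> x \<le> t) \<and> (x, s) \<in> U))"
    proof
      fix x show "((x, f x) \<in> U) = ((s \<le> x \<and> x \<le> t \<and> (\<exists>y. G a b x y \<and> (x, y) \<in> U)) \<or> (\<not> (s \<le> x \<and> x \<le> t) \<and> (x, s) \<in> U))"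
      proof (cases "s \<le> x \<and> x \<le> t")
        case True
        then have "(\<exists>y. G a b x y \<and> (x, y) \<in> U) \<longleftrightarrow> (x, f x) \<in> U" using f[of x] fI[of x] by blast
        then show ?thesis using True by simp
      next
        case False
        then have "f x = s" unfolding f_def by (rule if_not_P)
        then show ?thesis using False by auto
      qed
    qed
    then show "df1 (\<lambda>x. (x, f x) \<in> U)"
      by (simp only:) (intro dfp_rules dfp_G_UNIV dfp_pair_mem[OF U]; simp add: coord_simps)
  qed
  moreover have "(\<lambda>x. (x, f x)) ` {s..t} = {(x, y). s \<le> x \<and> x \<le> t \<and> G a b x y}"
    using f fI by (auto simp: image_def)
  ultimately show "dc {(x, y). s \<le> x \<and> x \<le> t \<and> G a b x y}" by simp
  show "def2 {(x, y). s \<le> x \<and> x \<le> t \<and> G a b x y}" unfolding definable2_Collect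
    by (intro dfp_rules dfp_G_UNIV; simp add: coord_simps)
qed

text \<open>Whether \<open>C q\<close> touches \<open>X\<close> at a given point depends only on the classes of \<open>q\<close> for the following
  relation on the two sides of the point. There are finitely many classes, which makes the set of
  these \<open>q\<close> definable.\<close>

definition eqv :: "('a \<times> 'a) set \<Rightarrow> 'a filter \<Rightarrow> 'a \<times> 'a \<Rightarrow> 'a \<times> 'a \<Rightarrow> bool" where
  "eqv X F q q' \<longleftrightarrow>
     eventually (\<lambda>x. \<exists>u v. G (fst q) (snd q) x u \<and> G (fst q') (snd q') x v \<and> (x, u) \<in> X \<and> (x, v) \<in> X) F \<or>
     eventually (\<lambda>x. \<exists>u v. G (fst q) (snd q) x u \<and> G (fst q') (snd q') x v \<and> (\<forall>y. btw u v y \<longrightarrow> (x, y) \<notin> X)) F"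

lemma btw_refl: "btw u v u" "btw u v v"
  unfolding btw_def by auto

lemma eqv_sym: "eqv X F q q' \<Longrightarrow> eqv X F q' q"
proof -
  have b: "btw u v = btw v u" for u v :: 'a unfolding btw_def by auto
  assume "eqv X F q q'"
  then show ?thesis unfolding eqv_def
    by (elim disjE) (rule disjI1, erule eventually_mono, blast, rule disjI2, erule eventually_mono, metis b)
qed

text \<open>A curve cannot run inside and outside \<open>X\<close> in the same germ, so the two
  alternatives of \<open>eqv\<close> never mix.\<close>

lemma eqv_trans:
  assumes F: "F \<noteq> bot" and e: "eqv X F q q'" "eqv X F q' q''"
  shows "eqv X F q q''"
proof -
  let ?I = "\<lambda>q q' x. \<exists>u v. G (fst q) (snd q) x u \<and> G (fst q') (snd q') x v \<and> (x, u) \<in> X \<and> (x, v) \<in> X"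
  let ?O = "\<lambda>q q' x. \<exists>u v. G (fst q) (snd q) x u \<and> G (fst q') (snd q') x v \<and> (\<forall>y. btw u v y \<longrightarrow> (x, y) \<notin> X)"
  have mixed: False if m: "eventually (?I p q') F" "eventually (?O q' r) F" for p r
  proof -
    have "eventually (\<lambda>x. False) F"
      using m by eventually_elim (metis G_unique btw_refl)
    then show False using F by simp
  qed
  have mixed': False if m: "eventually (?O p q') F" "eventually (?I q' r) F" for p r
  proof -
    have "eventually (\<lambda>x. False) F"
      using m by eventually_elim (metis G_unique btw_refl)
    then show False using F by simp
  qed
  from e consider "eventually (?I q q') F" "eventually (?I q' q'') F" | "eventually (?O q q') F" "eventually (?O q' q'') F"
    unfolding eqv_def using mixed mixed' by blast
  then show ?thesis
  proof cases
    case 1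
    then have "eventually (?I q q'') F" by eventually_elim blast
    then show ?thesis unfolding eqv_def by blast
  next
    case 2
    then have "eventually (?O q q'') F"
    proof eventually_elim
      case (elim x)
      then obtain u v v' w where *: "G (fst q) (snd q) x u" "G (fst q') (snd q') x v" "G (fst q') (snd q') x v'"
        "G (fst q'') (snd q'') x w" "\<forall>y. btw u v y \<longrightarrow> (x, y) \<notin> X" "\<forall>y. btw v' w y \<longrightarrow> (x, y) \<notin> X" by blast
      have v: "v' = v" using *(2,3) G_unique by blast
      have "(x, y) \<notin> X" if "btw u w y" for y
      proof -
        have "btw u v y \<or> btw v w y" using that unfolding btw_def by (meson linorder_linear)
        then show ?thesis using *(5,6) v by blast
      qed
      then show ?case using *(1,4) by blast
    qed
    then show ?thesis unfolding eqv_def by blast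
  qed
qed

lemma dfp_eqv:
  assumes X: "def2 X" and F: "side F a"
  shows "dfp M UNIV [fst, snd] (\<lambda>q. eqv X F q q')"
  unfolding eqv_def btw_def
  by (intro dfp_disj dfp_eventually_side[OF F] dfp_ex dfp_conj dfp_all dfp_imp dfp_not dfp_le dfp_G_UNIV dfp_pair_mem[OF X];
      simp add: coord_simps)

lemma G_eventually_side:
  assumes "G a b x y" "side F x" shows "eventually (\<lambda>x. \<exists>u. G a b x u) F"
proof -
  obtain u v where uv: "u < y" "y < v" using lt_ex gt_ex by blast
  from G_nbhd_x[OF assms(1) uv] obtain p q where pq: "p < x" "x < q" "\<forall>x'. p < x' \<and> x' < q \<longrightarrow> (\<exists>y'. G a b x' y')" by blast
  from assms(2) show ?thesis unfolding side_def
  proof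
    assume F: "F = at_left x"
    show ?thesis unfolding F eventually_at_left_iff using pq by (meson less_trans)
  next
    assume F: "F = at_right x"
    show ?thesis unfolding F eventually_at_right_iff using pq by (meson less_trans)
  qed
qed

text \<open>All curves whose germ runs inside \<open>X\<close> are equivalent. Inequivalent curves
  outside \<open>X\<close> have a point of \<open>X\<close> between them on nearby fibres, so many
  classes would require large finite fibres, which saturation excludes.\<close>

lemma eqv_finite_classes:
  assumes X: "def2 X" "thin X" and F: "side F x0"
  shows "\<exists>S. finite S \<and> (\<forall>q. G (fst q) (snd q) x0 y0 \<longrightarrow> (\<exists>s\<in>S. eqv X F q s))"
proof (rule ccontr)
  assume neg: "\<nexists>S. finite S \<and> (\<forall>q. G (fst q) (snd q) x0 y0 \<longrightarrow> (\<exists>s\<in>S. eqv X F q s))"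
  define L where "L q \<longleftrightarrow> G (fst q) (snd q) x0 y0" for q
  define inX where "inX q \<longleftrightarrow> eventually (\<lambda>x. \<exists>u. G (fst q) (snd q) x u \<and> (x, u) \<in> X) F" for q
  have Lev: "eventually (\<lambda>x. \<exists>u. G (fst q) (snd q) x u) F" if "L q" for q
    using G_eventually_side F that unfolding L_def by blast
  have outX: "eventually (\<lambda>x. \<exists>u. G (fst q) (snd q) x u \<and> (x, u) \<notin> X) F" if q: "L q" "\<not> inX q" for q
  proof -
    have "df1 (\<lambda>x. \<exists>u. G (fst q) (snd q) x u \<and> (x, u) \<in> X)"
      by (intro dfp_rules dfp_G_UNIV dfp_pair_mem[OF X(1)]; simp add: coord_simps)
    then have "eventually (\<lambda>x. \<not> (\<exists>u. G (fst q) (snd q) x u \<and> (x, u) \<in> X)) F"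
      using side_germ[OF F] q(2) unfolding inX_def by blast
    with Lev[OF q(1)] show ?thesis by eventually_elim blast
  qed
  have inX_eqv: "eqv X F q q'" if q: "inX q" "inX q'" for q q'
  proof -
    have "eventually (\<lambda>x. \<exists>u v. G (fst q) (snd q) x u \<and> G (fst q') (snd q') x v \<and> (x, u) \<in> X \<and> (x, v) \<in> X) F"
      using q[unfolded inX_def] by eventually_elim blast
    then show ?thesis unfolding eqv_def by blast
  qed
  have refl: "eqv X F q q" if q: "L q" "\<not> inX q" for q
  proof -
    have "eventually (\<lambda>x. \<exists>u v. G (fst q) (snd q) x u \<and> G (fst q) (snd q) x v \<and> (\<forall>y. btw u v y \<longrightarrow> (x, y) \<notin> X)) F"
      using outX[OF q]
    proof eventually_elim
      case (elim x)
      then obtain u where "G (fst q) (snd q) x u" "(x, u) \<notin> X" by blast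
      moreover have "y = u" if "btw u u y" for y using that unfolding btw_def by auto
      ultimately show ?case by blast
    qed
    then show ?thesis unfolding eqv_def by blast
  qed
  have many: "\<exists>T. finite T \<and> card T = n \<and> (\<forall>q\<in>T. L q \<and> \<not> inX q) \<and> (\<forall>q\<in>T. \<forall>q'\<in>T. q \<noteq> q' \<longrightarrow> \<not> eqv X F q q')" for n
  proof (induction n)
    case 0
    show ?case by (intro exI[of _ "{}"]) simp
  next
    case (Suc n)
    from Suc obtain T where T: "finite T" "card T = n" "\<forall>q\<in>T. L q \<and> \<not> inX q"
      "\<forall>q\<in>T. \<forall>q'\<in>T. q \<noteq> q' \<longrightarrow> \<not> eqv X F q q'" by (elim exE conjE)
    \<comment> \<open>A representative of the curves inside \<open>X\<close>, if there are any: a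
      curve inequivalent to it must run outside \<open>X\<close>. If there are none, an arbitrary
      \<open>r\<close> does no harm.\<close>
    define r where "r = (SOME q. L q \<and> inX q)"
    have "finite (insert r T)" using T(1) by simp
    then obtain q where q: "L q" "\<forall>s\<in>insert r T. \<not> eqv X F q s" using neg unfolding L_def by meson
    have nq: "\<not> inX q"
    proof
      assume "inX q"
      then have "\<exists>q. L q \<and> inX q" using q(1) by blast
      from someI_ex[OF this] have "L r \<and> inX r" unfolding r_def .
      then show False using q(2) inX_eqv \<open>inX q\<close> by blast
    qed
    have "q \<notin> T" using q(2) refl[OF q(1) nq] by blast
    then have "card (insert q T) = Suc n" using T by simp
    moreover have "\<forall>p\<in>insert q T. L p \<and> \<not> inX p" using T(3) q(1) nq by blast
    moreover have "\<forall>p\<in>insert q T. \<forall>p'\<in>insert q T. p \<noteq> p' \<longrightarrow> \<not> eqv X F p p'"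
      using T(4) q(2) eqv_sym by blast
    ultimately show ?case using T(1) by (intro exI[of _ "insert q T"]) simp
  qed
  have "\<exists>x. infinite {y. finite {y. (x, y) \<in> X} \<and> (x, y) \<in> X}"
  proof (rule saturation_infinite)
    show "df2 (\<lambda>x y. finite {y. (x, y) \<in> X} \<and> (x, y) \<in> X)"
    proof (rule dfp_conj)
      show "dfp M UNIV [fst, snd] (\<lambda>z. finite {y. (fst z, y) \<in> X})"
        by (rule dfp_finite) (intro dfp_pair_mem[OF X(1)]; simp add: coord_simps)
      show "dfp M UNIV [fst, snd] (\<lambda>z. (fst z, snd z) \<in> X)" by (rule definable2_mem[OF X(1)])
    qed
    fix n
    from many[of "Suc n"] obtain T where T: "finite T" "card T = Suc n" "\<forall>q\<in>T. L q \<and> \<not> inX q" "\<forall>q\<in>T. \<forall>q'\<in>T. q \<noteq> q' \<longrightarrow> \<not> eqv X F q q'"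
      by (elim exE conjE)
    have sepT: "eventually (\<lambda>x. q \<noteq> q' \<longrightarrow> (\<exists>u v y. G (fst q) (snd q) x u \<and> G (fst q') (snd q') x v \<and> btw u v y \<and> (x, y) \<in> X)) F"
      if q: "q \<in> T" "q' \<in> T" for q q'
    proof (cases "q = q'")
      case False
      let ?O = "\<lambda>x. \<exists>u v. G (fst q) (snd q) x u \<and> G (fst q') (snd q') x v \<and> (\<forall>y. btw u v y \<longrightarrow> (x, y) \<notin> X)"
      have "df1 ?O" unfolding btw_def
        by (intro dfp_rules dfp_G_UNIV dfp_pair_mem[OF X(1)]; simp add: coord_simps)
      moreover have "\<not> eventually ?O F" using T(4) q False unfolding eqv_def by blast
      ultimately have "eventually (\<lambda>x. \<not> ?O x) F" using side_germ[OF F] by blast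
      moreover have "eventually (\<lambda>x. \<exists>u. G (fst q) (snd q) x u) F" "eventually (\<lambda>x. \<exists>u. G (fst q') (snd q') x u) F"
        using Lev T(3) q by blast+
      ultimately show ?thesis by eventually_elim blast
    qed simp
    have "eventually (\<lambda>x. \<forall>q\<in>T. \<forall>q'\<in>T. q \<noteq> q' \<longrightarrow> (\<exists>u v y. G (fst q) (snd q) x u \<and> G (fst q') (snd q') x v \<and> btw u v y \<and> (x, y) \<in> X)) F"
      using sepT T(1) by (simp add: eventually_ball_finite_distrib)
    moreover have "eventually (\<lambda>x. \<forall>q\<in>T. \<exists>u. G (fst q) (snd q) x u \<and> (x, u) \<notin> X) F"
      using outX T(1,3) by (simp add: eventually_ball_finite_distrib)
    moreover note thin_eventually_finite[OF X F]
    ultimately have "eventually (\<lambda>x. (\<forall>q\<in>T. \<forall>q'\<in>T. q \<noteq> q' \<longrightarrow> (\<exists>u v y. G (fst q) (snd q) x u \<and> G (fst q') (snd q') x v \<and> btw u v y \<and> (x, y) \<in> X)) \<and>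
        (\<forall>q\<in>T. \<exists>u. G (fst q) (snd q) x u \<and> (x, u) \<notin> X) \<and> finite {y. (x, y) \<in> X}) F" by eventually_elim blast
    from eventually_happens'[OF side_neq_bot[OF F] this] obtain x where
      x: "\<forall>q\<in>T. \<forall>q'\<in>T. q \<noteq> q' \<longrightarrow> (\<exists>u v y. G (fst q) (snd q) x u \<and> G (fst q') (snd q') x v \<and> btw u v y \<and> (x, y) \<in> X)"
       "\<forall>q\<in>T. \<exists>u. G (fst q) (snd q) x u \<and> (x, u) \<notin> X" "finite {y. (x, y) \<in> X}" by (elim exE conjE)
    from bchoice[OF x(2)] obtain val where val: "\<forall>q\<in>T. G (fst q) (snd q) x (val q) \<and> (x, val q) \<notin> X" by (elim exE)
    \<comment> \<open>The number of points of the fibre below the curve tells the curves apart. It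
      takes one value more than the fibre has points, which is why \<open>Suc n\<close> curves were
      taken.\<close>
    define \<phi> where "\<phi> q = card {y. (x, y) \<in> X \<and> y < val q}" for q
    have less: "\<phi> q < \<phi> q'" if h: "q \<in> T" "q' \<in> T" "(x, y) \<in> X" "val q < y" "y < val q'" for q q' y
      unfolding \<phi>_def
    proof (rule psubset_card_mono)
      show "finite {y. (x, y) \<in> X \<and> y < val q'}" using x(3) by simp
      have "{y. (x, y) \<in> X \<and> y < val q} \<subseteq> {y. (x, y) \<in> X \<and> y < val q'}" using h by auto
      moreover have "y \<in> {y. (x, y) \<in> X \<and> y < val q'}" "y \<notin> {y. (x, y) \<in> X \<and> y < val q}" using h by auto
      ultimately show "{y. (x, y) \<in> X \<and> y < val q} \<subset> {y. (x, y) \<in> X \<and> y < val q'}" by blast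
    qed
    have "inj_on \<phi> T"
    proof (rule inj_onI, rule ccontr)
      fix q q' assume q: "q \<in> T" "q' \<in> T" "\<phi> q = \<phi> q'" "q \<noteq> q'"
      then obtain u v y where uv: "G (fst q) (snd q) x u" "G (fst q') (snd q') x v" "btw u v y" "(x, y) \<in> X" using x(1) by blast
      have eq: "u = val q" "v = val q'" using uv(1,2) val q(1,2) G_unique by blast+
      have ne: "y \<noteq> val q" "y \<noteq> val q'" using uv(4) val q(1,2) by blast+
      from uv(3) have "val q < y \<and> y < val q' \<or> val q' < y \<and> y < val q" unfolding eq btw_def using ne by auto
      then show False using less[of q q' y] less[of q' q y] q uv(4) by auto
    qed
    moreover have "\<phi> ` T \<subseteq> {..card {y. (x, y) \<in> X}}" unfolding \<phi>_def using x(3) by (auto intro!: card_mono)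
    ultimately have "card T \<le> card {..card {y. (x, y) \<in> X}}" by (rule card_inj_on_le) simp
    then have "n \<le> card {y. (x, y) \<in> X}" using T(2) by simp
    then obtain S where "S \<subseteq> {y. (x, y) \<in> X}" "card S = n" "finite S" using obtain_subset_with_card_n[of n "{y. (x, y) \<in> X}"] by auto
    then show "\<exists>x S. finite S \<and> card S = n \<and> (\<forall>y\<in>S. finite {y. (x, y) \<in> X} \<and> (x, y) \<in> X)"
      using x(3) by (intro exI[of _ x] exI[of _ S]) auto
  qed
  then show False by auto
qed

text \<open>The component is followed along \<open>C q'\<close> from \<open>x'\<close> to
  \<open>x''\<close> and then vertically to \<open>C q\<close>. Neither path meets \<open>X\<close>,
  and monotonicity in \<open>x\<close> keeps the arc between the heights \<open>c\<close> and
  \<open>d\<close>.\<close>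

lemma component_transfer:
  assumes K: "K \<in> def_components M (V - X)" and V: "V = {a<..<b} \<times> {c<..<d}"
    and x: "a < x'" "x' < b" "a < x''" "x'' < b"
    and h: "\<And>x. min x' x'' \<le> x \<Longrightarrow> x \<le> max x' x'' \<Longrightarrow>
       \<exists>u v. G (fst q) (snd q) x u \<and> G (fst q') (snd q') x v \<and> (\<forall>y. btw u v y \<longrightarrow> (x, y) \<notin> X)"
    and v: "G (fst q') (snd q') x' v'" "(x', v') \<in> K"
    and w: "G (fst q') (snd q') x'' w'" "c < w'" "w' < d" and u: "G (fst q) (snd q) x'' u" "c < u" "u < d"
  shows "(x'', u) \<in> K"
proof -
  have KV: "K \<subseteq> V - X" using K unfolding def_components_def by blast
  have cv: "c < v'" "v' < d" using KV v(2) unfolding V by auto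
  have mm: "min x' x'' \<le> max x' x''" by (rule order_trans[OF min.cobounded1 max.cobounded1])
  let ?s = "min x' x''" and ?t = "max x' x''"
  let ?L = "{(x, y). ?s \<le> x \<and> x \<le> ?t \<and> G (fst q') (snd q') x y}"
  have "\<exists>y. G (fst q') (snd q') x y" if "?s \<le> x" "x \<le> ?t" for x using h[OF that] by blast
  note arc = curve_arc[OF mm this]
  have between: "c < y \<and> y < d" if xy: "?s \<le> x" "x \<le> ?t" "G (fst q') (snd q') x y" for x y
  proof -
    have yeq: "y = v'" if "x = x'" using that xy(3) v(1) G_unique by blast
    have yeq': "y = w'" if "x = x''" using that xy(3) w(1) G_unique by blast
    have "x = x' \<or> x = x'' \<or> x' < x \<and> x < x'' \<or> x'' < x \<and> x < x'"
    proof (cases "x' \<le> x''")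
      case True
      then have "x' \<le> x" "x \<le> x''" using xy(1,2) by (simp_all add: min_absorb1 max_absorb2)
      then show ?thesis by (auto simp: le_less)
    next
      case False
      then have "x'' \<le> x" "x \<le> x'" using xy(1,2) by (simp_all add: min_absorb2 max_absorb1)
      then show ?thesis by (auto simp: le_less)
    qed
    then consider "x = x'" | "x = x''" | "x' < x" "x < x''" | "x'' < x" "x < x'" by blast
    then show ?thesis
    proof cases
      case 1 then show ?thesis using yeq cv by blast
    next
      case 2 then show ?thesis using yeq' w by blast
    next
      case 3
      from G_mono_x have "v' < y \<and> y < w' \<or> w' < y \<and> y < v'" using 3 xy(3) v(1) w(1) by blast
      then show ?thesis using cv w(2,3) by (meson less_trans)
    next
      case 4
      from G_mono_x have "v' < y \<and> y < w' \<or> w' < y \<and> y < v'" using 4 xy(3) v(1) w(1) by blast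
      then show ?thesis using cv w(2,3) by (meson less_trans)
    qed
  qed
  have LV: "?L \<subseteq> V - X"
  proof
    fix z assume "z \<in> ?L"
    then obtain x1 y where z: "z = (x1, y)" "?s \<le> x1" "x1 \<le> ?t" "G (fst q') (snd q') x1 y" by blast
    have "a < x1" "x1 < b" using z(2,3) x by (auto simp: min_le_iff_disj le_max_iff_disj)
    moreover obtain u v where "G (fst q') (snd q') x1 v" "\<forall>y. btw u v y \<longrightarrow> (x1, y) \<notin> X" using h[OF z(2,3)] by blast
    moreover from this have "v = y" using z(4) G_unique by blast
    ultimately show "z \<in> V - X" using between[OF z(2-4)] btw_refl(2) unfolding V z(1) by auto
  qed
  have "(x', v') \<in> ?L" using v(1) by simp
  from def_component_absorbs[OF K arc LV this v(2)] have "?L \<subseteq> K" .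
  then have wK: "(x'', w') \<in> K" using w(1) by auto
  let ?m = "min u w'" and ?n = "max u w'"
  have mn: "?m \<le> ?n" by (rule order_trans[OF min.cobounded1 max.cobounded1])
  have segV: "{x''} \<times> {?m..?n} \<subseteq> V - X"
  proof
    fix z assume "z \<in> {x''} \<times> {?m..?n}"
    then obtain y where z: "z = (x'', y)" "?m \<le> y" "y \<le> ?n" by auto
    have "c < y" "y < d" using z(2,3) u w by (auto simp: min_le_iff_disj le_max_iff_disj)
    moreover obtain u1 v1 where 1: "G (fst q) (snd q) x'' u1" "G (fst q') (snd q') x'' v1" "\<forall>y. btw u1 v1 y \<longrightarrow> (x'', y) \<notin> X"
      using h[of x''] by auto
    moreover have "u1 = u" "v1 = w'" using 1 u(1) w(1) G_unique by blast+
    moreover have "btw u w' y" using z(2,3) unfolding btw_def min_def max_def by (auto split: if_splits)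
    ultimately show "z \<in> V - X" unfolding V z(1) using x by auto
  qed
  have "(x'', w') \<in> {x''} \<times> {?m..?n}" by simp
  from def_component_absorbs[OF K vseg[OF mn] segV this wK] have "{x''} \<times> {?m..?n} \<subseteq> K" .
  then show ?thesis by auto
qed

text \<open>A component missed by \<open>C q\<close> is missed by \<open>C q'\<close> as well: a
  point of \<open>C q'\<close> in it could be transferred to a point of \<open>C q\<close>, over an
  abscissa so close to \<open>x0\<close> that both curves lie in the rectangle there.\<close>

lemma eqv_touches:
  assumes Q: "q \<in> Q" "q' \<in> Q" and L: "G (fst q) (snd q) x0 y0" "G (fst q') (snd q') x0 y0"
    and el: "eqv X (at_left x0) q q'" and er: "eqv X (at_right x0) q q'"
    and t: "touches M (C q) X (x0, y0)"
  shows "touches M (C q') X (x0, y0)"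
proof -
  let ?I = "\<lambda>x. \<exists>u v. G (fst q) (snd q) x u \<and> G (fst q') (snd q') x v \<and> (x, u) \<in> X \<and> (x, v) \<in> X"
  let ?O = "\<lambda>x. \<exists>u v. G (fst q) (snd q) x u \<and> G (fst q') (snd q') x v \<and> (\<forall>y. btw u v y \<longrightarrow> (x, y) \<notin> X)"
  have pX: "(x0, y0) \<in> X" using t unfolding touches_def C0_point_def by blast
  from el obtain l where l: "l < x0" "(\<forall>x. l < x \<and> x < x0 \<longrightarrow> ?I x) \<or> (\<forall>x. l < x \<and> x < x0 \<longrightarrow> ?O x)"
    unfolding eqv_def eventually_at_left_iff by blast
  from er obtain r where r: "x0 < r" "(\<forall>x. x0 < x \<and> x < r \<longrightarrow> ?I x) \<or> (\<forall>x. x0 < x \<and> x < r \<longrightarrow> ?O x)"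
    unfolding eqv_def eventually_at_right_iff by blast
  have "\<exists>V\<in>rectangular_nbhds (x0, y0). V \<subseteq> U \<and> card (def_components M (V - X)) = 2 \<and>
           (\<exists>K\<in>def_components M (V - X). C q' \<inter> V \<inter> K = {})" if U: "open U" "(x0, y0) \<in> U" for U
  proof -
    \<comment> \<open>Over this strip the alternatives of \<open>eqv\<close> hold at every point on
      each side of \<open>x0\<close>, and not only as germs.\<close>
    let ?U = "U \<inter> {l<..<r} \<times> UNIV"
    have "open ?U" using U(1) by (intro open_Int open_Times open_greaterThanLessThan open_UNIV)
    moreover have "(x0, y0) \<in> ?U" using U(2) l(1) r(1) by simp
    ultimately obtain V K where V: "V \<in> rectangular_nbhds (x0, y0)" "V \<subseteq> ?U" "card (def_components M (V - X)) = 2"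
      "K \<in> def_components M (V - X)" "C q \<inter> V \<inter> K = {}" using t unfolding touches_def by meson
    then obtain a b c d where Vb: "V = {a<..<b} \<times> {c<..<d}" "(x0, y0) \<in> V" unfolding rectangular_nbhds_def by blast
    have p: "a < x0" "x0 < b" "c < y0" "y0 < d" using Vb by auto
    have KV: "K \<subseteq> V - X" using V(4) unfolding def_components_def by blast
    from G_nbhd_x[OF L(1) p(3,4)] obtain m1 m2 where m: "m1 < x0" "x0 < m2"
      "\<forall>x'. m1 < x' \<and> x' < m2 \<longrightarrow> (\<exists>y'. G (fst q) (snd q) x' y' \<and> c < y' \<and> y' < d)" by blast
    from G_nbhd_x[OF L(2) p(3,4)] obtain n1 n2 where n: "n1 < x0" "x0 < n2"
      "\<forall>x'. n1 < x' \<and> x' < n2 \<longrightarrow> (\<exists>y'. G (fst q') (snd q') x' y' \<and> c < y' \<and> y' < d)" by blast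
    have "C q' \<inter> V \<inter> K = {}"
    proof (rule ccontr)
      assume "C q' \<inter> V \<inter> K \<noteq> {}"
      then obtain x' v' where z: "(x', v') \<in> C q'" "(x', v') \<in> V" "(x', v') \<in> K" by (metis IntE all_not_in_conv surj_pair)
      have g': "G (fst q') (snd q') x' v'" unfolding G_def using z(1) Q(2) by simp
      have nX: "(x', v') \<notin> X" using z(3) KV by blast
      have xV: "a < x'" "x' < b" using z(2) unfolding Vb(1) by auto
      have xl: "l < x'" "x' < r" using z(2) V(2) by auto
      \<comment> \<open>Hence on the side of \<open>x0\<close> containing \<open>x'\<close> it is
        the alternative \<open>?O\<close> that holds.\<close>
      have nI: "\<not> ?I x'" using nX g' G_unique by blast
      have x0': "x' \<noteq> x0" using nX pX g' L(2) G_unique by blast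
      have "\<exists>x''. a < x'' \<and> x'' < b \<and> m1 < x'' \<and> x'' < m2 \<and> n1 < x'' \<and> x'' < n2 \<and>
         (\<forall>x. min x' x'' \<le> x \<and> x \<le> max x' x'' \<longrightarrow> ?O x)"
      proof (cases "x0 < x'")
        case True
        have O: "\<forall>x. x0 < x \<and> x < r \<longrightarrow> ?O x" using r(2) nI True xl by blast
        have "x0 < min x' (min m2 n2)" using True m n by simp
        then obtain x'' where x'': "x0 < x''" "x'' < min x' (min m2 n2)" using dense by blast
        have "?O x" if "min x' x'' \<le> x \<and> x \<le> max x' x''" for x
        proof -
          have "x0 < x" "x < r" using that x'' xl True by (auto simp: min_le_iff_disj le_max_iff_disj)
          then show ?thesis using O by blast
        qed
        moreover have "a < x''" "x'' < b" "m1 < x''" "x'' < m2" "n1 < x''" "x'' < n2" using x'' m n p xV by auto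
        ultimately show ?thesis by blast
      next
        case False
        then have lt: "x' < x0" using x0' by simp
        have O: "\<forall>x. l < x \<and> x < x0 \<longrightarrow> ?O x" using l(2) nI lt xl by blast
        have "max x' (max m1 n1) < x0" using lt m n by simp
        then obtain x'' where x'': "max x' (max m1 n1) < x''" "x'' < x0" using dense by blast
        have "?O x" if "min x' x'' \<le> x \<and> x \<le> max x' x''" for x
        proof -
          have "l < x" "x < x0" using that x'' xl lt by (auto simp: min_le_iff_disj le_max_iff_disj)
          then show ?thesis using O by blast
        qed
        moreover have "a < x''" "x'' < b" "m1 < x''" "x'' < m2" "n1 < x''" "x'' < n2" using x'' m n p xV by auto
        ultimately show ?thesis by blast
      qed
      then obtain x'' where x'': "a < x''" "x'' < b" "m1 < x''" "x'' < m2" "n1 < x''" "x'' < n2"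
         "\<And>x. min x' x'' \<le> x \<Longrightarrow> x \<le> max x' x'' \<Longrightarrow> ?O x" by blast
      obtain u where u: "G (fst q) (snd q) x'' u" "c < u" "u < d" using m(3) x'' by blast
      obtain w where w: "G (fst q') (snd q') x'' w" "c < w" "w < d" using n(3) x'' by blast
      have "(x'', u) \<in> K" by (rule component_transfer[OF V(4) Vb(1) xV x''(1,2) x''(7) g' z(3) w u])
      moreover have "(x'', u) \<in> C q" using u(1) unfolding G_def by simp
      moreover have "(x'', u) \<in> V" unfolding Vb(1) using u x'' by simp
      ultimately show False using V(5) by blast
    qed
    then show ?thesis using V by blast
  qed
  moreover have "C0_point M (C q') (x0, y0)" using curve_C0_point[OF L(2)] by simp
  ultimately show ?thesis using t C_curve[OF Q(2)] unfolding touches_def by blast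
qed

text \<open>A union of finitely many classes, each definable. The definition is not uniform in the
  point, but it is applied only at the finitely many exceptional points.\<close>

lemma tau_at_definable:
  assumes X: "plane_curve M UNIV X"
  shows "def2 (tau_at M Q C X (x0, y0))"
proof -
  have X': "def2 X" "thin X" using X plane_curve_thin unfolding plane_curve_def by auto
  have sides: "side (at_left x0) x0" "side (at_right x0) x0" unfolding side_def by auto
  let ?T = "tau_at M Q C X (x0, y0)"
  obtain Sl where Sl: "finite Sl" "\<forall>q. G (fst q) (snd q) x0 y0 \<longrightarrow> (\<exists>s\<in>Sl. eqv X (at_left x0) q s)"
    using eqv_finite_classes[OF X' sides(1)] by blast
  obtain Sr where Sr: "finite Sr" "\<forall>q. G (fst q) (snd q) x0 y0 \<longrightarrow> (\<exists>s\<in>Sr. eqv X (at_right x0) q s)"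
    using eqv_finite_classes[OF X' sides(2)] by blast
  define cl where "cl p = {q. G (fst q) (snd q) x0 y0 \<and> eqv X (at_left x0) q (fst p) \<and> eqv X (at_right x0) q (snd p)}" for p
  define I where "I = {p \<in> Sl \<times> Sr. cl p \<inter> ?T \<noteq> {}}"
  have TG: "G (fst q) (snd q) x0 y0" "q \<in> Q" if "q \<in> ?T" for q
    using that touches_G[of "fst q" "snd q"] unfolding tau_at_def by auto
  have "?T = (\<Union>p\<in>I. cl p)"
  proof (intro subset_antisym subsetI)
    fix q assume q: "q \<in> ?T"
    then obtain s r where "s \<in> Sl" "eqv X (at_left x0) q s" "r \<in> Sr" "eqv X (at_right x0) q r"
      using Sl(2) Sr(2) TG(1) by blast
    then have "(s, r) \<in> I" "q \<in> cl (s, r)" using q TG(1)[OF q] unfolding I_def cl_def by auto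
    then show "q \<in> (\<Union>p\<in>I. cl p)" by blast
  next
    fix q' assume "q' \<in> (\<Union>p\<in>I. cl p)"
    then obtain p where p: "p \<in> I" "q' \<in> cl p" by blast
    then obtain q where q: "q \<in> cl p" "q \<in> ?T" unfolding I_def by blast
    have g: "G (fst q') (snd q') x0 y0" "G (fst q) (snd q) x0 y0" using p(2) q(1) unfolding cl_def by auto
    have Q': "q' \<in> Q" using g(1) unfolding G_def by simp
    have "eqv X (at_left x0) q q'" "eqv X (at_right x0) q q'"
      using q(1) p(2) eqv_sym eqv_trans[OF side_neq_bot[OF sides(1)]] eqv_trans[OF side_neq_bot[OF sides(2)]]
      unfolding cl_def by blast+
    moreover have "touches M (C q) X (x0, y0)" using q(2) unfolding tau_at_def by blast
    ultimately have "touches M (C q') X (x0, y0)" using eqv_touches[OF TG(2)[OF q(2)] Q' g(2,1)] by blast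
    then show "q' \<in> ?T" unfolding tau_at_def using Q' by blast
  qed
  moreover have "finite I" unfolding I_def using Sl(1) Sr(1) by simp
  moreover have "def2 (cl p)" for p unfolding cl_def definable2_dfp mem_Collect_eq
    by (intro dfp_conj dfp_G_UNIV dfp_eqv[OF X'(1) sides(1)] dfp_eqv[OF X'(1) sides(2)]; simp add: coord_simps)
  ultimately show ?thesis using definable2_UN by metis
qed

end

section \<open>The curve of tangents\<close>

context omin
begin

lemma definable_interval_iff:
  assumes P: "df1 P" and st: "s \<le> t"
    and open1: "\<And>x. s \<le> x \<Longrightarrow> x \<le> t \<Longrightarrow> P x \<Longrightarrow> \<exists>u v. u < x \<and> x < v \<and> (\<forall>y. u < y \<and> y < v \<and> s \<le> y \<and> y \<le> t \<longrightarrow> P y)"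
    and open2: "\<And>x. s \<le> x \<Longrightarrow> x \<le> t \<Longrightarrow> \<not> P x \<Longrightarrow> \<exists>u v. u < x \<and> x < v \<and> (\<forall>y. u < y \<and> y < v \<and> s \<le> y \<and> y \<le> t \<longrightarrow> \<not> P y)"
  shows "P s \<longleftrightarrow> P t"
proof
  show "P t" if "P s" by (rule definable_connected_interval[OF P open1 open2 st that])
  have "\<not> P t" if "\<not> P s"
    by (rule definable_connected_interval[OF dfp_not[OF P] open2 _ st that]) (use open1 in simp_all)
  then show "P s" if "P t" using that by blast
qed

lemma dfun_ivt:
  assumes f: "dfun i1 i2 f" "continuous_on {i1<..<i2} f" and st: "i1 < s" "s < t" "t < i2"
    and c: "f s < c \<and> c < f t \<or> f t < c \<and> c < f s"
  shows "\<exists>x. s < x \<and> x < t \<and> f x = c"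
proof (rule ccontr)
  assume neg: "\<nexists>x. s < x \<and> x < t \<and> f x = c"
  note F = dfp2_coord[OF f(1)[unfolded dfun_def]]
  have ne: "f x \<noteq> c" if "s \<le> x" "x \<le> t" for x
    using neg c that by (cases "x = s"; cases "x = t") auto
  have I: "i1 < x \<and> x < i2" if "s \<le> x" "x \<le> t" for x using st that by (auto intro: less_le_trans le_less_trans)
  define P where "P x \<longleftrightarrow> (\<exists>y. (i1 < x \<and> x < i2 \<and> f x = y) \<and> y < c)" for x
  have P: "P x \<longleftrightarrow> f x < c" if "s \<le> x" "x \<le> t" for x using I[OF that] unfolding P_def by blast
  have "P s \<longleftrightarrow> P t"
  proof (rule definable_interval_iff)
    show "df1 P" unfolding P_def by (rule dfp_ex, rule dfp_conj[OF F dfp_less]; simp add: coord_simps)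
    show "s \<le> t" using st by simp
    show "\<exists>u v. u < x \<and> x < v \<and> (\<forall>y. u < y \<and> y < v \<and> s \<le> y \<and> y \<le> t \<longrightarrow> P y)" if x: "s \<le> x" "x \<le> t" "P x" for x
    proof -
      have "f x \<in> {..<c}" using P x by auto
      from continuous_on_Ioo_nbhd[OF f(2) _ _ open_lessThan this] I[OF x(1,2)] obtain u v where
        "u < x" "x < v" "\<forall>y. u < y \<and> y < v \<longrightarrow> i1 < y \<and> y < i2 \<and> f y \<in> {..<c}" by blast
      then show ?thesis using P by (intro exI[of _ u] exI[of _ v]) auto
    qed
    show "\<exists>u v. u < x \<and> x < v \<and> (\<forall>y. u < y \<and> y < v \<and> s \<le> y \<and> y \<le> t \<longrightarrow> \<not> P y)" if x: "s \<le> x" "x \<le> t" "\<not> P x" for x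
    proof -
      have "f x \<in> {c<..}" using P[OF x(1,2)] ne[OF x(1,2)] x(3) by auto
      from continuous_on_Ioo_nbhd[OF f(2) _ _ open_greaterThan this] I[OF x(1,2)] obtain u v where
        "u < x" "x < v" "\<forall>y. u < y \<and> y < v \<longrightarrow> i1 < y \<and> y < i2 \<and> f y \<in> {c<..}" by blast
      then show ?thesis using P by (intro exI[of _ u] exI[of _ v]) (auto simp: not_less less_imp_le)
    qed
  qed
  then show False using P[of s] P[of t] st(2) c by (auto dest: less_asym)
qed

end

context nice
begin

abbreviation le_or_ge :: "('a \<Rightarrow> 'a \<Rightarrow> bool) \<Rightarrow> bool" where
  "le_or_ge R \<equiv> R = (\<le>) \<or> R = (\<ge>)"

section \<open>Touching along an arc\<close>

lemma dfp_R:
  assumes "le_or_ge R" "coord B vs v" "coord B vs w" shows "dfp M B vs (\<lambda>e. R (v e) (w e))"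
  using assms(1) by (elim disjE) (simp_all add: dfp_le assms(2,3))

lemma dfp_tang:
  assumes R: "le_or_ge R" and X: "definable2 M B X" and B: "A \<subseteq> B"
    and c: "coord B vs a" "coord B vs b" "coord B vs x" "coord B vs y"
  shows "dfp M B vs (\<lambda>e. tang R X (a e) (b e) (x e) (y e))"
proof -
  have "dfp M B [fst, \<lambda>e. fst (snd e), \<lambda>e. fst (snd (snd e)), \<lambda>e. snd (snd (snd e))]
       (\<lambda>e. tang R X (fst e) (fst (snd e)) (fst (snd (snd e))) (snd (snd (snd e))))"
    unfolding tang_def
    by (intro dfp_conj dfp_ex dfp_all dfp_imp dfp_less dfp_G_param[OF B] dfp_pair_mem[OF X] dfp_R[OF R]; simp add: coord_simps)
  from dfp_subst[OF this, of vs "\<lambda>e. (a e, b e, x e, y e)"] c show ?thesis by simp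
qed

lemma tang_G: "tang R X a b x y \<Longrightarrow> G a b x y"
  unfolding tang_def by blast

text \<open>For each \<open>x\<close> the curve at \<open>x\<close> stays on the side
  \<open>R\<close> of the arc for all \<open>x'\<close> near \<open>x\<close>. With
  \<open>star_left\<close> and \<open>star_right\<close> the size of this range becomes uniform, and
  on a short interval it covers all pairs.\<close>

lemma uniform_touching:
  assumes R: "le_or_ge R" and i: "i1 < i2"
    and z: "dfun i1 i2 z" "continuous_on {i1<..<i2} z" and ab: "dfun i1 i2 \<alpha>" "dfun i1 i2 \<beta>"
    and t: "\<And>x. i1 < x \<Longrightarrow> x < i2 \<Longrightarrow> tang R X (\<alpha> x) (\<beta> x) x (z x) \<and> (x, z x) \<in> X"
  shows "\<exists>j1 j2. i1 \<le> j1 \<and> j1 < j2 \<and> j2 \<le> i2 \<and>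
    (\<forall>x x'. j1 < x \<and> x < j2 \<and> j1 < x' \<and> x' < j2 \<longrightarrow> (\<exists>v. G (\<alpha> x) (\<beta> x) x' v \<and> R (z x') v))"
proof -
  note F = z(1)[unfolded dfun_def] ab(1)[unfolded dfun_def] ab(2)[unfolded dfun_def]
  define E where "E x x' \<longleftrightarrow> (\<exists>a b w v. (i1 < x \<and> x < i2 \<and> \<alpha> x = a) \<and> (i1 < x \<and> x < i2 \<and> \<beta> x = b) \<and>
     (i1 < x' \<and> x' < i2 \<and> z x' = w) \<and> G a b x' v \<and> R w v)" for x x'
  have E: "df2 E" unfolding E_def
    by (rule dfp_ex, rule dfp_ex, rule dfp_ex, rule dfp_ex,
        rule dfp_conj[OF dfp2_coord[OF F(2)] dfp_conj[OF dfp2_coord[OF F(3)] dfp_conj[OF dfp2_coord[OF F(1)]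
          dfp_conj[OF dfp_G_UNIV dfp_R[OF R]]]]]; simp add: coord_simps)
  have ED: "\<exists>v. G (\<alpha> x) (\<beta> x) x' v \<and> R (z x') v" if "E x x'" for x x' using that unfolding E_def by blast
  have nb: "\<exists>s t. s < x \<and> x < t \<and> (\<forall>x'. s < x' \<and> x' < t \<longrightarrow> E x x')" if x: "i1 < x" "x < i2" for x
  proof -
    obtain x1 x2 y1 y2 where b: "x1 < x" "x < x2" "y1 < z x" "z x < y2"
      "\<forall>x' y'. x1 < x' \<and> x' < x2 \<and> y1 < y' \<and> y' < y2 \<and> (x', y') \<in> X \<longrightarrow> (\<exists>v. G (\<alpha> x) (\<beta> x) x' v \<and> R y' v)"
      using t[OF x] unfolding tang_def by blast
    from continuous_on_Ioo_nbhd[OF z(2) x, of "{y1<..<y2}"] b(3,4) obtain s r where sr: "s < x" "x < r"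
      "\<forall>y. s < y \<and> y < r \<longrightarrow> i1 < y \<and> y < i2 \<and> z y \<in> {y1<..<y2}" by auto
    have "E x x'" if h: "max s x1 < x' \<and> x' < min r x2" for x'
    proof -
      have x': "i1 < x'" "x' < i2" "y1 < z x'" "z x' < y2" "x1 < x'" "x' < x2" using sr(3) h by auto
      then have "(x', z x') \<in> X" using t by blast
      then have "\<exists>v. G (\<alpha> x) (\<beta> x) x' v \<and> R (z x') v" using b(5) x' by blast
      then show ?thesis unfolding E_def using x x' by blast
    qed
    then show ?thesis using sr b by (intro exI[of _ "max s x1"] exI[of _ "min r x2"]) auto
  qed
  define E1 where "E1 x l \<longleftrightarrow> (\<forall>x'. l < x' \<and> x' < x \<longrightarrow> E x x')" for x l
  define E2 where "E2 x l \<longleftrightarrow> (\<forall>x'. x < x' \<and> x' < l \<longrightarrow> E x x')" for x l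
  have E12: "df2 E1" "df2 E2" unfolding E1_def E2_def by (intro dfp_rules dfp2_coord[OF E]; simp add: coord_simps)+
  have ev1: "eventually (E1 x) (at_left x)" if x: "i1 < x" "x < i2" for x
  proof -
    from nb[OF x] obtain s t where "s < x" "x < t" "\<forall>x'. s < x' \<and> x' < t \<longrightarrow> E x x'" by blast
    then show ?thesis unfolding eventually_at_left_iff E1_def by (meson less_trans)
  qed
  have ev2: "eventually (E2 x) (at_right x)" if x: "i1 < x" "x < i2" for x
  proof -
    from nb[OF x] obtain s t where "s < x" "x < t" "\<forall>x'. s < x' \<and> x' < t \<longrightarrow> E x x'" by blast
    then show ?thesis unfolding eventually_at_right_iff E2_def by (meson less_trans)
  qed
  \<comment> \<open>First a common left end \<open>l\<close>, then, on a subinterval, a common right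
    end \<open>r\<close>; the final interval lies between them, so every \<open>x'\<close> in it is
    in range.\<close>
  obtain l where l: "infinite {x. i1 < x \<and> x < i2 \<and> l < x \<and> E1 x l}" using star_left[OF E12(1) i] ev1 by blast
  have "df1 (\<lambda>x. i1 < x \<and> x < i2 \<and> l < x \<and> E1 x l)" by (intro dfp_rules dfp2_coord[OF E12(1)]; simp add: coord_simps)
  from infinite_interval[OF l this] obtain k1 k2 where k: "k1 < k2"
    "\<forall>x. k1 < x \<and> x < k2 \<longrightarrow> i1 < x \<and> x < i2 \<and> l < x \<and> E1 x l" by (elim exE conjE)
  obtain r where r: "infinite {x. k1 < x \<and> x < k2 \<and> x < r \<and> E2 x r}" using star_right[OF E12(2) k(1)] ev2 k(2) by blast
  have "df1 (\<lambda>x. k1 < x \<and> x < k2 \<and> x < r \<and> E2 x r)" by (intro dfp_rules dfp2_coord[OF E12(2)]; simp add: coord_simps)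
  from infinite_interval[OF r this] obtain j1 j2 where j: "j1 < j2"
    "\<forall>x. j1 < x \<and> x < j2 \<longrightarrow> k1 < x \<and> x < k2 \<and> x < r \<and> E2 x r" by (elim exE conjE)
  have ij: "i1 \<le> j1" "j2 \<le> i2" using Ioo_subsetD[OF j(1), of i1 i2] j(2) k(2) by blast+
  have "\<exists>v. G (\<alpha> x) (\<beta> x) x' v \<and> R (z x') v" if h: "j1 < x \<and> x < j2 \<and> j1 < x' \<and> x' < j2" for x x'
  proof -
    have x: "i1 < x" "x < i2" "E1 x l" "E2 x r" "l < x'" "x' < r" using h j(2) k(2) by blast+
    consider "x' < x" | "x' = x" | "x < x'" by (meson linorder_neqE)
    then show ?thesis
    proof cases
      case 1 then have "E x x'" using x(3,5) unfolding E1_def by blast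
      then show ?thesis by (rule ED)
    next
      case 2
      have "R (z x) (z x)" using R by auto
      then show ?thesis using 2 tang_G t[OF x(1,2)] by blast
    next
      case 3 then have "E x x'" using x(4,6) unfolding E2_def by blast
      then show ?thesis by (rule ED)
    qed
  qed
  then show ?thesis using j(1) ij by blast
qed

text \<open>For fixed \<open>a\<close> the curves are ordered by \<open>b\<close> in the same way
  over every abscissa. If \<open>b\<close> and \<open>b'\<close> differed, the order would violate
  \<open>R\<close> at one of the two contact points.\<close>

lemma uniform_touching_const:
  assumes R: "le_or_ge R" and x: "G a b x y" "G a b' x' y'"
    and v: "G a b x' v" "R y' v" and v': "G a b' x v'" "R y v'"
  shows "b = b'"
proof (rule ccontr)
  assume "b \<noteq> b'"
  then consider "b < b'" | "b' < b" by (meson linorder_neqE)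
  then have "v < y' \<and> y < v' \<or> y' < v \<and> v' < y"
    using G_mono_b x v(1) v'(1) by cases blast+
  then show False using R v(2) v'(2) by auto
qed

definition tangs :: "('a \<times> 'a) set \<Rightarrow> 'a \<Rightarrow> 'a \<Rightarrow> 'a \<Rightarrow> 'a \<Rightarrow> bool" where
  "tangs X a b x y \<longleftrightarrow> tang (\<le>) X a b x y \<or> tang (\<ge>) X a b x y"

lemma tangs_G: "tangs X a b x y \<Longrightarrow> G a b x y"
  unfolding tangs_def using tang_G by blast

lemma dfp_tangs:
  assumes X: "definable2 M B X" and B: "A \<subseteq> B"
    and c: "coord B vs a" "coord B vs b" "coord B vs x" "coord B vs y"
  shows "dfp M B vs (\<lambda>e. tangs X (a e) (b e) (x e) (y e))"
  unfolding tangs_def by (intro dfp_disj dfp_tang[OF _ X B c]) simp_all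

text \<open>Along an arc of \<open>X\<close> that lies on a curve of the family, contact with
  \<open>X\<close> becomes contact of two curves of the family, which \<open>no_touching\<close>
  excludes.\<close>

lemma tang_no_touching:
  assumes R: "le_or_ge R" and t: "tang R X a' b' x y" and ne: "(a, b) \<noteq> (a', b')" and g: "G a b x y"
    and z: "s < x" "x < r" "\<And>x'. s < x' \<Longrightarrow> x' < r \<Longrightarrow> G a b x' (z x') \<and> (x', z x') \<in> X"
    and cont: "continuous_on {s<..<r} z"
  shows False
proof -
  have zx: "z x = y" using z(3)[OF z(1,2)] g G_unique by blast
  obtain x1 x2 y1 y2 where b: "x1 < x" "x < x2" "y1 < y" "y < y2"
     "\<forall>x' y'. x1 < x' \<and> x' < x2 \<and> y1 < y' \<and> y' < y2 \<and> (x', y') \<in> X \<longrightarrow> (\<exists>v. G a' b' x' v \<and> R y' v)"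
    using t unfolding tang_def by blast
  from continuous_on_Ioo_nbhd[OF cont z(1,2), of "{y1<..<y2}"] b(3,4) zx obtain p q where pq: "p < x" "x < q"
      "\<forall>y. p < y \<and> y < q \<longrightarrow> s < y \<and> y < r \<and> z y \<in> {y1<..<y2}" by auto
  have key: "\<exists>u v. G a b x' u \<and> G a' b' x' v \<and> R u v" if h: "max p x1 < x'" "x' < min q x2" for x'
  proof -
    have x': "s < x'" "x' < r" "y1 < z x'" "z x' < y2" "x1 < x'" "x' < x2" using pq(3) h by auto
    then obtain v where "G a' b' x' v" "R (z x') v" using b(5) z(3) by blast
    then show ?thesis using z(3) x' by blast
  qed
  have box: "max p x1 < x" "x < min q x2" using pq b by auto
  from R show False
  proof
    assume "R = (\<le>)"
    then show False using no_touching[OF g tang_G[OF t] ne box] key by blast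
  next
    assume R: "R = (\<ge>)"
    have "\<exists>u v. G a' b' x' u \<and> G a b x' v \<and> u \<le> v" if "max p x1 < x'" "x' < min q x2" for x'
      using key[OF that] unfolding R by blast
    then show False using no_touching[OF tang_G[OF t] g _ box] ne by metis
  qed
qed

text \<open>Otherwise \<open>fubini\<close> provides one \<open>a\<close> such that curves with
  first parameter \<open>a\<close> are tangent, on one side, along a whole arc. By
  \<open>uniform_touching_const\<close> they are a single curve, which therefore contains the arc,
  and any other tangent on that arc would touch it.\<close>

lemma finite_many_tangents:
  assumes X: "def2 X" "thin X"
  shows "finite {(x, y). ggraph X x y \<and> infinite {a. \<exists>b. tangs X a b x y}}"
proof (rule ccontr)
  let ?Z = "\<lambda>R. {(x, y). ggraph X x y \<and> infinite {a. \<exists>b. tang R X a b x y}}"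
  assume inf: "infinite {(x, y). ggraph X x y \<and> infinite {a. \<exists>b. tangs X a b x y}}"
  have "{(x, y). ggraph X x y \<and> infinite {a. \<exists>b. tangs X a b x y}} \<subseteq> ?Z (\<le>) \<union> ?Z (\<ge>)"
  proof
    fix p assume p: "p \<in> {(x, y). ggraph X x y \<and> infinite {a. \<exists>b. tangs X a b x y}}"
    obtain x y where xy: "p = (x, y)" by (cases p)
    have "{a. \<exists>b. tangs X a b x y} = {a. \<exists>b. tang (\<le>) X a b x y} \<union> {a. \<exists>b. tang (\<ge>) X a b x y}"
      unfolding tangs_def by blast
    then have "infinite {a. \<exists>b. tang (\<le>) X a b x y} \<or> infinite {a. \<exists>b. tang (\<ge>) X a b x y}"
      using p unfolding xy by auto
    then show "p \<in> ?Z (\<le>) \<union> ?Z (\<ge>)" using p unfolding xy by auto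
  qed
  then have "infinite (?Z (\<le>)) \<or> infinite (?Z (\<ge>))" using inf by (meson finite_UnI finite_subset)
  then obtain R where R: "le_or_ge R" "infinite (?Z R)" by blast
  have T: "dfp M UNIV vs (\<lambda>e. tang R X (a e) (b e) (x e) (y e))"
    if "coord UNIV vs a" "coord UNIV vs b" "coord UNIV vs x" "coord UNIV vs y" for vs :: "('e \<Rightarrow> 'a) list" and a b x y
    by (rule dfp_tang[OF R(1) X(1) subset_UNIV that])
  have Zdef: "def2 (?Z R)" unfolding definable2_Collect
    by (intro dfp_conj dfp_ggraph[OF X(1)] dfp_not dfp_finite dfp_ex dfp_tang[OF R(1) X(1) subset_UNIV]; simp add: coord_simps)
  have ZX: "?Z R \<subseteq> X" using ggraph_mem by blast
  have "finite {y. (x, y) \<in> ?Z R}" for x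
    by (rule finite_subset[OF _ ggraph_fibre_finite[OF X(1), of x]]) auto
  then have "infinite {x. \<exists>y. (x, y) \<in> ?Z R}" using finite_fst_image[of "?Z R"] R(2) by blast
  from thin_min_section[OF Zdef R(2) X(2) ZX X(1) this] obtain i1 i2 z where i: "i1 < i2" "dfun i1 i2 z"
    "\<forall>x. i1 < x \<and> x < i2 \<longrightarrow> (x, z x) \<in> ?Z R \<and> finite {y. (x, y) \<in> X}" by (elim exE conjE)
  from monotone_continuous_subinterval[OF i(2,1)] obtain j1 j2 where j: "i1 \<le> j1" "j1 < j2" "j2 \<le> i2"
      "continuous_on {j1<..<j2} z" by (elim exE conjE)
  have zj: "dfun j1 j2 z" by (rule dfun_subinterval[OF i(2) j(1,3)])
  have Zj: "(x, z x) \<in> ?Z R" if "j1 < x" "x < j2" for x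
    using i(3) j(1,3) that by (meson le_less_trans less_le_trans)
  define E where "E x a \<longleftrightarrow> (\<exists>w b. (j1 < x \<and> x < j2 \<and> z x = w) \<and> tang R X a b x w)" for x a
  have E: "df2 E" unfolding E_def
    by (rule dfp_ex, rule dfp_ex, rule dfp_conj[OF dfp2_coord[OF zj[unfolded dfun_def]] dfp_tang[OF R(1) X(1) subset_UNIV]];
        simp add: coord_simps)
  have Einf: "infinite {a. E x a}" if "j1 < x" "x < j2" for x
  proof -
    have "{a. E x a} = {a. \<exists>b. tang R X a b x (z x)}" unfolding E_def using that by blast
    then show ?thesis using Zj[OF that] by simp
  qed
  obtain a where a: "infinite {x. j1 < x \<and> x < j2 \<and> E x a}" using fubini[OF E j(2)] Einf by blast
  have "df1 (\<lambda>x. j1 < x \<and> x < j2 \<and> E x a)" by (intro dfp_rules dfp2_coord[OF E]; simp add: coord_simps)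
  from infinite_interval[OF a this] obtain k1 k2 where k: "k1 < k2" "\<forall>x. k1 < x \<and> x < k2 \<longrightarrow> j1 < x \<and> x < j2 \<and> E x a"
    by (elim exE conjE)
  have jk: "j1 \<le> k1" "k2 \<le> j2" using Ioo_subsetD[OF k(1), of j1 j2] k(2) by blast+
  have zk: "dfun k1 k2 z" by (rule dfun_subinterval[OF zj jk])
  have ck: "continuous_on {k1<..<k2} z" by (rule continuous_on_subset[OF j(4)]) (use k(2) in auto)
  define \<beta> where "\<beta> x = (THE b. G a b x (z x))" for x
  have \<beta>I: "\<beta> x = b" if "G a b x (z x)" for x b
    unfolding \<beta>_def by (rule the_equality) (use that G_b_unique in blast)+
  have \<beta>: "tang R X a (\<beta> x) x (z x)" if "k1 < x" "x < k2" for x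
  proof -
    obtain b where "tang R X a b x (z x)" using k(2) \<open>k1 < x\<close> \<open>x < k2\<close> unfolding E_def by blast
    then show ?thesis using \<beta>I tang_G by metis
  qed
  have "dfun k1 k2 \<beta>"
  proof -
    have "(\<lambda>e. k1 < fst e \<and> fst e < k2 \<and> \<beta> (fst e) = snd e) =
       (\<lambda>e. \<exists>w. (k1 < fst e \<and> fst e < k2 \<and> z (fst e) = w) \<and> G a (snd e) (fst e) w)"
      using \<beta> \<beta>I tang_G by (intro ext) metis
    then show ?thesis unfolding dfun_def
      by (simp only:) (rule dfp_ex, rule dfp_conj[OF dfp2_coord[OF zk[unfolded dfun_def]] dfp_G_UNIV]; simp add: coord_simps)
  qed
  moreover have "dfun k1 k2 (\<lambda>_. a)" unfolding dfun_def by (intro dfp_rules; simp add: coord_simps)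
  moreover have "tang R X a (\<beta> x) x (z x) \<and> (x, z x) \<in> X" if "k1 < x" "x < k2" for x
    using \<beta>[OF that] Zj[of x] ZX k(2) that by blast
  ultimately have "\<exists>l1 l2. k1 \<le> l1 \<and> l1 < l2 \<and> l2 \<le> k2 \<and>
    (\<forall>x x'. l1 < x \<and> x < l2 \<and> l1 < x' \<and> x' < l2 \<longrightarrow> (\<exists>v. G a (\<beta> x) x' v \<and> R (z x') v))"
    using uniform_touching[OF R(1) k(1) zk ck, of "\<lambda>_. a" \<beta> X] by blast
  then obtain l1 l2 where l: "k1 \<le> l1" "l1 < l2" "l2 \<le> k2"
    "\<forall>x x'. l1 < x \<and> x < l2 \<and> l1 < x' \<and> x' < l2 \<longrightarrow> (\<exists>v. G a (\<beta> x) x' v \<and> R (z x') v)" by (elim exE conjE)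
  have kl: "k1 < x \<and> x < k2" if "l1 < x" "x < l2" for x using l(1,3) that by (meson le_less_trans less_le_trans)
  obtain x where x: "l1 < x" "x < l2" using dense[OF l(2)] by blast
  have const: "\<beta> x' = \<beta> x" if x': "l1 < x'" "x' < l2" for x'
  proof -
    obtain v where v: "G a (\<beta> x') x v" "R (z x) v" using l(4) x x' by blast
    obtain v' where v': "G a (\<beta> x) x' v'" "R (z x') v'" using l(4) x x' by blast
    show ?thesis
      using uniform_touching_const[OF R(1) tang_G[OF \<beta>] tang_G[OF \<beta>] v v'] kl x x' by blast
  qed
  have "infinite {a'. E x a'}" using Einf[of x] k(2) kl[OF x] by blast
  \<comment> \<open>There are infinitely many first parameters at \<open>x\<close>, so one differs
    from \<open>a\<close> and yields a second curve.\<close>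
  then have "infinite ({a'. E x a'} - {a})" by simp
  then obtain a' where a': "E x a'" "a' \<noteq> a" by (metis Diff_iff infinite_imp_nonempty insertI1 mem_Collect_eq ex_in_conv)
  then obtain b' where b': "tang R X a' b' x (z x)" unfolding E_def by blast
  show False
  proof (rule tang_no_touching[OF R(1) b' _ _ x, of a "\<beta> x" z])
    show "(a, \<beta> x) \<noteq> (a', b')" using a'(2) by blast
    show "G a (\<beta> x) x (z x)" using tang_G[OF \<beta>] kl[OF x] by blast
    show "G a (\<beta> x) x' (z x') \<and> (x', z x') \<in> X" if "l1 < x'" "x' < l2" for x'
      using tang_G[OF \<beta>[of x']] const[OF that] kl[OF that] Zj[of x'] ZX k(2) by auto
    show "continuous_on {l1<..<l2} z" by (rule continuous_on_subset[OF ck]) (use kl in auto)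
  qed
qed

definition regular :: "('a \<times> 'a) set \<Rightarrow> ('a \<times> 'a) set" where
  "regular X = {(x, y). ggraph X x y \<and> finite {a. \<exists>b. tangs X a b x y}}"

definition tau_reg :: "('a \<times> 'a) set \<Rightarrow> ('a \<times> 'a) set" where
  "tau_reg X = {(a, b). \<exists>x y. (x, y) \<in> regular X \<and> tangs X a b x y}"

text \<open>Vertical points are left out although they are not regular: there may be infinitely many
  of them, and nothing touches \<open>X\<close> there. What remains is finite.\<close>

definition exceptional :: "('a \<times> 'a) set \<Rightarrow> ('a \<times> 'a) set" where
  "exceptional X = {(x, y). (x, y) \<in> X \<and> (x, y) \<notin> regular X \<and> \<not> vgood X x y}"

definition tau_hull :: "('a \<times> 'a) set \<Rightarrow> ('a \<times> 'a) set" where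
  "tau_hull X = {(a, b). (a, b) \<in> tau_reg X \<or> (\<exists>x y. (x, y) \<in> exceptional X \<and> G a b x y)}"

text \<open>The parameter set is left open: \<open>A\<close> is needed for genericity,
  \<open>UNIV\<close> for the finiteness arguments.\<close>

lemma definable_regular:
  assumes X: "definable2 M B X" and B: "A \<subseteq> B"
  shows "definable2 M B (regular X)" "definable2 M B (tau_reg X)" "definable2 M B (exceptional X)" "definable2 M B (tau_hull X)"
proof -
  show 1: "definable2 M B (regular X)" unfolding regular_def definable2_Collect
    by (intro dfp_conj dfp_ggraph[OF X] dfp_finite dfp_ex dfp_tangs[OF X B]; simp add: coord_simps)
  show 2: "definable2 M B (tau_reg X)" unfolding tau_reg_def definable2_Collect
    by (intro dfp_conj dfp_ex dfp_pair_mem[OF 1] dfp_tangs[OF X B]; simp add: coord_simps)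
  show 3: "definable2 M B (exceptional X)" unfolding exceptional_def definable2_Collect
    by (intro dfp_conj dfp_not dfp_pair_mem[OF 1] dfp_pair_mem[OF X] dfp_vgood[OF X]; simp add: coord_simps)
  show "definable2 M B (tau_hull X)" unfolding tau_hull_def definable2_Collect
    by (intro dfp_conj dfp_disj dfp_ex dfp_pair_mem[OF 2] dfp_pair_mem[OF 3] dfp_G_param[OF B]; simp add: coord_simps)
qed

lemma finite_exceptional:
  assumes X: "def2 X" "thin X" shows "finite (exceptional X)"
proof (rule finite_subset)
  show "exceptional X \<subseteq> {(x, y). (x, y) \<in> X \<and> \<not> ggraph X x y \<and> \<not> vgood X x y} \<union>
     {(x, y). ggraph X x y \<and> infinite {a. \<exists>b. tangs X a b x y}}"
    unfolding exceptional_def regular_def by auto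
  show "finite ({(x, y). (x, y) \<in> X \<and> \<not> ggraph X x y \<and> \<not> vgood X x y} \<union>
     {(x, y). ggraph X x y \<and> infinite {a. \<exists>b. tangs X a b x y}})"
    using finite_bad_points[OF X] finite_many_tangents[OF X] by (rule finite_UnI)
qed

section \<open>The set of all tangents is one-dimensional\<close>

lemma dual_thin: "thin {(a, b). G a b x y}"
proof -
  have "finite {b. G a b x y}" for a
  proof (cases "\<exists>b. G a b x y")
    case True
    then obtain b where "G a b x y" by blast
    then have "{b. G a b x y} \<subseteq> {b}" using G_b_unique by blast
    then show ?thesis using finite_subset by blast
  qed simp
  then show ?thesis unfolding thin_def by simp
qed

text \<open>For given \<open>a\<close> and \<open>x\<close> only finitely many \<open>b\<close>
  occur, so an infinite fibre over \<open>a\<close> involves infinitely many \<open>x\<close>. If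
  this happened for an interval of \<open>a\<close>, \<open>fubini\<close> would give one
  \<open>x\<close> with infinitely many \<open>a\<close>, against regularity.\<close>

lemma thin_tau_reg:
  assumes X: "def2 X" shows "thin (tau_reg X)"
proof (rule ccontr)
  assume "\<not> thin (tau_reg X)"
  then have inf: "infinite {a. infinite {b. (a, b) \<in> tau_reg X}}" unfolding thin_def .
  note D = definable_regular[OF X subset_UNIV]
  define H where "H a x \<longleftrightarrow> (\<exists>b y. (x, y) \<in> regular X \<and> tangs X a b x y)" for a x
  have H: "df2 H" unfolding H_def
    by (intro dfp_ex dfp_conj dfp_pair_mem[OF D(1)] dfp_tangs[OF X subset_UNIV]; simp add: coord_simps)
  have finy: "finite {y. (x, y) \<in> regular X}" for x
    by (rule finite_subset[OF _ ggraph_fibre_finite[OF X, of x]]) (auto simp: regular_def)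
  have finb: "finite {b. \<exists>y. (x, y) \<in> regular X \<and> tangs X a b x y}" for a x
  proof -
    have "{b. \<exists>y. (x, y) \<in> regular X \<and> tangs X a b x y} \<subseteq> (\<lambda>y. THE b. G a b x y) ` {y. (x, y) \<in> regular X}"
    proof
      fix b assume "b \<in> {b. \<exists>y. (x, y) \<in> regular X \<and> tangs X a b x y}"
      then obtain y where y: "(x, y) \<in> regular X" "tangs X a b x y" by blast
      have "(THE b. G a b x y) = b" by (rule the_equality) (use tangs_G[OF y(2)] G_b_unique in blast)+
      then show "b \<in> (\<lambda>y. THE b. G a b x y) ` {y. (x, y) \<in> regular X}" using y(1) by force
    qed
    then show ?thesis using finy finite_surj by blast
  qed
  have Hinf: "infinite {x. H a x}" if a: "infinite {b. (a, b) \<in> tau_reg X}" for a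
  proof
    assume fin: "finite {x. H a x}"
    have "{b. (a, b) \<in> tau_reg X} \<subseteq> (\<Union>x\<in>{x. H a x}. {b. \<exists>y. (x, y) \<in> regular X \<and> tangs X a b x y})"
      unfolding tau_reg_def H_def by blast
    moreover have "finite (\<Union>x\<in>{x. H a x}. {b. \<exists>y. (x, y) \<in> regular X \<and> tangs X a b x y})" using fin finb by blast
    ultimately show False using a finite_subset by blast
  qed
  from infinite_interval[OF inf dfp_infinite_fibre[OF definable2_mem[OF D(2)]]] obtain i1 i2 where
    i: "i1 < i2" "\<forall>a. i1 < a \<and> a < i2 \<longrightarrow> infinite {b. (a, b) \<in> tau_reg X}" by (elim exE conjE)
  obtain x where x: "infinite {a. i1 < a \<and> a < i2 \<and> H a x}" using fubini[OF H i(1)] i(2) Hinf by blast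
  have "{a. i1 < a \<and> a < i2 \<and> H a x} \<subseteq> (\<Union>y\<in>{y. (x, y) \<in> regular X}. {a. \<exists>b. tangs X a b x y})"
    unfolding H_def by blast
  moreover have "finite (\<Union>y\<in>{y. (x, y) \<in> regular X}. {a. \<exists>b. tangs X a b x y})"
    using finy[of x] by (auto simp: regular_def)
  ultimately show False using x finite_subset by blast
qed

lemma thin_tau_hull:
  assumes X: "def2 X" "thin X" shows "thin (tau_hull X)"
proof -
  have "tau_hull X = tau_reg X \<union> (\<Union>p\<in>exceptional X. {(a, b). G a b (fst p) (snd p)})"
    unfolding tau_hull_def by auto
  moreover have "thin (\<Union>p\<in>exceptional X. {(a, b). G a b (fst p) (snd p)})"
    by (rule thin_UN[OF finite_exceptional[OF X] dual_thin])
  ultimately show ?thesis using thin_Un[OF thin_tau_reg[OF X(1)]] by simp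
qed

text \<open>At regular points touching coincides with \<open>tangs\<close>, at vertical points
  nothing touches, and all other points of \<open>X\<close> are exceptional.\<close>

lemma tau_decomposition:
  assumes X: "plane_curve M UNIV X"
  shows "tau M Q C X = tau_reg X \<union> (\<Union>p\<in>exceptional X. tau_at M Q C X p)" "tau M Q C X \<subseteq> tau_hull X"
proof -
  have reg: "touches M (C (a, b)) X (x, y) \<longleftrightarrow> tangs X a b x y" if "(a, b) \<in> Q" "(x, y) \<in> regular X" for a b x y
    using touches_iff_tang[OF X _ that(1), of x y] that(2) unfolding regular_def tangs_def by blast
  have 1: "(a, b) \<in> tau_reg X \<or> (\<exists>p\<in>exceptional X. (a, b) \<in> tau_at M Q C X p)" if h: "(a, b) \<in> tau M Q C X" for a b
  proof -
    obtain x y where p: "C0_point M X (x, y)" "(a, b) \<in> Q" "touches M (C (a, b)) X (x, y)"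
      using h unfolding tau_def tau_at_def by auto
    have "(x, y) \<in> X" using p(1) unfolding C0_point_def by blast
    moreover have "\<not> vgood X x y" using vgood_not_touches[OF _ p(2)] p(3) by blast
    ultimately consider "(x, y) \<in> regular X" | "(x, y) \<in> exceptional X" unfolding exceptional_def by blast
    then show ?thesis
    proof cases
      case 1
      then show ?thesis using reg[OF p(2) 1] p(3) unfolding tau_reg_def by blast
    next
      case 2
      then show ?thesis using p unfolding tau_at_def by blast
    qed
  qed
  have 2: "(a, b) \<in> tau M Q C X" if h: "touches M (C (a, b)) X p" "(a, b) \<in> Q" for a b p
    using h unfolding tau_def tau_at_def touches_def by blast
  have 3: "(a, b) \<in> tau M Q C X" if h: "(a, b) \<in> tau_reg X" for a b
  proof -
    obtain x y where p: "(x, y) \<in> regular X" "tangs X a b x y" using h unfolding tau_reg_def by blast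
    have q: "(a, b) \<in> Q" using tangs_G[OF p(2)] unfolding G_def by blast
    show ?thesis using 2[OF _ q] reg[OF q p(1)] p(2) by blast
  qed
  show "tau M Q C X = tau_reg X \<union> (\<Union>p\<in>exceptional X. tau_at M Q C X p)"
  proof (intro subset_antisym subsetI)
    fix q assume "q \<in> tau M Q C X"
    then show "q \<in> tau_reg X \<union> (\<Union>p\<in>exceptional X. tau_at M Q C X p)" using 1[of "fst q" "snd q"] by auto
  next
    fix q assume "q \<in> tau_reg X \<union> (\<Union>p\<in>exceptional X. tau_at M Q C X p)"
    then show "q \<in> tau M Q C X" using 2[of "fst q" "snd q"] 3[of "fst q" "snd q"] unfolding tau_at_def by auto
  qed
  show "tau M Q C X \<subseteq> tau_hull X"
  proof
    fix q assume "q \<in> tau M Q C X"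
    then have "q \<in> tau_reg X \<or> (\<exists>p\<in>exceptional X. q \<in> tau_at M Q C X p)" using 1[of "fst q" "snd q"] by auto
    moreover have "G (fst q) (snd q) (fst p) (snd p)" if "q \<in> tau_at M Q C X p" for p
      using that touches_G[of "fst q" "snd q" X "fst p" "snd p"] unfolding tau_at_def by auto
    ultimately have "q \<in> tau_reg X \<or> (\<exists>p\<in>exceptional X. G (fst q) (snd q) (fst p) (snd p))" by blast
    then show "q \<in> tau_hull X" unfolding tau_hull_def by (cases q) auto
  qed
qed

lemma tau_definable:
  assumes X: "plane_curve M UNIV X" shows "def2 (tau M Q C X)"
proof -
  have X': "def2 X" "thin X" using X plane_curve_thin unfolding plane_curve_def by auto
  have "def2 (tau_at M Q C X p)" for p using tau_at_definable[OF X, of "fst p" "snd p"] by simp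
  then show ?thesis unfolding tau_decomposition(1)[OF X]
    by (intro definable2_Un definable_regular(2)[OF X'(1) subset_UNIV] definable2_UN finite_exceptional[OF X'])
qed

definition locally_in :: "('a \<times> 'a) set \<Rightarrow> 'a \<Rightarrow> 'a \<Rightarrow> 'a \<Rightarrow> 'a \<Rightarrow> bool" where
  "locally_in X a b x y \<longleftrightarrow> (\<exists>x1 x2 y1 y2. x1 < x \<and> x < x2 \<and> y1 < y \<and> y < y2 \<and>
     (\<forall>x' y'. x1 < x' \<and> x' < x2 \<and> y1 < y' \<and> y' < y2 \<and> (x', y') \<in> X \<longrightarrow> G a b x' y'))"

text \<open>If \<open>X\<close> is an arc of one curve of the family, this curve touches it at every
  point nearby, and a second tangent would touch that curve.\<close>

lemma locally_in_linear:
  assumes X: "plane_curve M UNIV X" and gg: "ggraph X x y" and l: "locally_in X a b x y"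
  shows "family_linear_near M Q C X (x, y)"
proof -
  obtain x1 x2 y1 y2 g where g: "x1 < x" "x < x2" "g x = y" "gbox X x1 x2 y1 y2 g" "wmono g x1 x2"
    using gg by (rule ggraph_gbox)
  obtain s t u v where b: "s < x" "x < t" "u < y" "y < v"
     "\<forall>x' y'. s < x' \<and> x' < t \<and> u < y' \<and> y' < v \<and> (x', y') \<in> X \<longrightarrow> G a b x' y'" using l unfolding locally_in_def by blast
  have y12: "y1 < y" "y < y2" and cont: "continuous_on {x1<..<x2} g" using g unfolding gbox_def by blast+
  let ?V = "{max s x1<..<min t x2} \<times> {max u y1<..<min v y2}"
  have V: "open ?V" "(x, y) \<in> ?V" using b g y12 by (auto intro: open_Times)
  have "(x, y) \<in> X" using ggraph_mem gg by blast
  then have "G a b x y" using b by blast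
  then have qQ: "(a, b) \<in> Q" unfolding G_def by blast
  have "tau_at M Q C X p' = {(a, b)}" if p': "p' \<in> ?V \<inter> X" for p'
  proof -
    obtain x' y' where xy: "p' = (x', y')" by (cases p')
    have h: "s < x'" "x' < t" "x1 < x'" "x' < x2" "u < y'" "y' < v" "y1 < y'" "y' < y2" "(x', y') \<in> X" using p' unfolding xy by auto
    have gy: "g x' = y'" using g(4) h unfolding gbox_def by blast
    have gg': "ggraph X x' y'" using gbox_ggraph[OF g(4,5) h(3,4)] unfolding gy .
    have Gx': "G a b x' y'" using b(5) h by blast
    from continuous_on_Ioo_nbhd[OF cont h(3,4), of "{max u y1<..<min v y2}"] gy h obtain p q where pq: "p < x'" "x' < q"
      "\<forall>z. p < z \<and> z < q \<longrightarrow> x1 < z \<and> z < x2 \<and> g z \<in> {max u y1<..<min v y2}" by auto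
    have near: "G a b z (g z) \<and> (z, g z) \<in> X" if hz: "max p s < z" "z < min q t" for z
    proof -
      have z: "x1 < z" "z < x2" "u < g z" "g z < v" "s < z" "z < t" using pq(3) hz by auto
      then have "(z, g z) \<in> X" using g(4) unfolding gbox_def by blast
      then show ?thesis using b(5) z by blast
    qed
    have box: "max p s < x'" "x' < min q t" using pq h by auto
    have "\<forall>z w. s < z \<and> z < t \<and> u < w \<and> w < v \<and> (z, w) \<in> X \<longrightarrow> (\<exists>v. G a b z v \<and> w \<le> v)"
      using b(5) by blast
    then have "tang (\<le>) X a b x' y'" unfolding tang_def using Gx' h by blast
    then have "(a, b) \<in> tau_at M Q C X p'" unfolding tau_at_def xy using touches_iff_tang[OF X gg' qQ] qQ by blast
    moreover have "q' = (a, b)" if q': "q' \<in> tau_at M Q C X p'" for q'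
    proof (rule ccontr)
      assume ne: "q' \<noteq> (a, b)"
      obtain a' b' where ab: "q' = (a', b')" by (cases q')
      have "(a', b') \<in> Q" "touches M (C (a', b')) X (x', y')" using q' unfolding tau_at_def ab xy by auto
      then have "tang (\<le>) X a' b' x' y' \<or> tang (\<ge>) X a' b' x' y'" using touches_iff_tang[OF X gg'] by blast
      then obtain R where R: "le_or_ge R" "tang R X a' b' x' y'" by blast
      show False
      proof (rule tang_no_touching[OF R _ Gx' box, where z = g])
        show "(a, b) \<noteq> (a', b')" using ne ab by blast
        show "G a b z (g z) \<and> (z, g z) \<in> X" if "max p s < z" "z < min q t" for z by (rule near[OF that])
        show "continuous_on {max p s<..<min q t} g"
          by (rule continuous_on_subset[OF cont]) (use pq(3) in auto)
      qed
    qed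
    ultimately show ?thesis by blast
  qed
  then show ?thesis unfolding family_linear_near_def using V qQ by blast
qed

end

section \<open>The dual curve\<close>

context nice
begin

text \<open>First-order form of the conclusion: near \<open>(a, b)\<close> the hull of \<open>\<tau>(X)\<close> is a graph consisting of
  regular tangents, and their curves pass on the side \<open>R\<close> of \<open>(x, y)\<close>.\<close>

definition one_sided :: "('a \<Rightarrow> 'a \<Rightarrow> bool) \<Rightarrow> ('a \<times> 'a) set \<Rightarrow> 'a \<Rightarrow> 'a \<Rightarrow> 'a \<Rightarrow> 'a \<Rightarrow> bool" where
  "one_sided R X a b x y \<longleftrightarrow> ggraph (tau_hull X) a b \<and>
     (\<exists>a1 a2 b1 b2. a1 < a \<and> a < a2 \<and> b1 < b \<and> b < b2 \<and>
       (\<forall>a' b'. a1 < a' \<and> a' < a2 \<and> b1 < b' \<and> b' < b2 \<and> (a', b') \<in> tau_hull X \<longrightarrow>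
          (a', b') \<in> tau_reg X \<and> (\<exists>v. G a' b' x v \<and> R y v)))"

text \<open>The theorem fails for this tangent for a reason other than local linearity. It is
  first-order over the parameters of \<open>X\<close> and of the family.\<close>

definition bad_tangent :: "('a \<Rightarrow> 'a \<Rightarrow> bool) \<Rightarrow> ('a \<times> 'a) set \<Rightarrow> 'a \<Rightarrow> 'a \<Rightarrow> 'a \<Rightarrow> 'a \<Rightarrow> bool" where
  "bad_tangent R X a b x y \<longleftrightarrow> (x, y) \<in> regular X \<and> tang R X a b x y \<and> \<not> locally_in X a b x y \<and> \<not> one_sided R X a b x y"

lemma dfp_bad_tangent:
  assumes R: "le_or_ge R" and X: "definable2 M B X" and B: "A \<subseteq> B"
    and c: "coord B vs a" "coord B vs b" "coord B vs x" "coord B vs y"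
  shows "dfp M B vs (\<lambda>e. bad_tangent R X (a e) (b e) (x e) (y e))"
proof -
  note D = definable_regular[OF X B]
  have "dfp M B [fst, \<lambda>e. fst (snd e), \<lambda>e. fst (snd (snd e)), \<lambda>e. snd (snd (snd e))]
       (\<lambda>e. bad_tangent R X (fst e) (fst (snd e)) (fst (snd (snd e))) (snd (snd (snd e))))"
    unfolding bad_tangent_def locally_in_def one_sided_def
    by (intro dfp_conj dfp_not dfp_ex dfp_all dfp_imp dfp_less dfp_G_param[OF B] dfp_pair_mem[OF X] dfp_pair_mem[OF D(1)]
        dfp_pair_mem[OF D(2)] dfp_pair_mem[OF D(4)] dfp_ggraph[OF D(4)] dfp_tang[OF R X B] dfp_R[OF R]; simp add: coord_simps)
  from dfp_subst[OF this, of vs "\<lambda>e. (a e, b e, x e, y e)"] c show ?thesis by simp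
qed

text \<open>Along an arc of bad points the touching parameter can be chosen definably, with
  continuous coordinates, the first one constant or injective. Constancy puts the arc on one curve,
  contradicting \<open>\<not> locally_in\<close>; injectivity leads to \<open>one_sided\<close> at
  all but finitely many points.\<close>

lemma finite_bad_tangent:
  assumes R: "le_or_ge R" and X: "def2 X" "thin X"
  shows "finite {(x, y). \<exists>a b. bad_tangent R X a b x y}"
proof (rule ccontr)
  let ?Z = "{(x, y). \<exists>a b. bad_tangent R X a b x y}"
  assume inf: "infinite ?Z"
  note W = dfp_bad_tangent[OF R X(1) subset_UNIV]
  have Zdef: "def2 ?Z" unfolding definable2_Collect by (intro dfp_ex W; simp add: coord_simps)
  have Zreg: "?Z \<subseteq> regular X" unfolding bad_tangent_def by blast
  have ZX: "?Z \<subseteq> X" using Zreg ggraph_mem unfolding regular_def by blast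
  have "finite {y. (x, y) \<in> ?Z}" for x
    by (rule finite_subset[OF _ ggraph_fibre_finite[OF X(1), of x]]) (use Zreg in \<open>auto simp: regular_def\<close>)
  then have "infinite {x. \<exists>y. (x, y) \<in> ?Z}" using finite_fst_image[of ?Z] inf by blast
  from thin_min_section[OF Zdef inf X(2) ZX X(1) this] obtain i1 i2 z where i: "i1 < i2" "dfun i1 i2 z"
    "\<forall>x. i1 < x \<and> x < i2 \<longrightarrow> (x, z x) \<in> ?Z \<and> finite {y. (x, y) \<in> X}" by (elim exE conjE)
  from monotone_continuous_subinterval[OF i(2,1)] obtain j1 j2 where j: "i1 \<le> j1" "j1 < j2" "j2 \<le> i2"
      "continuous_on {j1<..<j2} z" by (elim exE conjE)
  have zj: "dfun j1 j2 z" by (rule dfun_subinterval[OF i(2) j(1,3)])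
  note F = dfp2_coord[OF zj[unfolded dfun_def]]
  have Zj: "(x, z x) \<in> ?Z" if "j1 < x" "x < j2" for x
    using i(3) j(1,3) that by (meson le_less_trans less_le_trans)
  \<comment> \<open>Definable choice of a tangent: regularity leaves finitely many first parameters,
    and the second is then determined by the point.\<close>
  define \<alpha> where "\<alpha> x = Min {a. \<exists>b. bad_tangent R X a b x (z x)}" for x
  define \<beta> where "\<beta> x = (THE b. G (\<alpha> x) b x (z x))" for x
  have WG: "G a b x y" if "bad_tangent R X a b x y" for a b x y using that tang_G unfolding bad_tangent_def by blast
  have \<alpha>: "\<alpha> x = a \<longleftrightarrow> (\<exists>b. bad_tangent R X a b x (z x)) \<and> (\<forall>a'. (\<exists>b. bad_tangent R X a' b x (z x)) \<longrightarrow> a \<le> a')"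
    if x: "j1 < x" "x < j2" for x a
  proof -
    have "(x, z x) \<in> regular X" using Zj[OF x] Zreg by blast
    then have "finite {a. \<exists>b. tangs X a b x (z x)}" unfolding regular_def by blast
    then have "finite {a. \<exists>b. bad_tangent R X a b x (z x)}"
      by (rule rev_finite_subset) (use R in \<open>auto simp: bad_tangent_def tangs_def\<close>)
    moreover have "{a. \<exists>b. bad_tangent R X a b x (z x)} \<noteq> {}" using Zj[OF x] by blast
    ultimately show ?thesis unfolding \<alpha>_def using Min_eq_iff[of "{a. \<exists>b. bad_tangent R X a b x (z x)}"] by auto
  qed
  have \<beta>I: "\<beta> x = b" if "G (\<alpha> x) b x (z x)" for x b
    unfolding \<beta>_def by (rule the_equality) (use that G_b_unique in blast)+
  have \<alpha>\<beta>: "bad_tangent R X (\<alpha> x) (\<beta> x) x (z x)" if x: "j1 < x" "x < j2" for x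
  proof -
    obtain b where "bad_tangent R X (\<alpha> x) b x (z x)" using \<alpha>[OF x, of "\<alpha> x"] by blast
    then show ?thesis using \<beta>I WG by metis
  qed
  have d\<alpha>: "dfun j1 j2 \<alpha>"
  proof -
    have "(\<lambda>e. j1 < fst e \<and> fst e < j2 \<and> \<alpha> (fst e) = snd e) =
       (\<lambda>e. \<exists>w. (j1 < fst e \<and> fst e < j2 \<and> z (fst e) = w) \<and> (\<exists>b. bad_tangent R X (snd e) b (fst e) w) \<and>
          (\<forall>a'. (\<exists>b. bad_tangent R X a' b (fst e) w) \<longrightarrow> snd e \<le> a'))"
      using \<alpha> by (intro ext) blast
    then show ?thesis unfolding dfun_def
      by (simp only:) (rule dfp_ex, rule dfp_conj[OF F dfp_conj[OF dfp_ex[OF W] dfp_all[OF dfp_imp[OF dfp_ex[OF W] dfp_le]]]];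
        simp add: coord_simps)
  qed
  have d\<beta>: "dfun j1 j2 \<beta>"
  proof -
    have "(j1 < x \<and> x < j2 \<and> \<beta> x = b) \<longleftrightarrow>
      (\<exists>w a. (j1 < x \<and> x < j2 \<and> z x = w) \<and> (j1 < x \<and> x < j2 \<and> \<alpha> x = a) \<and> G a b x w)" for x b
      using WG[OF \<alpha>\<beta>[of x]] \<beta>I[of x b] by blast
    then have "(\<lambda>e. j1 < fst e \<and> fst e < j2 \<and> \<beta> (fst e) = snd e) =
       (\<lambda>e. \<exists>w a. (j1 < fst e \<and> fst e < j2 \<and> z (fst e) = w) \<and> (j1 < fst e \<and> fst e < j2 \<and> \<alpha> (fst e) = a) \<and> G a (snd e) (fst e) w)"
      by (intro ext)
    then show ?thesis unfolding dfun_def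
      by (simp only:) (rule dfp_ex, rule dfp_ex, rule dfp_conj[OF F dfp_conj[OF dfp2_coord[OF d\<alpha>[unfolded dfun_def]] dfp_G_UNIV]];
        simp add: coord_simps)
  qed
  from monotone_continuous_subinterval[OF d\<alpha> j(2)] obtain k1 k2 where k: "j1 \<le> k1" "k1 < k2" "k2 \<le> j2"
      "continuous_on {k1<..<k2} \<alpha>" and mono: "((\<forall>x y. k1 < x \<and> x < y \<and> y < k2 \<longrightarrow> \<alpha> x < \<alpha> y) \<or>
      (\<forall>x y. k1 < x \<and> x < y \<and> y < k2 \<longrightarrow> \<alpha> x > \<alpha> y) \<or>
      (\<forall>x y. k1 < x \<and> x < y \<and> y < k2 \<longrightarrow> \<alpha> x = \<alpha> y))" by (elim exE conjE)
  have d\<beta>k: "dfun k1 k2 \<beta>" by (rule dfun_subinterval[OF d\<beta> k(1,3)])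
  from monotone_continuous_subinterval[OF d\<beta>k k(2)] obtain l1 l2 where l: "k1 \<le> l1" "l1 < l2" "l2 \<le> k2"
      "continuous_on {l1<..<l2} \<beta>" by (elim exE conjE)
  have lk: "k1 < x \<and> x < k2" if "l1 < x" "x < l2" for x using l(1,3) that by (meson le_less_trans less_le_trans)
  have lj: "j1 < x \<and> x < j2" if "l1 < x" "x < l2" for x using k(1,3) lk[OF that] by (meson le_less_trans less_le_trans)
  have jl: "j1 \<le> l1" "l2 \<le> j2" using k l by order+
  note dl = dfun_subinterval[OF zj jl] dfun_subinterval[OF d\<alpha> jl] dfun_subinterval[OF d\<beta> jl]
  have cz: "continuous_on {l1<..<l2} z" by (rule continuous_on_subset[OF j(4)]) (use lj in auto)
  have t: "tang R X (\<alpha> x) (\<beta> x) x (z x) \<and> (x, z x) \<in> X" if "l1 < x" "x < l2" for x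
    using \<alpha>\<beta>[of x] Zj[of x] ZX lj[OF that] unfolding bad_tangent_def by blast
  from uniform_touching[OF R l(2) dl(1) cz dl(2,3) t] obtain m1 m2 where m: "l1 \<le> m1" "m1 < m2" "m2 \<le> l2"
    "\<forall>x x'. m1 < x \<and> x < m2 \<and> m1 < x' \<and> x' < m2 \<longrightarrow> (\<exists>v. G (\<alpha> x) (\<beta> x) x' v \<and> R (z x') v)" by blast
  have ml: "l1 < x \<and> x < l2" if "m1 < x" "x < m2" for x using m(1,3) that by (meson le_less_trans less_le_trans)
  have mk: "k1 < x \<and> x < k2" if "m1 < x" "x < m2" for x using lk ml[OF that] by blast
  have mj: "j1 < x \<and> x < j2" if "m1 < x" "x < m2" for x using lj ml[OF that] by blast
  have czm: "continuous_on {m1<..<m2} z" by (rule continuous_on_subset[OF cz]) (use ml in auto)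
  have c\<alpha>: "continuous_on {m1<..<m2} \<alpha>" by (rule continuous_on_subset[OF k(4)]) (use mk in auto)
  have c\<beta>: "continuous_on {m1<..<m2} \<beta>" by (rule continuous_on_subset[OF l(4)]) (use ml in auto)
  have ml': "l1 \<le> m1" "m2 \<le> l2" by (rule m(1), rule m(3))
  note d\<alpha>m = dfun_subinterval[OF dl(2) ml']
  have bt: "bad_tangent R X (\<alpha> x) (\<beta> x) x (z x)" if "m1 < x" "x < m2" for x using \<alpha>\<beta> mj[OF that] by blast
  from mono consider (const) "\<forall>x y. k1 < x \<and> x < y \<and> y < k2 \<longrightarrow> \<alpha> x = \<alpha> y"
    | (inj) "\<forall>x y. k1 < x \<and> x < y \<and> y < k2 \<longrightarrow> \<alpha> x < \<alpha> y \<or> \<alpha> y < \<alpha> x" by blast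
  then show False
  proof cases
    case const
    obtain x where x: "m1 < x" "x < m2" using dense[OF m(2)] by blast
    have \<alpha>c: "\<alpha> x' = \<alpha> x" if "m1 < x'" "x' < m2" for x'
      using const mk[OF that] mk[OF x] by (cases x x' rule: linorder_cases) auto
    have \<beta>c: "\<beta> x' = \<beta> x" if x': "m1 < x'" "x' < m2" for x'
    proof -
      obtain v where v: "G (\<alpha> x) (\<beta> x') x v" "R (z x) v" using m(4) x x' \<alpha>c[OF x'] by metis
      obtain v' where v': "G (\<alpha> x) (\<beta> x) x' v'" "R (z x') v'" using m(4) x x' by blast
      have "G (\<alpha> x) (\<beta> x') x' (z x')" using WG[OF bt[OF x']] \<alpha>c[OF x'] by simp
      from uniform_touching_const[OF R this WG[OF bt[OF x]] v v'] show ?thesis .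
    qed
    have Gx: "G (\<alpha> x) (\<beta> x) x' (z x')" if "m1 < x'" "x' < m2" for x'
      using WG[OF bt[OF that]] \<alpha>c[OF that] \<beta>c[OF that] by simp
    \<comment> \<open>The arc \<open>z\<close> might be only one of several pieces of
      \<open>X\<close>; since \<open>X\<close> is a graph near this point, it is all of
      \<open>X\<close> there.\<close>
    have "ggraph X x (z x)" using bt[OF x] unfolding bad_tangent_def regular_def by blast
    then obtain x1 x2 y1 y2 g where g: "x1 < x" "x < x2" "g x = z x" "gbox X x1 x2 y1 y2 g" "wmono g x1 x2"
      by (rule ggraph_gbox)
    have gz: "y1 < z x" "z x < y2" using g unfolding gbox_def by metis+
    from continuous_on_Ioo_nbhd[OF czm x, of "{y1<..<y2}"] gz obtain p q where pq: "p < x" "x < q"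
      "\<forall>y. p < y \<and> y < q \<longrightarrow> m1 < y \<and> y < m2 \<and> z y \<in> {y1<..<y2}" by auto
    have "G (\<alpha> x) (\<beta> x) x' y'"
      if h: "max p x1 < x' \<and> x' < min q x2 \<and> y1 < y' \<and> y' < y2 \<and> (x', y') \<in> X" for x' y'
    proof -
      have x': "m1 < x'" "x' < m2" "y1 < z x'" "z x' < y2" "x1 < x'" "x' < x2" using pq(3) h by auto
      have "(x', z x') \<in> X" using t ml[OF x'(1,2)] by blast
      then have "z x' = g x'" "y' = g x'" using g(4) x' h unfolding gbox_def by blast+
      then show ?thesis using Gx[OF x'(1,2)] by simp
    qed
    moreover have "max p x1 < x" "x < min q x2" using pq g by auto
    ultimately have "locally_in X (\<alpha> x) (\<beta> x) x (z x)" unfolding locally_in_def using gz by blast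
    then show False using bt[OF x] unfolding bad_tangent_def by blast
  next
    case inj
    have ne: "\<alpha> x \<noteq> \<alpha> y" if "m1 < x" "x < m2" "m1 < y" "y < m2" "x \<noteq> y" for x y
    proof -
      have "x < y \<or> y < x" using that(5) by (meson linorder_neqE)
      then have "\<alpha> x < \<alpha> y \<or> \<alpha> y < \<alpha> x" using inj mk[OF that(1,2)] mk[OF that(3,4)] by blast
      then show ?thesis by auto
    qed
    note T = definable_regular(4)[OF X(1) subset_UNIV] thin_tau_hull[OF X]
    \<comment> \<open>\<open>tau_hull X\<close> is itself a thin definable set, so its bad points
      are finitely many. As \<alpha> is injective, only finitely many \<open>x\<close> have to be
      discarded.\<close>
    let ?B = "{(a, b). (a, b) \<in> tau_hull X \<and> \<not> ggraph (tau_hull X) a b \<and> \<not> vgood (tau_hull X) a b}"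
    have "finite (?B :: ('a \<times> 'a) set)" by (rule finite_bad_points[OF T])
    moreover have "inj_on (\<lambda>x. (\<alpha> x, \<beta> x)) {m1<..<m2}" by (rule inj_onI) (use ne in force)
    ultimately have "finite ((\<lambda>x. (\<alpha> x, \<beta> x)) -` ?B \<inter> {m1<..<m2})" by (rule finite_vimage_IntI)
    then have "infinite ({m1<..<m2} - ((\<lambda>x. (\<alpha> x, \<beta> x)) -` ?B \<inter> {m1<..<m2}))" using infinite_Ioo[OF m(2)] by simp
    from infinite_imp_nonempty[OF this] obtain x where "x \<in> {m1<..<m2} - ((\<lambda>x. (\<alpha> x, \<beta> x)) -` ?B \<inter> {m1<..<m2})" by blast
    then have x: "m1 < x" "x < m2" "(\<alpha> x, \<beta> x) \<notin> ?B" by (auto simp only: Diff_iff Int_iff vimage_eq greaterThanLessThan_iff)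
    have reg: "(\<alpha> y, \<beta> y) \<in> tau_reg X" if y: "m1 < y" "y < m2" for y
    proof -
      have "(y, z y) \<in> regular X" "tangs X (\<alpha> y) (\<beta> y) y (z y)" using bt[OF y] R unfolding bad_tangent_def tangs_def by auto
      then show ?thesis unfolding tau_reg_def by blast
    qed
    then have hull: "(\<alpha> y, \<beta> y) \<in> tau_hull X" if "m1 < y" "y < m2" for y using that unfolding tau_hull_def by blast
    have nb: "\<exists>s r. s < x \<and> x < r \<and> (\<forall>y. s < y \<and> y < r \<longrightarrow> m1 < y \<and> y < m2 \<and> a1 < \<alpha> y \<and> \<alpha> y < a2 \<and> b1 < \<beta> y \<and> \<beta> y < b2)"
      if "a1 < \<alpha> x" "\<alpha> x < a2" "b1 < \<beta> x" "\<beta> x < b2" for a1 a2 b1 b2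
    proof -
      from continuous_on_Ioo_nbhd[OF c\<alpha> x(1,2), of "{a1<..<a2}"] that obtain p q where pq: "p < x" "x < q"
        "\<forall>y. p < y \<and> y < q \<longrightarrow> m1 < y \<and> y < m2 \<and> \<alpha> y \<in> {a1<..<a2}" by auto
      from continuous_on_Ioo_nbhd[OF c\<beta> x(1,2), of "{b1<..<b2}"] that obtain p' q' where pq': "p' < x" "x < q'"
        "\<forall>y. p' < y \<and> y < q' \<longrightarrow> m1 < y \<and> y < m2 \<and> \<beta> y \<in> {b1<..<b2}" by auto
      show ?thesis using pq pq' by (intro exI[of _ "max p p'"] exI[of _ "min q q'"]) auto
    qed
    \<comment> \<open>On a vertical piece of the hull, \<alpha> would take the value
      \<open>\<alpha> x\<close> also at nearby points, against injectivity.\<close>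
    have "\<not> vgood (tau_hull X) (\<alpha> x) (\<beta> x)"
    proof
      assume "vgood (tau_hull X) (\<alpha> x) (\<beta> x)"
      then obtain a1 a2 b1 b2 where v: "a1 < \<alpha> x" "\<alpha> x < a2" "b1 < \<beta> x" "\<beta> x < b2"
        "\<forall>x' y'. a1 < x' \<and> x' < a2 \<and> b1 < y' \<and> y' < b2 \<longrightarrow> ((x', y') \<in> tau_hull X \<longleftrightarrow> x' = \<alpha> x)" unfolding vgood_def by blast
      from nb[OF v(1-4)] obtain s r where sr: "s < x" "x < r"
        "\<forall>y. s < y \<and> y < r \<longrightarrow> m1 < y \<and> y < m2 \<and> a1 < \<alpha> y \<and> \<alpha> y < a2 \<and> b1 < \<beta> y \<and> \<beta> y < b2" by blast
      obtain y where y: "x < y" "y < r" using dense[OF sr(2)] by blast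
      have "s < y" using sr(1) y(1) by order
      then have "m1 < y" "y < m2" "\<alpha> y = \<alpha> x" using sr(3) y(2) v(5) hull by blast+
      then show False using ne[OF x(1,2), of y] y(1) by auto
    qed
    then have "ggraph (tau_hull X) (\<alpha> x) (\<beta> x)" using x(3) hull[OF x(1,2)] by blast
    note gg = this
    then obtain a1 a2 b1 b2 h where h: "a1 < \<alpha> x" "\<alpha> x < a2" "h (\<alpha> x) = \<beta> x" "gbox (tau_hull X) a1 a2 b1 b2 h" "wmono h a1 a2"
      by (rule ggraph_gbox)
    have b12: "b1 < \<beta> x" "\<beta> x < b2" using h unfolding gbox_def by metis+
    from nb[OF h(1,2) b12] obtain s r where sr: "s < x" "x < r"
        "\<forall>y. s < y \<and> y < r \<longrightarrow> m1 < y \<and> y < m2 \<and> a1 < \<alpha> y \<and> \<alpha> y < a2 \<and> b1 < \<beta> y \<and> \<beta> y < b2" by blast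
    \<comment> \<open>Ends strictly inside the interval, so that the intermediate value theorem can
      be used between them.\<close>
    obtain s' where s': "s < s'" "s' < x" using dense[OF sr(1)] by blast
    obtain r' where r': "x < r'" "r' < r" using dense[OF sr(2)] by blast
    have sr': "m1 < s'" "s' < r'" "r' < m2" "s' < r" "s < r'" using sr s' r' by (auto intro: less_trans)
    have xin: "\<alpha> s' < \<alpha> x \<and> \<alpha> x < \<alpha> r' \<or> \<alpha> r' < \<alpha> x \<and> \<alpha> x < \<alpha> s'"
    proof -
      have "k1 < s'" "s' < x" "x < r'" "r' < k2" using s' r' sr' mk[of s'] mk[of r'] by (auto intro: less_trans)
      then show ?thesis using mono
      proof (elim disjE)
        assume *: "\<forall>x y. k1 < x \<and> x < y \<and> y < k2 \<longrightarrow> \<alpha> x = \<alpha> y"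
        have "\<alpha> s' = \<alpha> r'" using * \<open>k1 < s'\<close> sr'(2) \<open>r' < k2\<close> by blast
        moreover have "m1 < r'" "s' < m2" using sr' by (auto intro: less_trans)
        ultimately show ?thesis using ne[of s' r'] sr' by auto
      qed (meson less_trans)+
    qed
    \<comment> \<open>The arc covers a neighbourhood of \<open>\<alpha> x\<close>, so near this
      point every element of the hull, being a graph, has the form
      \<open>(\<alpha> y, \<beta> y)\<close>.\<close>
    have onto: "\<exists>y. s' < y \<and> y < r' \<and> \<alpha> y = a'" if "min (\<alpha> s') (\<alpha> r') < a'" "a' < max (\<alpha> s') (\<alpha> r')" for a'
    proof (rule dfun_ivt[OF d\<alpha>m c\<alpha> sr'(1,2,3)])
      show "\<alpha> s' < a' \<and> a' < \<alpha> r' \<or> \<alpha> r' < a' \<and> a' < \<alpha> s'"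
        using that xin by (auto simp: min_def max_def split: if_splits)
    qed
    have "(a', b') \<in> tau_reg X \<and> (\<exists>v. G a' b' x v \<and> R (z x) v)"
      if ab: "min (\<alpha> s') (\<alpha> r') < a' \<and> a' < max (\<alpha> s') (\<alpha> r') \<and> b1 < b' \<and> b' < b2 \<and> (a', b') \<in> tau_hull X" for a' b'
    proof -
      obtain y where y: "s' < y" "y < r'" "\<alpha> y = a'" using onto ab by blast
      have "s < y" "y < r" using y s' r' by order+
      then have Y: "m1 < y" "y < m2" "a1 < a'" "a' < a2" "b1 < \<beta> y" "\<beta> y < b2" using sr(3) y(3) by blast+
      have "(a', \<beta> y) \<in> tau_hull X" using hull[OF Y(1,2)] y(3) by simp
      then have "\<beta> y = h a'" "b' = h a'" using h(4) Y ab unfolding gbox_def by blast+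
      then have eq: "b' = \<beta> y" by simp
      have "(a', b') \<in> tau_reg X" using reg[OF Y(1,2)] y(3) eq by simp
      \<comment> \<open>Uniform touching with the roles exchanged: the abscissa \<open>x\<close> is
        fixed and the curve varies with \<open>y\<close>.\<close>
      moreover have "\<exists>v. G a' b' x v \<and> R (z x) v" using m(4) Y(1,2) x y(3) eq by blast
      ultimately show ?thesis by blast
    qed
    moreover have "min (\<alpha> s') (\<alpha> r') < \<alpha> x" "\<alpha> x < max (\<alpha> s') (\<alpha> r')"
      using xin by (auto simp: min_less_iff_disj less_max_iff_disj)
    ultimately have "one_sided R X (\<alpha> x) (\<beta> x) x (z x)" unfolding one_sided_def using gg b12 by blast
    then show False using bt[OF x(1,2)] unfolding bad_tangent_def by blast
  qed
qed

text \<open>Implicit function argument. For \<open>s < b < t\<close> the curves of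
  \<open>(a, s)\<close> and \<open>(a, t)\<close> pass on opposite sides of \<open>(x, y)\<close>;
  this persists for \<open>a'\<close> near \<open>a\<close>, and connectedness in the second
  parameter gives a curve through the point.\<close>

lemma dual_nbhd:
  assumes g: "G a b x y" and uv: "u < b" "b < v"
  shows "\<exists>a1 a2. a1 < a \<and> a < a2 \<and> (\<forall>a'. a1 < a' \<and> a' < a2 \<longrightarrow> (\<exists>b'. G a' b' x y \<and> u < b' \<and> b' < v))"
proof -
  obtain l r where lr: "l < y" "y < r" using lt_ex gt_ex by blast
  from G_nbhd[OF g lr] obtain a1 a2 b1 b2 where N: "a1 < a" "a < a2" "b1 < b" "b < b2"
    "\<forall>a' b'. a1 < a' \<and> a' < a2 \<and> b1 < b' \<and> b' < b2 \<longrightarrow> (\<exists>y'. G a' b' x y')" by meson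
  have "max u b1 < b" "b < min v b2" using N uv by auto
  then obtain s t where st: "max u b1 < s" "s < b" "b < t" "t < min v b2" using dense by meson
  then have st': "b1 < s" "s < b2" "b1 < t" "t < b2" "u < s" "t < v" using N by auto
  obtain ys yt where yst: "G a s x ys" "G a t x yt" using N st' by meson
  have dir: "ys < y \<and> y < yt \<or> yt < y \<and> y < ys" using G_mono_b g yst st(2,3) by blast
  have near: "\<exists>p q. p < a \<and> a < q \<and> (\<forall>a'. p < a' \<and> a' < q \<longrightarrow> (\<exists>y'. G a' c x y' \<and> (w < y \<longrightarrow> y' < y) \<and> (y < w \<longrightarrow> y < y')))"
    if cw: "G a c x w" "w \<noteq> y" for c w
  proof (cases "w < y")
    case True
    obtain e where "e < w" using lt_ex by blast
    from G_nbhd[OF cw(1) this True] obtain p q where pq: "p < a" "a < q"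
      "\<forall>a'. p < a' \<and> a' < q \<longrightarrow> (\<exists>y'. G a' c x y' \<and> e < y' \<and> y' < y)" by meson
    have "\<exists>y'. G a' c x y' \<and> (w < y \<longrightarrow> y' < y) \<and> (y < w \<longrightarrow> y < y')" if "p < a' \<and> a' < q" for a'
      using pq(3) that True less_asym by blast
    then show ?thesis using pq(1,2) by blast
  next
    case False
    then have F: "y < w" using cw(2) by simp
    obtain e where "w < e" using gt_ex by blast
    from G_nbhd[OF cw(1) F this] obtain p q where pq: "p < a" "a < q"
      "\<forall>a'. p < a' \<and> a' < q \<longrightarrow> (\<exists>y'. G a' c x y' \<and> y < y' \<and> y' < e)" by meson
    have "\<exists>y'. G a' c x y' \<and> (w < y \<longrightarrow> y' < y) \<and> (y < w \<longrightarrow> y < y')" if "p < a' \<and> a' < q" for a'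
      using pq(3) that F less_asym by blast
    then show ?thesis using pq(1,2) by blast
  qed
  have "ys \<noteq> y" "yt \<noteq> y" using dir by auto
  from near[OF yst(1) this(1)] near[OF yst(2) this(2)] obtain p q p' q' where
    pq: "p < a" "a < q" "\<forall>a'. p < a' \<and> a' < q \<longrightarrow> (\<exists>y'. G a' s x y' \<and> (ys < y \<longrightarrow> y' < y) \<and> (y < ys \<longrightarrow> y < y'))"
    and pq': "p' < a" "a < q'" "\<forall>a'. p' < a' \<and> a' < q' \<longrightarrow> (\<exists>y'. G a' t x y' \<and> (yt < y \<longrightarrow> y' < y) \<and> (y < yt \<longrightarrow> y < y'))"
    by blast
  have "\<exists>b'. G a' b' x y \<and> u < b' \<and> b' < v" if ha: "max a1 (max p p') < a' \<and> a' < min a2 (min q q')" for a'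
  proof (rule ccontr)
    assume neg: "\<nexists>b'. G a' b' x y \<and> u < b' \<and> b' < v"
    have a': "a1 < a'" "a' < a2" "p < a'" "a' < q" "p' < a'" "a' < q'" using ha by auto
    \<comment> \<open>If no curve between \<open>s\<close> and \<open>t\<close> passed through
      \<open>(x, y)\<close>, lying below it would be an open and closed condition on the parameter,
      yet its truth differs at the two ends.\<close>
    define P where "P c \<longleftrightarrow> (\<exists>w. G a' c x w \<and> w < y)" for c
    have dom: "\<exists>w. G a' c x w \<and> w \<noteq> y" if c: "s \<le> c" "c \<le> t" for c
    proof -
      have c': "b1 < c" "c < b2" "u < c" "c < v" using c st' by order+
      then obtain w where w: "G a' c x w" using N(5) a' by blast
      then have "w \<noteq> y" using neg c' by blast
      then show ?thesis using w by blast
    qed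
    have "P s \<longleftrightarrow> P t"
    proof (rule definable_interval_iff)
      show "df1 P" unfolding P_def by (intro dfp_rules dfp_G_UNIV; simp add: coord_simps)
      show "s \<le> t" using st by (auto intro: less_imp_le less_trans)
      show "\<exists>u v. u < c \<and> c < v \<and> (\<forall>y. u < y \<and> y < v \<and> s \<le> y \<and> y \<le> t \<longrightarrow> P y)" if c: "s \<le> c" "c \<le> t" "P c" for c
      proof -
        obtain w where w: "G a' c x w" "w < y" using c(3) unfolding P_def by blast
        obtain e where "e < w" using lt_ex by blast
        from G_nbhd[OF w(1) this w(2)] show ?thesis unfolding P_def by meson
      qed
      show "\<exists>u v. u < c \<and> c < v \<and> (\<forall>z. u < z \<and> z < v \<and> s \<le> z \<and> z \<le> t \<longrightarrow> \<not> P z)" if c: "s \<le> c" "c \<le> t" "\<not> P c" for c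
      proof -
        obtain w where w: "G a' c x w" "w \<noteq> y" using dom[OF c(1,2)] by blast
        then have w2: "y < w" using c(3) unfolding P_def by (meson linorder_neqE)
        obtain e where "w < e" using gt_ex by blast
        from G_nbhd[OF w(1) w2 this] obtain d1 d2 where d: "d1 < c" "c < d2"
          "\<forall>z. d1 < z \<and> z < d2 \<longrightarrow> (\<exists>y'. G a' z x y' \<and> y < y' \<and> y' < e)" by meson
        have "\<not> P z" if "d1 < z \<and> z < d2" for z
          using d(3) that G_unique unfolding P_def by (metis less_asym)
        then show ?thesis using d(1,2) by blast
      qed
    qed
    moreover obtain y1 where "G a' s x y1" "ys < y \<longrightarrow> y1 < y" "y < ys \<longrightarrow> y < y1" using pq(3) a' by blast
    moreover obtain y2 where "G a' t x y2" "yt < y \<longrightarrow> y2 < y" "y < yt \<longrightarrow> y < y2" using pq'(3) a' by blast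
    ultimately show False using dir G_unique unfolding P_def by (metis less_asym)
  qed
  moreover have "max a1 (max p p') < a" "a < min a2 (min q q')" using N pq pq' by auto
  ultimately show ?thesis by blast
qed

lemma dual_gbox:
  assumes g: "G a b x y"
  shows "\<exists>a1 a2 u v f. a1 < a \<and> a < a2 \<and> f a = b \<and> gbox {(a, b). G a b x y} a1 a2 u v f"
proof -
  obtain u v where uv: "u < b" "b < v" using lt_ex gt_ex by blast
  from dual_nbhd[OF g uv] obtain a1 a2 where a: "a1 < a" "a < a2"
    "\<forall>a'. a1 < a' \<and> a' < a2 \<longrightarrow> (\<exists>b'. G a' b' x y \<and> u < b' \<and> b' < v)" by blast
  define f where "f a' = (THE b'. G a' b' x y)" for a'
  have fI: "f a' = b'" if "G a' b' x y" for a' b'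
    unfolding f_def by (rule the_equality) (use that G_b_unique in blast)+
  have f: "G a' (f a') x y" "u < f a'" "f a' < v" if "a1 < a'" "a' < a2" for a'
    using a(3) that fI by blast+
  have nb: "\<exists>s t. s < a' \<and> a' < t \<and> (\<forall>z. s < z \<and> z < t \<longrightarrow> l < f z \<and> f z < r)"
    if "a1 < a'" "a' < a2" "l < f a'" "f a' < r" for a' l r
    using dual_nbhd[OF f(1)[OF that(1,2)] that(3,4)] fI by metis
  have "continuous_on {a1<..<a2} f"
  proof (rule continuous_on_Ioo_if)
    fix a' w assume x': "a1 < a'" "a' < a2" and w: "w < f a'"
    show "\<exists>s t. s < a' \<and> a' < t \<and> (\<forall>z. s < z \<and> z < t \<longrightarrow> w < f z)" using nb[OF x' w f(3)[OF x']] by blast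
  next
    fix a' w assume x': "a1 < a'" "a' < a2" and w: "f a' < w"
    show "\<exists>s t. s < a' \<and> a' < t \<and> (\<forall>z. s < z \<and> z < t \<longrightarrow> f z < w)" using nb[OF x' f(2)[OF x'] w] by blast
  qed
  moreover have "(a', b') \<in> {(a, b). G a b x y} \<longleftrightarrow> b' = f a'" if "a1 < a' \<and> a' < a2" for a' b'
    using f(1)[of a'] fI[of a' b'] that by auto
  ultimately have "gbox {(a, b). G a b x y} a1 a2 u v f" unfolding gbox_def using f by blast
  then show ?thesis using a(1,2) fI[OF g] by blast
qed

text \<open>Near the given parameter the hull consists of regular tangents, hence coincides with
  \<open>tau\<close> and is a graph \<open>h\<close>. Monotonicity in \<open>b\<close> translates
  the position of the curves relative to \<open>(x0, y0)\<close> into the position of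
  \<open>h\<close> relative to the dual curve.\<close>

lemma one_sided_touches:
  assumes X: "plane_curve M UNIV X" and R: "le_or_ge R" and q: "G a0 b0 x0 y0" and o: "one_sided R X a0 b0 x0 y0"
  shows "touches M (dual_curve Q C (x0, y0)) (tau M Q C X) (a0, b0)"
proof -
  have X': "def2 X" "thin X" using X plane_curve_thin unfolding plane_curve_def by auto
  have dual: "dual_curve Q C (x0, y0) = {(a, b). G a b x0 y0}" unfolding dual_curve_def G_def by auto
  have tdef: "def2 (tau M Q C X)" by (rule tau_definable[OF X])
  have tthin: "thin (tau M Q C X)" by (rule thin_subset[OF thin_tau_hull[OF X'] tau_decomposition(2)[OF X]])
  have "ggraph (tau_hull X) a0 b0" using o unfolding one_sided_def by blast
  then obtain a1 a2 b1 b2 h where h: "a1 < a0" "a0 < a2" "h a0 = b0" "gbox (tau_hull X) a1 a2 b1 b2 h" "wmono h a1 a2"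
    by (rule ggraph_gbox)
  have cont: "continuous_on {a1<..<a2} h" using h unfolding gbox_def by blast
  have hb: "b1 < b0" "b0 < b2" using h unfolding gbox_def by metis+
  obtain s t l r where b: "s < a0" "a0 < t" "l < b0" "b0 < r"
    "\<forall>a' b'. s < a' \<and> a' < t \<and> l < b' \<and> b' < r \<and> (a', b') \<in> tau_hull X \<longrightarrow>
          (a', b') \<in> tau_reg X \<and> (\<exists>v. G a' b' x0 v \<and> R y0 v)" using o unfolding one_sided_def by blast
  from continuous_on_Ioo_nbhd[OF cont h(1,2), of "{max l b1<..<min r b2}"] hb b h(3) obtain p p' where p: "p < a0" "a0 < p'"
    "\<forall>y. p < y \<and> y < p' \<longrightarrow> a1 < y \<and> y < a2 \<and> h y \<in> {max l b1<..<min r b2}" by auto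
  define c1 where "c1 = max s p"
  define c2 where "c2 = min t p'"
  have c12: "c1 < a0" "a0 < c2" unfolding c1_def c2_def using b p by auto
  have c: "s < y" "y < t" "a1 < y" "y < a2" "max l b1 < h y" "h y < min r b2" if "c1 < y" "y < c2" for y
    using p(3) that unfolding c1_def c2_def by auto
  have g: "gbox (tau M Q C X) c1 c2 (max l b1) (min r b2) h" unfolding gbox_def
  proof (intro conjI allI impI)
    show "max l b1 < h y" "h y < min r b2" if "c1 < y \<and> y < c2" for y using c that by blast+
    show "continuous_on {c1<..<c2} h" by (rule continuous_on_subset[OF cont]) (use c in auto)
    fix a' b' assume H: "c1 < a' \<and> a' < c2 \<and> max l b1 < b' \<and> b' < min r b2"
    then have c': "s < a'" "a' < t" "a1 < a'" "a' < a2" using c by blast+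
    have hull: "(a', b') \<in> tau_hull X \<longleftrightarrow> b' = h a'" using h(4) c' H unfolding gbox_def by auto
    show "(a', b') \<in> tau M Q C X \<longleftrightarrow> b' = h a'"
    proof
      assume "(a', b') \<in> tau M Q C X"
      then show "b' = h a'" using hull tau_decomposition(2)[OF X] by blast
    next
      assume "b' = h a'"
      then have "(a', b') \<in> tau_reg X" using hull b(5) c' H by auto
      then show "(a', b') \<in> tau M Q C X" using tau_decomposition(1)[OF X] by blast
    qed
  qed
  have ca: "a1 \<le> c1" "c2 \<le> a2" using Ioo_subsetD[of c1 c2 a1 a2] c(3,4) c12 by (meson less_trans)+
  have wm: "wmono h c1 c2" using h(5) ca unfolding wmono_def by (meson le_less_trans less_le_trans)
  have tau_curve: "plane_curve M UNIV (tau M Q C X)"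
  proof (rule plane_curveI[OF tdef tthin])
    show "c1 < c2" using c12 by order
    show "\<exists>y. (x, y) \<in> tau M Q C X" if "c1 < x" "x < c2" for x using g that unfolding gbox_def by blast
  qed
  from dual_gbox[OF q] obtain d1 d2 u v f where f: "d1 < a0" "a0 < d2" "f a0 = b0" "gbox {(a, b). G a b x0 y0} d1 d2 u v f" by blast
  have ddef: "def2 {(a, b). G a b x0 y0}" unfolding definable2_Collect by (rule dfp_G_UNIV; simp add: coord_simps)
  have dual_curve: "plane_curve M UNIV {(a, b). G a b x0 y0}"
  proof (rule plane_curveI[OF ddef dual_thin])
    show "d1 < d2" using f by order
    show "\<exists>y. (x, y) \<in> {(a, b). G a b x0 y0}" if "d1 < x" "x < d2" for x using f(4) that unfolding gbox_def by blast
  qed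
  have C0: "C0_point M {(a, b). G a b x0 y0} (a0, h a0)" using gbox_C0_point[OF ddef f(4,1,2)] f(3) h(3) by simp
  have U: "open ({c1<..<c2} \<times> (UNIV :: 'a set))" "(a0, h a0) \<in> {c1<..<c2} \<times> UNIV" using c12 by (auto intro: open_Times)
  have above: "\<exists>w. G a' (h a') x0 w \<and> R y0 w" if "c1 < a'" "a' < c2" for a'
  proof -
    have "(a', h a') \<in> tau_hull X" using h(4) c[OF that] unfolding gbox_def by auto
    then show ?thesis using b(5) c[OF that] by auto
  qed
  have sideD: "\<exists>w. G a' (h a') x0 w \<and> R y0 w \<and> G a' b' x0 y0"
    if "(a', b') \<in> {(a, b). G a b x0 y0} \<inter> {c1<..<c2} \<times> UNIV" for a' b' using above[of a'] that by auto
  have side: "(\<forall>x y. (x, y) \<in> {(a, b). G a b x0 y0} \<inter> {c1<..<c2} \<times> UNIV \<longrightarrow> y \<le> h x) \<or>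
        (\<forall>x y. (x, y) \<in> {(a, b). G a b x0 y0} \<inter> {c1<..<c2} \<times> UNIV \<longrightarrow> h x \<le> y)"
  proof -
    have le: "b' \<le> h a'" if d: "\<And>a b b' x y y'. G a b x y \<Longrightarrow> G a b' x y' \<Longrightarrow> b < b' \<Longrightarrow> \<not> R y' y"
      and m: "(a', b') \<in> {(a, b). G a b x0 y0} \<inter> {c1<..<c2} \<times> UNIV" for a' b'
      using sideD[OF m] d by (meson linorder_not_le)
    have ge: "h a' \<le> b'" if d: "\<And>a b b' x y y'. G a b x y \<Longrightarrow> G a b' x y' \<Longrightarrow> b < b' \<Longrightarrow> \<not> R y y'"
      and m: "(a', b') \<in> {(a, b). G a b x0 y0} \<inter> {c1<..<c2} \<times> UNIV" for a' b'
      using sideD[OF m] d by (meson linorder_not_le)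
    \<comment> \<open>Which alternative holds depends on \<open>R\<close> and on the direction of
      monotonicity in \<open>b\<close>; it decides on which side of \<open>h\<close> the dual curve
      lies.\<close>
    have "(\<forall>a b b' x y y'. G a b x y \<longrightarrow> G a b' x y' \<longrightarrow> b < b' \<longrightarrow> \<not> R y' y) \<or>
       (\<forall>a b b' x y y'. G a b x y \<longrightarrow> G a b' x y' \<longrightarrow> b < b' \<longrightarrow> \<not> R y y')"
      using G_mono_b R by (elim disjE) (metis not_le)+
    then show ?thesis
    proof
      assume "\<forall>a b b' x y y'. G a b x y \<longrightarrow> G a b' x y' \<longrightarrow> b < b' \<longrightarrow> \<not> R y' y"
      then show ?thesis using le by blast
    next
      assume "\<forall>a b b' x y y'. G a b x y \<longrightarrow> G a b' x y' \<longrightarrow> b < b' \<longrightarrow> \<not> R y y'"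
      then show ?thesis using ge by blast
    qed
  qed
  have "touches M {(a, b). G a b x0 y0} (tau M Q C X) (a0, h a0)"
    by (rule gbox_touchI[OF tau_curve dual_curve g wm c12 C0 U side])
  then show ?thesis unfolding dual h(3) .
qed

end

theorem theorem1p15:
  fixes M :: "('f, 'r, 'a::{unbounded_dense_linorder, linorder_topology}) struct"
    and A :: "'a set" and P Q X :: "('a \<times> 'a) set"
    and C :: "'a \<times> 'a \<Rightarrow> ('a \<times> 'a) set" and p0 q0 :: "'a \<times> 'a"
  assumes "o_minimal M" and "omega_saturated M"
    and "finite A"
    and "nice_family M A P Q C"
    and "plane_curve M A X"
    and "generic M A X p0"
    and "\<not> family_linear_near M Q C X p0"
    and "q0 \<in> Q" and "touches M (C q0) X p0"
  shows "touches M (dual_curve Q C p0) (tau M Q C X) q0"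
proof -
  interpret nice M A P Q C by unfold_locales (rule assms)+
  have XA: "definable2 M A X" using assms(5) unfolding plane_curve_def by blast
  have X: "plane_curve M UNIV X" using assms(9) unfolding touches_def by blast
  have X': "def2 X" "thin X" using X plane_curve_thin unfolding plane_curve_def by auto
  obtain x0 y0 a0 b0 where pq: "p0 = (x0, y0)" "q0 = (a0, b0)" by (metis surj_pair)
  have q: "(a0, b0) \<in> Q" and t: "touches M (C (a0, b0)) X (x0, y0)" using assms(8,9) unfolding pq by auto
  have generic: "p0 \<notin> Y" if "finite Y" "definable2 M A Y" for Y
    using generic_not_finite[OF assms(6,5) that(2)] that(1) by blast
  have pX: "(x0, y0) \<in> X" using assms(6) unfolding generic_def pq by blast
  have "p0 \<notin> exceptional X"
    by (rule generic[OF finite_exceptional[OF X'] definable_regular(3)[OF XA order_refl]])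
  \<comment> \<open>The point is not vertical either, since a curve of the family touches
    \<open>X\<close> there.\<close>
  then have reg: "(x0, y0) \<in> regular X"
    using vgood_not_touches[OF _ q] t pX unfolding exceptional_def pq by blast
  then have gg: "ggraph X x0 y0" unfolding regular_def by blast
  obtain R where R: "le_or_ge R" "tang R X a0 b0 x0 y0" using touches_iff_tang[OF X gg q] t by blast
  have "definable2 M A {(x, y). \<exists>a b. bad_tangent R X a b x y}" unfolding definable2_Collect
    by (intro dfp_ex dfp_bad_tangent[OF R(1) XA order_refl]; simp add: coord_simps)
  from generic[OF finite_bad_tangent[OF R(1) X'] this] have "\<not> bad_tangent R X a0 b0 x0 y0" unfolding pq by blast
  \<comment> \<open>Here non-linearity enters: it excludes that \<open>X\<close> runs along
    \<open>C q0\<close> near \<open>p0\<close>.\<close>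
  moreover have "\<not> locally_in X a0 b0 x0 y0" using locally_in_linear[OF X gg] assms(7) unfolding pq by blast
  ultimately have "one_sided R X a0 b0 x0 y0" using reg R(2) unfolding bad_tangent_def by blast
  from one_sided_touches[OF X R(1) tang_G[OF R(2)] this] show ?thesis unfolding pq .
qed

end
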